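(* Let $m,N\geq 1$ be integers, let $\Omega\subset\mathbb{R}^N$ be a bounded open set with Lipschitz boundary, let $\mathbb{M}$ be the space of real $m\times N$ matrices, let $p\in\,]1,\infty[$ and $q\in[1,\infty]$, and let $L:\mathbb{M}\to[0,\infty]$ be continuous. Assume that $L$ is $W^{1,q}$-quasiconvex and satisfies the following condition: (C$_{p,q}$) for every $\xi\in\mathbb{M}$ and every sequence $\{v_n\}_n\subset W^{1,p}(Y;\mathbb{R}^m)$ such that $v_n\rightharpoonup l_\xi$ in $W^{1,p}(Y;\mathbb{R}^m)$ and $\sup_n\int_Y L(\nabla v_n(y))\,dy<\infty$, there exist a subsequence $\{v_n\}_n$ (not relabeled) and $\{w_n\}_n\subset l_\xi+W^{1,q}_0(Y;\mathbb{R}^m)$ such that $|\nabla v_n-\nabla w_n|\to 0$ in measure on $Y$ and $\{L(\nabla w_n)\}_n$ is equi-integrable on $Y$. Then the functional $I:W^{1,p}(\Omega;\mathbb{R}^m)\to[0,\infty]$, $I(u):=\int_\Omega L(\nabla u(x))\,dx$, is sequentially weakly lower semicontinuous on $W^{1,p}(\Omega;\mathbb{R}^m)$.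
   Context: $Y:=\,]-\tfrac12,\tfrac12[^N$ is the open unit cube of $\mathbb{R}^N$, and for $\xi\in\mathbb{M}$, $l_\xi(y):=\xi y$. The symbol $\rightharpoonup$ denotes weak convergence. $W^{1,q}_0(Y;\mathbb{R}^m)$ is the usual Sobolev space of functions with zero boundary values (for $q=\infty$: $W^{1,\infty}\cap W^{1,1}_0$). Continuity of $L$ is with respect to the usual topology of $[0,\infty]$. $W^{1,q}$-quasiconvexity: $L$ is $W^{1,q}$-quasiconvex if for every $\xi\in\mathbb{M}$, $\int_Y L(\nabla u(y))\,dy\geq L(\xi)$ for all $u\in l_\xi+W^{1,q}_0(Y;\mathbb{R}^m)$. Sequential weak lower semicontinuity of $I$ on $W^{1,p}(\Omega;\mathbb{R}^m)$: $u_n\rightharpoonup u$ in $W^{1,p}(\Omega;\mathbb{R}^m)$ implies $\liminf_{n\to\infty}I(u_n)\geq I(u)$. *)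

theory Defs
  imports "HOL-Analysis.Analysis"
begin

text \<open>
  An element of a Lebesgue or Sobolev space on \<open>U\<close> is represented by any total function whose
  restriction to \<open>U\<close> is a representative of its class; values outside \<open>U\<close> are irrelevant.
\<close>

section \<open>Test functions\<close>

definition partial_derivative :: "'n \<Rightarrow> (real^'n \<Rightarrow> real) \<Rightarrow> real^'n \<Rightarrow> real"
  where "partial_derivative j f x = frechet_derivative f (at x) (axis j 1)"

primrec Ck :: "nat \<Rightarrow> (real^'n \<Rightarrow> real) \<Rightarrow> bool"
  where
    "Ck 0 f \<longleftrightarrow> continuous_on UNIV f"
  | "Ck (Suc k) f \<longleftrightarrow> (\<forall>x. f differentiable (at x)) \<and> (\<forall>j. Ck k (partial_derivative j f))"

definition test_function :: "(real^'n) set \<Rightarrow> (real^'n \<Rightarrow> real) \<Rightarrow> bool"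
  where "test_function U \<phi> \<longleftrightarrow>
    (\<forall>k. Ck k \<phi>) \<and> compact (closure {x. \<phi> x \<noteq> 0}) \<and> closure {x. \<phi> x \<noteq> 0} \<subseteq> U"

section \<open>Lebesgue and Sobolev spaces\<close>

definition Lp :: "ennreal \<Rightarrow> 'a::euclidean_space set \<Rightarrow> ('a \<Rightarrow> 'b::euclidean_space) set"
  where "Lp q S = {f \<in> borel_measurable (lebesgue_on S).
    if q = \<infinity> then \<exists>C. AE x in lebesgue_on S. norm (f x) \<le> C
    else (\<integral>\<^sup>+ x. ennreal (norm (f x) powr enn2real q) \<partial>lebesgue_on S) < \<infinity>}"

text \<open>The norms are only used for finite exponents, and only on elements of the respective
  spaces, where the integrals are finite.\<close>

definition Lp_norm :: "real \<Rightarrow> 'a::euclidean_space set \<Rightarrow> ('a \<Rightarrow> 'b::euclidean_space) \<Rightarrow> real"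
  where "Lp_norm p S f = (\<integral> x. norm (f x) powr p \<partial>lebesgue_on S) powr (1 / p)"

definition locally_integrable :: "'a::euclidean_space set \<Rightarrow> ('a \<Rightarrow> 'b::euclidean_space) \<Rightarrow> bool"
  where "locally_integrable U f \<longleftrightarrow> (\<forall>K. compact K \<and> K \<subseteq> U \<longrightarrow> f absolutely_integrable_on K)"

definition has_weak_gradient ::
    "(real^'n) set \<Rightarrow> (real^'n \<Rightarrow> real^'m) \<Rightarrow> (real^'n \<Rightarrow> real^'n^'m) \<Rightarrow> bool"
  where "has_weak_gradient U u G \<longleftrightarrow>
    locally_integrable U u \<and> locally_integrable U G \<and>
    (\<forall>\<phi> i j. test_function U \<phi> \<longrightarrow>
      (\<integral> x. u x $ i * partial_derivative j \<phi> x \<partial>lebesgue_on U)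
        = - (\<integral> x. G x $ i $ j * \<phi> x \<partial>lebesgue_on U))"

text \<open>For open \<open>U\<close> the weak gradient is unique up to null sets; an arbitrary version is chosen.\<close>

definition weak_gradient :: "(real^'n) set \<Rightarrow> (real^'n \<Rightarrow> real^'m) \<Rightarrow> real^'n \<Rightarrow> real^'n^'m"
  where "weak_gradient U u = (SOME G. has_weak_gradient U u G)"

definition W1 :: "ennreal \<Rightarrow> (real^'n) set \<Rightarrow> (real^'n \<Rightarrow> real^'m) set"
  where "W1 q U = {u \<in> Lp q U. \<exists>G \<in> Lp q U. has_weak_gradient U u G}"

definition W1_norm :: "real \<Rightarrow> (real^'n) set \<Rightarrow> (real^'n \<Rightarrow> real^'m) \<Rightarrow> real"
  where "W1_norm p U u = Lp_norm p U u + Lp_norm p U (weak_gradient U u)"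

definition W1_zero_finite :: "real \<Rightarrow> (real^'n) set \<Rightarrow> (real^'n \<Rightarrow> real^'m) set"
  where "W1_zero_finite p U = {u \<in> W1 (ennreal p) U.
    \<exists>\<phi> :: nat \<Rightarrow> real^'n \<Rightarrow> real^'m.
      (\<forall>k i. test_function U (\<lambda>x. \<phi> k x $ i)) \<and>
      (\<lambda>k. W1_norm p U (\<lambda>x. \<phi> k x - u x)) \<longlonglongrightarrow> 0}"

definition W1_zero :: "ennreal \<Rightarrow> (real^'n) set \<Rightarrow> (real^'n \<Rightarrow> real^'m) set"
  where "W1_zero q U =
    (if q = \<infinity> then W1 \<infinity> U \<inter> W1_zero_finite 1 U else W1_zero_finite (enn2real q) U)"

section \<open>Weak convergence\<close>

text \<open>Boundedness forces a functional in the dual to respect equality almost everywhere on \<open>U\<close>.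
  Its values outside \<open>W1 (ennreal p) U\<close> are irrelevant.\<close>

definition W1_dual :: "real \<Rightarrow> (real^'n) set \<Rightarrow> ((real^'n \<Rightarrow> real^'m) \<Rightarrow> real) set"
  where "W1_dual p U = {l.
    (\<forall>u \<in> W1 (ennreal p) U. \<forall>v \<in> W1 (ennreal p) U. l (\<lambda>x. u x + v x) = l u + l v) \<and>
    (\<forall>c. \<forall>u \<in> W1 (ennreal p) U. l (\<lambda>x. c *\<^sub>R u x) = c * l u) \<and>
    (\<exists>C. \<forall>u \<in> W1 (ennreal p) U. \<bar>l u\<bar> \<le> C * W1_norm p U u)}"

definition W1_weakly_converges ::
    "real \<Rightarrow> (real^'n) set \<Rightarrow> (nat \<Rightarrow> real^'n \<Rightarrow> real^'m) \<Rightarrow> (real^'n \<Rightarrow> real^'m) \<Rightarrow> bool"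
  where "W1_weakly_converges p U u v \<longleftrightarrow>
    (\<forall>n. u n \<in> W1 (ennreal p) U) \<and> v \<in> W1 (ennreal p) U \<and>
    (\<forall>l \<in> W1_dual p U. (\<lambda>n. l (u n)) \<longlonglongrightarrow> l v)"

definition W1_seq_weakly_lsc ::
    "real \<Rightarrow> (real^'n) set \<Rightarrow> ((real^'n \<Rightarrow> real^'m) \<Rightarrow> ennreal) \<Rightarrow> bool"
  where "W1_seq_weakly_lsc p U F \<longleftrightarrow>
    (\<forall>u v. W1_weakly_converges p U u v \<longrightarrow> F v \<le> liminf (\<lambda>n. F (u n)))"

section \<open>Convergence in measure and equi-integrability\<close>

definition converges_to_zero_in_measure :: "'a measure \<Rightarrow> (nat \<Rightarrow> 'a \<Rightarrow> real) \<Rightarrow> bool"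
  where "converges_to_zero_in_measure M f \<longleftrightarrow>
    (\<forall>n. f n \<in> borel_measurable M) \<and>
    (\<forall>\<epsilon>>0. (\<lambda>n. emeasure M {x \<in> space M. \<bar>f n x\<bar> > \<epsilon>}) \<longlonglongrightarrow> 0)"

text \<open>On the unit cube the measure is finite and non-atomic, so the condition below already
  entails that the integrals are uniformly bounded.\<close>

definition equi_integrable :: "'a measure \<Rightarrow> (nat \<Rightarrow> 'a \<Rightarrow> ennreal) \<Rightarrow> bool"
  where "equi_integrable M f \<longleftrightarrow>
    (\<forall>n. f n \<in> borel_measurable M) \<and>
    (\<forall>\<epsilon>::real. \<epsilon> > 0 \<longrightarrow> (\<exists>\<delta>::real. \<delta> > 0 \<and>
      (\<forall>n. \<forall>E \<in> sets M. emeasure M E < ennreal \<delta> \<longrightarrow> (\<integral>\<^sup>+ x \<in> E. f n x \<partial>M) < ennreal \<epsilon>)))"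

section \<open>Lipschitz boundary\<close>

text \<open>Near every boundary point, \<open>U\<close> is the strict epigraph, in some direction \<open>e\<close>, of a Lipschitz
  function \<open>g\<close> on the hyperplane orthogonal to \<open>e\<close>.\<close>

definition lipschitz_boundary :: "(real^'n) set \<Rightarrow> bool"
  where "lipschitz_boundary U \<longleftrightarrow> (\<forall>x \<in> frontier U. \<exists>r>0. \<exists>e g C.
    norm e = 1 \<and> C-lipschitz_on {z. z \<bullet> e = 0} (g :: real^'n \<Rightarrow> real) \<and>
    U \<inter> ball x r = {y \<in> ball x r. y \<bullet> e > g (y - (y \<bullet> e) *\<^sub>R e)})"

section \<open>Quasiconvexity and the compactness condition\<close>

definition unit_cube :: "(real^'n) set"
  where "unit_cube = {y. \<forall>i. - 1 / 2 < y $ i \<and> y $ i < 1 / 2}"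

definition energy :: "(real^'n^'m \<Rightarrow> ennreal) \<Rightarrow> (real^'n) set \<Rightarrow> (real^'n \<Rightarrow> real^'m) \<Rightarrow> ennreal"
  where "energy L U u = (\<integral>\<^sup>+ x. L (weak_gradient U u x) \<partial>lebesgue_on U)"

definition affine_W1_zero :: "ennreal \<Rightarrow> real^'n^'m \<Rightarrow> (real^'n \<Rightarrow> real^'m) set"
  where "affine_W1_zero q \<xi> = (\<lambda>w y. \<xi> *v y + w y) ` W1_zero q unit_cube"

definition W1_quasiconvex :: "ennreal \<Rightarrow> (real^'n^'m \<Rightarrow> ennreal) \<Rightarrow> bool"
  where "W1_quasiconvex q L \<longleftrightarrow>
    (\<forall>\<xi>. \<forall>u \<in> affine_W1_zero q \<xi>. energy L unit_cube u \<ge> L \<xi>)"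

definition condition_C :: "real \<Rightarrow> ennreal \<Rightarrow> (real^'n^'m \<Rightarrow> ennreal) \<Rightarrow> bool"
  where "condition_C p q L \<longleftrightarrow>
    (\<forall>\<xi> v. W1_weakly_converges p unit_cube v (\<lambda>y. \<xi> *v y) \<and>
           (SUP n. energy L unit_cube (v n)) < \<infinity> \<longrightarrow>
      (\<exists>r w. strict_mono (r :: nat \<Rightarrow> nat) \<and> (\<forall>n. w n \<in> affine_W1_zero q \<xi>) \<and>
        converges_to_zero_in_measure (lebesgue_on unit_cube)
          (\<lambda>n y. norm (weak_gradient unit_cube (v (r n)) y - weak_gradient unit_cube (w n) y)) \<and>
        equi_integrable (lebesgue_on unit_cube)
          (\<lambda>n y. L (weak_gradient unit_cube (w n) y))))"

end

theory Submission
  imports Defs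
begin

text \<open>
  Condition \<open>C\<close> and quasiconvexity give the lower bound \<open>L \<xi> \<le> liminf (energy L unit_cube (v n))\<close> whenever
  \<open>v n\<close> converges weakly to the linear map \<open>\<xi>\<close> on the unit cube. Instead of blowing up at single points, this is turned into
  a quantitative statement: by compactness there is a \<open>\<delta>\<close>, uniform for bounded \<open>\<xi>\<close>, such that a function with bounded gradient
  that is \<open>\<delta>\<close>-close to \<open>\<xi>\<close> in \<open>Lp\<close> has energy at least \<open>min (L \<xi>) K - e\<close>. The domain is then exhausted by finitely many
  small cubes \<open>Q\<close>, on which the weak limit is close to an affine map with gradient the mean of its gradient over \<open>Q\<close>
  (Poincare inequality), and so is every late member of the sequence (Rellich's theorem). Rescaling \<open>Q\<close> to the
  unit cube yields the lower bound on all cubes but a few, whose total measure is controlled by the \<open>p\<close>-energies.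

  The Poincare inequality comes from successive bisection: testing the weak gradient with a tent function compares the
  means over the two halves of a box. That strong \<open>Lp\<close> convergence with bounded gradients implies
  weak convergence against every bounded functional is proved without representing the dual space, by minimising the
  gradient norm in a convex set and using the uniform convexity of \<open>Lp\<close>.
\<close>

section \<open>Lp spaces\<close>

text \<open>The obstacle is that \<open>L\<close> has no upper bound: it may be infinite, no energy
  is controlled by gradients, and functions cannot be cut off near the boundary of a cube. Condition
  \<open>C\<close> can therefore only be used on sequences as it stands, and compactness turns it
  into an estimate for single functions. Truncating \<open>L\<close> at a level \<open>K\<close>
  makes this possible in two ways. A counterexample to the truncated estimate has energy at most
  \<open>K\<close>, which is the bound that \<open>condition_C\<close> asks for; and a set of
  measure \<open>s\<close> on which the estimate fails costs at most \<open>K * s\<close>. Monotone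
  convergence removes the level at the end.

  The compactness argument produces convergence in \<open>Lp\<close> with bounded gradients, while
  \<open>condition_C\<close> speaks of all functionals in \<open>W1_dual\<close>. In the other
  direction a weakly convergent sequence enters only through its bounded gradients and the
  convergence of its means. As \<delta> is fixed before the cubes are chosen, the cubes may be as
  small as the limit function requires, and only finitely many of them have to be waited
  for.\<close>

definition in_Lp :: "'a measure \<Rightarrow> real \<Rightarrow> ('a \<Rightarrow> 'b::euclidean_space) \<Rightarrow> bool"
  where "in_Lp M p f \<longleftrightarrow> f \<in> borel_measurable M \<and> integrable M (\<lambda>x. norm (f x) powr p)"

text \<open>The p-th power of the norm is kept as a quantity of its own because it is additive over
  disjoint domains and scales by a power of the dilation factor.\<close>

definition Lp_int :: "'a measure \<Rightarrow> real \<Rightarrow> ('a \<Rightarrow> 'b::euclidean_space) \<Rightarrow> real"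
  where "Lp_int M p f = (\<integral>x. norm (f x) powr p \<partial>M)"

lemma in_Lp_measurable: "in_Lp M p f \<Longrightarrow> f \<in> borel_measurable M"
  by (simp add: in_Lp_def)

lemma Lp_int_nonneg: "0 \<le> Lp_int M p f"
  unfolding Lp_int_def by (rule integral_nonneg_AE) auto

lemma powr_add_le:
  fixes a b p :: real
  assumes "0 \<le> a" "0 \<le> b" "0 \<le> p"
  shows "(a + b) powr p \<le> 2 powr p * (a powr p + b powr p)"
proof -
  have "(a + b) powr p \<le> (2 * max a b) powr p"
    by (rule powr_mono2) (use assms in auto)
  also have "\<dots> = 2 powr p * (max a b) powr p"
    using assms by (simp add: powr_mult)
  also have "\<dots> \<le> 2 powr p * (a powr p + b powr p)"
    by (rule mult_left_mono) (auto simp: max_def)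
  finally show ?thesis .
qed

lemma in_Lp_bound:
  assumes "in_Lp M p g" "f \<in> borel_measurable M" "AE x in M. norm (f x) \<le> norm (g x)" "0 \<le> p"
  shows "in_Lp M p f" "Lp_int M p f \<le> Lp_int M p g"
proof -
  have g: "integrable M (\<lambda>x. norm (g x) powr p)" using assms by (simp add: in_Lp_def)
  have ae: "AE x in M. norm (f x) powr p \<le> norm (g x) powr p"
    using assms(3) by eventually_elim (use \<open>0 \<le> p\<close> in \<open>simp add: powr_mono2\<close>)
  have f: "integrable M (\<lambda>x. norm (f x) powr p)"
    using g by (rule Bochner_Integration.integrable_bound) (use assms(2) ae in auto)
  show "in_Lp M p f" using f assms(2) by (simp add: in_Lp_def)
  show "Lp_int M p f \<le> Lp_int M p g"
    unfolding Lp_int_def by (rule integral_mono_AE[OF f g ae])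
qed

lemma in_Lp_cong_AE:
  assumes "f \<in> borel_measurable M" "g \<in> borel_measurable M" "AE x in M. f x = g x"
  shows "in_Lp M p f \<longleftrightarrow> in_Lp M p g" "Lp_int M p f = Lp_int M p g"
proof -
  have ae: "AE x in M. norm (f x) powr p = norm (g x) powr p"
    using assms(3) by eventually_elim simp
  have [measurable]: "f \<in> borel_measurable M" "g \<in> borel_measurable M" using assms by auto
  show "in_Lp M p f \<longleftrightarrow> in_Lp M p g"
    unfolding in_Lp_def using integrable_cong_AE[OF _ _ ae] assms by auto
  show "Lp_int M p f = Lp_int M p g"
    unfolding Lp_int_def by (rule integral_cong_AE[OF _ _ ae]) auto
qed

lemma in_Lp_add:
  assumes "in_Lp M p f" "in_Lp M p g" "0 \<le> p"
  shows "in_Lp M p (\<lambda>x. f x + g x)"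
    and "Lp_int M p (\<lambda>x. f x + g x) \<le> 2 powr p * (Lp_int M p f + Lp_int M p g)"
proof -
  have [measurable]: "f \<in> borel_measurable M" "g \<in> borel_measurable M"
    using assms by (auto simp: in_Lp_def)
  have i: "integrable M (\<lambda>x. norm (f x) powr p)" "integrable M (\<lambda>x. norm (g x) powr p)"
    using assms by (auto simp: in_Lp_def)
  have le: "norm (f x + g x) powr p \<le> 2 powr p * (norm (f x) powr p + norm (g x) powr p)" for x
  proof -
    have "norm (f x + g x) powr p \<le> (norm (f x) + norm (g x)) powr p"
      by (rule powr_mono2) (use assms norm_triangle_ineq in auto)
    also have "\<dots> \<le> 2 powr p * (norm (f x) powr p + norm (g x) powr p)"
      by (rule powr_add_le) (use assms in auto)
    finally show ?thesis .
  qed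
  have i2: "integrable M (\<lambda>x. 2 powr p * (norm (f x) powr p + norm (g x) powr p))"
    using i by auto
  have i3: "integrable M (\<lambda>x. norm (f x + g x) powr p)"
    using i2 by (rule Bochner_Integration.integrable_bound) (use le in auto)
  show "in_Lp M p (\<lambda>x. f x + g x)" using i3 by (simp add: in_Lp_def)
  have "Lp_int M p (\<lambda>x. f x + g x) \<le> (\<integral>x. 2 powr p * (norm (f x) powr p + norm (g x) powr p) \<partial>M)"
    unfolding Lp_int_def by (rule integral_mono[OF i3 i2]) (use le in auto)
  also have "\<dots> = 2 powr p * (Lp_int M p f + Lp_int M p g)"
    unfolding Lp_int_def using i by simp
  finally show "Lp_int M p (\<lambda>x. f x + g x) \<le> 2 powr p * (Lp_int M p f + Lp_int M p g)" .
qed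

lemma in_Lp_scaleR:
  assumes "in_Lp M p f"
  shows "in_Lp M p (\<lambda>x. c *\<^sub>R f x)" "Lp_int M p (\<lambda>x. c *\<^sub>R f x) = \<bar>c\<bar> powr p * Lp_int M p f"
  using assms by (auto simp: in_Lp_def Lp_int_def powr_mult)

lemma in_Lp_uminus:
  assumes "in_Lp M p f"
  shows "in_Lp M p (\<lambda>x. - f x)" "Lp_int M p (\<lambda>x. - f x) = Lp_int M p f"
  using assms by (auto simp: in_Lp_def Lp_int_def)

lemma in_Lp_diff:
  assumes "in_Lp M p f" "in_Lp M p g" "0 \<le> p"
  shows "in_Lp M p (\<lambda>x. f x - g x)"
    and "Lp_int M p (\<lambda>x. f x - g x) \<le> 2 powr p * (Lp_int M p f + Lp_int M p g)"
  using in_Lp_add[OF assms(1) in_Lp_uminus(1)[OF assms(2)] assms(3)] in_Lp_uminus(2)[OF assms(2)]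
  by auto

lemma in_Lp_const:
  assumes "finite_measure M"
  shows "in_Lp M p (\<lambda>x. c)" "Lp_int M p (\<lambda>x. c) = norm c powr p * measure M (space M)"
  using finite_measure.emeasure_finite[OF assms] assms finite_measure.integrable_const[OF assms]
  by (auto simp: in_Lp_def Lp_int_def)

section \<open>Convexity and the classical integral inequalities\<close>

lemma convex_powr_ineq:
  fixes a b p s :: real
  assumes "0 \<le> a" "0 \<le> b" "1 \<le> p" "0 \<le> s" "s \<le> 1"
  shows "((1 - s) * a + s * b) powr p \<le> (1 - s) * a powr p + s * b powr p"
proof -
  \<comment> \<open>Convexity is applied on the open half-line; an endpoint 0 is covered by
    \<open>t powr p \<le> t\<close> for \<open>t\<close> in the unit interval.\<close>
  have aux: "(t * c) powr p \<le> t * c powr p" if "0 \<le> t" "t \<le> 1" "0 \<le> c" for t c :: real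
  proof (cases "t = 0")
    case False
    have "(t * c) powr p = t powr p * c powr p" using that by (simp add: powr_mult)
    also have "t powr p \<le> t powr 1"
      by (rule powr_mono') (use that False assms in auto)
    finally show ?thesis using that False by (simp add: mult_right_mono)
  qed (use assms in auto)
  show ?thesis
  proof (cases "a = 0 \<or> b = 0")
    case True
    then show ?thesis using aux[of s b] aux[of "1 - s" a] assms by auto
  next
    case False
    have "convex_on {0<..} (\<lambda>x::real. x powr p)" by (rule powr_convex) (use assms in auto)
    from convex_onD[OF this, of s a b] False assms show ?thesis by auto
  qed
qed

lemma Lp_int_convex:
  assumes f: "in_Lp M p f" and g: "in_Lp M p g" and p: "1 \<le> p" and s: "0 \<le> s" "s \<le> 1"
  shows "Lp_int M p (\<lambda>x. (1 - s) *\<^sub>R f x + s *\<^sub>R g x) \<le> (1 - s) * Lp_int M p f + s * Lp_int M p g"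
proof -
  have i: "integrable M (\<lambda>x. norm (f x) powr p)" "integrable M (\<lambda>x. norm (g x) powr p)"
    using f g by (auto simp: in_Lp_def)
  have h: "in_Lp M p (\<lambda>x. (1 - s) *\<^sub>R f x + s *\<^sub>R g x)"
    by (intro in_Lp_add in_Lp_scaleR f g) (use p in auto)
  have "Lp_int M p (\<lambda>x. (1 - s) *\<^sub>R f x + s *\<^sub>R g x)
      \<le> (\<integral>x. (1 - s) * norm (f x) powr p + s * norm (g x) powr p \<partial>M)"
    unfolding Lp_int_def
  proof (rule integral_mono)
    show "integrable M (\<lambda>x. norm ((1 - s) *\<^sub>R f x + s *\<^sub>R g x) powr p)"
      using h by (simp add: in_Lp_def)
    show "integrable M (\<lambda>x. (1 - s) * norm (f x) powr p + s * norm (g x) powr p)"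
      using i by auto
    fix x
    have "norm ((1 - s) *\<^sub>R f x + s *\<^sub>R g x) powr p \<le> ((1 - s) * norm (f x) + s * norm (g x)) powr p"
    proof (rule powr_mono2)
      show "norm ((1 - s) *\<^sub>R f x + s *\<^sub>R g x) \<le> (1 - s) * norm (f x) + s * norm (g x)"
        using norm_triangle_ineq[of "(1 - s) *\<^sub>R f x" "s *\<^sub>R g x"] s by simp
    qed (use p in auto)
    also have "\<dots> \<le> (1 - s) * norm (f x) powr p + s * norm (g x) powr p"
      by (rule convex_powr_ineq) (use p s in auto)
    finally show "norm ((1 - s) *\<^sub>R f x + s *\<^sub>R g x) powr p
        \<le> (1 - s) * norm (f x) powr p + s * norm (g x) powr p" .
  qed
  also have "\<dots> = (1 - s) * Lp_int M p f + s * Lp_int M p g"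
    unfolding Lp_int_def using i by simp
  finally show ?thesis .
qed

definition Lp_nrm :: "'a measure \<Rightarrow> real \<Rightarrow> ('a \<Rightarrow> 'b::euclidean_space) \<Rightarrow> real"
  where "Lp_nrm M p f = Lp_int M p f powr (1 / p)"

lemma Lp_nrm_nonneg: "0 \<le> Lp_nrm M p f"
  by (simp add: Lp_nrm_def)

lemma Lp_nrm_powr: "0 < p \<Longrightarrow> Lp_nrm M p f powr p = Lp_int M p f"
  using Lp_int_nonneg[of M p f] by (simp add: Lp_nrm_def powr_powr)

lemma Lp_nrm_le_iff: "0 < p \<Longrightarrow> 0 \<le> c \<Longrightarrow> Lp_nrm M p f \<le> c \<longleftrightarrow> Lp_int M p f \<le> c powr p"
  by (metis Lp_nrm_nonneg Lp_nrm_powr linorder_not_less order_less_imp_le powr_less_mono2 powr_mono2)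

lemma Lp_int_0_AE:
  assumes "in_Lp M p f" "Lp_int M p f = 0"
  shows "AE x in M. f x = 0"
proof -
  have "AE x in M. norm (f x) powr p = 0"
    using assms integral_nonneg_eq_0_iff_AE[of M "\<lambda>x. norm (f x) powr p"]
    by (auto simp: in_Lp_def Lp_int_def)
  then show ?thesis by eventually_elim auto
qed

lemma Lp_nrm_scaleR:
  assumes "in_Lp M p f" "0 < p"
  shows "Lp_nrm M p (\<lambda>x. c *\<^sub>R f x) = \<bar>c\<bar> * Lp_nrm M p f"
  using assms Lp_int_nonneg[of M p f] by (simp add: Lp_nrm_def in_Lp_scaleR powr_mult powr_powr)

text \<open>The sum is \<open>a' + b'\<close> times a convex combination of \<open>f / a'\<close>
  and \<open>g / b'\<close>, both of norm at most 1, so convexity of the p-th power gives the bound.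
  Taking \<open>a'\<close> and \<open>b'\<close> strictly above the norms avoids a division by zero;
  afterwards they tend to the norms.\<close>

lemma Lp_nrm_triangle:
  assumes f: "in_Lp M p f" and g: "in_Lp M p g" and p: "1 \<le> p"
  shows "Lp_nrm M p (\<lambda>x. f x + g x) \<le> Lp_nrm M p f + Lp_nrm M p g"
proof -
  define a where "a = Lp_nrm M p f"
  define b where "b = Lp_nrm M p g"
  have ab0: "0 \<le> a" "0 \<le> b" by (auto simp: a_def b_def Lp_nrm_nonneg)
  have key: "Lp_int M p (\<lambda>x. f x + g x) \<le> (a' + b') powr p"
    if a': "a < a'" and b': "b < b'" for a' b'
  proof -
    define s where "s = b' / (a' + b')"
    have pos: "0 < a'" "0 < b'" using a' b' ab0 by auto
    have s: "0 \<le> s" "s \<le> 1" "1 - s = a' / (a' + b')" using pos by (auto simp: s_def field_simps)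
    have fi: "in_Lp M p (\<lambda>x. (1 / a') *\<^sub>R f x)" "in_Lp M p (\<lambda>x. (1 / b') *\<^sub>R g x)"
      using f g in_Lp_scaleR(1) by blast+
    have "Lp_int M p f \<le> a' powr p" "Lp_int M p g \<le> b' powr p"
      using Lp_nrm_le_iff[of p a' M f] Lp_nrm_le_iff[of p b' M g] a' b' p pos
      by (auto simp: a_def b_def)
    then have n1: "Lp_int M p (\<lambda>x. (1 / a') *\<^sub>R f x) \<le> 1" "Lp_int M p (\<lambda>x. (1 / b') *\<^sub>R g x) \<le> 1"
      using pos f g by (auto simp: in_Lp_scaleR powr_divide field_simps)
    have "Lp_int M p (\<lambda>x. (1 - s) *\<^sub>R ((1 / a') *\<^sub>R f x) + s *\<^sub>R ((1 / b') *\<^sub>R g x))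
      \<le> (1 - s) * Lp_int M p (\<lambda>x. (1 / a') *\<^sub>R f x) + s * Lp_int M p (\<lambda>x. (1 / b') *\<^sub>R g x)"
      by (rule Lp_int_convex[OF fi p s(1,2)])
    also have "\<dots> \<le> (1 - s) * 1 + s * 1"
      by (intro add_mono mult_left_mono n1) (use s in auto)
    finally have le1: "Lp_int M p (\<lambda>x. (1 - s) *\<^sub>R ((1 / a') *\<^sub>R f x) + s *\<^sub>R ((1 / b') *\<^sub>R g x)) \<le> 1"
      by simp
    have eq: "(\<lambda>x. f x + g x) = (\<lambda>x. (a' + b') *\<^sub>R ((1 - s) *\<^sub>R ((1 / a') *\<^sub>R f x) + s *\<^sub>R ((1 / b') *\<^sub>R g x)))"
      using pos s(3) by (auto simp: s_def scaleR_add_right)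
    have "Lp_int M p (\<lambda>x. f x + g x) = (a' + b') powr p *
        Lp_int M p (\<lambda>x. (1 - s) *\<^sub>R ((1 / a') *\<^sub>R f x) + s *\<^sub>R ((1 / b') *\<^sub>R g x))"
      proof -
      have "in_Lp M p (\<lambda>x. (1 - s) *\<^sub>R ((1 / a') *\<^sub>R f x) + s *\<^sub>R ((1 / b') *\<^sub>R g x))"
        by (intro in_Lp_add in_Lp_scaleR f g) (use p in auto)
      from in_Lp_scaleR(2)[OF this, of "a' + b'"] pos show ?thesis unfolding eq by simp
    qed
    also have "\<dots> \<le> (a' + b') powr p * 1"
      by (rule mult_left_mono[OF le1]) auto
    finally show ?thesis by simp
  qed
  have "Lp_nrm M p (\<lambda>x. f x + g x) \<le> a + b + e" if "e > 0" for e
  proof -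
    have "Lp_nrm M p (\<lambda>x. f x + g x) \<le> (a + e/2) + (b + e/2)"
      using key[of "a + e/2" "b + e/2"] Lp_nrm_le_iff[of p "(a + e/2) + (b + e/2)" M "\<lambda>x. f x + g x"]
        that p ab0 by simp
    then show ?thesis by simp
  qed
  then show ?thesis unfolding a_def b_def by (rule field_le_epsilon)
qed

text \<open>Young's inequality, applied after normalising both functions. The inner product in the
  integrand is what later pairs gradients with matrix fields of the conjugate exponent.\<close>

lemma Holder_inequality:
  fixes f g :: "'a \<Rightarrow> 'b::euclidean_space"
  assumes f: "in_Lp M p f" and g: "in_Lp M q g" and pq: "1 < p" "1 < q" "1 / p + 1 / q = 1"
  shows "integrable M (\<lambda>x. f x \<bullet> g x)"
    and "\<bar>\<integral>x. f x \<bullet> g x \<partial>M\<bar> \<le> Lp_nrm M p f * Lp_nrm M q g"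
proof -
  have [measurable]: "f \<in> borel_measurable M" "g \<in> borel_measurable M"
    using f g by (auto simp: in_Lp_def)
  have i: "integrable M (\<lambda>x. norm (f x) powr p)" "integrable M (\<lambda>x. norm (g x) powr q)"
    using f g by (auto simp: in_Lp_def)
  have bd: "norm (f x \<bullet> g x) \<le> norm (f x) powr p / p + norm (g x) powr q / q" for x
    using Youngs_inequality[OF pq, of "norm (f x)" "norm (g x)"] Cauchy_Schwarz_ineq2[of "f x" "g x"]
    by auto
  have i2: "integrable M (\<lambda>x. norm (f x) powr p / p + norm (g x) powr q / q)" using i by auto
  show int: "integrable M (\<lambda>x. f x \<bullet> g x)"
  proof (rule Bochner_Integration.integrable_bound[OF i2])
    show "AE x in M. norm (f x \<bullet> g x) \<le> norm (norm (f x) powr p / p + norm (g x) powr q / q)"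
      using order_trans[OF bd abs_ge_self] by (auto simp del: real_norm_def simp: real_norm_def)
  qed simp
  define a where "a = Lp_nrm M p f"
  define b where "b = Lp_nrm M q g"
  have ab0: "0 \<le> a" "0 \<le> b" by (auto simp: a_def b_def Lp_nrm_nonneg)
  show "\<bar>\<integral>x. f x \<bullet> g x \<partial>M\<bar> \<le> Lp_nrm M p f * Lp_nrm M q g"
  proof (cases "a = 0 \<or> b = 0")
    case True
    then have "Lp_int M p f = 0 \<or> Lp_int M q g = 0"
      using pq by (auto simp: a_def b_def Lp_nrm_def)
    then have "AE x in M. f x = 0 \<or> g x = 0"
      using Lp_int_0_AE[OF f] Lp_int_0_AE[OF g] by (auto elim: eventually_mono)
    then have "AE x in M. f x \<bullet> g x = 0" by eventually_elim auto
    then have "(\<integral>x. f x \<bullet> g x \<partial>M) = (\<integral>x. 0 \<partial>M)"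
      by (intro integral_cong_AE) auto
    then show ?thesis using ab0 by (simp add: a_def b_def)
  next
    case False
    then have pos: "0 < a" "0 < b" using ab0 by auto
    have ap: "a powr p = Lp_int M p f" "b powr q = Lp_int M q g"
      using pq by (auto simp: a_def b_def Lp_nrm_powr)
    have bd2: "\<bar>f x \<bullet> g x\<bar> \<le> a * b * (norm (f x) powr p / (p * a powr p) + norm (g x) powr q / (q * b powr q))" for x
    proof -
      have "norm (f x) / a * (norm (g x) / b) \<le> (norm (f x) / a) powr p / p + (norm (g x) / b) powr q / q"
        by (rule Youngs_inequality[OF pq]) (use pos in auto)
      also have "\<dots> = norm (f x) powr p / (p * a powr p) + norm (g x) powr q / (q * b powr q)"
        using pos by (simp add: powr_divide mult.commute)
      finally have "norm (f x) * norm (g x) \<le> a * b * (norm (f x) powr p / (p * a powr p) + norm (g x) powr q / (q * b powr q))"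
        using pos by (simp add: field_simps)
      then show ?thesis using Cauchy_Schwarz_ineq2[of "f x" "g x"] by linarith
    qed
    have i3: "integrable M (\<lambda>x. a * b * (norm (f x) powr p / (p * a powr p) + norm (g x) powr q / (q * b powr q)))"
      using i by auto
    have "\<bar>\<integral>x. f x \<bullet> g x \<partial>M\<bar> \<le> (\<integral>x. \<bar>f x \<bullet> g x\<bar> \<partial>M)" by (rule integral_abs_bound)
    also have "\<dots> \<le> (\<integral>x. a * b * (norm (f x) powr p / (p * a powr p) + norm (g x) powr q / (q * b powr q)) \<partial>M)"
      by (rule integral_mono[OF _ i3]) (use int bd2 in auto)
    also have "\<dots> = a * b * (Lp_int M p f / (p * a powr p) + Lp_int M q g / (q * b powr q))"
      using i by (simp add: Lp_int_def)
    also have "\<dots> = a * b * (1 / p + 1 / q)" using pos by (simp flip: ap)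
    finally show ?thesis using pq by (simp add: a_def b_def)
  qed
qed

text \<open>Hoelder's inequality against the constant 1 on a finite measure space.\<close>

lemma in_Lp_integrable:
  assumes M: "finite_measure M" and f: "in_Lp M p f" and p: "1 < p"
  shows "integrable M f"
    and "(\<integral>x. norm (f x) \<partial>M) \<le> Lp_nrm M p f * measure M (space M) powr (1 - 1 / p)"
proof -
  define q where "q = p / (p - 1)"
  have q: "1 < q" "1 / p + 1 / q = 1" "1 / q = 1 - 1 / p" using p by (auto simp: q_def field_simps)
  have [measurable]: "f \<in> borel_measurable M" using f by (auto simp: in_Lp_def)
  have f': "in_Lp M p (\<lambda>x. norm (f x))" "Lp_nrm M p (\<lambda>x. norm (f x)) = Lp_nrm M p f"
    using f by (auto simp: in_Lp_def Lp_nrm_def Lp_int_def)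
  have g: "in_Lp M q (\<lambda>x. 1::real)" using in_Lp_const[OF M] by blast
  have "Lp_nrm M q (\<lambda>x. 1::real) = measure M (space M) powr (1 - 1 / p)"
    using q(3) by (simp add: Lp_nrm_def in_Lp_const[OF M])
  note H = Holder_inequality[OF f'(1) g p q(1,2)]
  have n: "integrable M (\<lambda>x. norm (f x))" using H(1) by simp
  then show "integrable M f" by (subst (asm) integrable_norm_iff) auto
  show "(\<integral>x. norm (f x) \<partial>M) \<le> Lp_nrm M p f * measure M (space M) powr (1 - 1 / p)"
    using H(2) f'(2) \<open>Lp_nrm M q (\<lambda>x. 1::real) = _\<close> by simp
qed

lemma Lp_Jensen:
  assumes M: "finite_measure M" and f: "in_Lp M p f" and p: "1 < p"
  shows "norm (\<integral>x. f x \<partial>M) powr p \<le> measure M (space M) powr (p - 1) * Lp_int M p f"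
proof -
  have "norm (\<integral>x. f x \<partial>M) \<le> Lp_nrm M p f * measure M (space M) powr (1 - 1 / p)"
    using in_Lp_integrable(2)[OF assms] integral_norm_bound[of M f] by linarith
  then have "norm (\<integral>x. f x \<partial>M) powr p \<le> (Lp_nrm M p f * measure M (space M) powr (1 - 1 / p)) powr p"
    by (rule powr_mono2[rotated 2]) (use p in auto)
  also have "\<dots> = Lp_int M p f * measure M (space M) powr (p - 1)"
    using p by (simp add: powr_mult Lp_nrm_nonneg Lp_nrm_powr powr_powr left_diff_distrib)
  finally show ?thesis by (simp add: mult.commute)
qed

lemma Lp_Markov:
  assumes f: "in_Lp M p f" and c: "0 < c" and p: "0 < p"
  shows "emeasure M {x \<in> space M. norm (f x) \<ge> c} \<le> ennreal (Lp_int M p f / c powr p)"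
proof -
  have iff: "c \<le> t \<longleftrightarrow> c powr p \<le> t powr p" if "0 \<le> t" for t
    using powr_mono2[of p c t] powr_less_mono2[of p t c] c p that by (cases "c \<le> t") auto
  have "{x \<in> space M. norm (f x) \<ge> c} = {x \<in> space M. norm (f x) powr p \<ge> c powr p}"
    by (intro Collect_cong conj_cong refl iff) simp
  moreover have "emeasure M {x \<in> space M. norm (f x) powr p \<ge> c powr p}
      \<le> (1 / c powr p) * (\<integral>x. norm (f x) powr p \<partial>M)"
    by (rule integral_Markov_inequality) (use f c in \<open>auto simp: in_Lp_def\<close>)
  ultimately show ?thesis by (simp add: Lp_int_def)
qed

section \<open>Fatou's lemma and completeness\<close>

lemma Lp_Fatou:
  fixes f :: "nat \<Rightarrow> 'a \<Rightarrow> 'b::euclidean_space"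
  assumes f: "\<And>k. in_Lp M p (f k)" and le: "\<And>k. k \<ge> K \<Longrightarrow> Lp_int M p (f k) \<le> C"
    and lim: "AE x in M. (\<lambda>k. f k x) \<longlonglongrightarrow> g x" and g[measurable]: "g \<in> borel_measurable M" and p: "0 < p"
  shows "in_Lp M p g" "Lp_int M p g \<le> C"
proof -
  have [measurable]: "f k \<in> borel_measurable M" for k using f by (auto simp: in_Lp_def)
  have C0: "0 \<le> C" using le[of K] Lp_int_nonneg[of M p "f K"] by simp
  have eq: "(\<integral>\<^sup>+x. ennreal (norm (f k x) powr p) \<partial>M) = ennreal (Lp_int M p (f k))" for k
    unfolding Lp_int_def by (rule nn_integral_eq_integral) (use f[of k] in \<open>auto simp: in_Lp_def\<close>)
  have ae: "AE x in M. ennreal (norm (g x) powr p) = liminf (\<lambda>k. ennreal (norm (f k x) powr p))"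
    using lim
  proof eventually_elim
    case (elim x)
    then have "(\<lambda>k. ennreal (norm (f k x) powr p)) \<longlonglongrightarrow> ennreal (norm (g x) powr p)"
      by (intro tendsto_ennrealI tendsto_powr' tendsto_norm tendsto_const) (use p in auto)
    then show ?case by (simp add: lim_imp_Liminf[symmetric])
  qed
  have "(\<integral>\<^sup>+x. ennreal (norm (g x) powr p) \<partial>M) = (\<integral>\<^sup>+x. liminf (\<lambda>k. ennreal (norm (f k x) powr p)) \<partial>M)"
    by (rule nn_integral_cong_AE[OF ae])
  also have "\<dots> \<le> liminf (\<lambda>k. \<integral>\<^sup>+x. ennreal (norm (f k x) powr p) \<partial>M)"
    by (rule nn_integral_liminf) measurable
  also have "\<dots> \<le> ennreal C"
    unfolding eq by (intro Liminf_le) (auto simp: eventually_sequentially intro!: exI[of _ K] ennreal_leI le)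
  finally have le': "(\<integral>\<^sup>+x. ennreal (norm (g x) powr p) \<partial>M) \<le> ennreal C" .
  have i: "integrable M (\<lambda>x. norm (g x) powr p)"
    by (rule integrableI_nonneg) (use le' in \<open>auto simp: le_less_trans\<close>)
  then show "in_Lp M p g" by (simp add: in_Lp_def)
  have "ennreal (Lp_int M p g) \<le> ennreal C"
    using le' nn_integral_eq_integral[OF i] by (simp add: Lp_int_def)
  then show "Lp_int M p g \<le> C" using C0 by simp
qed

text \<open>A subsequence whose consecutive differences have norm below \<open>(1/4) ^ k\<close>
  moves by \<open>(1/2) ^ k\<close> or more only on sets of summable measure, so by Borel-Cantelli
  it converges almost everywhere. Fatou's lemma then turns the Cauchy property into norm convergence
  of the whole sequence.\<close>

lemma Lp_complete:
  fixes f :: "nat \<Rightarrow> 'a \<Rightarrow> 'b::euclidean_space"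
  assumes f: "\<And>n. in_Lp M p (f n)" and p: "0 < p"
    and cauchy: "\<And>e. e > 0 \<Longrightarrow> \<exists>N. \<forall>m\<ge>N. \<forall>n\<ge>N. Lp_int M p (\<lambda>x. f m x - f n x) < e"
  obtains F where "in_Lp M p F" "(\<lambda>n. Lp_int M p (\<lambda>x. f n x - F x)) \<longlonglongrightarrow> 0"
proof -
  have [measurable]: "f k \<in> borel_measurable M" for k using f by (auto simp: in_Lp_def)
  obtain N where N: "\<And>k m n. m \<ge> N k \<Longrightarrow> n \<ge> N k \<Longrightarrow> Lp_int M p (\<lambda>x. f m x - f n x) < ((1/4)^k) powr p"
  proof -
    have "\<forall>k. \<exists>N. \<forall>m\<ge>N. \<forall>n\<ge>N. Lp_int M p (\<lambda>x. f m x - f n x) < ((1/4)^k) powr p"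
      by (intro allI cauchy) simp
    then show ?thesis using that by metis
  qed
  \<comment> \<open>Adding up all thresholds so far keeps \<open>r\<close> increasing and above
    \<open>N k\<close>; the summand \<open>k\<close> drives it to infinity.\<close>
  define r where "r k = (\<Sum>j\<le>k. N j) + k" for k
  have rN: "r k \<ge> N k" for k
    using sum_nonneg_leq_bound[of "{..k}" N "(\<Sum>j\<le>k. N j)" k] by (simp add: r_def)
  have rS: "r (Suc k) \<ge> r k" and rk: "r k \<ge> k" for k by (auto simp: r_def)
  have dLp: "in_Lp M p (\<lambda>x. f m x - f n x)" for m n
    by (rule in_Lp_diff(1)[OF f f]) (use p in auto)
  define A where "A k = {x \<in> space M. norm (f (r (Suc k)) x - f (r k) x) \<ge> (1/2)^k}" for k
  have Ae: "emeasure M (A k) \<le> ennreal ((1 / 2 powr p) ^ k)" for k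
  proof -
    have "emeasure M (A k) \<le> ennreal (Lp_int M p (\<lambda>x. f (r (Suc k)) x - f (r k) x) / ((1/2)^k) powr p)"
      unfolding A_def by (rule Lp_Markov[OF dLp]) (use p in auto)
    also have "\<dots> \<le> ennreal (((1/4)^k) powr p / ((1/2)^k) powr p)"
      using N[of k "r (Suc k)" "r k"] rN[of k] rS[of k]
      by (intro ennreal_leI divide_right_mono) auto
    also have "((1/4)^k) powr p / ((1/2)^k) powr p = ((1/2::real)^k) powr p"
      by (simp add: powr_divide[symmetric] power_divide[symmetric])
    also have "\<dots> = (1 / 2 powr p) ^ k"
      by (induction k) (auto simp: powr_mult powr_divide)
    finally show ?thesis .
  qed
  have small: "1 / 2 powr p < (1::real)"
    using p by (simp add: field_simps)
  have "AE x in M. eventually (\<lambda>k. x \<in> space M - A k) sequentially"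
  proof (rule borel_cantelli_AE1)
    show "A n \<in> sets M" for n unfolding A_def by measurable
    show "emeasure M (A n) < \<infinity>" for n using Ae[of n] by (simp add: le_less_trans)
    have "measure M (A n) \<le> (1 / 2 powr p) ^ n" for n
      using Ae[of n] by (simp add: measure_def enn2real_leI)
    then show "summable (\<lambda>n. measure M (A n))"
      by (intro summable_comparison_test'[OF summable_geometric[of "1 / 2 powr p"]])
         (use small in auto)
  qed
  then have conv: "AE x in M. convergent (\<lambda>k. f (r k) x)"
  proof eventually_elim
    case (elim x)
    have "summable (\<lambda>k. f (r (Suc k)) x - f (r k) x)"
    proof (rule summable_comparison_test_ev)
      show "eventually (\<lambda>k. norm (f (r (Suc k)) x - f (r k) x) \<le> (1/2)^k) sequentially"
        using elim by eventually_elim (auto simp: A_def)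
      show "summable (\<lambda>k. (1/2::real)^k)" by (rule summable_geometric) auto
    qed
    then have "convergent (\<lambda>n. \<Sum>k<n. f (r (Suc k)) x - f (r k) x)"
      by (simp add: summable_iff_convergent)
    then have "convergent (\<lambda>n. f (r n) x - f (r 0) x)"
      using sum_lessThan_telescope[of "\<lambda>k. f (r k) x"] by simp
    then have "convergent (\<lambda>n. (f (r n) x - f (r 0) x) + f (r 0) x)"
      by (intro convergent_add convergent_const)
    then show ?case by simp
  qed
  define F where "F x = lim (\<lambda>k. f (r k) x)" for x
  have [measurable]: "F \<in> borel_measurable M" unfolding F_def by measurable
  have lim: "AE x in M. (\<lambda>k. f (r k) x) \<longlonglongrightarrow> F x"
    using conv by eventually_elim (simp add: F_def convergent_LIMSEQ_iff)
  have fin: "in_Lp M p (\<lambda>x. f n x - F x)" "Lp_int M p (\<lambda>x. f n x - F x) \<le> e"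
    if e: "\<And>m. m \<ge> K \<Longrightarrow> Lp_int M p (\<lambda>x. f n x - f m x) \<le> e" for n e K
  proof -
    have l: "AE x in M. (\<lambda>k. f n x - f (r k) x) \<longlonglongrightarrow> f n x - F x"
      using lim by eventually_elim (intro tendsto_intros)
    have ek: "k \<ge> K \<Longrightarrow> Lp_int M p (\<lambda>x. f n x - f (r k) x) \<le> e" for k
      using e rk[of k] by auto
    show "in_Lp M p (\<lambda>x. f n x - F x)" "Lp_int M p (\<lambda>x. f n x - F x) \<le> e"
      by (rule Lp_Fatou[where K=K, OF dLp ek l _ p]; simp)+
  qed
  obtain N1 where N1: "\<forall>m\<ge>N1. \<forall>n\<ge>N1. Lp_int M p (\<lambda>x. f m x - f n x) < 1"
    using cauchy[of 1] by auto
  have "in_Lp M p (\<lambda>x. f N1 x - F x)"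
    by (rule fin(1)[of N1 N1 1]) (use N1 in \<open>auto intro: less_imp_le\<close>)
  from in_Lp_diff(1)[OF f[of N1] this] p have F: "in_Lp M p F" by simp
  have "(\<lambda>n. Lp_int M p (\<lambda>x. f n x - F x)) \<longlonglongrightarrow> 0"
  proof (rule LIMSEQ_I)
    fix e :: real assume "0 < e"
    then obtain N2 where N2: "\<forall>m\<ge>N2. \<forall>n\<ge>N2. Lp_int M p (\<lambda>x. f m x - f n x) < e/2"
      using cauchy[of "e/2"] by auto
    have "Lp_int M p (\<lambda>x. f n x - F x) \<le> e/2" if "n \<ge> N2" for n
      by (rule fin(2)[of N2]) (use N2 that in \<open>auto intro: less_imp_le\<close>)
    then show "\<exists>no. \<forall>n\<ge>no. norm (Lp_int M p (\<lambda>x. f n x - F x) - 0) < e"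
      using \<open>0 < e\<close> Lp_int_nonneg[of M p "\<lambda>x. f n x - F x" for n]
      by (intro exI[of _ N2]) (fastforce simp: abs_of_nonneg intro: le_less_trans)
  qed
  with F show ?thesis by (rule that)
qed

section \<open>Uniform convexity\<close>

lemma powr_midpoint_strict:
  fixes a b p :: real
  assumes "0 \<le> a" "a < b" "1 < p"
  shows "((a + b) / 2) powr p < (a powr p + b powr p) / 2"
proof -
  define m where "m = (a + b) / 2"
  have m: "a < m" "m < b" "m - a = b - m" using assms by (auto simp: m_def field_simps)
  have der: "((\<lambda>x. x powr p) has_derivative (\<lambda>h. h * (p * x powr (p - 1)))) (at x)" if "0 < x" for x :: real
    using has_real_derivative_powr[OF that, of p]
    by (simp add: has_field_derivative_def mult_commute_abs)
  have cont: "continuous_on {c..d} (\<lambda>x. x powr p)" if "0 \<le> c" for c d :: real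
    by (rule continuous_on_powr') (use that assms in \<open>auto intro!: continuous_intros\<close>)
  obtain y where y: "a < y" "y < m" "m powr p - a powr p = (m - a) * (p * y powr (p - 1))"
    by (rule mvt[OF m(1) cont der]) (use assms in auto)
  obtain z where z: "m < z" "z < b" "b powr p - m powr p = (b - m) * (p * z powr (p - 1))"
    by (rule mvt[OF m(2) cont der]) (use assms m in auto)
  \<comment> \<open>The secant over the right half is steeper than the one over the left half; as
    both halves have the same length, this is the strict midpoint inequality.\<close>
  have "y powr (p - 1) < z powr (p - 1)"
    by (rule powr_less_mono2) (use assms y z in auto)
  then have "(m - a) * (p * y powr (p - 1)) < (b - m) * (p * z powr (p - 1))"
    unfolding m(3)[symmetric] using m(1) assms by (intro mult_strict_left_mono) auto
  then show ?thesis using y z by (simp add: m_def[symmetric])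
qed

text \<open>For equal norms strictness comes from the parallelogram law, for different norms from
  the strict convexity of the scalar power.\<close>

lemma norm_midpoint_powr_strict:
  fixes a b :: "'b::real_inner"
  assumes p: "1 < p" and ab: "a \<noteq> b"
  shows "norm ((1/2) *\<^sub>R (a + b)) powr p < (norm a powr p + norm b powr p) / 2"
proof (cases "norm a = norm b")
  case True
  have "(norm (a + b))\<^sup>2 + (norm (a - b))\<^sup>2 = 2 * (norm a)\<^sup>2 + 2 * (norm b)\<^sup>2"
    by (simp add: power2_norm_eq_inner inner_add inner_diff inner_commute)
  moreover have "(norm (a - b))\<^sup>2 > 0" using ab by simp
  moreover have "(2 * norm a)\<^sup>2 = 2 * (norm a)\<^sup>2 + 2 * (norm b)\<^sup>2" using True by (simp add: power_mult_distrib)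
  ultimately have "(norm (a + b))\<^sup>2 < (2 * norm a)\<^sup>2" by linarith
  then have "norm (a + b) < 2 * norm a" by (rule power_less_imp_less_base) auto
  then have "norm ((1/2) *\<^sub>R (a + b)) powr p < norm a powr p"
    by (intro powr_less_mono2) (use p in auto)
  then show ?thesis using True by simp
next
  case False
  have "norm ((1/2) *\<^sub>R (a + b)) powr p \<le> ((norm a + norm b) / 2) powr p"
    by (rule powr_mono2) (use p norm_triangle_ineq[of a b] in auto)
  also have "\<dots> < (norm a powr p + norm b powr p) / 2"
    using powr_midpoint_strict[of "norm a" "norm b" p] powr_midpoint_strict[of "norm b" "norm a" p] False p
    by (cases "norm a < norm b") (auto simp: add.commute)
  finally show ?thesis .
qed

text \<open>Both sides are homogeneous of degree \<open>p\<close>, so the constant comes from compactness of the unit sphere.\<close>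

lemma powr_uniformly_convex:
  fixes p e :: real
  assumes p: "1 < p" and e: "0 < e"
  obtains C where "0 < C" "\<And>a b :: 'b::euclidean_space. norm (a - b) powr p \<le> e * (norm a powr p + norm b powr p)
     + C * ((norm a powr p + norm b powr p) / 2 - norm ((1/2) *\<^sub>R (a + b)) powr p)"
proof -
  define N where "N z = norm (fst z) powr p + norm (snd z) powr p" for z :: "'b \<times> 'b"
  define \<phi> where "\<phi> z = N z / 2 - norm ((1/2) *\<^sub>R (fst z + snd z)) powr p" for z :: "'b \<times> 'b"
  define D where "D z = norm (fst z - snd z) powr p" for z :: "'b \<times> 'b"
  have cont: "continuous_on UNIV N" "continuous_on UNIV \<phi>" "continuous_on UNIV D"
    unfolding \<phi>_def N_def D_def by (auto intro!: continuous_intros continuous_on_powr' simp: p order_less_trans[OF zero_less_one p])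
  have \<phi>0: "\<phi> z \<ge> 0" for z
    using norm_midpoint_powr_strict[OF p, of "fst z" "snd z"] 
    by (cases "fst z = snd z") (auto simp: \<phi>_def N_def scaleR_2[symmetric])
  \<comment> \<open>Where \<open>D z\<close> is below \<open>e\<close>, the first summand of the
    estimate suffices. On the rest of the normalised set the two components differ, so the convexity
    gap \<open>\<phi>\<close> has a positive minimum \<open>m\<close>.\<close>
  define K where "K = {z. N z = 1 \<and> e \<le> D z}"
  have "compact K"
  proof (rule compact_eq_bounded_closed[THEN iffD2], intro conjI)
    have "norm z \<le> 2" if "z \<in> K" for z
    proof -
      have "norm (fst z) powr p \<le> 1" "norm (snd z) powr p \<le> 1"
        using that powr_ge_zero[of "norm (fst z)" p] powr_ge_zero[of "norm (snd z)" p]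
        unfolding K_def N_def by (auto simp del: powr_ge_zero)
      then have "norm (fst z) \<le> 1" "norm (snd z) \<le> 1"
        using p by (smt (verit) powr_one_eq_one powr_less_mono2)+
      then show ?thesis using norm_Pair_le[of "fst z" "snd z"] by simp
    qed
    then show "bounded K" by (rule boundedI)
    have "K = {z. N z = 1} \<inter> {z. e \<le> D z}" by (auto simp: K_def)
    then show "closed K" using cont by (auto intro!: closed_Int closed_Collect_eq closed_Collect_le)
  qed
  obtain m where m: "0 < m" "\<And>z. z \<in> K \<Longrightarrow> m \<le> \<phi> z"
  proof (cases "K = {}")
    case True then show ?thesis using that[of 1] by auto
  next
    case False
    obtain z0 where z0: "z0 \<in> K" "\<And>z. z \<in> K \<Longrightarrow> \<phi> z0 \<le> \<phi> z"
      using continuous_attains_inf[OF \<open>compact K\<close> False continuous_on_subset[OF cont(2)]] by auto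
    have "fst z0 \<noteq> snd z0" using z0(1) e p by (auto simp: K_def D_def)
    then have "0 < \<phi> z0" using norm_midpoint_powr_strict[OF p] by (auto simp: \<phi>_def N_def)
    then show ?thesis using z0 that by blast
  qed
  \<comment> \<open>\<open>D\<close> never exceeds \<open>2 powr p * N\<close>, so with this
    constant \<open>C * m\<close> alone dominates \<open>D\<close> on \<open>K\<close>.\<close>
  define C where "C = 2 powr p / m"
  have C: "0 < C" using m by (simp add: C_def)
  have D_le: "D z \<le> 2 powr p * N z" for z
  proof -
    have "D z \<le> (norm (fst z) + norm (snd z)) powr p"
      unfolding D_def by (rule powr_mono2) (use p norm_triangle_ineq4 in auto)
    also have "\<dots> \<le> 2 powr p * N z" unfolding N_def by (rule powr_add_le) (use p in auto)
    finally show ?thesis .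
  qed
  have unit: "D z \<le> e * N z + C * \<phi> z" if N1: "N z = 1" for z
  proof (cases "z \<in> K")
    case True
    have "D z \<le> C * m" using D_le[of z] N1 m by (simp add: C_def)
    also have "\<dots> \<le> C * \<phi> z" using m True C by simp
    finally show ?thesis using e N1 by simp
  next
    case False
    then have "D z \<le> e" using N1 by (simp add: K_def)
    then show ?thesis using N1 C \<phi>0[of z] by (simp add: add_increasing2)
  qed
  have gen: "D z \<le> e * N z + C * \<phi> z" for z
  proof (cases "N z = 0")
    case True
    then have "D z \<le> 0" "0 \<le> C * \<phi> z" using D_le[of z] C \<phi>0[of z] by auto
    then show ?thesis using True by simp
  next
    case False
    then have pos: "0 < N z" unfolding N_def by (smt (verit) powr_ge_zero)
    define s where "s = N z powr (- 1 / p)"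
    have "s powr p = N z powr (- 1)" unfolding s_def powr_powr using p by simp
    then have s: "0 < s" "s powr p * N z = 1" using pos by (auto simp: s_def powr_neg_one)
    have sc: "N (s *\<^sub>R z) = s powr p * N z" "D (s *\<^sub>R z) = s powr p * D z"
      using s by (auto simp: N_def D_def powr_mult distrib_left simp flip: scaleR_diff_right)
    have "norm ((1/2) *\<^sub>R (fst (s *\<^sub>R z) + snd (s *\<^sub>R z))) = s * norm ((1/2) *\<^sub>R (fst z + snd z))"
      using s by (simp flip: scaleR_add_right)
    then have "norm ((1/2) *\<^sub>R (fst (s *\<^sub>R z) + snd (s *\<^sub>R z))) powr p = s powr p * norm ((1/2) *\<^sub>R (fst z + snd z)) powr p"
      using s by (simp only: powr_mult)
    then have "\<phi> (s *\<^sub>R z) = s powr p * \<phi> z"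
      using sc by (simp add: \<phi>_def right_diff_distrib)
    then have "s powr p * D z \<le> s powr p * (e * N z + C * \<phi> z)"
      using unit[of "s *\<^sub>R z"] s sc by (simp add: algebra_simps)
    then show ?thesis using s by simp
  qed
  show ?thesis
    by (rule that[OF C]) (use gen[of "(a, b)" for a b] in \<open>auto simp: D_def N_def \<phi>_def\<close>)
qed

section \<open>Smooth test functions\<close>

text \<open>The test functions below are products of functions of a single coordinate, so smoothness
  is treated on the line first. The derivative is an existential witness, which suits functions
  whose derivatives are given by explicit formulas.\<close>

primrec smooth1 :: "nat \<Rightarrow> (real \<Rightarrow> real) \<Rightarrow> bool"
  where
    "smooth1 0 f \<longleftrightarrow> continuous_on UNIV f"
  | "smooth1 (Suc k) f \<longleftrightarrow> (\<exists>f'. (\<forall>x. (f has_real_derivative f' x) (at x)) \<and> smooth1 k f')"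

lemma smooth1_continuous: "smooth1 k f \<Longrightarrow> continuous_on UNIV f"
  by (cases k) (auto intro: continuous_at_imp_continuous_on DERIV_isCont)

lemma smooth1_mono: "smooth1 (Suc k) f \<Longrightarrow> smooth1 k f"
proof (induction k arbitrary: f)
  case 0
  then show ?case using smooth1_continuous[OF 0] by simp
next
  case (Suc k)
  then show ?case by (metis smooth1.simps(2))
qed

lemma smooth1_const: "smooth1 k (\<lambda>x. c)"
proof (induction k arbitrary: c)
  case (Suc k)
  show ?case unfolding smooth1.simps by (rule exI[of _ "\<lambda>_. 0"]) (auto simp: Suc)
qed simp

lemma smooth1_add: "smooth1 k f \<Longrightarrow> smooth1 k g \<Longrightarrow> smooth1 k (\<lambda>x. f x + g x)"
proof (induction k arbitrary: f g)
  case (Suc k)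
  then obtain f' g' where "\<forall>x. (f has_real_derivative f' x) (at x)" "smooth1 k f'"
    "\<forall>x. (g has_real_derivative g' x) (at x)" "smooth1 k g'" by auto
  with Suc.IH show ?case
    unfolding smooth1.simps by (intro exI[of _ "\<lambda>x. f' x + g' x"]) (auto intro!: derivative_eq_intros)
qed (auto intro: continuous_intros)

lemma smooth1_mult: "smooth1 k f \<Longrightarrow> smooth1 k g \<Longrightarrow> smooth1 k (\<lambda>x. f x * g x)"
proof (induction k arbitrary: f g)
  case (Suc k)
  from Suc.prems obtain f' g' where *: "\<forall>x. (f has_real_derivative f' x) (at x)" "smooth1 k f'"
    "\<forall>x. (g has_real_derivative g' x) (at x)" "smooth1 k g'" by auto
  have "smooth1 k f" "smooth1 k g" using Suc.prems smooth1_mono by blast+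
  then have "smooth1 k (\<lambda>x. f' x * g x + f x * g' x)"
    using * Suc.IH by (intro smooth1_add) auto
  then show ?case unfolding smooth1.simps using *
    by (intro exI[of _ "\<lambda>x. f' x * g x + f x * g' x"]) (auto intro!: derivative_eq_intros)
qed (auto intro: continuous_intros)

lemma smooth1_affine: "smooth1 k f \<Longrightarrow> smooth1 k (\<lambda>x. f (a * x + b))"
proof (induction k arbitrary: f)
  case 0
  then have "continuous_on UNIV f" by simp
  then have "continuous_on UNIV (\<lambda>x. f (a * x + b))"
    by (rule continuous_on_compose2) (auto intro!: continuous_intros)
  then show ?case by simp
next
  case (Suc k)
  then obtain f' where f': "\<forall>x. (f has_real_derivative f' x) (at x)" "smooth1 k f'" by auto
  have "((\<lambda>x. f (a * x + b)) has_real_derivative f' (a * x + b) * a) (at x)" for x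
    by (rule DERIV_chain2[where g="\<lambda>x. a * x + b"]) (use f' in \<open>auto intro!: derivative_eq_intros\<close>)
  then show ?case unfolding smooth1.simps using Suc.IH[OF f'(2)] smooth1_mult smooth1_const
    by (intro exI[of _ "\<lambda>x. f' (a * x + b) * a"]) auto
qed

text \<open>Serves the tent profiles in \<open>box_tent_estimate\<close>, which are known through
  their derivative.\<close>

lemma smooth1_antiderivative:
  assumes "\<And>x. (F has_real_derivative f x) (at x)" "\<And>k. smooth1 k f"
  shows "smooth1 k F"
proof (cases k)
  case 0
  then show ?thesis using assms(1) by (auto intro: continuous_at_imp_continuous_on DERIV_isCont)
qed (use assms in auto)

text \<open>The powers of \<open>1 / x\<close> make the family closed under differentiation, so the
  smoothness of the usual flat function, the case \<open>m = 0\<close>, follows by an induction that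
  treats all \<open>m\<close> at once.\<close>

definition flat_exp :: "real \<Rightarrow> nat \<Rightarrow> real \<Rightarrow> real"
  where "flat_exp c m x = (if x \<le> 0 then 0 else (1 / x) ^ m * exp (- c / x))"

lemma flat_exp_tendsto:
  assumes "0 < c"
  shows "(flat_exp c m \<longlongrightarrow> 0) (at 0)"
proof -
  have "((\<lambda>t::real. t ^ m / exp (c * t)) \<longlongrightarrow> 0) at_top"
  proof -
    have "((\<lambda>t::real. (c * t) ^ m / exp (c * t)) \<longlongrightarrow> 0) at_top"
      by (rule filterlim_compose[OF tendsto_power_div_exp_0])
        (rule filterlim_tendsto_pos_mult_at_top[OF tendsto_const assms filterlim_ident])
    then have "((\<lambda>t::real. (1 / c ^ m) * ((c * t) ^ m / exp (c * t))) \<longlongrightarrow> (1 / c ^ m) * 0) at_top"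
      by (intro tendsto_intros)
    then show ?thesis using assms by (simp add: power_mult_distrib)
  qed
  from filterlim_compose[OF this filterlim_inverse_at_top_right]
  have r: "((\<lambda>x::real. inverse x ^ m / exp (c * inverse x)) \<longlongrightarrow> 0) (at_right 0)" .
  have "(flat_exp c m \<longlongrightarrow> 0) (at_right 0)"
    by (rule Lim_transform_eventually[OF r])
      (auto simp: eventually_at_filter flat_exp_def exp_minus divide_inverse intro!: always_eventually)
  moreover have "(flat_exp c m \<longlongrightarrow> 0) (at_left 0)"
    by (rule Lim_transform_eventually[OF tendsto_const])
      (auto simp: eventually_at_filter flat_exp_def intro!: always_eventually)
  ultimately show ?thesis by (simp add: filterlim_split_at_real)
qed

lemma flat_exp_has_derivative:
  assumes "0 < c"
  shows "(flat_exp c m has_real_derivative (- real m * flat_exp c (Suc m) x + c * flat_exp c (Suc (Suc m)) x)) (at x)"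
proof -
  consider "x < 0" | "x = 0" | "x > 0" by linarith
  then show ?thesis
  proof cases
    case 1
    have "((\<lambda>x. 0) has_real_derivative 0) (at x)" by simp
    then have "(flat_exp c m has_real_derivative 0) (at x)"
      by (rule has_field_derivative_transform_within_open[of _ _ _ "{..<0}"]) (use 1 in \<open>auto simp: flat_exp_def\<close>)
    then show ?thesis using 1 by (simp add: flat_exp_def)
  next
    case 2
    \<comment> \<open>The difference quotient at 0 is again a member of the family, with
      \<open>m\<close> raised by one.\<close>
    have "((\<lambda>y. (flat_exp c m y - flat_exp c m 0) / (y - 0)) \<longlongrightarrow> 0) (at 0)"
      by (rule Lim_transform_eventually[OF flat_exp_tendsto[OF assms, of "Suc m"]])
        (auto simp: eventually_at_filter flat_exp_def intro!: always_eventually)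
    then have "(flat_exp c m has_real_derivative 0) (at 0)"
      by (simp add: has_field_derivative_iff)
    then show ?thesis using 2 by (simp add: flat_exp_def)
  next
    case 3
    have "((\<lambda>x. (1 / x) ^ m * exp (- c / x)) has_real_derivative
        (- real m * (1 / x) ^ (Suc m) * exp (- c / x) + c * (1 / x) ^ (Suc (Suc m)) * exp (- c / x))) (at x)"
    proof (cases m)
      case 0
      show ?thesis unfolding 0 using 3
        by (auto intro!: derivative_eq_intros simp: field_simps power2_eq_square)
    next
      case (Suc l)
      have 1: "((\<lambda>x. 1 / x) has_real_derivative (- (1 / x)\<^sup>2)) (at x)"
        using 3 by (auto intro!: derivative_eq_intros simp: field_simps power2_eq_square)
      have 2: "((\<lambda>x. exp (- c / x)) has_real_derivative (c * (1 / x)\<^sup>2 * exp (- c / x))) (at x)"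
        using 3 by (auto intro!: derivative_eq_intros simp: field_simps power2_eq_square)
      show ?thesis unfolding Suc
        by (rule DERIV_cong[OF DERIV_mult[OF DERIV_power_Suc[OF 1, of l] 2]])
          (simp add: power2_eq_square algebra_simps add_divide_distrib diff_divide_distrib)
    qed
    then have "(flat_exp c m has_real_derivative
        (- real m * (1 / x) ^ (Suc m) * exp (- c / x) + c * (1 / x) ^ (Suc (Suc m)) * exp (- c / x))) (at x)"
      by (rule has_field_derivative_transform_within_open[of _ _ _ "{0<..}"]) (use 3 in \<open>auto simp: flat_exp_def\<close>)
    then show ?thesis using 3 by (simp add: flat_exp_def mult.assoc)
  qed
qed

lemma smooth1_flat_exp: "0 < c \<Longrightarrow> smooth1 k (flat_exp c m)"
proof (induction k arbitrary: m)
  case 0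
  then show ?case
    using flat_exp_has_derivative by (auto intro!: continuous_at_imp_continuous_on dest: DERIV_isCont)
next
  case (Suc k)
  show ?case unfolding smooth1.simps
  proof (intro exI conjI allI)
    show "(flat_exp c m has_real_derivative (- real m * flat_exp c (Suc m) x + c * flat_exp c (Suc (Suc m)) x)) (at x)" for x
      by (rule flat_exp_has_derivative[OF Suc.prems])
    show "smooth1 k (\<lambda>x. - real m * flat_exp c (Suc m) x + c * flat_exp c (Suc (Suc m)) x)"
      by (intro smooth1_add smooth1_mult smooth1_const Suc)
  qed
qed

text \<open>The factors \<open>1 / (n + 1)\<close> in the exponents make the bumps increase to the indicator of the open interval.\<close>

definition bump1 :: "real \<Rightarrow> real \<Rightarrow> nat \<Rightarrow> real \<Rightarrow> real"
  where "bump1 a b n x = flat_exp (1 / real (Suc n)) 0 (x - a) * flat_exp (1 / real (Suc n)) 0 (b - x)"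

lemma smooth1_bump1: "smooth1 k (bump1 a b n)"
proof -
  have "smooth1 k (\<lambda>x. flat_exp (1 / real (Suc n)) 0 (1 * x + (- a)) * flat_exp (1 / real (Suc n)) 0 ((-1) * x + b))"
    by (intro smooth1_mult smooth1_affine smooth1_flat_exp) auto
  moreover have "bump1 a b n = (\<lambda>x. flat_exp (1 / real (Suc n)) 0 (1 * x + (- a)) * flat_exp (1 / real (Suc n)) 0 ((-1) * x + b))"
    by (auto simp: bump1_def fun_eq_iff)
  ultimately show ?thesis by simp
qed

lemma flat_exp_bounds: "0 < c \<Longrightarrow> 0 \<le> flat_exp c 0 x" "0 < c \<Longrightarrow> flat_exp c 0 x \<le> 1"
  by (auto simp: flat_exp_def)

lemma bump1_bounds: "0 \<le> bump1 a b n x" "bump1 a b n x \<le> 1"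
  by (auto simp: bump1_def intro!: mult_le_one flat_exp_bounds mult_nonneg_nonneg)

lemma bump1_outside: "x \<notin> {a<..<b} \<Longrightarrow> bump1 a b n x = 0"
  by (auto simp: bump1_def flat_exp_def)

lemma bump1_tendsto: "(\<lambda>n. bump1 a b n x) \<longlonglongrightarrow> indicator {a<..<b} x"
proof (cases "x \<in> {a<..<b}")
  case True
  have *: "(\<lambda>n. exp (- (1 / real (Suc n)) / t)) \<longlonglongrightarrow> exp (- 0 / t)" if "t > 0" for t :: real
    by (intro tendsto_intros LIMSEQ_Suc[OF lim_1_over_n]) (use that in auto)
  have "(\<lambda>n. exp (- (1 / real (Suc n)) / (x - a)) * exp (- (1 / real (Suc n)) / (b - x))) \<longlonglongrightarrow> exp (-0 / (x - a)) * exp (-0/(b - x))"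
    by (intro tendsto_mult *) (use True in auto)
  then show ?thesis using True by (simp add: bump1_def flat_exp_def)
qed (simp add: bump1_outside)

section \<open>Products of functions of one coordinate\<close>

lemma frechet_derivative_axis:
  assumes "(f has_derivative f') (at x)"
  shows "partial_derivative j f x = f' (axis j 1)"
  unfolding partial_derivative_def using frechet_derivative_at[OF assms] by simp

lemma has_derivative_prod_coords:
  fixes f f' :: "'n::finite \<Rightarrow> real \<Rightarrow> real"
  assumes "\<And>i x. (f i has_real_derivative f' i x) (at x)"
  shows "((\<lambda>x::real^'n. \<Prod>i\<in>UNIV. f i (x $ i)) has_derivative
     (\<lambda>h. \<Sum>i\<in>UNIV. (f' i (x $ i) * h $ i) * (\<Prod>j\<in>UNIV - {i}. f j (x $ j)))) (at x)"
proof (rule has_derivative_prod)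
  fix i :: 'n
  have "(f i has_derivative (\<lambda>h. f' i (x $ i) * h)) (at (x $ i))"
    using assms[of i "x $ i"] by (simp add: has_field_derivative_def)
  from diff_chain_at[of "\<lambda>x. x $ i" "\<lambda>h. h $ i" x, OF _ this]
  show "((\<lambda>x. f i (x $ i)) has_derivative (\<lambda>h. f' i (x $ i) * h $ i)) (at x)"
    using bounded_linear_imp_has_derivative[OF bounded_linear_vec_nth] by (auto simp: o_def)
qed

text \<open>The derivative keeps the form of a product over the coordinates, which is what allows
  \<open>Ck_prod_coords\<close> to go by induction on the order.\<close>

lemma partial_derivative_prod_coords:
  fixes f f' :: "'n::finite \<Rightarrow> real \<Rightarrow> real"
  assumes "\<And>i x. (f i has_real_derivative f' i x) (at x)"
  shows "partial_derivative j (\<lambda>x::real^'n. \<Prod>i\<in>UNIV. f i (x $ i))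
    = (\<lambda>x. \<Prod>i\<in>UNIV. (if i = j then f' j else f i) (x $ i))"
proof
  fix x :: "real^'n"
  have "partial_derivative j (\<lambda>x::real^'n. \<Prod>i\<in>UNIV. f i (x $ i)) x
    = (\<Sum>i\<in>UNIV. (f' i (x $ i) * axis j 1 $ i) * (\<Prod>j\<in>UNIV - {i}. f j (x $ j)))"
    by (rule frechet_derivative_axis[OF has_derivative_prod_coords[OF assms]])
  also have "\<dots> = (\<Sum>i\<in>UNIV. if i = j then f' j (x $ j) * (\<Prod>i\<in>UNIV - {j}. f i (x $ i)) else 0)"
    by (rule sum.cong) (auto simp: axis_def)
  also have "\<dots> = f' j (x $ j) * (\<Prod>i\<in>UNIV - {j}. f i (x $ i))" by simp
  also have "\<dots> = (\<Prod>i\<in>UNIV. (if i = j then f' j else f i) (x $ i))"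
    by (subst prod.remove[of UNIV j]) (auto intro!: prod.cong)
  finally show "partial_derivative j (\<lambda>x::real^'n. \<Prod>i\<in>UNIV. f i (x $ i)) x
    = (\<Prod>i\<in>UNIV. (if i = j then f' j else f i) (x $ i))" .
qed

lemma Ck_prod_coords:
  fixes f :: "'n::finite \<Rightarrow> real \<Rightarrow> real"
  assumes "\<And>i. smooth1 k (f i)"
  shows "Ck k (\<lambda>x::real^'n. \<Prod>i\<in>UNIV. f i (x $ i))"
  using assms
proof (induction k arbitrary: f)
  case 0
  have "continuous_on UNIV (\<lambda>x::real^'n. f i (x $ i))" for i
    using 0[of i] by (auto intro!: continuous_on_compose2[of UNIV "f i"] continuous_intros)
  then show ?case by (auto intro!: continuous_on_prod)
next
  case (Suc k)
  have "\<forall>i. \<exists>f'. (\<forall>x. (f i has_real_derivative f' x) (at x)) \<and> smooth1 k f'"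
    using Suc.prems by simp
  then obtain f' where f': "\<And>i x. (f i has_real_derivative f' i x) (at x)" "\<And>i. smooth1 k (f' i)"
    by metis
  show ?case unfolding Ck.simps
  proof (intro conjI allI)
    show "(\<lambda>x::real^'n. \<Prod>i\<in>UNIV. f i (x $ i)) differentiable at x" for x
      unfolding differentiable_def by (rule exI, rule has_derivative_prod_coords[OF f'(1)])
    have "smooth1 k (f i)" for i using Suc.prems smooth1_mono by blast
    then show "Ck k (partial_derivative j (\<lambda>x::real^'n. \<Prod>i\<in>UNIV. f i (x $ i)))" for j
      unfolding partial_derivative_prod_coords[OF f'(1)] using f'(2) by (intro Suc.IH) auto
  qed
qed

lemma test_function_prod_coords:
  fixes f :: "'n::finite \<Rightarrow> real \<Rightarrow> real"
  assumes sm: "\<And>i k. smooth1 k (f i)" and out: "\<And>i x. x \<notin> {a $ i..b $ i} \<Longrightarrow> f i x = 0"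
    and sub: "cbox a b \<subseteq> U"
  shows "test_function U (\<lambda>x::real^'n. \<Prod>i\<in>UNIV. f i (x $ i))"
proof -
  have "{x::real^'n. (\<Prod>i\<in>UNIV. f i (x $ i)) \<noteq> 0} \<subseteq> cbox a b"
    using out by (fastforce simp: mem_box_cart)
  then have cl: "closure {x::real^'n. (\<Prod>i\<in>UNIV. f i (x $ i)) \<noteq> 0} \<subseteq> cbox a b"
    by (rule closure_minimal) (rule closed_cbox)
  moreover have "compact (closure {x::real^'n. (\<Prod>i\<in>UNIV. f i (x $ i)) \<noteq> 0})"
    using cl bounded_subset[OF bounded_cbox] by (auto simp: compact_eq_bounded_closed)
  ultimately show ?thesis
    unfolding test_function_def using Ck_prod_coords[OF sm] sub by auto
qed

text \<open>The factor \<open>s\<close> is carried along because each derivative brings out another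
  factor \<open>c\<close>; it makes the induction on \<open>k\<close> close.\<close>

lemma Ck_affine:
  fixes f :: "real^'n \<Rightarrow> real"
  assumes "Ck k f" "c \<noteq> 0"
  shows "Ck k (\<lambda>x. s * f (a + c *\<^sub>R x))"
    and "k > 0 \<Longrightarrow> partial_derivative j (\<lambda>x. s * f (a + c *\<^sub>R x)) = (\<lambda>x. (s * c) * partial_derivative j f (a + c *\<^sub>R x))"
proof -
  have der: "((\<lambda>x. s * f (a + c *\<^sub>R x)) has_derivative (\<lambda>h. s * frechet_derivative f (at (a + c *\<^sub>R x)) (c *\<^sub>R h))) (at x)"
    if "\<forall>x. f differentiable (at x)" for f :: "real^'n \<Rightarrow> real" and s x
  proof -
    have "(f has_derivative frechet_derivative f (at (a + c *\<^sub>R x))) (at (a + c *\<^sub>R x))"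
      using that frechet_derivative_works by blast
    moreover have "((\<lambda>x. a + c *\<^sub>R x) has_derivative (\<lambda>h. c *\<^sub>R h)) (at x)"
      by (auto intro!: derivative_eq_intros)
    ultimately have "((\<lambda>x. f (a + c *\<^sub>R x)) has_derivative (\<lambda>h. frechet_derivative f (at (a + c *\<^sub>R x)) (c *\<^sub>R h))) (at x)"
      using diff_chain_at[of "\<lambda>x. a + c *\<^sub>R x" "\<lambda>h. c *\<^sub>R h" x f] by (simp add: o_def)
    then show ?thesis by (intro has_derivative_mult_right)
  qed
  have pd: "partial_derivative j (\<lambda>x. s * f (a + c *\<^sub>R x)) = (\<lambda>x. (s * c) * partial_derivative j f (a + c *\<^sub>R x))"
    if d: "\<forall>x. f differentiable (at x)" for f :: "real^'n \<Rightarrow> real" and s j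
  proof
    fix x
    have "linear (frechet_derivative f (at (a + c *\<^sub>R x)))"
      using d by (intro linear_frechet_derivative) auto
    then show "partial_derivative j (\<lambda>x. s * f (a + c *\<^sub>R x)) x = (s * c) * partial_derivative j f (a + c *\<^sub>R x)"
      using frechet_derivative_axis[OF der[OF d, of s x], of j] by (simp add: linear_scale partial_derivative_def)
  qed
  show "Ck k (\<lambda>x. s * f (a + c *\<^sub>R x))" using assms(1)
  proof (induction k arbitrary: f s)
    case 0
    then have "continuous_on UNIV (\<lambda>x. f (a + c *\<^sub>R x))"
      by (auto intro!: continuous_on_compose2[of UNIV f] continuous_intros)
    then show ?case by (auto intro!: continuous_intros)
  next
    case (Suc k)
    then have d: "\<forall>x. f differentiable (at x)" by simp
    show ?case unfolding Ck.simps pd[OF d]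
    proof (intro conjI allI)
      show "(\<lambda>x. s * f (a + c *\<^sub>R x)) differentiable at x" for x
        unfolding differentiable_def by (rule exI, rule der[OF d])
      show "Ck k (\<lambda>x. s * c * partial_derivative j f (a + c *\<^sub>R x))" for j
        using Suc by simp
    qed
  qed
  show "partial_derivative j (\<lambda>x. s * f (a + c *\<^sub>R x)) = (\<lambda>x. (s * c) * partial_derivative j f (a + c *\<^sub>R x))" if "k > 0"
    using pd assms(1) that by (cases k) auto
qed

section \<open>Weak gradients\<close>

lemma lebesgue_on_support:
  fixes h :: "'a::euclidean_space \<Rightarrow> 'b::euclidean_space"
  assumes "S \<in> sets lebesgue" "\<And>x. x \<notin> S \<Longrightarrow> h x = 0"
  shows "integrable (lebesgue_on S) h \<longleftrightarrow> integrable lebesgue h"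
    and "integral\<^sup>L (lebesgue_on S) h = integral\<^sup>L lebesgue h"
proof -
  have "(\<lambda>x. if x \<in> S then h x else 0) = h" using assms(2) by auto
  then show "integrable (lebesgue_on S) h \<longleftrightarrow> integrable lebesgue h"
    and "integral\<^sup>L (lebesgue_on S) h = integral\<^sup>L lebesgue h"
    using Lebesgue_Measure.integrable_restrict_UNIV[OF assms(1), of h] Lebesgue_Measure.integral_restrict_UNIV[OF assms(1), of h] by simp_all
qed

lemma continuous_compact_support_bounded:
  fixes \<psi> :: "'a::euclidean_space \<Rightarrow> real"
  assumes "continuous_on UNIV \<psi>" "compact K" "\<And>x. x \<notin> K \<Longrightarrow> \<psi> x = 0"
  obtains B where "0 < B" "\<And>x. \<bar>\<psi> x\<bar> \<le> B"
proof -
  have "bounded (\<psi> ` K)"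
    using assms by (intro compact_imp_bounded compact_continuous_image continuous_on_subset[OF assms(1)]) auto
  then obtain B where "0 < B" "\<And>x. x \<in> K \<Longrightarrow> norm (\<psi> x) \<le> B" by (auto simp: bounded_pos)
  then show ?thesis using that[of B] assms(3) by (metis abs_zero less_imp_le real_norm_def)
qed

lemma continuous_borel_lebesgue: 
  fixes \<psi> :: "'a::euclidean_space \<Rightarrow> 'b::euclidean_space"
  shows "continuous_on UNIV \<psi> \<Longrightarrow> \<psi> \<in> borel_measurable lebesgue"
  by (simp add: borel_measurable_continuous_onI measurable_completion)

lemma integrable_mult_support:
  fixes f \<psi> :: "'a::euclidean_space \<Rightarrow> real"
  assumes f: "f absolutely_integrable_on K" and m: "\<psi> \<in> borel_measurable lebesgue"
    and B: "\<And>x. \<bar>\<psi> x\<bar> \<le> B" and out: "\<And>x. x \<notin> K \<Longrightarrow> \<psi> x = 0"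
  shows "integrable lebesgue (\<lambda>x. f x * \<psi> x)"
proof -
  have "integrable lebesgue (\<lambda>x. indicator K x *\<^sub>R f x)" using f by (simp add: set_integrable_def)
  then have i: "integrable lebesgue (\<lambda>x. B *\<^sub>R (indicator K x *\<^sub>R f x))" by (intro integrable_scaleR_right)
  have [measurable]: "(\<lambda>x. indicator K x *\<^sub>R f x) \<in> borel_measurable lebesgue"
    using f by (auto simp: set_integrable_def)
  note [measurable] = m
  have "norm (indicator K x *\<^sub>R f x * \<psi> x) \<le> norm (B *\<^sub>R (indicator K x *\<^sub>R f x))" for x
    using mult_right_mono[OF order_trans[OF B[of x] abs_ge_self], of "\<bar>indicator K x * f x\<bar>"]
    by (simp add: abs_mult mult_ac)
  then have "integrable lebesgue (\<lambda>x. (indicator K x *\<^sub>R f x) * \<psi> x)"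
    by (intro Bochner_Integration.integrable_bound[OF i] AE_I2) measurable
  moreover have "(\<lambda>x. (indicator K x *\<^sub>R f x) * \<psi> x) = (\<lambda>x. f x * \<psi> x)"
  proof
    show "(indicator K x *\<^sub>R f x) * \<psi> x = f x * \<psi> x" for x
      using out[of x] by (cases "x \<in> K") auto
  qed
  ultimately show ?thesis by simp
qed

text \<open>Dominated convergence with majorant \<open>B * norm (f x)\<close> on \<open>K\<close>.
  It suits locally integrable \<open>f\<close>, whose integrability is only known on a set
  \<open>K\<close> that carries all the \<psi>.\<close>

lemma tendsto_integral_mult_support:
  fixes f :: "'a::euclidean_space \<Rightarrow> real" and \<psi> :: "nat \<Rightarrow> 'a \<Rightarrow> real"
  assumes f: "f absolutely_integrable_on K" and m: "\<And>n. \<psi> n \<in> borel_measurable lebesgue"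
    and B: "\<And>n x. \<bar>\<psi> n x\<bar> \<le> B" and out: "\<And>n x. x \<notin> K \<Longrightarrow> \<psi> n x = 0"
    and lim: "\<And>x. (\<lambda>n. \<psi> n x) \<longlonglongrightarrow> \<phi> x" and U: "K \<subseteq> U" "U \<in> sets lebesgue"
  shows "(\<lambda>n. \<integral>x. f x * \<psi> n x \<partial>lebesgue_on U) \<longlonglongrightarrow> (\<integral>x. f x * \<phi> x \<partial>lebesgue_on U)"
proof -
  have out': "\<phi> x = 0" if "x \<notin> K" for x
    using lim[of x] out[OF that] by (simp add: LIMSEQ_const_iff)
  have i: "integrable lebesgue (\<lambda>x. indicator K x *\<^sub>R f x)" using f by (simp add: set_integrable_def)
  then have [measurable]: "(\<lambda>x. indicator K x *\<^sub>R f x) \<in> borel_measurable lebesgue" by auto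
  note [measurable] = m
  have [measurable]: "\<phi> \<in> borel_measurable lebesgue"
    by (rule borel_measurable_LIMSEQ_real[OF lim]) measurable
  have eq: "f x * \<psi> n x = (indicator K x *\<^sub>R f x) * \<psi> n x" "f x * \<phi> x = (indicator K x *\<^sub>R f x) * \<phi> x" for n x
    using out out' by (auto simp: indicator_def)
  have "(\<lambda>n. \<integral>x. f x * \<psi> n x \<partial>lebesgue) \<longlonglongrightarrow> (\<integral>x. f x * \<phi> x \<partial>lebesgue)"
    unfolding eq
  proof (rule integral_dominated_convergence[where w="\<lambda>x. B * norm (indicator K x *\<^sub>R f x)"])
    show "integrable lebesgue (\<lambda>x. B * norm (indicator K x *\<^sub>R f x))" using i by (intro integrable_mult_right integrable_norm)
    show "AE x in lebesgue. (\<lambda>n. indicator K x *\<^sub>R f x * \<psi> n x) \<longlonglongrightarrow> indicator K x *\<^sub>R f x * \<phi> x"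
      by (intro AE_I2 tendsto_intros lim)
    show "AE x in lebesgue. norm (indicator K x *\<^sub>R f x * \<psi> n x) \<le> B * norm (indicator K x *\<^sub>R f x)" for n
      by (auto simp: abs_mult mult.commute intro!: AE_I2 mult_right_mono B)
  qed measurable
  moreover have "(\<integral>x. f x * \<psi> n x \<partial>lebesgue_on U) = (\<integral>x. f x * \<psi> n x \<partial>lebesgue)" for n
    using U out by (intro lebesgue_on_support) auto
  moreover have "(\<integral>x. f x * \<phi> x \<partial>lebesgue_on U) = (\<integral>x. f x * \<phi> x \<partial>lebesgue)"
    using U out' by (intro lebesgue_on_support) auto
  ultimately show ?thesis by simp
qed

lemma test_function_support:
  assumes "test_function U \<phi>"
  obtains K where "compact K" "K \<subseteq> U" "\<And>x. x \<notin> K \<Longrightarrow> \<phi> x = 0"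
    "\<And>x j. x \<notin> K \<Longrightarrow> partial_derivative j \<phi> x = 0"
proof
  let ?K = "closure {x. \<phi> x \<noteq> 0}"
  show "compact ?K" "?K \<subseteq> U" using assms by (auto simp: test_function_def)
  show "\<phi> x = 0" if "x \<notin> ?K" for x using that closure_subset[of "{x. \<phi> x \<noteq> 0}"] by auto
  show "partial_derivative j \<phi> x = 0" if "x \<notin> ?K" for x j
  proof -
    have "((\<lambda>x. 0) has_derivative (\<lambda>h. 0)) (at x)" by simp
    then have "(\<phi> has_derivative (\<lambda>h. 0)) (at x)"
      by (rule has_derivative_transform_within_open[of _ _ _ _ "- ?K"])
        (use that closure_subset[of "{x. \<phi> x \<noteq> 0}"] in auto)
    then show ?thesis by (rule frechet_derivative_axis)
  qed
qed

lemma test_function_continuous: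
  assumes "test_function U \<phi>"
  shows "continuous_on UNIV \<phi>" "continuous_on UNIV (partial_derivative j \<phi>)"
    "\<phi> differentiable (at x)"
proof -
  have "Ck 0 \<phi>" "Ck (Suc 0) \<phi>" using assms unfolding test_function_def by blast+
  then show "continuous_on UNIV \<phi>" "continuous_on UNIV (partial_derivative j \<phi>)" "\<phi> differentiable (at x)"
    by auto
qed

lemma absolutely_integrable_entry:
  fixes u :: "'a::euclidean_space \<Rightarrow> real^'m" and G :: "'a \<Rightarrow> real^'n^'m"
  shows "u absolutely_integrable_on K \<Longrightarrow> (\<lambda>x. u x $ i) absolutely_integrable_on K"
    and "G absolutely_integrable_on K \<Longrightarrow> (\<lambda>x. G x $ i $ j) absolutely_integrable_on K"
proof -
  have *: "u absolutely_integrable_on K \<Longrightarrow> (\<lambda>x. u x $ i) absolutely_integrable_on K"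
    for u :: "'a \<Rightarrow> 'c::euclidean_space^'l" and i
    unfolding set_integrable_def
    using integrable_bounded_linear[OF bounded_linear_vec_nth, of lebesgue "\<lambda>x. indicator K x *\<^sub>R u x" i] by simp
  show "u absolutely_integrable_on K \<Longrightarrow> (\<lambda>x. u x $ i) absolutely_integrable_on K" by (rule *)
  show "G absolutely_integrable_on K \<Longrightarrow> (\<lambda>x. G x $ i $ j) absolutely_integrable_on K" by (intro *)
qed

lemma integrable_test_function_mult:
  assumes U: "open U" and \<phi>: "test_function U \<phi>"
  shows "locally_integrable U u \<Longrightarrow> integrable (lebesgue_on U) (\<lambda>x. (u x :: real^'m) $ i * partial_derivative j \<phi> x)"
    and "locally_integrable U G \<Longrightarrow> integrable (lebesgue_on U) (\<lambda>x. (G x :: real^'n^'m) $ i $ j * \<phi> x)"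
proof -
  obtain K where K: "compact K" "K \<subseteq> U" "\<And>x. x \<notin> K \<Longrightarrow> \<phi> x = 0"
    "\<And>x j. x \<notin> K \<Longrightarrow> partial_derivative j \<phi> x = 0" using test_function_support[OF \<phi>] by blast
  note c = test_function_continuous[OF \<phi>]
  obtain B where B: "\<And>x. \<bar>\<phi> x\<bar> \<le> B" using continuous_compact_support_bounded[OF c(1) K(1,3)] by metis
  obtain B' where B': "\<And>x. \<bar>partial_derivative j \<phi> x\<bar> \<le> B'"
    using continuous_compact_support_bounded[OF c(2) K(1,4)] by metis
  have UL: "U \<in> sets lebesgue" using U by auto
  have *: "integrable (lebesgue_on U) (\<lambda>x. f x * \<psi> x)"
    if "f absolutely_integrable_on K" "continuous_on UNIV \<psi>" "\<And>x. \<bar>\<psi> x\<bar> \<le> B" "\<And>x. x \<notin> K \<Longrightarrow> \<psi> x = 0" for f \<psi> :: "real^'n \<Rightarrow> real" and B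
  proof -
    have "integrable lebesgue (\<lambda>x. f x * \<psi> x)"
      by (rule integrable_mult_support[OF that(1) continuous_borel_lebesgue[OF that(2)] that(3,4)])
    then show ?thesis using lebesgue_on_support(1)[OF UL, of "\<lambda>x. f x * \<psi> x"] that(4) K(2) by auto
  qed
  show "locally_integrable U u \<Longrightarrow> integrable (lebesgue_on U) (\<lambda>x. u x $ i * partial_derivative j \<phi> x)"
    using K by (intro *[OF _ c(2) B' K(4)] absolutely_integrable_entry) (auto simp: locally_integrable_def)
  show "locally_integrable U G \<Longrightarrow> integrable (lebesgue_on U) (\<lambda>x. G x $ i $ j * \<phi> x)"
    using K by (intro *[OF _ c(1) B K(3)] absolutely_integrable_entry) (auto simp: locally_integrable_def)
qed

section \<open>Separation by test functions and uniqueness of weak gradients\<close>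

definition box_bump :: "real^'n \<Rightarrow> real^'n \<Rightarrow> nat \<Rightarrow> real^'n \<Rightarrow> real"
  where "box_bump a b n x = (\<Prod>i\<in>UNIV. bump1 (a $ i) (b $ i) n (x $ i))"

lemma box_bump_test: "cbox a b \<subseteq> U \<Longrightarrow> test_function U (box_bump a b n)"
  unfolding box_bump_def by (rule test_function_prod_coords[OF smooth1_bump1 bump1_outside]) auto

lemma box_bump_bounds: "0 \<le> box_bump a b n x" "box_bump a b n x \<le> 1"
  by (auto simp: box_bump_def intro!: prod_nonneg prod_le_1 bump1_bounds)

lemma box_bump_outside: "x \<notin> cbox a b \<Longrightarrow> box_bump a b n x = 0"
proof -
  assume "x \<notin> cbox a b"
  then obtain i where "\<not> (a $ i \<le> x $ i \<and> x $ i \<le> b $ i)" by (auto simp: mem_box_cart)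
  then have "x $ i \<notin> {a $ i<..<b $ i}" by auto
  then have "bump1 (a $ i) (b $ i) n (x $ i) = 0" by (rule bump1_outside)
  then show "box_bump a b n x = 0" unfolding box_bump_def by (intro prod_zero) auto
qed

lemma indicator_box_prod: 
  fixes x :: "real^'n"
  shows "(\<Prod>i\<in>UNIV. indicator {a $ i<..<b $ i} (x $ i)) = (indicator (box a b) x :: real)"
  by (auto simp: indicator_def mem_box_cart prod.neutral)

lemma box_bump_tendsto: "(\<lambda>n. box_bump a b n x) \<longlonglongrightarrow> indicator (box a b) x"
  unfolding box_bump_def indicator_box_prod[symmetric] by (intro tendsto_prod bump1_tendsto)

text \<open>By Lebesgue differentiation, averages of the zero extension \<open>g\<close> over
  shrinking cubes tend to \<open>g\<close> almost everywhere. All these averages vanish, because two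
  boxes meet in a box.\<close>

lemma zero_integral_boxes_AE_zero:
  fixes f :: "real^'n \<Rightarrow> real"
  assumes f: "f absolutely_integrable_on cbox a b"
    and 0: "\<And>c d. cbox c d \<subseteq> cbox a b \<Longrightarrow> integral (cbox c d) f = 0"
  shows "AE x in lebesgue. x \<in> cbox a b \<longrightarrow> f x = 0"
proof -
  define g where "g x = (if x \<in> cbox a b then f x else 0)" for x
  have gi: "g integrable_on cbox c d" for c d
  proof -
    obtain e e' where e: "cbox a b \<inter> cbox c d = cbox e e'" using Int_interval[of a b c d] by blast
    have "f integrable_on cbox e e'"
      by (rule integrable_on_subcbox[of f "cbox a b"]) (use f e in \<open>auto simp: absolutely_integrable_on_def\<close>)
    then have "f integrable_on (cbox a b \<inter> cbox c d)" by (simp add: e)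
    then show ?thesis
      using Henstock_Kurzweil_Integration.integrable_restrict_Int[where S="cbox a b" and T="cbox c d" and f=f]
      by (simp add: g_def[abs_def])
  qed
  have g0: "integral (cbox c d) g = 0" for c d
  proof -
    obtain e e' where e: "cbox c d \<inter> cbox a b = cbox e e'" using Int_interval[of c d a b] by blast
    have "integral (cbox c d) g = integral (cbox c d \<inter> cbox a b) f"
      using Henstock_Kurzweil_Integration.integral_restrict_Int[where S="cbox a b" and T="cbox c d" and f=f]
      by (simp add: g_def[abs_def] Int_commute)
    also have "\<dots> = 0" using 0[of e e'] e by auto
    finally show ?thesis .
  qed
  obtain N where N: "negligible N" "\<And>x e. \<lbrakk>x \<notin> N; 0 < e\<rbrakk> \<Longrightarrow>
     \<exists>d>0. \<forall>h. 0 < h \<and> h < d \<longrightarrow> norm (integral (cbox x (x + h *\<^sub>R One)) g /\<^sub>R h ^ DIM(real^'n) - g x) < e"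
    by (rule integrable_ccontinuous_explicit[OF gi]) metis
  have "g x = 0" if xN: "x \<notin> N" for x
  proof (rule ccontr)
    assume "g x \<noteq> 0"
    then obtain d where "d > 0" "\<forall>h. 0 < h \<and> h < d \<longrightarrow> norm (integral (cbox x (x + h *\<^sub>R One)) g /\<^sub>R h ^ DIM(real^'n) - g x) < norm (g x)"
      using N(2)[OF xN, of "norm (g x)"] by auto
    then show False using g0 by (auto dest!: spec[of _ "d/2"])
  qed
  then have "{x. \<not> (x \<in> cbox a b \<longrightarrow> f x = 0)} \<subseteq> N" unfolding g_def by fastforce
  then show ?thesis using N(1)
    by (auto intro!: AE_I'[of N] simp: negligible_iff_null_sets)
qed

text \<open>The bumps of a box are admissible and tend to the indicator of its interior, so
  \<open>f\<close> integrates to zero over every closed box inside \<open>U\<close>; countably many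
  closed boxes cover \<open>U\<close>.\<close>

lemma test_functions_separate:
  fixes f :: "real^'n \<Rightarrow> real"
  assumes U: "open U" and f: "locally_integrable U f"
    and 0: "\<And>\<phi>. test_function U \<phi> \<Longrightarrow> (\<integral>x. f x * \<phi> x \<partial>lebesgue_on U) = 0"
  shows "AE x in lebesgue_on U. f x = 0"
proof -
  obtain \<D> where \<D>: "countable \<D>" "\<D> \<subseteq> Pow U" "\<And>X. X \<in> \<D> \<Longrightarrow> \<exists>a b. X = cbox a b" "\<Union>\<D> = U"
    using open_countable_Union_open_cbox[OF U] by blast
  have UL: "U \<in> sets lebesgue" using U by auto
  have cb: "AE x in lebesgue. x \<in> cbox a b \<longrightarrow> f x = 0" if ab: "cbox a b \<subseteq> U" for a b
  proof (rule zero_integral_boxes_AE_zero)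
    have fi: "f absolutely_integrable_on cbox c d" if "cbox c d \<subseteq> U" for c d
      using f that by (auto simp: locally_integrable_def)
    show "f absolutely_integrable_on cbox a b" by (rule fi[OF ab])
    show "integral (cbox c d) f = 0" if "cbox c d \<subseteq> cbox a b" for c d
    proof -
      have cd: "cbox c d \<subseteq> U" using that ab by auto
      have "(\<lambda>n. \<integral>x. f x * box_bump c d n x \<partial>lebesgue_on U) \<longlonglongrightarrow> (\<integral>x. f x * indicator (box c d) x \<partial>lebesgue_on U)"
      proof (rule tendsto_integral_mult_support[OF fi[OF cd], where B=1])
        show "box_bump c d n \<in> borel_measurable lebesgue" for n
          by (rule continuous_borel_lebesgue[OF test_function_continuous(1)[OF box_bump_test[OF cd]]])
        show "\<bar>box_bump c d n x\<bar> \<le> 1" for n x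
          using box_bump_bounds[of c d n x] by simp
      qed (use box_bump_outside box_bump_tendsto cd U in auto)
      then have "(\<integral>x. f x * indicator (box c d) x \<partial>lebesgue_on U) = 0"
        using 0[OF box_bump_test[OF cd]] by (simp add: LIMSEQ_const_iff)
      also have "(\<integral>x. f x * indicator (box c d) x \<partial>lebesgue_on U) = (\<integral>x. f x * indicator (box c d) x \<partial>lebesgue)"
        using cd box_subset_cbox[of c d] by (intro lebesgue_on_support(2)[OF UL]) (auto simp: indicator_def)
      also have "\<dots> = (LINT x:box c d|lebesgue. f x)"
        unfolding set_lebesgue_integral_def by (simp add: mult.commute)
      also have "\<dots> = integral (box c d) f"
        by (rule set_lebesgue_integral_eq_integral(2)) (use fi[OF cd] absolutely_integrable_on_open_interval in blast)
      finally show ?thesis by (simp add: integral_open_interval)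
    qed
  qed
  have "\<forall>X\<in>\<D>. AE x in lebesgue. x \<in> X \<longrightarrow> f x = 0"
  proof
    fix X assume X: "X \<in> \<D>"
    then obtain a b where "X = cbox a b" using \<D>(3) by blast
    then show "AE x in lebesgue. x \<in> X \<longrightarrow> f x = 0" using cb[of a b] X \<D>(2) by blast
  qed
  then have "AE x in lebesgue. \<forall>X\<in>\<D>. x \<in> X \<longrightarrow> f x = 0"
    by (subst AE_ball_countable[OF \<D>(1)])
  then have "AE x in lebesgue. x \<in> U \<longrightarrow> f x = 0"
    by eventually_elim (use \<D>(4) in auto)
  then show ?thesis using UL by (subst AE_restrict_space_iff) auto
qed

lemma locally_integrable_add:
  "locally_integrable U f \<Longrightarrow> locally_integrable U g \<Longrightarrow> locally_integrable U (\<lambda>x. f x + g x)"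
  by (auto simp: locally_integrable_def intro: set_integral_add)

lemma locally_integrable_scaleR:
  "locally_integrable U f \<Longrightarrow> locally_integrable U (\<lambda>x. c *\<^sub>R f x)"
  by (auto simp: locally_integrable_def)

lemma has_weak_gradient_add:
  assumes "open U" "has_weak_gradient U u G" "has_weak_gradient U v H"
  shows "has_weak_gradient U (\<lambda>x. u x + v x) (\<lambda>x. G x + H x)"
  unfolding has_weak_gradient_def
proof (intro conjI allI impI)
  have l: "locally_integrable U u" "locally_integrable U v" "locally_integrable U G" "locally_integrable U H"
    using assms by (auto simp: has_weak_gradient_def)
  then show "locally_integrable U (\<lambda>x. u x + v x)" "locally_integrable U (\<lambda>x. G x + H x)"
    by (auto intro: locally_integrable_add)
  fix \<phi> i j assume \<phi>: "test_function U \<phi>"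
  note i = integrable_test_function_mult[OF assms(1) \<phi>]
  have "(\<integral>x. u x $ i * partial_derivative j \<phi> x \<partial>lebesgue_on U) = - (\<integral>x. G x $ i $ j * \<phi> x \<partial>lebesgue_on U)"
    "(\<integral>x. v x $ i * partial_derivative j \<phi> x \<partial>lebesgue_on U) = - (\<integral>x. H x $ i $ j * \<phi> x \<partial>lebesgue_on U)"
    using assms \<phi> by (auto simp: has_weak_gradient_def)
  then show "(\<integral>x. (u x + v x) $ i * partial_derivative j \<phi> x \<partial>lebesgue_on U) = - (\<integral>x. (G x + H x) $ i $ j * \<phi> x \<partial>lebesgue_on U)"
    by (simp add: distrib_right Bochner_Integration.integral_add i l)
qed

lemma has_weak_gradient_scaleR:
  assumes "open U" "has_weak_gradient U u G"
  shows "has_weak_gradient U (\<lambda>x. c *\<^sub>R u x) (\<lambda>x. c *\<^sub>R G x)"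
  using assms unfolding has_weak_gradient_def
  by (auto simp: mult.assoc intro: locally_integrable_scaleR)

lemma has_weak_gradient_diff:
  assumes "open U" "has_weak_gradient U u G" "has_weak_gradient U v H"
  shows "has_weak_gradient U (\<lambda>x. u x - v x) (\<lambda>x. G x - H x)"
  using has_weak_gradient_add[OF assms(1,2) has_weak_gradient_scaleR[OF assms(1,3), of "-1"]] by simp

lemma has_weak_gradient_zero_AE:
  assumes U: "open U" and G: "has_weak_gradient U (\<lambda>x. 0) G"
  shows "AE x in lebesgue_on U. G x = 0"
proof -
  have "AE x in lebesgue_on U. G x $ i $ j = 0" for i j
  proof (rule test_functions_separate[OF U])
    show "locally_integrable U (\<lambda>x. G x $ i $ j)"
      using G by (auto simp: has_weak_gradient_def locally_integrable_def intro: absolutely_integrable_entry)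
    show "(\<integral>x. G x $ i $ j * \<phi> x \<partial>lebesgue_on U) = 0" if "test_function U \<phi>" for \<phi>
      using G that unfolding has_weak_gradient_def by fastforce
  qed
  then have "AE x in lebesgue_on U. \<forall>i. \<forall>j. G x $ i $ j = 0" by (simp add: AE_all_countable)
  then show ?thesis by eventually_elim (simp add: vec_eq_iff)
qed

lemma has_weak_gradient_unique:
  assumes "open U" "has_weak_gradient U u G" "has_weak_gradient U u H"
  shows "AE x in lebesgue_on U. G x = H x"
  using has_weak_gradient_zero_AE[OF assms(1) has_weak_gradient_diff[OF assms, simplified]] by simp

section \<open>Change of variables by dilations\<close>

lemma lebesgue_scale_eq:
  fixes a :: "'a::euclidean_space"
  assumes c: "c \<noteq> 0"
  shows "(\<lambda>x. a + c *\<^sub>R x) \<in> lebesgue \<rightarrow>\<^sub>M lebesgue"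
    and "lebesgue = density (distr lebesgue lebesgue (\<lambda>x. a + c *\<^sub>R x)) (\<lambda>_. ennreal (\<bar>c\<bar> ^ DIM('a)))"
proof -
  have eq: "(\<lambda>x. a + (\<Sum>j\<in>Basis. (c * (x \<bullet> j)) *\<^sub>R j)) = (\<lambda>x. a + c *\<^sub>R x)"
    by (simp add: euclidean_representation flip: scaleR_scaleR scaleR_sum_right)
  show "(\<lambda>x. a + c *\<^sub>R x) \<in> lebesgue \<rightarrow>\<^sub>M lebesgue"
    using lebesgue_affine_measurable[of "\<lambda>_. c" a] c unfolding eq by simp
  show "lebesgue = density (distr lebesgue lebesgue (\<lambda>x. a + c *\<^sub>R x)) (\<lambda>_. ennreal (\<bar>c\<bar> ^ DIM('a)))"
    using lebesgue_affine_euclidean[of "\<lambda>_. c" a] c unfolding eq by simp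
qed

text \<open>All the integral formulas come from one identity of measures: Lebesgue measure on
  \<open>S\<close> is the image of Lebesgue measure on \<open>V\<close>, multiplied by the Jacobian
  \<open>c ^ DIM('a)\<close>.\<close>

lemma lebesgue_scaling:
  fixes a :: "'a::euclidean_space" and f :: "'a \<Rightarrow> ennreal" and h :: "'a \<Rightarrow> 'b::euclidean_space"
  assumes c: "0 < c" and V: "V \<in> sets lebesgue" and S: "S \<in> sets lebesgue"
    and VS: "\<And>x. a + c *\<^sub>R x \<in> S \<longleftrightarrow> x \<in> V"
  shows "(\<lambda>x. a + c *\<^sub>R x) \<in> lebesgue_on V \<rightarrow>\<^sub>M lebesgue_on S"
    and "f \<in> borel_measurable (lebesgue_on S) \<Longrightarrow>
      (\<integral>\<^sup>+x. f x \<partial>lebesgue_on S) = ennreal (c ^ DIM('a)) * (\<integral>\<^sup>+x. f (a + c *\<^sub>R x) \<partial>lebesgue_on V)"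
    and "(AE x in lebesgue_on S. P x) \<Longrightarrow> (AE x in lebesgue_on V. P (a + c *\<^sub>R x))"
    and "integrable (lebesgue_on S) h \<Longrightarrow> integrable (lebesgue_on V) (\<lambda>x. h (a + c *\<^sub>R x))"
    and "integral\<^sup>L (lebesgue_on S) h = c ^ DIM('a) *\<^sub>R (\<integral>x. h (a + c *\<^sub>R x) \<partial>lebesgue_on V)"
proof -
  let ?T = "\<lambda>x. a + c *\<^sub>R x"
  have c0: "c \<noteq> 0" using c by simp
  note T = lebesgue_scale_eq[OF c0, of a]
  have T1[measurable]: "?T \<in> lebesgue_on V \<rightarrow>\<^sub>M lebesgue_on S"
    by (rule measurable_restrict_space3[OF T(1)]) (use VS in auto)
  then show "?T \<in> lebesgue_on V \<rightarrow>\<^sub>M lebesgue_on S" .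
  have eq: "lebesgue_on S = density (distr (lebesgue_on V) (lebesgue_on S) ?T) (\<lambda>_. ennreal (c ^ DIM('a)))" (is "_ = ?D")
  proof (rule measure_eqI)
    show "sets (lebesgue_on S) = sets ?D" by simp
    fix A assume A: "A \<in> sets (lebesgue_on S)"
    then have AS: "A \<subseteq> S" "A \<in> sets lebesgue" using S by (auto simp: sets_restrict_space_iff)
    have sp: "space (lebesgue :: 'a measure) = UNIV" by simp
    have "emeasure (lebesgue_on S) A = emeasure lebesgue A"
      using AS S by (simp add: emeasure_restrict_space)
    also have "\<dots> = emeasure (density (distr lebesgue lebesgue ?T) (\<lambda>_. ennreal (\<bar>c\<bar> ^ DIM('a)))) A"
      using T(2) by metis
    also have "emeasure (density (distr lebesgue lebesgue ?T) (\<lambda>_. ennreal (\<bar>c\<bar> ^ DIM('a)))) A = ennreal (c ^ DIM('a)) * emeasure lebesgue (?T -` A)"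
      using AS T(1) c by (simp add: emeasure_density nn_integral_cmult emeasure_distr sp del: emeasure_completion space_completion)
    also have "emeasure lebesgue (?T -` A) = emeasure (lebesgue_on V) (?T -` A)"
      using AS V VS by (subst emeasure_restrict_space) auto
    also have "ennreal (c ^ DIM('a)) * \<dots> = emeasure ?D A"
    proof -
      have "?T -` A \<inter> V = ?T -` A" using AS VS by auto
      then show ?thesis using A by (simp add: emeasure_density nn_integral_cmult emeasure_distr)
    qed
    finally show "emeasure (lebesgue_on S) A = emeasure ?D A" .
  qed
  show "(\<integral>\<^sup>+x. f x \<partial>lebesgue_on S) = ennreal (c ^ DIM('a)) * (\<integral>\<^sup>+x. f (?T x) \<partial>lebesgue_on V)"
    if f[measurable]: "f \<in> borel_measurable (lebesgue_on S)"
  proof -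
    have "(\<integral>\<^sup>+x. f x \<partial>lebesgue_on S) = (\<integral>\<^sup>+x. f x \<partial>?D)" using eq by metis
    also have "\<dots> = ennreal (c ^ DIM('a)) * (\<integral>\<^sup>+x. f (?T x) \<partial>lebesgue_on V)"
      by (subst nn_integral_density) (auto simp: nn_integral_cmult nn_integral_distr)
    finally show ?thesis .
  qed
  show "AE x in lebesgue_on V. P (?T x)" if "AE x in lebesgue_on S. P x"
  proof -
    have "AE x in ?D. P x" using that eq by metis
    then have "AE x in distr (lebesgue_on V) (lebesgue_on S) ?T. P x"
      using c by (subst (asm) AE_density) auto
    then show ?thesis by (rule AE_distrD[OF T1])
  qed
  show "integrable (lebesgue_on V) (\<lambda>x. h (?T x))" if "integrable (lebesgue_on S) h"
  proof -
    have [measurable]: "h \<in> borel_measurable (lebesgue_on S)" using that by auto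
    have "integrable ?D h" using that eq by metis
    then have "integrable (distr (lebesgue_on V) (lebesgue_on S) ?T) (\<lambda>x. c ^ DIM('a) *\<^sub>R h x)"
      using c by (subst (asm) integrable_density) auto
    then have cV: "integrable (lebesgue_on V) (\<lambda>x. c ^ DIM('a) *\<^sub>R h (?T x))"
      by (subst (asm) integrable_distr_eq) auto
    have "integrable (lebesgue_on V) (\<lambda>x. (1 / c ^ DIM('a)) *\<^sub>R (c ^ DIM('a) *\<^sub>R h (?T x)))"
      by (rule integrable_scaleR_right) (rule cV)
    then show ?thesis using c by simp
  qed
  show "integral\<^sup>L (lebesgue_on S) h = c ^ DIM('a) *\<^sub>R (\<integral>x. h (?T x) \<partial>lebesgue_on V)"
  proof (cases "h \<in> borel_measurable (lebesgue_on S)")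
    case True
    note [measurable] = True
    have "integral\<^sup>L (lebesgue_on S) h = integral\<^sup>L ?D h" using eq by metis
    also have "\<dots> = c ^ DIM('a) *\<^sub>R (\<integral>x. h (?T x) \<partial>lebesgue_on V)"
      using c by (subst integral_density) (auto simp: integral_distr)
    finally show ?thesis .
  next
    \<comment> \<open>For a function that is not measurable both integrals are 0 by convention. The
      inverse dilation \<open>?R\<close> shows that composing with \<open>?T\<close> cannot create
      measurability.\<close>
    case False
    have "(\<lambda>x. h (?T x)) \<notin> borel_measurable (lebesgue_on V)"
    proof
      assume m: "(\<lambda>x. h (?T x)) \<in> borel_measurable (lebesgue_on V)"
      let ?R = "\<lambda>x. (- (1 / c)) *\<^sub>R a + (1 / c) *\<^sub>R x"
      have "?R \<in> lebesgue_on S \<rightarrow>\<^sub>M lebesgue_on V"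
      proof (rule measurable_restrict_space3[OF lebesgue_scale_eq(1)])
        show "?R \<in> S \<rightarrow> V"
        proof
          fix x assume "x \<in> S"
          moreover have "x = ?T (?R x)" using c by (simp add: scaleR_add_right scaleR_diff_right)
          ultimately show "?R x \<in> V" using VS by metis
        qed
      qed (use c in auto)
      from measurable_compose[OF this m] have "h \<in> borel_measurable (lebesgue_on S)"
        using c by (simp add: scaleR_add_right scaleR_diff_right)
      then show False using False by simp
    qed
    then have "\<not> integrable (lebesgue_on V) (\<lambda>x. h (?T x))" "\<not> integrable (lebesgue_on S) h"
      using False borel_measurable_integrable by blast+
    then show ?thesis by (simp add: not_integrable_integral_eq)
  qed
qed

lemma in_Lp_scaling:
  fixes a :: "'a::euclidean_space"
  assumes c: "0 < c" and V: "V \<in> sets lebesgue" and S: "S \<in> sets lebesgue"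
    and VS: "\<And>x. a + c *\<^sub>R x \<in> S \<longleftrightarrow> x \<in> V" and f: "in_Lp (lebesgue_on S) p f"
  shows "in_Lp (lebesgue_on V) p (\<lambda>x. f (a + c *\<^sub>R x))"
    and "Lp_int (lebesgue_on S) p f = c ^ DIM('a) * Lp_int (lebesgue_on V) p (\<lambda>x. f (a + c *\<^sub>R x))"
proof -
  note sc = lebesgue_scaling[OF c V S VS]
  show "in_Lp (lebesgue_on V) p (\<lambda>x. f (a + c *\<^sub>R x))"
    unfolding in_Lp_def using f measurable_compose[OF sc(1), of f borel] sc(4)[of "\<lambda>x. norm (f x) powr p"]
    by (auto simp: in_Lp_def)
  show "Lp_int (lebesgue_on S) p f = c ^ DIM('a) * Lp_int (lebesgue_on V) p (\<lambda>x. f (a + c *\<^sub>R x))"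
    unfolding Lp_int_def using sc(5)[of "\<lambda>x. norm (f x) powr p"] by simp
qed

lemma in_Lp_subset:
  assumes S: "S \<in> sets lebesgue" and T: "T \<in> sets lebesgue" "T \<subseteq> S" and f: "in_Lp (lebesgue_on S) p f"
  shows "in_Lp (lebesgue_on T) p f" "Lp_int (lebesgue_on T) p f \<le> Lp_int (lebesgue_on S) p f"
proof -
  have m: "f \<in> borel_measurable (lebesgue_on S)" and i: "integrable (lebesgue_on S) (\<lambda>x. norm (f x) powr p)"
    using f by (auto simp: in_Lp_def)
  have mT: "f \<in> borel_measurable (lebesgue_on T)" by (rule measurable_restrict_mono[OF m T(2)])
  have r: "lebesgue_on T = restrict_space (lebesgue_on S) T"
    using T by (simp add: restrict_restrict_space S Int_absorb1)
  have TS: "T \<inter> space (lebesgue_on S) \<in> sets (lebesgue_on S)"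
    using T S by (auto simp: sets_restrict_space_iff)
  have iT: "integrable (lebesgue_on S) (\<lambda>x. indicator T x *\<^sub>R norm (f x) powr p)"
    using integrable_mult_indicator[OF _ i, of T] TS T by (simp add: Int_absorb2)
  have iT': "integrable (lebesgue_on T) (\<lambda>x. norm (f x) powr p)"
    unfolding r using iT by (subst integrable_restrict_space[OF TS]) simp
  with mT show "in_Lp (lebesgue_on T) p f" by (simp add: in_Lp_def)
  have "Lp_int (lebesgue_on T) p f = (\<integral>x. indicator T x *\<^sub>R norm (f x) powr p \<partial>lebesgue_on S)"
    unfolding Lp_int_def r by (rule integral_restrict_space[OF TS])
  also have "\<dots> \<le> Lp_int (lebesgue_on S) p f"
    unfolding Lp_int_def by (rule integral_mono[OF iT i]) (auto simp: indicator_def)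
  finally show "Lp_int (lebesgue_on T) p f \<le> Lp_int (lebesgue_on S) p f" .
qed

lemma finite_measure_lebesgue_on:
  "S \<in> lmeasurable \<Longrightarrow> finite_measure (lebesgue_on S)"
  by (intro finite_measureI) (auto simp: emeasure_restrict_space fmeasurable_def)

lemma measure_lebesgue_on_space: "S \<in> sets lebesgue \<Longrightarrow> measure (lebesgue_on S) (space (lebesgue_on S)) = measure lebesgue S"
  by (simp add: measure_restrict_space)

lemma in_Lp_locally_integrable:
  assumes U: "U \<in> sets lebesgue" and f: "in_Lp (lebesgue_on U) p f" and p: "1 < p"
  shows "locally_integrable U f"
  unfolding locally_integrable_def
proof (intro allI impI)
  fix K assume K: "compact K \<and> K \<subseteq> U"
  then have KL: "K \<in> lmeasurable" by (simp add: lmeasurable_compact)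
  then have KS: "K \<in> sets lebesgue" by (simp add: fmeasurable_def)
  have "in_Lp (lebesgue_on K) p f" by (rule in_Lp_subset(1)[OF U KS _ f]) (use K in simp)
  from in_Lp_integrable(1)[OF finite_measure_lebesgue_on[OF KL] this p]
  show "f absolutely_integrable_on K"
    using KS by (simp add: set_integrable_def integrable_restrict_space)
qed

lemma Lp_iff_in_Lp:
  assumes "0 \<le> p"
  shows "f \<in> Lp (ennreal p) S \<longleftrightarrow> in_Lp (lebesgue_on S) p f"
proof -
  have "(\<integral>\<^sup>+x. ennreal (norm (f x) powr p) \<partial>lebesgue_on S) < \<infinity> \<longleftrightarrow> integrable (lebesgue_on S) (\<lambda>x. norm (f x) powr p)"
    if "f \<in> borel_measurable (lebesgue_on S)"
    using that by (subst integrable_iff_bounded) auto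
  then show ?thesis using assms by (auto simp: Lp_def in_Lp_def)
qed

lemma Lp_norm_eq: "Lp_norm p S f = Lp_nrm (lebesgue_on S) p f"
  by (simp add: Lp_norm_def Lp_nrm_def Lp_int_def)

text \<open>The version picked by \<open>weak_gradient\<close> agrees almost everywhere with the one
  supplied by \<open>W1\<close>, and completeness of Lebesgue measure carries measurability over to
  it. From here on the chosen version can be used throughout.\<close>

lemma W1_iff:
  assumes U: "open U" and p: "1 < p"
  shows "u \<in> W1 (ennreal p) U \<longleftrightarrow> in_Lp (lebesgue_on U) p u \<and> has_weak_gradient U u (weak_gradient U u) \<and>
    in_Lp (lebesgue_on U) p (weak_gradient U u)"
proof
  assume "u \<in> W1 (ennreal p) U"
  then obtain G where u: "in_Lp (lebesgue_on U) p u" and G: "in_Lp (lebesgue_on U) p G" "has_weak_gradient U u G"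
    using p by (auto simp: W1_def Lp_iff_in_Lp)
  have w: "has_weak_gradient U u (weak_gradient U u)"
    unfolding weak_gradient_def by (rule someI[of "has_weak_gradient U u", OF G(2)])
  have ae: "AE x in lebesgue_on U. weak_gradient U u x = G x"
    by (rule has_weak_gradient_unique[OF U w G(2)])
  have m: "G \<in> borel_measurable (lebesgue_on U)" using G by (simp add: in_Lp_def)
  have UL: "U \<in> sets lebesgue" using U by auto
  have "AE x in lebesgue. x \<in> U \<longrightarrow> G x = weak_gradient U u x"
    using ae by (subst (asm) AE_restrict_space_iff) (auto simp: UL eq_commute)
  then have m': "weak_gradient U u \<in> borel_measurable (lebesgue_on U)"
    using borel_measurable_AE[of "\<lambda>x. if x \<in> U then G x else 0" "\<lambda>x. if x \<in> U then weak_gradient U u x else 0"] m UL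
    by (simp add: borel_measurable_if eventually_mono)
  show "in_Lp (lebesgue_on U) p u \<and> has_weak_gradient U u (weak_gradient U u) \<and> in_Lp (lebesgue_on U) p (weak_gradient U u)"
    using u w G(1) in_Lp_cong_AE(1)[OF m' m ae] by simp
next
  assume "in_Lp (lebesgue_on U) p u \<and> has_weak_gradient U u (weak_gradient U u) \<and> in_Lp (lebesgue_on U) p (weak_gradient U u)"
  then show "u \<in> W1 (ennreal p) U" using p by (auto simp: W1_def Lp_iff_in_Lp)
qed

lemma W1_intro:
  assumes U: "open U" and p: "1 < p" and u: "in_Lp (lebesgue_on U) p u"
    and G: "in_Lp (lebesgue_on U) p G" "has_weak_gradient U u G"
  shows "u \<in> W1 (ennreal p) U" "AE x in lebesgue_on U. weak_gradient U u x = G x"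
    "Lp_int (lebesgue_on U) p (weak_gradient U u) = Lp_int (lebesgue_on U) p G"
proof -
  show w: "u \<in> W1 (ennreal p) U" using p u G by (auto simp: W1_def Lp_iff_in_Lp)
  then have W: "has_weak_gradient U u (weak_gradient U u)" "in_Lp (lebesgue_on U) p (weak_gradient U u)"
    by (simp_all add: W1_iff[OF U p])
  show ae: "AE x in lebesgue_on U. weak_gradient U u x = G x"
    by (rule has_weak_gradient_unique[OF U W(1) G(2)])
  show "Lp_int (lebesgue_on U) p (weak_gradient U u) = Lp_int (lebesgue_on U) p G"
    by (rule in_Lp_cong_AE(2)[OF _ _ ae]) (use W G in \<open>auto simp: in_Lp_def\<close>)
qed

text \<open>A test function on \<open>V\<close> is transported to \<open>U\<close> by the inverse
  dilation. The Jacobians on the two sides of the identity cancel, and the chain rule leaves the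
  factor \<open>c\<close>.\<close>

lemma has_weak_gradient_scaling:
  fixes u :: "real^'n \<Rightarrow> real^'m"
  assumes c: "0 < c" and U: "open U" and V: "open V" and sub: "\<And>x. x \<in> V \<Longrightarrow> a + c *\<^sub>R x \<in> U"
    and G: "has_weak_gradient U u G"
    and li: "locally_integrable V (\<lambda>x. u (a + c *\<^sub>R x))" "locally_integrable V (\<lambda>x. G (a + c *\<^sub>R x))"
  shows "has_weak_gradient V (\<lambda>x. u (a + c *\<^sub>R x)) (\<lambda>x. c *\<^sub>R G (a + c *\<^sub>R x))"
  unfolding has_weak_gradient_def
proof (intro conjI allI impI)
  show "locally_integrable V (\<lambda>x. u (a + c *\<^sub>R x))" by (rule li(1))
  show "locally_integrable V (\<lambda>x. c *\<^sub>R G (a + c *\<^sub>R x))" using locally_integrable_scaleR[OF li(2)] by simp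
  fix \<phi> i j assume \<phi>: "test_function V \<phi>"
  obtain K where K: "compact K" "K \<subseteq> V" "\<And>x. x \<notin> K \<Longrightarrow> \<phi> x = 0"
    "\<And>x j. x \<notin> K \<Longrightarrow> partial_derivative j \<phi> x = 0" using test_function_support[OF \<phi>] by blast
  define d where "d = 1 / c"
  define b where "b = - d *\<^sub>R a"
  have inv: "a + c *\<^sub>R (b + d *\<^sub>R x) = x" "b + d *\<^sub>R (a + c *\<^sub>R x) = x" for x
    using c by (simp_all add: b_def d_def scaleR_add_right scaleR_diff_right)
  \<comment> \<open>The factor 1 gives \<open>\<psi>\<close> the shape required by
    \<open>Ck_affine\<close>.\<close>
  define \<psi> where "\<psi> x = 1 * \<phi> (b + d *\<^sub>R x)" for x
  have d0: "d \<noteq> 0" using c by (simp add: d_def)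
  have Ck: "\<And>k. Ck k \<phi>" using \<phi> by (simp add: test_function_def)
  have Ck\<psi>: "Ck k \<psi>" for k unfolding \<psi>_def by (rule Ck_affine(1)[OF Ck d0])
  have pd: "partial_derivative j \<psi> = (\<lambda>x. d * partial_derivative j \<phi> (b + d *\<^sub>R x))"
    unfolding \<psi>_def using Ck_affine(2)[OF Ck[of 1] d0, of j 1 b] by simp
  define K' where "K' = (\<lambda>x. a + c *\<^sub>R x) ` K"
  have "compact K'" unfolding K'_def by (intro compact_continuous_image K(1) continuous_intros)
  have K'U: "K' \<subseteq> U" using K(2) sub by (auto simp: K'_def)
  have out: "b + d *\<^sub>R x \<notin> K" if "x \<notin> K'" for x
    using that inv(1)[of x] unfolding K'_def by (metis image_eqI)
  have "{x. \<psi> x \<noteq> 0} \<subseteq> K'" using out K(3) by (auto simp: \<psi>_def)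
  then have cl: "closure {x. \<psi> x \<noteq> 0} \<subseteq> K'" using \<open>compact K'\<close> by (intro closure_minimal compact_imp_closed)
  have "compact (closure {x. \<psi> x \<noteq> 0})"
    using bounded_subset[OF compact_imp_bounded[OF \<open>compact K'\<close>] cl] by (simp add: compact_eq_bounded_closed)
  then have \<psi>: "test_function U \<psi>"
    unfolding test_function_def using Ck\<psi> K'U cl by auto
  have UL: "U \<in> sets lebesgue" and VL: "V \<in> sets lebesgue" using U V by auto
  have UN: "(UNIV :: (real^'n) set) \<in> sets lebesgue" by simp
  have ext: "(\<integral>x. h (a + c *\<^sub>R x) \<partial>lebesgue_on V) = d ^ DIM(real^'n) * (\<integral>x. h x \<partial>lebesgue_on U)"
    if h: "\<And>x. x \<notin> K' \<Longrightarrow> h x = 0" for h :: "real^'n \<Rightarrow> real"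
  proof -
    have "(\<integral>x. h (a + c *\<^sub>R x) \<partial>lebesgue_on V) = (\<integral>x. h (a + c *\<^sub>R x) \<partial>lebesgue)"
    proof (rule lebesgue_on_support(2)[OF VL])
      fix x assume "x \<notin> V"
      then have "x \<notin> K" using K(2) by auto
      then have "a + c *\<^sub>R x \<notin> K'" using c by (auto simp: K'_def)
      then show "h (a + c *\<^sub>R x) = 0" by (rule h)
    qed
    moreover have "(\<integral>x. h x \<partial>lebesgue_on U) = (\<integral>x. h x \<partial>lebesgue)"
      using K'U h by (intro lebesgue_on_support(2)[OF UL]) auto
    moreover have "(\<integral>x. h x \<partial>lebesgue) = c ^ DIM(real^'n) *\<^sub>R (\<integral>x. h (a + c *\<^sub>R x) \<partial>lebesgue)"
      using lebesgue_scaling(5)[OF c UN UN, of a h] by (simp add: lebesgue_on_UNIV_eq)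
    ultimately show ?thesis using c by (simp add: d_def power_one_over)
  qed
  have "(\<integral>x. u (a + c *\<^sub>R x) $ i * partial_derivative j \<phi> x \<partial>lebesgue_on V)
     = (\<integral>x. (\<lambda>z. c * (u z $ i * partial_derivative j \<psi> z)) (a + c *\<^sub>R x) \<partial>lebesgue_on V)"
    using c unfolding pd inv by (simp add: d_def)
  also have "\<dots> = d ^ DIM(real^'n) * (\<integral>z. c * (u z $ i * partial_derivative j \<psi> z) \<partial>lebesgue_on U)"
    by (rule ext) (use out K(4) in \<open>simp add: pd\<close>)
  also have "\<dots> = d ^ DIM(real^'n) * (c * - (\<integral>z. G z $ i $ j * \<psi> z \<partial>lebesgue_on U))"
    using G \<psi> by (simp add: has_weak_gradient_def)
  also have "\<dots> = - (d ^ DIM(real^'n) * (\<integral>z. c * (G z $ i $ j * \<psi> z) \<partial>lebesgue_on U))" by simp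
  also have "d ^ DIM(real^'n) * (\<integral>z. c * (G z $ i $ j * \<psi> z) \<partial>lebesgue_on U)
     = (\<integral>x. (\<lambda>z. c * (G z $ i $ j * \<psi> z)) (a + c *\<^sub>R x) \<partial>lebesgue_on V)"
    by (rule ext[symmetric]) (use out K(3) in \<open>simp add: \<psi>_def\<close>)
  also have "\<dots> = (\<integral>x. (c *\<^sub>R G (a + c *\<^sub>R x)) $ i $ j * \<phi> x \<partial>lebesgue_on V)"
    unfolding \<psi>_def inv by (simp add: mult.assoc)
  finally show "(\<integral>x. u (a + c *\<^sub>R x) $ i * partial_derivative j \<phi> x \<partial>lebesgue_on V)
     = - (\<integral>x. (c *\<^sub>R G (a + c *\<^sub>R x)) $ i $ j * \<phi> x \<partial>lebesgue_on V)" .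
qed

text \<open>Integration by parts through difference quotients: the partial derivative of the test
  function is the bounded limit of the quotients \<open>q n\<close>, and a translation passes the
  shift on to the affine function, whose difference quotients are constant.\<close>

lemma has_weak_gradient_linear:
  fixes \<xi> :: "real^'n^'m"
  assumes U: "open U"
  shows "has_weak_gradient U (\<lambda>y. \<xi> *v y + k) (\<lambda>y. \<xi>)"
  unfolding has_weak_gradient_def
proof (intro conjI allI impI)
  have cu: "continuous_on UNIV (\<lambda>y. \<xi> *v y + k)"
    by (intro continuous_intros linear_continuous_on linear_conv_bounded_linear[THEN iffD1] matrix_vector_mul_linear)
  have ci: "f absolutely_integrable_on K" if fK: "continuous_on UNIV f" "compact K" for f :: "real^'n \<Rightarrow> 'b::euclidean_space" and K
  proof -
    obtain a b where ab: "K \<subseteq> cbox a b" using compact_imp_bounded[OF fK(2)] bounded_subset_cbox_symmetric by blast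
    have "f absolutely_integrable_on cbox a b"
      by (rule absolutely_integrable_continuous[OF continuous_on_subset[OF fK(1)]]) auto
    then show ?thesis
      by (rule set_integrable_subset) (use ab fK in \<open>auto simp: fmeasurableD lmeasurable_compact\<close>)
  qed
  show "locally_integrable U (\<lambda>y. \<xi> *v y + k)" using ci[OF cu] by (auto simp: locally_integrable_def)
  show "locally_integrable U (\<lambda>y. \<xi>)"
    using ci[of "\<lambda>y. \<xi>"] by (auto simp: locally_integrable_def)
  fix \<phi> i j assume \<phi>: "test_function U \<phi>"
  obtain K where K: "compact K" "K \<subseteq> U" "\<And>x. x \<notin> K \<Longrightarrow> \<phi> x = 0"
    "\<And>x j. x \<notin> K \<Longrightarrow> partial_derivative j \<phi> x = 0" using test_function_support[OF \<phi>] by blast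
  note cont = test_function_continuous[OF \<phi>]
  have UL: "U \<in> sets lebesgue" using U by auto
  obtain B where B: "0 < B" "\<And>x. \<bar>partial_derivative j \<phi> x\<bar> \<le> B"
    using continuous_compact_support_bounded[OF cont(2) K(1,4)] by metis
  define e where "e = (axis j 1 :: real^'n)"
  define f where "f y = (\<xi> *v y + k) $ i" for y
  have fc: "continuous_on UNIV f"
    unfolding f_def by (rule continuous_on_component[OF cu])
  have fe: "f (y - t *\<^sub>R e) = f y - t * \<xi> $ i $ j" for y t
    by (simp add: f_def e_def matrix_vector_mult_diff_distrib matrix_vector_mult_scaleR matrix_vector_mul_component[symmetric] matrix_vector_mult_basis column_def)
  define t where "t n = 1 / real (Suc n)" for n
  have t: "0 < t n" "t n \<le> 1" for n by (auto simp: t_def)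
  \<comment> \<open>Shifts have length at most 1, so \<open>K'\<close> contains the support of every
    shifted test function. It may leave \<open>U\<close>; hence the computation is done on the whole
    space and restricted to \<open>U\<close> only at the end.\<close>
  define K' where "K' = (\<Union>x\<in>K. \<Union>y\<in>cball (0::real^'n) 1. {x + y})"
  have K': "compact K'"
    unfolding K'_def using compact_sums'[OF K(1) compact_cball[of 0 1]] .
  have sh: "\<phi> (x + t n *\<^sub>R e) = 0" "\<phi> x = 0" "partial_derivative j \<phi> x = 0" if "x \<notin> K'" for x n
  proof -
    have "x \<notin> K" using that by (force simp: K'_def)
    then show "\<phi> x = 0" "partial_derivative j \<phi> x = 0" using K by auto
    have "x + t n *\<^sub>R e \<notin> K"
    proof
      assume "x + t n *\<^sub>R e \<in> K"
      moreover have "- t n *\<^sub>R e \<in> cball 0 1" using t[of n] by (auto simp: e_def)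
      moreover have "x = (x + t n *\<^sub>R e) + (- t n *\<^sub>R e)" by simp
      ultimately have "x \<in> K'" unfolding K'_def by blast
      then show False using that by simp
    qed
    then show "\<phi> (x + t n *\<^sub>R e) = 0" using K by auto
  qed
  have line: "((\<lambda>s. \<phi> (x + s *\<^sub>R e)) has_real_derivative partial_derivative j \<phi> (x + s *\<^sub>R e)) (at s)" for x s
  proof -
    let ?F = "frechet_derivative \<phi> (at (x + s *\<^sub>R e))"
    have d: "(\<phi> has_derivative ?F) (at (x + s *\<^sub>R e))"
      using cont(3) frechet_derivative_works by blast
    have "((\<lambda>s. x + s *\<^sub>R e) has_derivative (\<lambda>h. h *\<^sub>R e)) (at s)" by (auto intro!: derivative_eq_intros)
    from diff_chain_at[OF this d] have "((\<lambda>s. \<phi> (x + s *\<^sub>R e)) has_derivative (\<lambda>h. ?F (h *\<^sub>R e))) (at s)"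
      by (simp add: o_def)
    moreover have "?F (h *\<^sub>R e) = partial_derivative j \<phi> (x + s *\<^sub>R e) * h" for h
      using has_derivative_linear[OF d] by (simp add: linear_scale partial_derivative_def e_def)
    ultimately show ?thesis by (simp add: has_field_derivative_def)
  qed
  define q where "q n x = (\<phi> (x + t n *\<^sub>R e) - \<phi> x) / t n" for n x
  have qB: "\<bar>q n x\<bar> \<le> B" for n x
  proof -
    obtain z where "\<phi> (x + t n *\<^sub>R e) - \<phi> (x + 0 *\<^sub>R e) = (t n - 0) * partial_derivative j \<phi> (x + z *\<^sub>R e)"
      using MVT2[OF t(1)[of n], of "\<lambda>s. \<phi> (x + s *\<^sub>R e)" "\<lambda>s. partial_derivative j \<phi> (x + s *\<^sub>R e)"] line[of x] by blast
    then have "q n x = partial_derivative j \<phi> (x + z *\<^sub>R e)" using t[of n] by (simp add: q_def)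
    then show ?thesis using B by simp
  qed
  have qlim: "(\<lambda>n. q n x) \<longlonglongrightarrow> partial_derivative j \<phi> x" for x
  proof -
    have "((\<lambda>h. (\<phi> (x + (0 + h) *\<^sub>R e) - \<phi> (x + 0 *\<^sub>R e)) / h) \<longlongrightarrow> partial_derivative j \<phi> (x + 0 *\<^sub>R e)) (at 0)"
      using line[of x 0] by (simp add: DERIV_def)
    moreover have "filterlim t (at 0) sequentially"
      unfolding filterlim_at using t LIMSEQ_Suc[OF lim_1_over_n] by (auto simp: t_def[abs_def] intro!: always_eventually)
    ultimately show ?thesis unfolding q_def
      using filterlim_compose by fastforce
  qed
  have ctr: "continuous_on UNIV (\<lambda>x. \<phi> (x + t n *\<^sub>R e))" for n
    by (rule continuous_on_compose2[OF cont(1)]) (auto intro!: continuous_intros)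
  have qm: "q n \<in> borel_measurable lebesgue" for n
    unfolding q_def using t(1)[of n] by (intro continuous_borel_lebesgue continuous_intros ctr cont(1)) auto
  have fi: "f absolutely_integrable_on K'" by (rule ci[OF fc K'])
  have L: "(\<lambda>n. \<integral>x. f x * q n x \<partial>lebesgue_on UNIV) \<longlonglongrightarrow> (\<integral>x. f x * partial_derivative j \<phi> x \<partial>lebesgue_on UNIV)"
    by (rule tendsto_integral_mult_support[OF fi qm qB _ qlim]) (use sh in \<open>auto simp: q_def\<close>)
  obtain B2 where B2: "\<And>x. \<bar>\<phi> x\<bar> \<le> B2" using continuous_compact_support_bounded[OF cont(1) K(1,3)] by metis
  have i0: "integrable lebesgue (\<lambda>x. f x * \<phi> x)"
    by (rule integrable_mult_support[OF fi continuous_borel_lebesgue[OF cont(1)] B2 sh(2)])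
  have i1: "integrable lebesgue (\<lambda>x. f x * \<phi> (x + t n *\<^sub>R e))" for n
    by (rule integrable_mult_support[OF fi continuous_borel_lebesgue[OF ctr] B2 sh(1)])
  have ip: "integrable lebesgue \<phi>"
    using integrable_mult_support[OF ci[of "\<lambda>_. 1::real", OF _ K'] continuous_borel_lebesgue[OF cont(1)] B2 sh(2)] by simp
  \<comment> \<open>After the translation the quotient of \<open>f\<close> is exactly the slope, so
    these integrals do not depend on \<open>n\<close> and the limit can be read off.\<close>
  have qi: "(\<integral>x. f x * q n x \<partial>lebesgue) = - (\<xi> $ i $ j * (\<integral>x. \<phi> x \<partial>lebesgue))" for n
  proof -
    have "(\<integral>x. f x * \<phi> (x + t n *\<^sub>R e) \<partial>lebesgue) = (\<integral>x. (\<lambda>z. f (z - t n *\<^sub>R e) * \<phi> z) (t n *\<^sub>R e + 1 *\<^sub>R x) \<partial>lebesgue)"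
      by (simp add: add.commute)
    also have "\<dots> = (\<integral>z. f (z - t n *\<^sub>R e) * \<phi> z \<partial>lebesgue)"
      using lebesgue_scaling(5)[of 1 UNIV UNIV "t n *\<^sub>R e" "\<lambda>z. f (z - t n *\<^sub>R e) * \<phi> z"] by (simp add: lebesgue_on_UNIV_eq)
    also have "\<dots> = (\<integral>z. f z * \<phi> z - t n * \<xi> $ i $ j * \<phi> z \<partial>lebesgue)"
      by (simp add: fe left_diff_distrib)
    also have "\<dots> = (\<integral>z. f z * \<phi> z \<partial>lebesgue) - t n * \<xi> $ i $ j * (\<integral>z. \<phi> z \<partial>lebesgue)"
      by (subst Bochner_Integration.integral_diff) (use i0 ip in auto)
    finally have 1: "(\<integral>x. f x * \<phi> (x + t n *\<^sub>R e) \<partial>lebesgue) = \<dots>" .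
    have "(\<integral>x. f x * q n x \<partial>lebesgue) = (\<integral>x. (f x * \<phi> (x + t n *\<^sub>R e) - f x * \<phi> x) / t n \<partial>lebesgue)"
      by (rule Bochner_Integration.integral_cong) (auto simp: q_def right_diff_distrib diff_divide_distrib)
    also have "\<dots> = ((\<integral>x. f x * \<phi> (x + t n *\<^sub>R e) \<partial>lebesgue) - (\<integral>x. f x * \<phi> x \<partial>lebesgue)) / t n"
      using i0 i1 by simp
    also have "\<dots> = - (\<xi> $ i $ j * (\<integral>x. \<phi> x \<partial>lebesgue))" unfolding 1 using t(1)[of n] by simp
    finally show ?thesis .
  qed
  have "(\<integral>x. f x * partial_derivative j \<phi> x \<partial>lebesgue) = - (\<xi> $ i $ j * (\<integral>x. \<phi> x \<partial>lebesgue))"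
    using L unfolding lebesgue_on_UNIV_eq qi by (simp add: LIMSEQ_const_iff)
  moreover have "(\<integral>x. f x * partial_derivative j \<phi> x \<partial>lebesgue_on U) = (\<integral>x. f x * partial_derivative j \<phi> x \<partial>lebesgue)"
    using K by (intro lebesgue_on_support(2)[OF UL]) auto
  moreover have "(\<integral>x. \<phi> x \<partial>lebesgue_on U) = (\<integral>x. \<phi> x \<partial>lebesgue)"
    using K by (intro lebesgue_on_support(2)[OF UL]) auto
  ultimately show "(\<integral>y. (\<xi> *v y + k) $ i * partial_derivative j \<phi> y \<partial>lebesgue_on U) = - (\<integral>y. \<xi> $ i $ j * \<phi> y \<partial>lebesgue_on U)"
    by (simp add: f_def)
qed

section \<open>The Poincare inequality on boxes\<close>

lemma tendsto_Lp_int_dominated: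
  fixes f :: "nat \<Rightarrow> 'a \<Rightarrow> 'b::euclidean_space"
  assumes m: "\<And>n. f n \<in> borel_measurable M" and g: "in_Lp M p g" and p: "0 < p"
    and le: "\<And>n. AE x in M. norm (f n x) \<le> norm (g x)" and lim: "AE x in M. (\<lambda>n. f n x) \<longlonglongrightarrow> 0"
  shows "(\<lambda>n. Lp_int M p (f n)) \<longlonglongrightarrow> 0"
proof -
  have "(\<lambda>n. \<integral>x. norm (f n x) powr p \<partial>M) \<longlonglongrightarrow> (\<integral>x. 0 \<partial>M)"
  proof (rule integral_dominated_convergence[where w="\<lambda>x. norm (g x) powr p"])
    show "(\<lambda>x. norm (f n x) powr p) \<in> borel_measurable M" for n
      using m[of n] by measurable
    show "integrable M (\<lambda>x. norm (g x) powr p)" using g by (simp add: in_Lp_def)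
    show "AE x in M. (\<lambda>n. norm (f n x) powr p) \<longlonglongrightarrow> 0"
      using lim
    proof eventually_elim
      case (elim x)
      have "(\<lambda>n. norm (f n x) powr p) \<longlonglongrightarrow> norm (0::'b) powr p"
        by (rule tendsto_powr'[OF tendsto_norm[OF elim] tendsto_const]) (use p in auto)
      then show ?case by simp
    qed
    show "AE x in M. norm (norm (f n x) powr p) \<le> norm (g x) powr p" for n
      using le[of n] by eventually_elim (use p in \<open>auto intro: powr_mono2\<close>)
  qed simp
  then show ?thesis by (simp add: Lp_int_def)
qed

lemma in_Lp_bounded:
  fixes f :: "'a \<Rightarrow> 'b::euclidean_space"
  assumes M: "finite_measure M" and m: "f \<in> borel_measurable M" and p: "0 \<le> p" and b: "\<And>x. norm (f x) \<le> C"
  shows "in_Lp M p f"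
proof (rule in_Lp_bound(1)[OF in_Lp_const(1)[OF M, of p C] m _ p])
  show "AE x in M. norm (f x) \<le> norm C" using b order_trans[OF b abs_ge_self] by simp
qed

text \<open>For positive \<open>C\<close> this is the radial retraction onto the closed ball of
  radius \<open>C\<close>; the maximum in the denominator replaces a case distinction and makes
  continuity immediate.\<close>

definition clamp_norm :: "real \<Rightarrow> 'b::real_normed_vector \<Rightarrow> 'b"
  where "clamp_norm C v = (C / max C (norm v)) *\<^sub>R v"

lemma clamp_norm:
  fixes v :: "'b::real_normed_vector"
  assumes "0 < C"
  shows "norm (clamp_norm C v) \<le> C" "norm v \<le> C \<Longrightarrow> clamp_norm C v = v"
    "continuous_on UNIV (clamp_norm C :: 'b \<Rightarrow> 'b)"
proof -
  have pos: "0 < max C (norm v)" for v :: 'b using assms by (simp add: less_max_iff_disj)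
  have "norm v \<le> max C (norm v)" by simp
  then show "norm (clamp_norm C v) \<le> C" 
    using assms pos[of v] by (simp add: clamp_norm_def field_simps)
  show "norm v \<le> C \<Longrightarrow> clamp_norm C v = v" using assms by (simp add: clamp_norm_def max_def)
  show "continuous_on UNIV (clamp_norm C :: 'b \<Rightarrow> 'b)"
    unfolding clamp_norm_def by (intro continuous_intros) (use pos in \<open>metis less_irrefl\<close>)
qed

text \<open>After cutting off large values, \<open>f\<close> is almost everywhere the limit of
  continuous functions on the whole space. Clamping these to the same bound leaves the limit
  unchanged and provides a constant majorant for dominated convergence.\<close>

lemma continuous_dense_Lp:
  fixes f :: "'a::euclidean_space \<Rightarrow> 'b::euclidean_space"
  assumes S: "S \<in> lmeasurable" and f: "in_Lp (lebesgue_on S) p f" and p: "0 < p" and e: "0 < e"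
  obtains g where "continuous_on UNIV g" "in_Lp (lebesgue_on S) p g" "Lp_int (lebesgue_on S) p (\<lambda>x. f x - g x) < e"
proof -
  let ?M = "lebesgue_on S"
  have fin: "finite_measure ?M" by (rule finite_measure_lebesgue_on[OF S])
  have SL: "S \<in> sets lebesgue" using S by (simp add: fmeasurable_def)
  have [measurable]: "f \<in> borel_measurable ?M" using f by (simp add: in_Lp_def)
  define c where "c n = real (Suc n)" for n
  define fc where "fc n x = (if norm (f x) \<le> c n then f x else 0)" for n x
  have fcm[measurable]: "fc n \<in> borel_measurable ?M" for n unfolding fc_def by measurable
  have fcb: "norm (fc n x) \<le> c n" for n x by (auto simp: fc_def c_def)
  have lim1: "(\<lambda>n. Lp_int ?M p (\<lambda>x. f x - fc n x)) \<longlonglongrightarrow> 0"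
  proof (rule tendsto_Lp_int_dominated[OF _ f p])
    show "AE x in ?M. norm (f x - fc n x) \<le> norm (f x)" for n by (auto simp: fc_def)
    show "AE x in ?M. (\<lambda>n. f x - fc n x) \<longlonglongrightarrow> 0"
    proof (rule AE_I2, rule tendsto_eventually)
      fix x
      obtain N :: nat where "norm (f x) \<le> real N" using real_arch_simple by blast
      then show "eventually (\<lambda>n. f x - fc n x = 0) sequentially"
        by (auto simp: eventually_sequentially fc_def c_def intro!: exI[of _ N])
    qed
  qed measurable
  obtain N where N: "Lp_int ?M p (\<lambda>x. f x - fc N x) < e / (2 * 2 powr p)"
    using order_tendstoD(2)[OF lim1, of "e / (2 * 2 powr p)"] e by (auto simp: eventually_sequentially)
  have "fc N measurable_on S" using fcm measurable_on_iff_borel_measurable[OF SL] by blast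
  then obtain Z h where Z: "negligible Z" "\<And>n. continuous_on UNIV (h n)"
    "\<And>x. x \<notin> Z \<Longrightarrow> (\<lambda>n. h n x) \<longlonglongrightarrow> (if x \<in> S then fc N x else 0)"
    unfolding measurable_on_def by blast
  have c0: "0 < c N" by (simp add: c_def)
  define g where "g n x = clamp_norm (c N) (h n x)" for n x
  have gc: "continuous_on UNIV (g n)" for n
    unfolding g_def by (rule continuous_on_compose2[OF clamp_norm(3)[OF c0] Z(2)]) auto
  have gb: "norm (g n x) \<le> c N" for n x unfolding g_def by (rule clamp_norm(1)[OF c0])
  have gm[measurable]: "g n \<in> borel_measurable ?M" for n
    using continuous_borel_lebesgue[OF gc[of n]] by (rule measurable_restrict_space1)
  have aeZ: "AE x in ?M. x \<notin> Z"
  proof -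
    have "AE x in lebesgue. x \<notin> Z" using Z(1) by (intro AE_not_in) (simp add: negligible_iff_null_sets)
    then have "AE x in lebesgue. x \<in> S \<longrightarrow> x \<notin> Z" by eventually_elim simp
    then show ?thesis using SL by (subst AE_restrict_space_iff) auto
  qed
  have lim2: "(\<lambda>n. Lp_int ?M p (\<lambda>x. fc N x - g n x)) \<longlonglongrightarrow> 0"
  proof (rule tendsto_Lp_int_dominated[OF _ in_Lp_const(1)[OF fin, of p "2 * c N"] p])
    show "AE x in ?M. norm (fc N x - g n x) \<le> norm (2 * c N)" for n
    proof (rule AE_I2)
      fix x show "norm (fc N x - g n x) \<le> norm (2 * c N)"
        using norm_triangle_ineq4[of "fc N x" "g n x"] fcb[of N x] gb[of n x] c0 by simp
    qed
    have "AE x in ?M. x \<in> S" by (intro AE_I2) auto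
    then show "AE x in ?M. (\<lambda>n. fc N x - g n x) \<longlonglongrightarrow> 0" using aeZ
    proof eventually_elim
      case (elim x)
      then have "(\<lambda>n. h n x) \<longlonglongrightarrow> fc N x" using Z(3)[of x] by simp
      then have "(\<lambda>n. g n x) \<longlonglongrightarrow> clamp_norm (c N) (fc N x)"
        unfolding g_def using clamp_norm(3)[OF c0]
        by (intro isCont_tendsto_compose[of _ "clamp_norm (c N)"]) (auto simp: continuous_on_eq_continuous_at)
      then have "(\<lambda>n. fc N x - g n x) \<longlonglongrightarrow> fc N x - fc N x"
        using clamp_norm(2)[OF c0 fcb] by (intro tendsto_diff tendsto_const) simp
      then show ?case by simp
    qed
  qed measurable
  obtain k where k: "Lp_int ?M p (\<lambda>x. fc N x - g k x) < e / (2 * 2 powr p)"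
    using order_tendstoD(2)[OF lim2, of "e / (2 * 2 powr p)"] e by (auto simp: eventually_sequentially)
  have gLp: "in_Lp ?M p (g k)" "in_Lp ?M p (fc N)"
    using p gb fcb by (auto intro!: in_Lp_bounded[OF fin])
  have d1: "in_Lp ?M p (\<lambda>x. f x - fc N x)" "in_Lp ?M p (\<lambda>x. fc N x - g k x)"
    by (intro in_Lp_diff f gLp; use p in simp)+
  have "Lp_int ?M p (\<lambda>x. (f x - fc N x) + (fc N x - g k x)) \<le> 2 powr p * (Lp_int ?M p (\<lambda>x. f x - fc N x) + Lp_int ?M p (\<lambda>x. fc N x - g k x))"
    by (rule in_Lp_add(2)[OF d1]) (use p in simp)
  also have "\<dots> < 2 powr p * (e / (2 * 2 powr p) + e / (2 * 2 powr p))"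
    using N k by (intro mult_strict_left_mono add_strict_mono) auto
  also have "\<dots> = e" by simp
  finally show ?thesis using that[OF gc gLp(1)] by simp
qed

section \<open>Means and oscillation\<close>

definition mean :: "'a::euclidean_space set \<Rightarrow> ('a \<Rightarrow> 'b::euclidean_space) \<Rightarrow> 'b"
  where "mean S f = (1 / measure lebesgue S) *\<^sub>R (\<integral>x. f x \<partial>lebesgue_on S)"

lemma mean_powr_le:
  assumes S: "S \<in> lmeasurable" "0 < measure lebesgue S" and f: "in_Lp (lebesgue_on S) p f" and p: "1 < p"
  shows "norm (mean S f) powr p * measure lebesgue S \<le> Lp_int (lebesgue_on S) p f"
proof -
  let ?v = "measure lebesgue S"
  have SL: "S \<in> sets lebesgue" using S by (simp add: fmeasurable_def)
  have "norm (mean S f) powr p = norm (\<integral>x. f x \<partial>lebesgue_on S) powr p / ?v powr p"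
    using S by (simp add: mean_def powr_mult powr_divide)
  also have "\<dots> \<le> (?v powr (p - 1) * Lp_int (lebesgue_on S) p f) / ?v powr p"
    using Lp_Jensen[OF finite_measure_lebesgue_on[OF S(1)] f p] measure_lebesgue_on_space[OF SL, simplified]
    by (intro divide_right_mono) auto
  also have "\<dots> = Lp_int (lebesgue_on S) p f / ?v"
    using S(2) by (simp add: powr_diff)
  finally show ?thesis using S(2) by (simp add: field_simps)
qed

lemma mean_diff_const:
  assumes S: "S \<in> lmeasurable" "0 < measure lebesgue S" and f: "integrable (lebesgue_on S) f"
  shows "mean S (\<lambda>x. f x - c) = mean S f - c"
proof -
  have SL: "S \<in> sets lebesgue" using S by (simp add: fmeasurable_def)
  have i: "integrable (lebesgue_on S) (\<lambda>x. c)"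
    using finite_measure.integrable_const[OF finite_measure_lebesgue_on[OF S(1)]] .
  have "(\<integral>x. f x - c \<partial>lebesgue_on S) = (\<integral>x. f x \<partial>lebesgue_on S) - measure lebesgue S *\<^sub>R c"
    using f i S(1) by (simp add: measure_lebesgue_on_space[OF SL, simplified])
  then show ?thesis using S(2) by (simp add: mean_def scaleR_diff_right)
qed

text \<open>The distance of \<open>c\<close> from the mean of \<open>f\<close> is the norm of the
  mean of \<open>f - c\<close>, which \<open>mean_powr_le\<close> bounds. Hence the mean is, up to a
  factor, as good a centre as any constant.\<close>

lemma osc_le_const:
  assumes S: "S \<in> lmeasurable" "0 < measure lebesgue S" and f: "in_Lp (lebesgue_on S) p f" and p: "1 < p"
  shows "Lp_int (lebesgue_on S) p (\<lambda>x. f x - mean S f) \<le> 2 * 2 powr p * Lp_int (lebesgue_on S) p (\<lambda>x. f x - c)"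
proof -
  let ?M = "lebesgue_on S"
  have SL: "S \<in> sets lebesgue" using S by (simp add: fmeasurable_def)
  note fin = finite_measure_lebesgue_on[OF S(1)]
  have p0: "0 \<le> p" using p by simp
  have fc: "in_Lp ?M p (\<lambda>x. f x - c)" by (rule in_Lp_diff(1)[OF f in_Lp_const(1)[OF fin] p0])
  have "Lp_int ?M p (\<lambda>x. c - mean S f) = norm (mean S (\<lambda>x. f x - c)) powr p * measure lebesgue S"
    using mean_diff_const[OF S in_Lp_integrable(1)[OF fin f p]]
    by (simp add: in_Lp_const(2)[OF fin] measure_lebesgue_on_space[OF SL, simplified] norm_minus_commute)
  also have "\<dots> \<le> Lp_int ?M p (\<lambda>x. f x - c)" by (rule mean_powr_le[OF S fc p])
  finally have 1: "Lp_int ?M p (\<lambda>x. c - mean S f) \<le> Lp_int ?M p (\<lambda>x. f x - c)" .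
  have "Lp_int ?M p (\<lambda>x. (f x - c) + (c - mean S f)) \<le> 2 powr p * (Lp_int ?M p (\<lambda>x. f x - c) + Lp_int ?M p (\<lambda>x. c - mean S f))"
    by (rule in_Lp_add(2)[OF fc in_Lp_const(1)[OF fin] p0])
  also have "\<dots> \<le> 2 powr p * (Lp_int ?M p (\<lambda>x. f x - c) + Lp_int ?M p (\<lambda>x. f x - c))"
    using 1 by (intro mult_left_mono) auto
  finally show ?thesis by simp
qed

text \<open>Subadditivity of the p-th powers stands in for disjointness of the pieces: it is
  available both for the list of boxes produced by bisection and for a disjoint family of cubes. The
  bound is on the sum over all pieces, uniformly in the family, once their diameters are at most
  \<open>d\<close>.\<close>

definition osc_fine :: "'a::euclidean_space set \<Rightarrow> real \<Rightarrow> ('a \<Rightarrow> 'b::euclidean_space) \<Rightarrow> real \<Rightarrow> real \<Rightarrow> bool"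
  where "osc_fine W p f d e \<longleftrightarrow> (\<forall>(I::nat set) S. finite I \<and>
     (\<forall>i\<in>I. S i \<in> lmeasurable \<and> 0 < measure lebesgue (S i) \<and> S i \<subseteq> W \<and> (\<forall>x\<in>S i. \<forall>y\<in>S i. dist x y \<le> d)) \<and>
     (\<forall>g :: 'a \<Rightarrow> 'b. in_Lp (lebesgue_on W) p g \<longrightarrow> (\<Sum>i\<in>I. Lp_int (lebesgue_on (S i)) p g) \<le> Lp_int (lebesgue_on W) p g) \<longrightarrow>
     (\<Sum>i\<in>I. Lp_int (lebesgue_on (S i)) p (\<lambda>x. f x - mean (S i) f)) \<le> e)"

text \<open>Approximate \<open>f\<close> by a continuous \<open>g\<close>, which is uniformly
  continuous on the compact closure of \<open>W\<close>. On a small piece \<open>f\<close> is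
  compared with the value of \<open>g\<close> at one point, and the errors are summed by means of
  the subadditivity hypothesis.\<close>

lemma osc_fine_exists:
  fixes f :: "'a::euclidean_space \<Rightarrow> 'b::euclidean_space"
  assumes W: "W \<in> lmeasurable" "bounded W" and f: "in_Lp (lebesgue_on W) p f" and p: "1 < p" and e: "0 < e"
  obtains d where "0 < d" "osc_fine W p f d e"
proof -
  let ?M = "lebesgue_on W"
  have WL: "W \<in> sets lebesgue" using W by (simp add: fmeasurable_def)
  note fin = finite_measure_lebesgue_on[OF W(1)]
  have p0: "0 < p" "0 \<le> p" using p by auto
  \<comment> \<open>The factor of \<open>osc_le_const\<close> times the factor of
    \<open>in_Lp_add\<close>.\<close>
  define C where "C = 2 * 2 powr p * 2 powr p"
  have C: "0 < C" by (simp add: C_def)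
  obtain g where g: "continuous_on UNIV g" "in_Lp ?M p g" "Lp_int ?M p (\<lambda>x. f x - g x) < e / (2 * C)"
    using continuous_dense_Lp[OF W(1) f p0(1), of "e / (2 * C)"] e C by (metis divide_pos_pos mult_pos_pos zero_less_numeral)
  \<comment> \<open>\<open>w *\<^sub>R b\<close> is a constant of norm \<open>w\<close> with values
    in the space of \<open>f\<close>, so that the subadditivity hypothesis applies to it as
    well.\<close>
  obtain b :: 'b where b: "norm b = 1" using vector_choose_size[of 1] by auto
  define A where "A = measure lebesgue W + 1"
  have A: "0 < A" "measure lebesgue W \<le> A" by (auto simp: A_def add_nonneg_pos)
  \<comment> \<open>Makes \<open>C * w powr p * A\<close> equal to \<open>e / 2\<close>, the share
    allotted to the oscillation of \<open>g\<close>; the approximation error takes the other half.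
    The summand 1 in \<open>A\<close> prevents a division by zero for null sets.\<close>
  define w where "w = (e / (2 * C * A)) powr (1 / p)"
  have w: "0 < w" "w powr p = e / (2 * C * A)" using e C A p by (auto simp: w_def powr_powr)
  have "uniformly_continuous_on (closure W) g"
    by (intro compact_uniformly_continuous continuous_on_subset[OF g(1)]) (use W in \<open>auto simp: compact_eq_bounded_closed\<close>)
  then obtain d where d: "0 < d" "\<And>x y. \<lbrakk>x \<in> closure W; y \<in> closure W; dist x y < d\<rbrakk> \<Longrightarrow> dist (g x) (g y) < w"
    unfolding uniformly_continuous_on_def using w(1) by metis
  show ?thesis
  \<comment> \<open>Diameters at most \<open>d/2\<close> give the strict inequality that uniform
    continuity asks for.\<close>
  proof (rule that[of "d/2"])
    show "0 < d/2" using d by simp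
    show "osc_fine W p f (d/2) e" unfolding osc_fine_def
    proof (intro allI impI, elim conjE)
      fix I :: "nat set" and S
      assume I: "finite I" and S0: "\<forall>i\<in>I. S i \<in> lmeasurable \<and> 0 < measure lebesgue (S i) \<and> S i \<subseteq> W \<and> (\<forall>x\<in>S i. \<forall>y\<in>S i. dist x y \<le> d/2)"
        and sub0: "\<forall>g :: 'a \<Rightarrow> 'b. in_Lp ?M p g \<longrightarrow> (\<Sum>i\<in>I. Lp_int (lebesgue_on (S i)) p g) \<le> Lp_int ?M p g"
      have S: "\<And>i. i \<in> I \<Longrightarrow> S i \<in> lmeasurable \<and> 0 < measure lebesgue (S i) \<and> S i \<subseteq> W"
        and dia: "\<And>i x y. \<lbrakk>i \<in> I; x \<in> S i; y \<in> S i\<rbrakk> \<Longrightarrow> dist x y \<le> d/2"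
        using S0 by blast+
      note sub = sub0[rule_format]
      have each: "Lp_int (lebesgue_on (S i)) p (\<lambda>x. f x - mean (S i) f)
         \<le> C * (Lp_int (lebesgue_on (S i)) p (\<lambda>x. f x - g x) + Lp_int (lebesgue_on (S i)) p (\<lambda>x. w *\<^sub>R b))" if i: "i \<in> I" for i
      proof -
        have Si: "S i \<in> lmeasurable" "0 < measure lebesgue (S i)" "S i \<subseteq> W" using S[OF i] by auto
        then have SL: "S i \<in> sets lebesgue" by (simp add: fmeasurable_def)
        note fi = finite_measure_lebesgue_on[OF Si(1)]
        have fS: "in_Lp (lebesgue_on (S i)) p f" "in_Lp (lebesgue_on (S i)) p g"
          using in_Lp_subset(1)[OF WL SL Si(3)] f g by auto
        obtain x0 where x0: "x0 \<in> S i" using Si(2) by (metis all_not_in_conv measure_empty less_irrefl)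
        have gi: "in_Lp (lebesgue_on (S i)) p (\<lambda>x. g x - g x0)" "Lp_int (lebesgue_on (S i)) p (\<lambda>x. g x - g x0) \<le> Lp_int (lebesgue_on (S i)) p (\<lambda>x. w *\<^sub>R b)"
        proof -
          show l: "in_Lp (lebesgue_on (S i)) p (\<lambda>x. g x - g x0)"
            by (rule in_Lp_diff(1)[OF fS(2) in_Lp_const(1)[OF fi] p0(2)])
          show "Lp_int (lebesgue_on (S i)) p (\<lambda>x. g x - g x0) \<le> Lp_int (lebesgue_on (S i)) p (\<lambda>x. w *\<^sub>R b)"
          proof (rule in_Lp_bound(2)[OF in_Lp_const(1)[OF fi] _ _ p0(2)])
            show "(\<lambda>x. g x - g x0) \<in> borel_measurable (lebesgue_on (S i))" using l by (simp add: in_Lp_def)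
            show "AE x in lebesgue_on (S i). norm (g x - g x0) \<le> norm (w *\<^sub>R b)"
            proof (rule AE_I2)
              fix x assume "x \<in> space (lebesgue_on (S i))"
              then have x: "x \<in> S i" by simp
              then have "dist (g x) (g x0) < w"
                using d(2)[of x x0] dia[OF i x x0] Si(3) x0 closure_subset[of W] \<open>0 < d\<close> by auto
              then show "norm (g x - g x0) \<le> norm (w *\<^sub>R b)" using w b by (simp add: dist_norm)
            qed
          qed
        qed
        have fg: "in_Lp (lebesgue_on (S i)) p (\<lambda>x. f x - g x)" by (rule in_Lp_diff(1)[OF fS p0(2)])
        have "Lp_int (lebesgue_on (S i)) p (\<lambda>x. f x - mean (S i) f) \<le> 2 * 2 powr p * Lp_int (lebesgue_on (S i)) p (\<lambda>x. f x - g x0)"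
          by (rule osc_le_const[OF Si(1,2) fS(1) p])
        also have "Lp_int (lebesgue_on (S i)) p (\<lambda>x. f x - g x0) = Lp_int (lebesgue_on (S i)) p (\<lambda>x. (f x - g x) + (g x - g x0))" by simp
        also have "\<dots> \<le> 2 powr p * (Lp_int (lebesgue_on (S i)) p (\<lambda>x. f x - g x) + Lp_int (lebesgue_on (S i)) p (\<lambda>x. g x - g x0))"
          by (rule in_Lp_add(2)[OF fg gi(1) p0(2)])
        also have "\<dots> \<le> 2 powr p * (Lp_int (lebesgue_on (S i)) p (\<lambda>x. f x - g x) + Lp_int (lebesgue_on (S i)) p (\<lambda>x. w *\<^sub>R b))"
          by (intro mult_left_mono add_left_mono gi(2)) auto
        finally show ?thesis by (simp add: C_def mult.assoc)
      qed
      have wb: "in_Lp ?M p (\<lambda>x. w *\<^sub>R b)" by (rule in_Lp_const(1)[OF fin])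
      have fg: "in_Lp ?M p (\<lambda>x. f x - g x)" by (rule in_Lp_diff(1)[OF f g(2) p0(2)])
      have "(\<Sum>i\<in>I. Lp_int (lebesgue_on (S i)) p (\<lambda>x. f x - mean (S i) f))
         \<le> (\<Sum>i\<in>I. C * (Lp_int (lebesgue_on (S i)) p (\<lambda>x. f x - g x) + Lp_int (lebesgue_on (S i)) p (\<lambda>x. w *\<^sub>R b)))"
        by (rule sum_mono[OF each])
      also have "\<dots> = C * ((\<Sum>i\<in>I. Lp_int (lebesgue_on (S i)) p (\<lambda>x. f x - g x)) + (\<Sum>i\<in>I. Lp_int (lebesgue_on (S i)) p (\<lambda>x. w *\<^sub>R b)))"
        by (simp add: sum.distrib flip: sum_distrib_left)
      also have "\<dots> \<le> C * (Lp_int ?M p (\<lambda>x. f x - g x) + Lp_int ?M p (\<lambda>x. w *\<^sub>R b))"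
        using C by (intro mult_left_mono add_mono sub fg wb) auto
      also have "Lp_int ?M p (\<lambda>x. w *\<^sub>R b) = w powr p * measure lebesgue W"
        using w b by (simp add: in_Lp_const(2)[OF fin] measure_lebesgue_on_space[OF WL, simplified])
      also have "C * (Lp_int ?M p (\<lambda>x. f x - g x) + w powr p * measure lebesgue W) \<le> C * (e / (2 * C) + w powr p * A)"
        using g(3) C A by (intro mult_left_mono add_mono) auto
      also have "\<dots> = e" using w C A by (simp add: field_simps)
      finally show "(\<Sum>i\<in>I. Lp_int (lebesgue_on (S i)) p (\<lambda>x. f x - mean (S i) f)) \<le> e" .
    qed
  qed
qed

section \<open>Tent functions and shifted boxes\<close>

lemma smooth1_derivative:
  assumes "\<And>k. smooth1 k f"
  obtains f' where "\<And>x. (f has_real_derivative f' x) (at x)"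
  using assms[of 1] by auto

text \<open>Since \<open>f\<close> vanishes to the left of \<open>a\<close>, the integral taken from
  \<open>a - 1\<close> is an antiderivative on the whole line.\<close>

lemma antiderivative_left_zero:
  fixes f :: "real \<Rightarrow> real"
  assumes f: "continuous_on UNIV f" and z: "\<And>x. x \<le> a \<Longrightarrow> f x = 0"
  obtains F where "\<And>x. (F has_real_derivative f x) (at x)"
proof
  define c where "c = a - 1"
  define F where "F x = integral {c..x} f" for x
  show "(F has_real_derivative f x) (at x)" for x
  proof (cases "x < a")
    case True
    have F0: "F y = 0" if "y < a" for y
    proof -
      have "integral {c..y} f = integral {c..y} (\<lambda>_. 0)"
        by (rule Henstock_Kurzweil_Integration.integral_cong) (use that z in auto)
      then show ?thesis by (simp add: F_def)
    qed
    have "((\<lambda>x. 0) has_real_derivative 0) (at x)" by simp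
    then have "(F has_real_derivative 0) (at x)"
      by (rule has_field_derivative_transform_within_open[of _ _ _ "{..<a}"]) (use True F0 in auto)
    then show ?thesis using True z[of x] by simp
  next
    case False
    then have x: "c < x" by (simp add: c_def)
    have "((\<lambda>u. integral {c..u} f) has_real_derivative f x) (at x within {c..x + 1})"
      by (rule integral_has_real_derivative[OF continuous_on_subset[OF f]]) (use x in auto)
    then show ?thesis
      using x unfolding F_def by (subst (asm) at_within_Icc_at) auto
  qed
qed

text \<open>The test function is a tent in direction \<open>j\<close> and a bump in the other
  coordinates. Its derivative in direction \<open>j\<close> is the bump of the box minus the bump of
  the shifted box, so testing with it compares the two integrals of \<open>u\<close>, while its own
  size is at most \<open>t\<close>.\<close>

lemma box_tent_estimate:
  fixes u :: "real^'n \<Rightarrow> real^'m" and G :: "real^'n \<Rightarrow> real^'n^'m"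
  assumes U: "open U" and uG: "has_weak_gradient U u G" and t: "0 < t"
    and sub: "cbox a (b + t *\<^sub>R axis j 1) \<subseteq> U"
  shows "\<bar>(\<integral>x. u x $ i \<partial>lebesgue_on (box (a + t *\<^sub>R axis j 1) (b + t *\<^sub>R axis j 1))) - (\<integral>x. u x $ i \<partial>lebesgue_on (box a b))\<bar>
    \<le> t * (\<integral>x. \<bar>G x $ i $ j\<bar> \<partial>lebesgue_on (cbox a (b + t *\<^sub>R axis j 1)))"
proof -
  let ?e = "axis j 1 :: real^'n"
  let ?c = "b + t *\<^sub>R ?e"
  let ?K = "cbox a ?c"
  have cmp: "(x + t *\<^sub>R ?e) $ l = (if l = j then x $ l + t else x $ l)" for x l by (simp add: axis_def)
  have cmp': "(x - t *\<^sub>R ?e) $ l = (if l = j then x $ l - t else x $ l)" for x l by (simp add: axis_def)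
  have UL: "U \<in> sets lebesgue" using U by auto
  define \<beta> where "\<beta> n = bump1 (a $ j) (b $ j) n" for n
  have "\<exists>\<Theta>. \<forall>x. (\<Theta> has_real_derivative \<beta> n x) (at x)" for n
  proof -
    have "continuous_on UNIV (\<beta> n)" unfolding \<beta>_def by (rule smooth1_continuous[OF smooth1_bump1])
    then show ?thesis using antiderivative_left_zero[of "\<beta> n" "a $ j"] bump1_outside[of _ "a $ j" "b $ j" n]
      by (metis \<beta>_def greaterThanLessThan_iff linorder_not_less)
  qed
  then obtain \<Theta> where \<Theta>: "\<And>n x. (\<Theta> n has_real_derivative \<beta> n x) (at x)" by metis
  \<comment> \<open>This is the integral of \<open>\<beta> n\<close> over the interval from
    \<open>x - t\<close> to \<open>x\<close>: a smoothed tent whose derivative is the difference of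
    two shifted bumps.\<close>
  define \<tau> where "\<tau> n x = \<Theta> n x - \<Theta> n (x - t)" for n x
  have \<tau>': "(\<tau> n has_real_derivative \<beta> n x - \<beta> n (x - t)) (at x)" for n x
    unfolding \<tau>_def by (rule DERIV_diff[OF \<Theta> DERIV_cong[OF DERIV_chain2[where g="\<lambda>x. x - t", OF \<Theta>]]])
      (auto intro!: derivative_eq_intros)
  have \<tau>s: "smooth1 k (\<tau> n)" for k n
  proof (rule smooth1_antiderivative[OF \<tau>'])
    fix k
    have 1: "smooth1 k (\<beta> n)" unfolding \<beta>_def by (rule smooth1_bump1)
    have "smooth1 k (\<lambda>x. \<beta> n x + (- 1) * \<beta> n (1 * x + (- t)))"
      by (intro smooth1_add smooth1_mult smooth1_const smooth1_affine 1)
    then show "smooth1 k (\<lambda>x. \<beta> n x - \<beta> n (x - t))" by simp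
  qed
  \<comment> \<open>The mean value form yields both the bound \<open>t\<close> and the location of
    the support.\<close>
  have \<tau>z: "\<exists>z. x - t < z \<and> z < x \<and> \<tau> n x = t * \<beta> n z" for n x
    using MVT2[of "x - t" x "\<Theta> n" "\<beta> n"] \<Theta> t by (auto simp: \<tau>_def)
  have \<tau>b: "\<bar>\<tau> n x\<bar> \<le> t" for n x
    using \<tau>z[of x n] t bump1_bounds[of "a $ j" "b $ j" n] by (auto simp: \<beta>_def abs_mult mult_left_le)
  have \<tau>0: "\<tau> n x = 0" if "x \<notin> {a $ j .. b $ j + t}" for n x
  proof -
    obtain z where z: "x - t < z" "z < x" "\<tau> n x = t * \<beta> n z" using \<tau>z by blast
    then have "z \<notin> {a $ j<..<b $ j}" using that by auto
    then show ?thesis using z bump1_outside by (simp add: \<beta>_def)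
  qed
  define f where "f n l = (if l = j then \<tau> n else bump1 (a $ l) (b $ l) n)" for n l
  define \<psi> where "\<psi> n x = (\<Prod>l\<in>UNIV. f n l (x $ l))" for n and x :: "real^'n"
  have fs: "smooth1 k (f n l)" for k n l using \<tau>s smooth1_bump1 by (simp add: f_def)
  have f0: "f n l x = 0" if "x \<notin> {a $ l..?c $ l}" for n l x
  proof (cases "l = j")
    case True
    then show ?thesis using that \<tau>0[of x n] unfolding f_def cmp by simp
  next
    case False
    then have "x \<notin> {a $ l<..<b $ l}" using that unfolding cmp by auto
    then show ?thesis using False bump1_outside unfolding f_def by simp
  qed
  have \<psi>t: "test_function U (\<psi> n)" for n
    unfolding \<psi>_def by (rule test_function_prod_coords[OF fs f0 sub])
  have \<psi>0: "\<psi> n x = 0" if "x \<notin> ?K" for n x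
  proof -
    obtain l where "\<not> (a $ l \<le> x $ l \<and> x $ l \<le> ?c $ l)" using \<open>x \<notin> ?K\<close> unfolding mem_box_cart by blast
    then have "x $ l \<notin> {a $ l..?c $ l}" by simp
    then show ?thesis using f0 unfolding \<psi>_def by (intro prod_zero) auto
  qed
  have \<psi>b: "\<bar>\<psi> n x\<bar> \<le> t" for n x
  proof -
    have "\<psi> n x = f n j (x $ j) * (\<Prod>l\<in>UNIV - {j}. f n l (x $ l))"
      unfolding \<psi>_def by (subst prod.remove[of UNIV j]) auto
    moreover have "\<bar>\<Prod>l\<in>UNIV - {j}. f n l (x $ l)\<bar> \<le> 1"
      unfolding abs_prod using bump1_bounds by (intro prod_le_1) (auto simp: f_def)
    moreover have "\<bar>f n j (x $ j)\<bar> \<le> t" by (simp add: f_def \<tau>b)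
    ultimately have "\<bar>\<psi> n x\<bar> \<le> t * 1"
      using t by (simp only: abs_mult) (rule mult_mono; simp)
    then show ?thesis by simp
  qed
  have pd: "partial_derivative j (\<psi> n) x = box_bump a b n x - box_bump a b n (x - t *\<^sub>R ?e)" for n x
  proof -
    have "\<forall>l. \<exists>d. \<forall>x. (bump1 (a $ l) (b $ l) n has_real_derivative d x) (at x)"
      using smooth1_derivative[OF smooth1_bump1] by metis
    then obtain d where d: "\<And>l x. (bump1 (a $ l) (b $ l) n has_real_derivative d l x) (at x)" by metis
    define f' where "f' l = (if l = j then (\<lambda>x. \<beta> n x - \<beta> n (x - t)) else d l)" for l
    have "(f n l has_real_derivative f' l x) (at x)" for l x
      using d \<tau>' by (simp add: f_def f'_def)
    from partial_derivative_prod_coords[OF this, of j]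
    have "partial_derivative j (\<psi> n) x = (\<Prod>i\<in>UNIV. (if i = j then f' j else f n i) (x $ i))"
      by (simp add: \<psi>_def[abs_def])
    also have "\<dots> = (\<beta> n (x $ j) - \<beta> n (x $ j - t)) * (\<Prod>l\<in>UNIV - {j}. bump1 (a $ l) (b $ l) n (x $ l))"
      by (subst prod.remove[of UNIV j]) (auto simp: f'_def f_def intro!: prod.cong)
    also have "\<dots> = box_bump a b n x - box_bump a b n (x - t *\<^sub>R ?e)"
    proof -
      have "box_bump a b n x = \<beta> n (x $ j) * (\<Prod>l\<in>UNIV - {j}. bump1 (a $ l) (b $ l) n (x $ l))"
        unfolding box_bump_def \<beta>_def by (subst prod.remove[of UNIV j]) auto
      moreover have "box_bump a b n (x - t *\<^sub>R ?e) = \<beta> n (x $ j - t) * (\<Prod>l\<in>UNIV - {j}. bump1 (a $ l) (b $ l) n (x $ l))"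
        unfolding box_bump_def \<beta>_def cmp' by (subst prod.remove[of UNIV j]) (auto intro!: prod.cong)
      ultimately show ?thesis by (simp add: left_diff_distrib)
    qed
    finally show ?thesis .
  qed
  have Ksub: "cbox a b \<subseteq> ?K" "cbox (a + t *\<^sub>R ?e) ?c \<subseteq> ?K"
  proof -
    have ex: "0 \<le> t * ?e $ l" for l using t by (simp add: axis_def)
    show "cbox a b \<subseteq> ?K" by (auto simp: mem_box_cart intro!: add_increasing2 ex)
    show "cbox (a + t *\<^sub>R ?e) ?c \<subseteq> ?K"
    proof
      fix x assume x: "x \<in> cbox (a + t *\<^sub>R ?e) ?c"
      have "a $ l \<le> x $ l" for l using x ex[of l] unfolding mem_box_cart by (auto dest!: spec[of _ l])
      then show "x \<in> ?K" using x by (simp add: mem_box_cart)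
    qed
  qed
  have sh_in: "x - t *\<^sub>R ?e \<in> cbox a b \<longleftrightarrow> x \<in> cbox (a + t *\<^sub>R ?e) ?c"
      "x - t *\<^sub>R ?e \<in> box a b \<longleftrightarrow> x \<in> box (a + t *\<^sub>R ?e) ?c" for x
    unfolding mem_box_cart by (intro iff_allI; auto simp: cmp cmp')+
  have uK: "(\<lambda>x. u x $ i) absolutely_integrable_on ?K" "(\<lambda>x. G x $ i $ j) absolutely_integrable_on ?K"
    using uG sub by (auto simp: has_weak_gradient_def locally_integrable_def intro!: absolutely_integrable_entry)
  have L: "(\<lambda>n. \<integral>x. u x $ i * partial_derivative j (\<psi> n) x \<partial>lebesgue_on U) \<longlonglongrightarrow>
     (\<integral>x. u x $ i * (indicator (box a b) x - indicator (box (a + t *\<^sub>R ?e) ?c) x) \<partial>lebesgue_on U)"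
  proof (rule tendsto_integral_mult_support[OF uK(1), where B=2])
    show "partial_derivative j (\<psi> n) \<in> borel_measurable lebesgue" for n
      by (rule continuous_borel_lebesgue[OF test_function_continuous(2)[OF \<psi>t]])
    show "\<bar>partial_derivative j (\<psi> n) x\<bar> \<le> 2" for n x
      unfolding pd using box_bump_bounds[of a b n x] box_bump_bounds[of a b n "x - t *\<^sub>R ?e"] by simp
    show "partial_derivative j (\<psi> n) x = 0" if "x \<notin> ?K" for n x
    proof -
      have "x \<notin> cbox a b" "x - t *\<^sub>R ?e \<notin> cbox a b" using that Ksub sh_in(1) by auto
      then show ?thesis unfolding pd by (simp add: box_bump_outside)
    qed
    show "(\<lambda>n. partial_derivative j (\<psi> n) x) \<longlonglongrightarrow> indicator (box a b) x - indicator (box (a + t *\<^sub>R ?e) ?c) x" for x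
    proof -
      have "indicator (box a b) (x - t *\<^sub>R ?e) = (indicator (box (a + t *\<^sub>R ?e) ?c) x :: real)"
        using sh_in(2)[of x] by (simp add: indicator_def)
      then show ?thesis unfolding pd
        using tendsto_diff[OF box_bump_tendsto[of a b x] box_bump_tendsto[of a b "x - t *\<^sub>R ?e"]] by simp
    qed
  qed (use sub UL in auto)
  have KL: "?K \<in> sets lebesgue" by simp
  have iG: "integrable (lebesgue_on ?K) (\<lambda>x. \<bar>G x $ i $ j\<bar>)"
    using uK(2) by (simp add: set_integrable_def integrable_restrict_space)
  have bd: "\<bar>\<integral>x. u x $ i * partial_derivative j (\<psi> n) x \<partial>lebesgue_on U\<bar> \<le> t * (\<integral>x. \<bar>G x $ i $ j\<bar> \<partial>lebesgue_on ?K)" for n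
  proof -
    have iGp: "integrable lebesgue (\<lambda>x. G x $ i $ j * \<psi> n x)"
      by (rule integrable_mult_support[OF uK(2) continuous_borel_lebesgue[OF test_function_continuous(1)[OF \<psi>t]] \<psi>b \<psi>0])
    have "(\<integral>x. u x $ i * partial_derivative j (\<psi> n) x \<partial>lebesgue_on U) = - (\<integral>x. G x $ i $ j * \<psi> n x \<partial>lebesgue_on U)"
      using uG \<psi>t by (simp add: has_weak_gradient_def)
    also have "(\<integral>x. G x $ i $ j * \<psi> n x \<partial>lebesgue_on U) = (\<integral>x. G x $ i $ j * \<psi> n x \<partial>lebesgue)"
      using sub \<psi>0 by (intro lebesgue_on_support(2)[OF UL]) auto
    also have "\<dots> = (\<integral>x. G x $ i $ j * \<psi> n x \<partial>lebesgue_on ?K)"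
      using \<psi>0 by (intro lebesgue_on_support(2)[OF KL, symmetric]) auto
    finally have eq: "(\<integral>x. u x $ i * partial_derivative j (\<psi> n) x \<partial>lebesgue_on U) = - (\<integral>x. G x $ i $ j * \<psi> n x \<partial>lebesgue_on ?K)" .
    have "\<bar>\<integral>x. G x $ i $ j * \<psi> n x \<partial>lebesgue_on ?K\<bar> \<le> (\<integral>x. \<bar>G x $ i $ j * \<psi> n x\<bar> \<partial>lebesgue_on ?K)"
      by (rule integral_abs_bound)
    also have "\<dots> \<le> (\<integral>x. t * \<bar>G x $ i $ j\<bar> \<partial>lebesgue_on ?K)"
    proof (rule integral_mono)
      show "integrable (lebesgue_on ?K) (\<lambda>x. \<bar>G x $ i $ j * \<psi> n x\<bar>)"
        using iGp \<psi>0 lebesgue_on_support(1)[OF KL, of "\<lambda>x. G x $ i $ j * \<psi> n x"] by auto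
      show "integrable (lebesgue_on ?K) (\<lambda>x. t * \<bar>G x $ i $ j\<bar>)" using iG by simp
      show "\<bar>G x $ i $ j * \<psi> n x\<bar> \<le> t * \<bar>G x $ i $ j\<bar>" for x
        unfolding abs_mult using mult_left_mono[OF \<psi>b[of n x], of "\<bar>G x $ i $ j\<bar>"] by (simp add: mult.commute)
    qed
    finally show ?thesis unfolding eq by simp
  qed
  have bound: "\<bar>\<integral>x. u x $ i * (indicator (box a b) x - indicator (box (a + t *\<^sub>R ?e) ?c) x) \<partial>lebesgue_on U\<bar>
     \<le> t * (\<integral>x. \<bar>G x $ i $ j\<bar> \<partial>lebesgue_on ?K)"
    by (rule LIMSEQ_le_const2[OF tendsto_rabs[OF L]]) (use bd in auto)
  have bx: "integrable lebesgue (\<lambda>x. u x $ i * indicator (box c d) x)"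
    "(\<integral>x. u x $ i * indicator (box c d) x \<partial>lebesgue) = (\<integral>x. u x $ i \<partial>lebesgue_on (box c d))"
    if "cbox c d \<subseteq> ?K" for c d
  proof -
    have "(\<lambda>x. u x $ i) absolutely_integrable_on box c d"
      by (rule set_integrable_subset[OF uK(1)]) (use that box_subset_cbox[of c d] in auto)
    then show "integrable lebesgue (\<lambda>x. u x $ i * indicator (box c d) x)" by (simp add: set_integrable_def mult.commute)
    show "(\<integral>x. u x $ i * indicator (box c d) x \<partial>lebesgue) = (\<integral>x. u x $ i \<partial>lebesgue_on (box c d))"
      by (simp add: integral_restrict_space mult.commute)
  qed
  have "(\<integral>x. u x $ i * (indicator (box a b) x - indicator (box (a + t *\<^sub>R ?e) ?c) x) \<partial>lebesgue_on U)
     = (\<integral>x. u x $ i * (indicator (box a b) x - indicator (box (a + t *\<^sub>R ?e) ?c) x) \<partial>lebesgue)"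
    using Ksub sub box_subset_cbox[of a b] box_subset_cbox[of "a + t *\<^sub>R ?e" ?c]
    by (intro lebesgue_on_support(2)[OF UL]) (auto simp: indicator_def)
  also have "\<dots> = (\<integral>x. u x $ i \<partial>lebesgue_on (box a b)) - (\<integral>x. u x $ i \<partial>lebesgue_on (box (a + t *\<^sub>R ?e) ?c))"
    unfolding right_diff_distrib
    by (subst Bochner_Integration.integral_diff[OF bx(1)[OF Ksub(1)] bx(1)[OF Ksub(2)]]) (simp add: bx(2) Ksub)
  finally show ?thesis using bound by (simp add: abs_minus_commute)
qed

section \<open>Bisection of boxes\<close>

lemma integral_lebesgue_on_split:
  fixes f :: "'a::euclidean_space \<Rightarrow> 'b::euclidean_space"
  assumes S: "S \<in> sets lebesgue" and T: "T \<in> sets lebesgue" and R: "R \<in> sets lebesgue"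
    and dj: "S \<inter> T = {}" and sub: "S \<subseteq> R" "T \<subseteq> R" and neg: "negligible (R - (S \<union> T))"
    and f: "integrable (lebesgue_on R) f"
  shows "integral\<^sup>L (lebesgue_on R) f = integral\<^sup>L (lebesgue_on S) f + integral\<^sup>L (lebesgue_on T) f"
proof -
  have fR: "set_integrable lebesgue R f" using f R by (simp add: set_integrable_def integrable_restrict_space)
  then have fS: "set_integrable lebesgue S f" and fT: "set_integrable lebesgue T f"
    using set_integrable_subset S T sub by blast+
  have "integral\<^sup>L (lebesgue_on R) f = (\<integral>x. indicator R x *\<^sub>R f x \<partial>lebesgue)"
    using R by (simp add: integral_restrict_space)
  also have "\<dots> = (\<integral>x. indicator S x *\<^sub>R f x + indicator T x *\<^sub>R f x \<partial>lebesgue)"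
  proof (rule integral_cong_AE)
    have "AE x in lebesgue. x \<notin> R - (S \<union> T)" using neg by (intro AE_not_in) (simp add: negligible_iff_null_sets)
    then show "AE x in lebesgue. indicator R x *\<^sub>R f x = indicator S x *\<^sub>R f x + indicator T x *\<^sub>R f x"
      by eventually_elim (use dj sub in \<open>auto simp: indicator_def\<close>)
  qed (use fR fS fT in \<open>auto simp: set_integrable_def\<close>)
  also have "\<dots> = (\<integral>x. indicator S x *\<^sub>R f x \<partial>lebesgue) + (\<integral>x. indicator T x *\<^sub>R f x \<partial>lebesgue)"
    using fS fT by (simp add: set_integrable_def)
  also have "\<dots> = integral\<^sup>L (lebesgue_on S) f + integral\<^sup>L (lebesgue_on T) f"
    using S T by (simp add: integral_restrict_space)
  finally show ?thesis .
qed

text \<open>The triangle inequality in \<open>Lp\<close> over a two-point space; the two points will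
  be the halves of a box.\<close>

lemma minkowski2:
  fixes x1 x2 y1 y2 p :: real
  assumes "0 \<le> x1" "0 \<le> x2" "0 \<le> y1" "0 \<le> y2" "1 \<le> p"
  shows "((x1 + y1) powr p + (x2 + y2) powr p) powr (1 / p)
     \<le> (x1 powr p + x2 powr p) powr (1 / p) + (y1 powr p + y2 powr p) powr (1 / p)"
proof -
  let ?M = "count_space (UNIV :: bool set)"
  have L: "in_Lp ?M p f" "Lp_nrm ?M p f = (norm (f True) powr p + norm (f False) powr p) powr (1 / p)" for f :: "bool \<Rightarrow> real"
    by (auto simp: in_Lp_def Lp_nrm_def Lp_int_def lebesgue_integral_count_space_finite UNIV_bool integrable_count_space add.commute)
  show ?thesis
    using Lp_nrm_triangle[OF L(1) L(1) \<open>1 \<le> p\<close>, of "\<lambda>b. if b then x1 else x2" "\<lambda>b. if b then y1 else y2"] assms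
    unfolding L(2) by simp
qed

lemma measure_box_pos:
  fixes a b :: "real^'n"
  assumes "\<And>i. a $ i < b $ i"
  shows "box a b \<in> lmeasurable" "0 < measure lebesgue (box a b)"
proof -
  show "box a b \<in> lmeasurable" by (simp add: bounded_set_imp_lmeasurable)
  have "box a b \<noteq> {}" using assms by (simp add: interval_ne_empty_cart)
  then have "\<not> negligible (box a b)" using open_not_negligible[OF open_box] by blast
  then show "0 < measure lebesgue (box a b)"
    using \<open>box a b \<in> lmeasurable\<close> negligible_iff_measure0 zero_less_measure_iff by blast
qed

text \<open>The right half is the left half shifted by \<open>t\<close>, whence the equal measures;
  what lies between them is contained in a hyperplane. Writing \<open>b'\<close> and
  \<open>a'\<close> as shifts makes the halves fit \<open>box_tent_estimate\<close>.\<close>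

lemma half_boxes:
  fixes a b :: "real^'n"
  assumes ab: "\<And>i. a $ i < b $ i" and t: "t = (b $ j - a $ j) / 2"
  defines "b' \<equiv> b - t *\<^sub>R axis j 1" and "a' \<equiv> a + t *\<^sub>R axis j 1"
  shows "0 < t" "\<And>i. a $ i < b' $ i" "\<And>i. a' $ i < b $ i" "box a b' \<inter> box a' b = {}"
    "box a b' \<subseteq> box a b" "box a' b \<subseteq> box a b" "cbox a b' \<subseteq> cbox a b" "cbox a' b \<subseteq> cbox a b"
    "negligible (box a b - (box a b' \<union> box a' b))"
    "measure lebesgue (box a b') = measure lebesgue (box a b) / 2" "measure lebesgue (box a' b) = measure lebesgue (box a b) / 2"
    "b' + t *\<^sub>R axis j 1 = b"
    "\<And>i. b' $ i - a $ i = (if i = j then (b $ i - a $ i) / 2 else b $ i - a $ i)"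
    "\<And>i. b $ i - a' $ i = (if i = j then (b $ i - a $ i) / 2 else b $ i - a $ i)"
proof -
  show t0: "0 < t" using ab[of j] by (simp add: t)
  have b': "b' $ i = (if i = j then (a $ j + b $ j) / 2 else b $ i)" for i
    by (auto simp: b'_def axis_def t field_simps)
  have a': "a' $ i = (if i = j then (a $ j + b $ j) / 2 else a $ i)" for i
    by (auto simp: a'_def axis_def t field_simps)
  show ab': "a $ i < b' $ i" "a' $ i < b $ i" for i using ab[of i] by (auto simp: a' b')
  have le: "b' $ i \<le> b $ i" "a $ i \<le> a' $ i" for i using ab[of i] by (auto simp: a' b')
  show "box a b' \<inter> box a' b = {}"
  proof (rule equals0I)
    fix x assume "x \<in> box a b' \<inter> box a' b"
    then have "x $ j < b' $ j" "a' $ j < x $ j" by (auto simp: mem_box_cart)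
    then show False by (simp add: a' b')
  qed
  show s: "box a b' \<subseteq> box a b" "box a' b \<subseteq> box a b" "cbox a b' \<subseteq> cbox a b" "cbox a' b \<subseteq> cbox a b"
    using le unfolding subset_iff mem_box_cart by (meson le_less_trans less_le_trans order_trans)+
  show neg: "negligible (box a b - (box a b' \<union> box a' b))"
  proof (rule negligible_subset)
    have "negligible {x::real^'n. x $ j = c}" for c
      using negligible_standard_hyperplane[of "axis j (1::real)" c] by (simp add: inner_axis)
    then show "negligible {x::real^'n. x $ j = (a $ j + b $ j) / 2}" .
    show "box a b - (box a b' \<union> box a' b) \<subseteq> {x. x $ j = (a $ j + b $ j) / 2}"
    proof
      fix x assume x: "x \<in> box a b - (box a b' \<union> box a' b)"
      then obtain i k where "\<not> (a $ i < x $ i \<and> x $ i < b' $ i)" "\<not> (a' $ k < x $ k \<and> x $ k < b $ k)"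
        by (auto simp: mem_box_cart)
      moreover have "a $ l < x $ l \<and> x $ l < b $ l" for l using x by (auto simp: mem_box_cart)
      ultimately show "x \<in> {x. x $ j = (a $ j + b $ j) / 2}"
        by (auto simp: a' b' split: if_splits)
    qed
  qed
  show bb: "b' + t *\<^sub>R axis j 1 = b" by (simp add: b'_def)
  have "box a' b = (+) (t *\<^sub>R axis j 1) ` box a b'"
  proof (rule set_eqI)
    fix x
    have "x \<in> (+) (t *\<^sub>R axis j 1) ` box a b' \<longleftrightarrow> x - t *\<^sub>R axis j 1 \<in> box a b'"
      by (auto simp: image_iff intro: bexI[of _ "x - t *\<^sub>R axis j 1"])
    also have "\<dots> \<longleftrightarrow> x \<in> box a' b"
      unfolding mem_box_cart a'_def b'_def by (intro iff_allI) auto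
    finally show "x \<in> box a' b \<longleftrightarrow> x \<in> (+) (t *\<^sub>R axis j 1) ` box a b'" by simp
  qed
  then have eq: "measure lebesgue (box a' b) = measure lebesgue (box a b')"
    by (simp add: measure_translation)
  have "integral\<^sup>L (lebesgue_on (box a b)) (\<lambda>x. 1::real) = integral\<^sup>L (lebesgue_on (box a b')) (\<lambda>x. 1) + integral\<^sup>L (lebesgue_on (box a' b)) (\<lambda>x. 1)"
    by (rule integral_lebesgue_on_split)
      (use s neg \<open>box a b' \<inter> box a' b = {}\<close> finite_measure.integrable_const[OF finite_measure_lebesgue_on[OF measure_box_pos(1)[OF ab]]] in auto)
  then have sum: "measure lebesgue (box a b) = measure lebesgue (box a b') + measure lebesgue (box a' b)"
    by (simp add: measure_restrict_space)
  show "measure lebesgue (box a b') = measure lebesgue (box a b) / 2" "measure lebesgue (box a' b) = measure lebesgue (box a b) / 2"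
    using sum eq by simp_all
  show "b' $ i - a $ i = (if i = j then (b $ i - a $ i) / 2 else b $ i - a $ i)"
    "b $ i - a' $ i = (if i = j then (b $ i - a $ i) / 2 else b $ i - a $ i)" for i
    by (auto simp: a' b' field_simps)
qed

primrec bisect :: "'n list \<Rightarrow> real^'n \<Rightarrow> real^'n \<Rightarrow> ((real^'n) \<times> (real^'n)) list"
  where
    "bisect [] a b = [(a, b)]"
  | "bisect (j # js) a b = bisect js a (b - ((b $ j - a $ j) / 2) *\<^sub>R axis j 1)
      @ bisect js (a + ((b $ j - a $ j) / 2) *\<^sub>R axis j 1) b"

text \<open>Halving a box in direction \<open>j\<close> moves the means by an amount proportional to
  half the current side, the \<open>t\<close> of \<open>half_means_diff\<close>. This adds up these
  amounts along one branch of the bisection; all branches have the same sides and hence the same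
  cost.\<close>

primrec bisect_cost :: "'n list \<Rightarrow> ('n \<Rightarrow> real) \<Rightarrow> real"
  where
    "bisect_cost [] s = 0"
  | "bisect_cost (j # js) s = s j / 2 + bisect_cost js (s(j := s j / 2))"

lemma bisect_boxes:
  fixes a b :: "real^'n"
  assumes "\<And>i. a $ i < b $ i" "(c, d) \<in> set (bisect js a b)"
  shows "d $ i - c $ i = (b $ i - a $ i) / 2 ^ count_list js i" "c $ i < d $ i" "box c d \<subseteq> box a b"
proof -
  have "(\<forall>i. d $ i - c $ i = (b $ i - a $ i) / 2 ^ count_list js i) \<and> box c d \<subseteq> box a b"
    using assms
  proof (induction js arbitrary: a b)
    case (Cons j js)
    note h = half_boxes[OF Cons.prems(1) refl, where j=j]
    from Cons.prems(2) consider
      "(c, d) \<in> set (bisect js a (b - ((b $ j - a $ j) / 2) *\<^sub>R axis j 1))"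
      | "(c, d) \<in> set (bisect js (a + ((b $ j - a $ j) / 2) *\<^sub>R axis j 1) b)" by auto
    then show ?case
    proof cases
      case 1
      from Cons.IH[OF h(2) this] h(5) h(13) show ?thesis by auto
    next
      case 2
      from Cons.IH[OF h(3) this] h(6) h(14) show ?thesis by auto
    qed
  qed auto
  then show "d $ i - c $ i = (b $ i - a $ i) / 2 ^ count_list js i" "box c d \<subseteq> box a b" by auto
  moreover have "0 < (b $ i - a $ i) / 2 ^ count_list js i" using assms(1)[of i] by simp
  ultimately show "c $ i < d $ i" by linarith
qed

lemma Lp_int_half_boxes:
  fixes a b :: "real^'n"
  assumes ab: "\<And>i. a $ i < b $ i" and t: "t = (b $ j - a $ j) / 2" and f: "in_Lp (lebesgue_on (box a b)) p f"
  shows "Lp_int (lebesgue_on (box a b)) p f = Lp_int (lebesgue_on (box a (b - t *\<^sub>R axis j 1))) p f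
    + Lp_int (lebesgue_on (box (a + t *\<^sub>R axis j 1) b)) p f"
  unfolding Lp_int_def
  by (rule integral_lebesgue_on_split) (use half_boxes[OF ab t] f in \<open>auto simp: in_Lp_def\<close>)

lemma bisect_Lp_int:
  fixes a b :: "real^'n"
  assumes "\<And>i. a $ i < b $ i" "in_Lp (lebesgue_on (box a b)) p f"
  shows "(\<Sum>(c, d)\<leftarrow>bisect js a b. Lp_int (lebesgue_on (box c d)) p f) = Lp_int (lebesgue_on (box a b)) p f"
  using assms
proof (induction js arbitrary: a b)
  case (Cons j js)
  note h = half_boxes[OF Cons.prems(1) refl, where j=j]
  have "in_Lp (lebesgue_on (box a (b - ((b $ j - a $ j) / 2) *\<^sub>R axis j 1))) p f"
    "in_Lp (lebesgue_on (box (a + ((b $ j - a $ j) / 2) *\<^sub>R axis j 1) b)) p f"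
    using h(5,6) by (auto intro!: in_Lp_subset(1)[OF _ _ _ Cons.prems(2)])
  then show ?case
    using Cons.IH[OF h(2)] Cons.IH[OF h(3)] Lp_int_half_boxes[OF Cons.prems(1) refl Cons.prems(2), of j] by simp
qed simp

lemma matrix_entry_le_norm:
  fixes M :: "real^'n^'m"
  shows "\<bar>M $ i $ j\<bar> \<le> norm M"
  using component_le_norm_cart[of "M $ i" j] Finite_Cartesian_Product.norm_nth_le[of M i] by linarith

text \<open>The left side is the \<open>Lp\<close> norm of the step function that corrects the mean
  over the box to the means over its halves. The tent estimate is used for each component, hence the
  factor \<open>CARD('m)\<close>. The powers of the volume coming from averaging and from Hoelder's
  inequality cancel.\<close>

lemma half_means_diff:
  fixes u :: "real^'n \<Rightarrow> real^'m" and G :: "real^'n \<Rightarrow> real^'n^'m"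
  assumes U: "open U" and uG: "has_weak_gradient U u G" and p: "1 < p"
    and G: "in_Lp (lebesgue_on (box a b)) p G" and u: "in_Lp (lebesgue_on (box a b)) p u"
    and ab: "\<And>i. a $ i < b $ i" and sub: "cbox a b \<subseteq> U" and t: "t = (b $ j - a $ j) / 2"
  defines "b' \<equiv> b - t *\<^sub>R axis j 1" and "a' \<equiv> a + t *\<^sub>R axis j 1"
  shows "(norm (mean (box a b') u - mean (box a b) u) powr p * measure lebesgue (box a b')
      + norm (mean (box a' b) u - mean (box a b) u) powr p * measure lebesgue (box a' b)) powr (1 / p)
    \<le> real CARD('m) * t * Lp_nrm (lebesgue_on (box a b)) p G"
proof -
  note h = half_boxes[OF ab t, folded a'_def b'_def]
  define v where "v = measure lebesgue (box a b')"
  have v: "0 < v" "measure lebesgue (box a' b) = v" "measure lebesgue (box a b) = 2 * v"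
    using measure_box_pos(2)[OF h(2)] h(10,11) by (auto simp: v_def)
  let ?B = "lebesgue_on (box a b)"
  note fin = finite_measure_lebesgue_on[OF measure_box_pos(1)[OF ab]]
  have iu: "integrable ?B u" by (rule in_Lp_integrable(1)[OF fin u p])
  have iG: "integrable ?B (\<lambda>x. norm (G x))" using in_Lp_integrable(1)[OF fin G p] by simp
  define X' where "X' = (\<integral>x. u x \<partial>lebesgue_on (box a b'))"
  define X'' where "X'' = (\<integral>x. u x \<partial>lebesgue_on (box a' b))"
  have X: "(\<integral>x. u x \<partial>?B) = X' + X''"
    unfolding X'_def X''_def by (rule integral_lebesgue_on_split) (use h iu in auto)
  have iu': "integrable (lebesgue_on (box c d)) u" if "box c d \<subseteq> box a b" "\<And>i. c $ i < d $ i" for c d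
    by (rule in_Lp_integrable(1)[OF finite_measure_lebesgue_on[OF measure_box_pos(1)[OF that(2)]] _ p])
      (use that u in \<open>auto intro!: in_Lp_subset(1)[OF _ _ _ u]\<close>)
  have comp: "\<bar>(X'' - X') $ i\<bar> \<le> t * (\<integral>x. norm (G x) \<partial>?B)" for i
  proof -
    have X'i: "X' $ i = (\<integral>x. u x $ i \<partial>lebesgue_on (box a b'))" "X'' $ i = (\<integral>x. u x $ i \<partial>lebesgue_on (box a' b))"
      unfolding X'_def X''_def using iu'[OF h(5) h(2)] iu'[OF h(6) h(3)]
      by (simp_all add: integral_bounded_linear[OF bounded_linear_vec_nth])
    have "\<bar>X'' $ i - X' $ i\<bar> \<le> t * (\<integral>x. \<bar>G x $ i $ j\<bar> \<partial>lebesgue_on (cbox a b))"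
      using box_tent_estimate[OF U uG h(1), where a=a and b=b' and j=j and i=i] sub unfolding h(12) X'i a'_def[symmetric] by simp
    also have "(\<integral>x. \<bar>G x $ i $ j\<bar> \<partial>lebesgue_on (cbox a b)) = (\<integral>x. \<bar>G x $ i $ j\<bar> \<partial>?B)"
    proof -
      have "(\<lambda>x. G x $ i $ j) absolutely_integrable_on cbox a b"
        using uG sub by (auto simp: has_weak_gradient_def locally_integrable_def intro!: absolutely_integrable_entry)
      then have "integrable (lebesgue_on (cbox a b)) (\<lambda>x. \<bar>G x $ i $ j\<bar>)"
        by (simp add: set_integrable_def integrable_restrict_space)
      then have "(\<integral>x. \<bar>G x $ i $ j\<bar> \<partial>lebesgue_on (cbox a b)) = (\<integral>x. \<bar>G x $ i $ j\<bar> \<partial>?B) + (\<integral>x. \<bar>G x $ i $ j\<bar> \<partial>lebesgue_on {})"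
        by (intro integral_lebesgue_on_split) (auto simp: box_subset_cbox negligible_frontier_interval)
      then show ?thesis by simp
    qed
    also have "t * \<dots> \<le> t * (\<integral>x. norm (G x) \<partial>?B)"
    proof (rule mult_left_mono[OF integral_mono])
      show "integrable ?B (\<lambda>x. \<bar>G x $ i $ j\<bar>)"
        using in_Lp_integrable(1)[OF fin G p]
        by (intro integrable_abs integrable_bounded_linear[OF bounded_linear_vec_nth] )
    qed (use iG h(1) in \<open>auto intro: matrix_entry_le_norm\<close>)
    finally show ?thesis by simp
  qed
  have "norm (X'' - X') \<le> (\<Sum>i\<in>UNIV. \<bar>(X'' - X') $ i\<bar>)" by (rule norm_le_l1_cart)
  also have "\<dots> \<le> (\<Sum>i\<in>(UNIV::'m set). t * (\<integral>x. norm (G x) \<partial>?B))" by (intro sum_mono comp)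
  also have "\<dots> = real CARD('m) * t * (\<integral>x. norm (G x) \<partial>?B)" by simp
  also have "\<dots> \<le> real CARD('m) * t * (Lp_nrm ?B p G * (2 * v) powr (1 - 1 / p))"
    using in_Lp_integrable(2)[OF fin G p] h(1)
    by (intro mult_left_mono) (auto simp: v(3) measure_restrict_space)
  finally have XX: "norm (X'' - X') \<le> real CARD('m) * t * Lp_nrm ?B p G * (2 * v) powr (1 - 1 / p)" by simp
  have m: "mean (box a b) u = (1 / (2 * v)) *\<^sub>R (X' + X'')" "mean (box a b') u = (1 / v) *\<^sub>R X'" "mean (box a' b) u = (1 / v) *\<^sub>R X''"
    by (simp_all add: mean_def X v X'_def X''_def flip: v_def)
  have "mean (box a b') u - mean (box a b) u = (1 / (2 * v)) *\<^sub>R (X' - X'')"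
    "mean (box a' b) u - mean (box a b) u = (1 / (2 * v)) *\<^sub>R (X'' - X')"
    unfolding m using v(1) by (simp_all add: vec_eq_iff field_simps)
  then have n: "norm (mean (box a b') u - mean (box a b) u) = norm (X'' - X') / (2 * v)"
    "norm (mean (box a' b) u - mean (box a b) u) = norm (X'' - X') / (2 * v)"
    using v(1) by (simp_all add: norm_minus_commute)
  have "(norm (mean (box a b') u - mean (box a b) u) powr p * measure lebesgue (box a b')
      + norm (mean (box a' b) u - mean (box a b) u) powr p * measure lebesgue (box a' b)) powr (1 / p)
    = ((norm (X'' - X') / (2 * v)) powr p * (2 * v)) powr (1 / p)"
    unfolding n v(2) v_def[symmetric] by (simp add: algebra_simps)
  also have "\<dots> = (norm (X'' - X') / (2 * v)) * (2 * v) powr (1 / p)"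
    using v(1) p by (simp add: powr_mult powr_powr)
  also have "\<dots> \<le> (real CARD('m) * t * Lp_nrm ?B p G * (2 * v) powr (1 - 1 / p) / (2 * v)) * (2 * v) powr (1 / p)"
    using XX v(1) by (intro mult_right_mono divide_right_mono) auto
  also have "\<dots> = real CARD('m) * t * Lp_nrm ?B p G * ((2 * v) powr (1 - 1 / p) * (2 * v) powr (1 / p) / (2 * v))"
    by simp
  also have "(2 * v) powr (1 - 1 / p) * (2 * v) powr (1 / p) / (2 * v) = 1"
    using v(1) by (simp flip: powr_add)
  finally show ?thesis by simp
qed

text \<open>Minkowski's inequality over the pair of halves is decisive: the gradient norms over the
  halves recombine to the norm over the whole box, so the constants of successive levels add up
  instead of multiplying.\<close>

lemma bisect_osc:
  fixes u :: "real^'n \<Rightarrow> real^'m" and G :: "real^'n \<Rightarrow> real^'n^'m"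
  assumes U: "open U" and uG: "has_weak_gradient U u G" and p: "1 < p"
    and "in_Lp (lebesgue_on (box a b)) p G" "in_Lp (lebesgue_on (box a b)) p u"
    and "\<And>i. a $ i < b $ i" "cbox a b \<subseteq> U"
  shows "Lp_nrm (lebesgue_on (box a b)) p (\<lambda>x. u x - mean (box a b) u)
    \<le> (\<Sum>(c, d)\<leftarrow>bisect js a b. Lp_int (lebesgue_on (box c d)) p (\<lambda>x. u x - mean (box c d) u)) powr (1 / p)
      + real CARD('m) * bisect_cost js (\<lambda>i. b $ i - a $ i) * Lp_nrm (lebesgue_on (box a b)) p G"
  using assms(4-)
proof (induction js arbitrary: a b)
  case Nil
  then show ?case by (simp add: Lp_nrm_def)
next
  case (Cons j js)
  define t where "t = (b $ j - a $ j) / 2"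
  define b' where "b' = b - t *\<^sub>R axis j 1"
  define a' where "a' = a + t *\<^sub>R axis j 1"
  note G = Cons.prems(1) and u = Cons.prems(2) and ab = Cons.prems(3) and sub = Cons.prems(4)
  note h = half_boxes[OF ab t_def, folded a'_def b'_def]
  let ?s = "\<lambda>i. b $ i - a $ i"
  let ?s' = "?s(j := ?s j / 2)"
  define c where "c = real CARD('m) * bisect_cost js ?s'"
  have s': "(\<lambda>i. b' $ i - a $ i) = ?s'" "(\<lambda>i. b $ i - a' $ i) = ?s'" using h(13,14) by auto
  have p0: "0 < p" "0 \<le> p" "1 \<le> p" using p by auto
  define S where "S a b = (\<Sum>(c, d)\<leftarrow>bisect js a b. Lp_int (lebesgue_on (box c d)) p (\<lambda>x. u x - mean (box c d) u))" for a b
  have S0: "0 \<le> S a b" for a b unfolding S_def by (rule sum_list_nonneg) (auto simp: Lp_int_nonneg)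
  have half: "Lp_nrm (lebesgue_on (box c1 c2)) p (\<lambda>x. u x - mean (box a b) u)
      \<le> (S c1 c2 powr (1 / p) + c * Lp_nrm (lebesgue_on (box c1 c2)) p G)
        + (norm (mean (box c1 c2) u - mean (box a b) u) powr p * measure lebesgue (box c1 c2)) powr (1 / p)"
    if cc: "\<And>i. c1 $ i < c2 $ i" "box c1 c2 \<subseteq> box a b" "cbox c1 c2 \<subseteq> cbox a b" and s: "(\<lambda>i. c2 $ i - c1 $ i) = ?s'" for c1 c2
  proof -
    let ?M = "lebesgue_on (box c1 c2)"
    note fin = finite_measure_lebesgue_on[OF measure_box_pos(1)[OF cc(1)]]
    have L: "in_Lp ?M p G" "in_Lp ?M p u" using cc(2) by (auto intro!: in_Lp_subset(1)[OF _ _ _ G] in_Lp_subset(1)[OF _ _ _ u])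
    have "Lp_nrm ?M p (\<lambda>x. u x - mean (box c1 c2) u) \<le> S c1 c2 powr (1 / p) + c * Lp_nrm ?M p G"
      using Cons.IH[OF L cc(1)] cc(3) sub unfolding s S_def c_def by simp
    moreover have "Lp_nrm ?M p (\<lambda>x. (u x - mean (box c1 c2) u) + (mean (box c1 c2) u - mean (box a b) u))
      \<le> Lp_nrm ?M p (\<lambda>x. u x - mean (box c1 c2) u) + Lp_nrm ?M p (\<lambda>x. mean (box c1 c2) u - mean (box a b) u)"
      by (rule Lp_nrm_triangle[OF in_Lp_diff(1)[OF L(2) in_Lp_const(1)[OF fin] p0(2)] in_Lp_const(1)[OF fin] p0(3)])
    moreover have "Lp_nrm ?M p (\<lambda>x. mean (box c1 c2) u - mean (box a b) u)
      = (norm (mean (box c1 c2) u - mean (box a b) u) powr p * measure lebesgue (box c1 c2)) powr (1 / p)"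
      by (simp add: Lp_nrm_def in_Lp_const(2)[OF fin] measure_restrict_space)
    ultimately show ?thesis by simp
  qed
  define x' where "x' = S a b' powr (1 / p)"
  define x'' where "x'' = S a' b powr (1 / p)"
  define g' where "g' = Lp_nrm (lebesgue_on (box a b')) p G"
  define g'' where "g'' = Lp_nrm (lebesgue_on (box a' b)) p G"
  define d' where "d' = (norm (mean (box a b') u - mean (box a b) u) powr p * measure lebesgue (box a b')) powr (1 / p)"
  define d'' where "d'' = (norm (mean (box a' b) u - mean (box a b) u) powr p * measure lebesgue (box a' b)) powr (1 / p)"
  have c0: "0 \<le> c"
  proof -
    have "0 \<le> bisect_cost js s" if "\<And>i. 0 \<le> s i" for s
      using that by (induction js arbitrary: s) auto
    then show ?thesis using ab by (simp add: c_def less_imp_le)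
  qed
  have nn: "0 \<le> x'" "0 \<le> x''" "0 \<le> g'" "0 \<le> g''" "0 \<le> d'" "0 \<le> d''"
    by (auto simp: x'_def x''_def g'_def g''_def d'_def d''_def Lp_nrm_nonneg)
  have uLp: "in_Lp (lebesgue_on (box a b)) p (\<lambda>x. u x - mean (box a b) u)"
    by (rule in_Lp_diff(1)[OF u in_Lp_const(1)[OF finite_measure_lebesgue_on[OF measure_box_pos(1)[OF ab]]] p0(2)])
  have "Lp_nrm (lebesgue_on (box a b)) p (\<lambda>x. u x - mean (box a b) u)
     = (Lp_nrm (lebesgue_on (box a b')) p (\<lambda>x. u x - mean (box a b) u) powr p
       + Lp_nrm (lebesgue_on (box a' b)) p (\<lambda>x. u x - mean (box a b) u) powr p) powr (1 / p)"
    unfolding Lp_nrm_powr[OF p0(1)] using Lp_int_half_boxes[OF ab t_def uLp] by (simp add: Lp_nrm_def a'_def b'_def)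
  also have "\<dots> \<le> ((x' + c * g' + d') powr p + (x'' + c * g'' + d'') powr p) powr (1 / p)"
    using half[OF h(2) h(5,7) s'(1)] half[OF h(3) h(6,8) s'(2)] p0
    by (intro powr_mono2 add_mono) (auto simp: x'_def x''_def g'_def g''_def d'_def d''_def Lp_nrm_nonneg)
  \<comment> \<open>The correction of the means at this level is split off first; the next
    application separates the leaves from the cost of the deeper levels.\<close>
  also have "\<dots> \<le> ((x' + c * g') powr p + (x'' + c * g'') powr p) powr (1 / p) + (d' powr p + d'' powr p) powr (1 / p)"
    using nn c0 p0 by (intro minkowski2) auto
  also have "\<dots> \<le> ((x' powr p + x'' powr p) powr (1 / p) + ((c * g') powr p + (c * g'') powr p) powr (1 / p)) + (d' powr p + d'' powr p) powr (1 / p)"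
    using nn c0 p0 by (intro add_right_mono minkowski2) auto
  also have "x' powr p + x'' powr p = S a b' + S a' b"
    using S0 p0 by (simp add: x'_def x''_def powr_powr)
  also have "((c * g') powr p + (c * g'') powr p) powr (1 / p) = c * Lp_nrm (lebesgue_on (box a b)) p G"
  proof -
    have "(c * g') powr p + (c * g'') powr p = c powr p * (g' powr p + g'' powr p)"
      using c0 nn by (simp add: powr_mult distrib_left)
    also have "g' powr p + g'' powr p = Lp_int (lebesgue_on (box a b)) p G"
      using Lp_int_half_boxes[OF ab t_def G] by (simp add: g'_def g''_def Lp_nrm_powr[OF p0(1)] a'_def b'_def)
    finally show ?thesis using c0 p0 Lp_int_nonneg[of "lebesgue_on (box a b)" p G] by (simp add: powr_mult powr_powr Lp_nrm_def)
  qed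
  also have "(d' powr p + d'' powr p) powr (1 / p) \<le> real CARD('m) * t * Lp_nrm (lebesgue_on (box a b)) p G"
    using half_means_diff[OF U uG p G u ab sub t_def] p0
    by (simp add: d'_def d''_def powr_powr flip: a'_def b'_def)
  finally have "Lp_nrm (lebesgue_on (box a b)) p (\<lambda>x. u x - mean (box a b) u)
     \<le> (S a b' + S a' b) powr (1 / p) + (c + real CARD('m) * t) * Lp_nrm (lebesgue_on (box a b)) p G"
    by (simp add: algebra_simps)
  moreover have "c + real CARD('m) * t = real CARD('m) * bisect_cost (j # js) ?s"
    by (simp add: c_def t_def distrib_left add.commute)
  moreover have "(\<Sum>(c, d)\<leftarrow>bisect (j # js) a b. Lp_int (lebesgue_on (box c d)) p (\<lambda>x. u x - mean (box c d) u)) = S a b' + S a' b"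
    by (simp add: S_def t_def a'_def b'_def)
  ultimately show ?case by simp
qed

primrec halve :: "'n list \<Rightarrow> ('n \<Rightarrow> real) \<Rightarrow> 'n \<Rightarrow> real"
  where
    "halve [] s = s"
  | "halve (j # js) s = halve js (s(j := s j / 2))"

lemma bisect_cost_append: "bisect_cost (xs @ ys) s = bisect_cost xs s + bisect_cost ys (halve xs s)"
  by (induction xs arbitrary: s) auto

lemma halve_eq: "halve js s i = s i / 2 ^ count_list js i"
  by (induction js arbitrary: s) auto

lemma bisect_cost_le: "(\<And>i. 0 \<le> s i \<and> s i \<le> h) \<Longrightarrow> bisect_cost js s \<le> length js * (h / 2)"
proof (induction js arbitrary: s)
  case (Cons j js)
  have "bisect_cost js (s(j := s j / 2)) \<le> length js * (h / 2)"
    using Cons.prems by (intro Cons.IH) (smt (verit) fun_upd_apply field_sum_of_halves)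
  then show ?case using Cons.prems[of j] by (simp add: distrib_right)
qed auto

lemma count_list_distinct: "distinct xs \<Longrightarrow> x \<in> set xs \<Longrightarrow> count_list xs x = 1"
  by (induction xs) (auto simp: count_list_0_iff)

text \<open>A geometric series: one round through all directions costs at most
  \<open>CARD('n) * (h / 2)\<close> and halves every side, so the total stays bounded independently
  of the number \<open>k\<close> of rounds.\<close>

lemma bisect_cost_cycles:
  fixes dirs :: "'n::finite list"
  assumes d: "distinct dirs" "set dirs = UNIV"
  shows "(\<And>i. 0 \<le> s i \<and> s i \<le> h) \<Longrightarrow> bisect_cost (concat (replicate k dirs)) s \<le> real CARD('n) * h"
proof (induction k arbitrary: s h)
  case 0
  have "0 \<le> h" using 0[of undefined] by linarith
  then show ?case by simp
next
  case (Suc k)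
  have len: "length dirs = CARD('n)" using distinct_card[OF d(1)] d(2) by simp
  have hv: "halve dirs s i = s i / 2" for i
    using d count_list_distinct[of dirs i] by (simp add: halve_eq)
  have "bisect_cost (concat (replicate k dirs)) (halve dirs s) \<le> real CARD('n) * (h / 2)"
    by (rule Suc.IH) (unfold hv, use Suc.prems in auto)
  moreover have "bisect_cost dirs s \<le> real CARD('n) * (h / 2)"
    using bisect_cost_le[of s h dirs] Suc.prems len by simp
  ultimately show ?case by (simp add: bisect_cost_append)
qed

text \<open>The total cost does not depend on the depth of the bisection, so the box is bisected
  until the oscillations over the leaves contribute at most \<open>e\<close>; then \<open>e\<close>
  tends to 0.\<close>

theorem Poincare_box:
  fixes u :: "real^'n \<Rightarrow> real^'m" and G :: "real^'n \<Rightarrow> real^'n^'m"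
  assumes U: "open U" and uG: "has_weak_gradient U u G" and p: "1 < p"
    and G: "in_Lp (lebesgue_on (box a b)) p G" and u: "in_Lp (lebesgue_on (box a b)) p u"
    and ab: "\<And>i. a $ i < b $ i" and h: "\<And>i. b $ i - a $ i \<le> h" and sub: "cbox a b \<subseteq> U"
  shows "Lp_nrm (lebesgue_on (box a b)) p (\<lambda>x. u x - mean (box a b) u)
    \<le> real CARD('m) * real CARD('n) * h * Lp_nrm (lebesgue_on (box a b)) p G"
proof (rule field_le_epsilon)
  fix e :: real assume e: "0 < e"
  let ?B = "lebesgue_on (box a b)"
  have p0: "0 < p" using p by simp
  have ep: "0 < e powr p" using e by simp
  obtain d where d: "0 < d" "osc_fine (box a b) p u d (e powr p)"
    by (rule osc_fine_exists[OF measure_box_pos(1)[OF ab] bounded_box u p ep])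
  obtain dirs :: "'n list" where dirs: "distinct dirs" "set dirs = UNIV" using finite_distinct_list[of "UNIV :: 'n set"] by auto
  \<comment> \<open>After \<open>k\<close> rounds the sides are at most \<open>h / 2 ^ k\<close>, so
    the sum of the \<open>CARD('n)\<close> sides, which bounds the diameter of a leaf, is below
    \<open>d\<close>.\<close>
  obtain k where k: "real CARD('n) * h / d < 2 ^ k" using real_arch_pow[of 2 "real CARD('n) * h / d"] by auto
  define js where "js = concat (replicate k dirs)"
  have cnt: "count_list js i = k" for i
    using dirs count_list_distinct[of dirs i] unfolding js_def by (induction k) auto
  define L where "L = bisect js a b"
  define S where "S i = box (fst (L ! i)) (snd (L ! i))" for i
  have mem: "(fst (L ! i), snd (L ! i)) \<in> set (bisect js a b)" if "i < length L" for i
    using that unfolding L_def by simp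
  have sumL: "(\<Sum>(c, d)\<leftarrow>L. F (box c d)) = (\<Sum>i\<in>{..<length L}. F (S i))" for F :: "(real^'n) set \<Rightarrow> real"
    by (simp add: sum_list_sum_nth S_def case_prod_beta lessThan_atLeast0)
  have "(\<Sum>i\<in>{..<length L}. Lp_int (lebesgue_on (S i)) p (\<lambda>x. u x - mean (S i) u)) \<le> e powr p"
  proof (rule d(2)[unfolded osc_fine_def, rule_format], intro conjI ballI allI impI)
    show "finite {..<length L}" by simp
  next
    fix i assume "i \<in> {..<length L}"
    then have i: "i < length L" by simp
    note B = bisect_boxes[OF ab mem[OF i]]
    show "S i \<in> lmeasurable" "0 < measure lebesgue (S i)" "S i \<subseteq> box a b"
      using measure_box_pos[OF B(2)] B(3) by (auto simp: S_def)
    fix x y assume "x \<in> S i" "y \<in> S i"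
    have "dist x y \<le> (\<Sum>l\<in>UNIV. \<bar>(x - y) $ l\<bar>)" unfolding dist_norm by (rule norm_le_l1_cart)
    also have "\<dots> \<le> (\<Sum>l\<in>(UNIV::'n set). h / 2 ^ k)"
    proof (rule sum_mono)
      fix l
      have "fst (L ! i) $ l < x $ l" "x $ l < snd (L ! i) $ l" "fst (L ! i) $ l < y $ l" "y $ l < snd (L ! i) $ l"
        using \<open>x \<in> S i\<close> \<open>y \<in> S i\<close> by (auto simp: S_def mem_box_cart)
      then have "\<bar>(x - y) $ l\<bar> \<le> snd (L ! i) $ l - fst (L ! i) $ l" by simp
      also have "\<dots> = (b $ l - a $ l) / 2 ^ k" using B(1)[of l] cnt by simp
      also have "\<dots> \<le> h / 2 ^ k" using h[of l] by (simp add: divide_right_mono)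
      finally show "\<bar>(x - y) $ l\<bar> \<le> h / 2 ^ k" .
    qed
    also have "\<dots> \<le> d" using k d(1) by (simp add: field_simps)
    finally show "dist x y \<le> d" .
  next
    fix g :: "real^'n \<Rightarrow> real^'m" assume "in_Lp ?B p g"
    then show "(\<Sum>i\<in>{..<length L}. Lp_int (lebesgue_on (S i)) p g) \<le> Lp_int ?B p g"
      using bisect_Lp_int[OF ab, of p g js] sumL[of "\<lambda>A. Lp_int (lebesgue_on A) p g"] unfolding L_def by simp
  qed
  then have "(\<Sum>(c, d)\<leftarrow>bisect js a b. Lp_int (lebesgue_on (box c d)) p (\<lambda>x. u x - mean (box c d) u)) \<le> e powr p"
    using sumL[of "\<lambda>A. Lp_int (lebesgue_on A) p (\<lambda>x. u x - mean A u)"] unfolding L_def by simp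
  then have "(\<Sum>(c, d)\<leftarrow>bisect js a b. Lp_int (lebesgue_on (box c d)) p (\<lambda>x. u x - mean (box c d) u)) powr (1 / p) \<le> (e powr p) powr (1 / p)"
    using p0 by (intro powr_mono2 sum_list_nonneg) (auto simp: Lp_int_nonneg)
  also have "\<dots> = e" using e p0 by (simp add: powr_powr)
  finally have 1: "(\<Sum>(c, d)\<leftarrow>bisect js a b. Lp_int (lebesgue_on (box c d)) p (\<lambda>x. u x - mean (box c d) u)) powr (1 / p) \<le> e" .
  have 2: "bisect_cost js (\<lambda>i. b $ i - a $ i) \<le> real CARD('n) * h"
    unfolding js_def by (rule bisect_cost_cycles[OF dirs]) (use ab h in \<open>auto intro: less_imp_le\<close>)
  have 3: "real CARD('m) * bisect_cost js (\<lambda>i. b $ i - a $ i) * Lp_nrm ?B p G \<le> real CARD('m) * (real CARD('n) * h) * Lp_nrm ?B p G"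
    by (intro mult_right_mono mult_left_mono 2) (auto simp: Lp_nrm_nonneg)
  have "Lp_nrm ?B p (\<lambda>x. u x - mean (box a b) u) \<le> e + real CARD('m) * (real CARD('n) * h) * Lp_nrm ?B p G"
    using bisect_osc[OF U uG p G u ab sub, of js] 1 3 by linarith
  then show "Lp_nrm ?B p (\<lambda>x. u x - mean (box a b) u) \<le> real CARD('m) * real CARD('n) * h * Lp_nrm ?B p G + e"
    by (simp add: mult.assoc)
qed

section \<open>Weak convergence\<close>

lemma W1_D:
  assumes "open U" "1 < p" "u \<in> W1 (ennreal p) U"
  shows "in_Lp (lebesgue_on U) p u" "has_weak_gradient U u (weak_gradient U u)"
    "in_Lp (lebesgue_on U) p (weak_gradient U u)"
  using assms by (auto simp: W1_iff)

lemma W1_lincomb: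
  assumes U: "open U" and p: "1 < p" and u: "u \<in> W1 (ennreal p) U" and v: "v \<in> W1 (ennreal p) U"
  shows "(\<lambda>x. a *\<^sub>R u x + b *\<^sub>R v x) \<in> W1 (ennreal p) U"
    and "AE x in lebesgue_on U. weak_gradient U (\<lambda>x. a *\<^sub>R u x + b *\<^sub>R v x) x = a *\<^sub>R weak_gradient U u x + b *\<^sub>R weak_gradient U v x"
    and "Lp_int (lebesgue_on U) p (weak_gradient U (\<lambda>x. a *\<^sub>R u x + b *\<^sub>R v x)) = Lp_int (lebesgue_on U) p (\<lambda>x. a *\<^sub>R weak_gradient U u x + b *\<^sub>R weak_gradient U v x)"
proof -
  note d = W1_D[OF U p u] W1_D[OF U p v]
  have "in_Lp (lebesgue_on U) p (\<lambda>x. a *\<^sub>R u x + b *\<^sub>R v x)"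
    "in_Lp (lebesgue_on U) p (\<lambda>x. a *\<^sub>R weak_gradient U u x + b *\<^sub>R weak_gradient U v x)"
    using p by (intro in_Lp_add in_Lp_scaleR d; simp)+
  moreover have "has_weak_gradient U (\<lambda>x. a *\<^sub>R u x + b *\<^sub>R v x) (\<lambda>x. a *\<^sub>R weak_gradient U u x + b *\<^sub>R weak_gradient U v x)"
    by (intro has_weak_gradient_add has_weak_gradient_scaleR U d)
  ultimately show "(\<lambda>x. a *\<^sub>R u x + b *\<^sub>R v x) \<in> W1 (ennreal p) U"
    "AE x in lebesgue_on U. weak_gradient U (\<lambda>x. a *\<^sub>R u x + b *\<^sub>R v x) x = a *\<^sub>R weak_gradient U u x + b *\<^sub>R weak_gradient U v x"
    "Lp_int (lebesgue_on U) p (weak_gradient U (\<lambda>x. a *\<^sub>R u x + b *\<^sub>R v x)) = Lp_int (lebesgue_on U) p (\<lambda>x. a *\<^sub>R weak_gradient U u x + b *\<^sub>R weak_gradient U v x)"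
    by (rule W1_intro[OF U p])+
qed

lemma W1_norm_eq: "W1_norm p U w = Lp_nrm (lebesgue_on U) p w + Lp_nrm (lebesgue_on U) p (weak_gradient U w)"
  by (simp add: W1_norm_def Lp_norm_eq)

text \<open>The equality case of Hoelder's inequality: \<phi> is \<open>G\<close> weighted by
  \<open>norm (G x) powr (p - 2)\<close> and normalised. Its q-th power is a multiple of the p-th
  power of \<open>G\<close> because \<open>(p - 1) * q = p\<close>.\<close>

lemma Lp_dual_element:
  fixes G :: "'a \<Rightarrow> 'b::euclidean_space"
  assumes G: "in_Lp M p G" and N: "0 < Lp_nrm M p G" and pq: "1 < p" "1 < q" "1 / p + 1 / q = 1"
  obtains \<phi> where "in_Lp M q \<phi>" "Lp_nrm M q \<phi> = 1" "(\<integral>x. G x \<bullet> \<phi> x \<partial>M) = Lp_nrm M p G"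
proof
  let ?N = "Lp_nrm M p G"
  define \<phi> where "\<phi> x = (norm (G x) powr (p - 2) / ?N powr (p - 1)) *\<^sub>R G x" for x
  have [measurable]: "G \<in> borel_measurable M" using G by (simp add: in_Lp_def)
  have \<phi>m[measurable]: "\<phi> \<in> borel_measurable M" unfolding \<phi>_def by measurable
  have npow: "norm (G x) powr (p - 2) * norm (G x) = norm (G x) powr (p - 1)" for x
    by (cases "G x = 0") (use pq in \<open>simp_all add: powr_mult_base[symmetric] mult.commute[of _ "norm _"] powr_mult_base\<close>)
  have qp: "(p - 1) * q = p" using pq by (simp add: field_simps)
  have nq: "norm (\<phi> x) powr q = norm (G x) powr p / ?N powr p" for x
  proof -
    have "norm (\<phi> x) = norm (G x) powr (p - 1) / ?N powr (p - 1)"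
      by (simp add: \<phi>_def npow)
    then show ?thesis by (simp add: powr_divide powr_powr qp)
  qed
  have i: "integrable M (\<lambda>x. norm (G x) powr p)" using G by (simp add: in_Lp_def)
  show "in_Lp M q \<phi>" unfolding in_Lp_def nq using i by simp
  have "Lp_int M q \<phi> = Lp_int M p G / ?N powr p" unfolding Lp_int_def nq by simp
  also have "\<dots> = 1"
  proof -
    have "Lp_int M p G = ?N powr p" "?N powr p \<noteq> 0" using Lp_nrm_powr[of p M G] pq N by auto
    then show ?thesis by simp
  qed
  finally show "Lp_nrm M q \<phi> = 1" by (simp add: Lp_nrm_def)
  have "G x \<bullet> \<phi> x = norm (G x) powr p / ?N powr (p - 1)" for x
  proof -
    have "G x \<bullet> \<phi> x = norm (G x) powr (p - 2) * norm (G x) * norm (G x) / ?N powr (p - 1)"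
      by (simp add: \<phi>_def dot_square_norm power2_eq_square)
    also have "norm (G x) powr (p - 2) * norm (G x) * norm (G x) = norm (G x) powr p"
      unfolding npow by (cases "G x = 0") (use pq in \<open>simp_all add: powr_mult_base mult.commute[of _ "norm _"]\<close>)
    finally show ?thesis .
  qed
  then have "(\<integral>x. G x \<bullet> \<phi> x \<partial>M) = Lp_int M p G / ?N powr (p - 1)" by (simp add: Lp_int_def)
  also have "\<dots> = ?N powr p / ?N powr (p - 1)" using Lp_nrm_powr[of p M G] pq by simp
  also have "\<dots> = ?N" using N by (simp flip: powr_diff)
  finally show "(\<integral>x. G x \<bullet> \<phi> x \<partial>M) = ?N" .
qed

primrec hump :: "(nat \<Rightarrow> 'x \<Rightarrow> real) \<Rightarrow> (nat \<Rightarrow> 'x) \<Rightarrow> nat \<Rightarrow> 'x \<Rightarrow> real"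
  where
    "hump l z 0 w = 0"
  | "hump l z (Suc k) w = hump l z k w + (if hump l z k (z k) \<ge> 0 then 1 else - 1) * ((1/3) ^ k * l k w)"

text \<open>Sokal's elementary proof of the uniform boundedness principle: the signs in \<open>hump\<close> are chosen so that the
  terms added up to stage \<open>k\<close> do not cancel at \<open>z k\<close>, and the remaining tail is too small to do so.\<close>

lemma gliding_hump:
  fixes l :: "nat \<Rightarrow> 'x \<Rightarrow> real"
  assumes l: "\<And>k w. w \<in> X \<Longrightarrow> \<bar>l k w\<bar> \<le> N w" and z: "\<And>k. z k \<in> X" "\<And>k. l k (z k) = N (z k)"
  obtains \<epsilon> where "\<And>k. \<bar>\<epsilon> k\<bar> = (1/3 :: real) ^ k" "\<And>w. w \<in> X \<Longrightarrow> summable (\<lambda>k. \<epsilon> k * l k w)"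
    "\<And>w. w \<in> X \<Longrightarrow> \<bar>\<Sum>k. \<epsilon> k * l k w\<bar> \<le> 3 / 2 * N w"
    "\<And>k'. \<bar>\<Sum>k. \<epsilon> k * l k (z k')\<bar> \<ge> (1/3) ^ k' / 2 * N (z k')"
proof -
  define \<epsilon> where "\<epsilon> k = (if hump l z k (z k) \<ge> 0 then 1 else - 1) * (1/3 :: real) ^ k" for k
  have e: "\<bar>\<epsilon> k\<bar> = (1/3) ^ k" for k by (simp add: \<epsilon>_def)
  have N0: "0 \<le> N w" if "w \<in> X" for w using l[OF that, of 0] by linarith
  have b: "\<bar>\<epsilon> k * l k w\<bar> \<le> (1/3) ^ k * N w" if "w \<in> X" for k w
    unfolding abs_mult e using l[OF that] by (intro mult_left_mono) auto
  have gs: "summable (\<lambda>k. (1/3::real) ^ k * c)" for c by (intro summable_mult2 summable_geometric) auto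
  have s: "summable (\<lambda>k. \<epsilon> k * l k w)" if "w \<in> X" for w
    by (rule summable_comparison_test'[OF gs[of "N w"]]) (use b[OF that] in auto)
  have tail: "\<bar>\<Sum>k. \<epsilon> (k + m) * l (k + m) w\<bar> \<le> (1/3) ^ m * (3/2) * N w" if w: "w \<in> X" for w m
  proof -
    have gm: "summable (\<lambda>k. (1/3::real) ^ k * ((1/3) ^ m * N w))" by (rule gs)
    have bm: "\<bar>\<epsilon> (k + m) * l (k + m) w\<bar> \<le> (1/3) ^ k * ((1/3) ^ m * N w)" for k
      using b[OF w, of "k + m"] by (simp add: power_add mult.assoc)
    have sm: "summable (\<lambda>k. \<bar>\<epsilon> (k + m) * l (k + m) w\<bar>)"
      by (rule summable_comparison_test'[OF gm]) (use bm in auto)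
    have "\<bar>\<Sum>k. \<epsilon> (k + m) * l (k + m) w\<bar> \<le> (\<Sum>k. \<bar>\<epsilon> (k + m) * l (k + m) w\<bar>)" by (rule summable_rabs[OF sm])
    also have "\<dots> \<le> (\<Sum>k. (1/3::real) ^ k * ((1/3) ^ m * N w))" by (rule suminf_le[OF bm sm gm])
    also have "\<dots> = (3/2) * ((1/3) ^ m * N w)"
      using suminf_mult2[of "\<lambda>k. (1/3::real) ^ k" "(1/3) ^ m * N w"] suminf_geometric[of "1/3::real"] summable_geometric[of "1/3::real"] by simp
    finally show ?thesis by (simp add: mult_ac)
  qed
  have hump_eq: "hump l z m w = (\<Sum>k<m. \<epsilon> k * l k w)" for m w
    by (induction m) (auto simp: \<epsilon>_def)
  show ?thesis
  proof (rule that[OF e s])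
    show "\<bar>\<Sum>k. \<epsilon> k * l k w\<bar> \<le> 3 / 2 * N w" if "w \<in> X" for w using tail[OF that, of 0] by simp
    show "\<bar>\<Sum>k. \<epsilon> k * l k (z k')\<bar> \<ge> (1/3) ^ k' / 2 * N (z k')" for k'
    proof -
      let ?z = "z k'"
      have "(\<Sum>k. \<epsilon> k * l k ?z) = (\<Sum>k. \<epsilon> (k + Suc k') * l (k + Suc k') ?z) + (\<Sum>k<Suc k'. \<epsilon> k * l k ?z)"
        using suminf_split_initial_segment[OF s[OF z(1)[of k']], of "Suc k'"] by simp
      also have "(\<Sum>k<Suc k'. \<epsilon> k * l k ?z) = hump l z (Suc k') ?z" by (simp only: hump_eq)
      finally have eq: "(\<Sum>k. \<epsilon> k * l k ?z) = (\<Sum>k. \<epsilon> (k + Suc k') * l (k + Suc k') ?z) + hump l z (Suc k') ?z" .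
      have "\<bar>hump l z (Suc k') ?z\<bar> \<ge> (1/3) ^ k' * N ?z"
      proof -
        define r where "r = (1/3) ^ k' * N ?z"
        have "0 \<le> r" using N0[OF z(1)[of k']] by (simp add: r_def)
        moreover have "hump l z (Suc k') ?z = hump l z k' ?z + (if hump l z k' ?z \<ge> 0 then 1 else - 1) * r"
          by (simp add: z(2) r_def)
        ultimately show ?thesis unfolding r_def[symmetric] by (cases "hump l z k' ?z \<ge> 0") auto
      qed
      \<comment> \<open>This is where the ratio \<open>1/3\<close> comes from: the tail past
        \<open>k'\<close> is at most half of the term at \<open>k'\<close>.\<close>
      moreover have "\<bar>\<Sum>k. \<epsilon> (k + Suc k') * l (k + Suc k') ?z\<bar> \<le> ((1/3) ^ k' * N ?z) / 2"
        using tail[OF z(1)[of k'], of "Suc k'"] by simp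
      ultimately have "\<bar>(\<Sum>k. \<epsilon> (k + Suc k') * l (k + Suc k') ?z) + hump l z (Suc k') ?z\<bar> \<ge> ((1/3) ^ k' * N ?z) / 2"
        by linarith
      then show ?thesis unfolding eq by simp
    qed
  qed
qed

text \<open>Uniform boundedness made concrete: along a subsequence with rapidly growing gradient
  norms, the norming functionals of its members are superposed to one bounded functional
  \<open>L\<close> that is unbounded on the sequence, although \<open>L (u n)\<close> converges.
  Only gradients are paired, hence the bound concerns gradients.\<close>

lemma W1_weakly_bounded:
  fixes u :: "nat \<Rightarrow> real^'n \<Rightarrow> real^'m"
  assumes U: "open U" and p: "1 < p" and w: "W1_weakly_converges p U u v"
  obtains M where "\<And>n. Lp_nrm (lebesgue_on U) p (weak_gradient U (u n)) \<le> M"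
proof (rule ccontr)
  let ?M = "lebesgue_on U"
  define q where "q = p / (p - 1)"
  have q: "1 < q" "1 / p + 1 / q = 1" using p by (auto simp: q_def field_simps)
  assume "\<not> thesis"
  \<comment> \<open>Growth \<open>4 ^ k\<close> outweighs the coefficients \<open>(1/3) ^ k\<close>
    of the superposition and leaves \<open>(4/3) ^ k\<close>.\<close>
  then have "\<not> (\<forall>n. Lp_nrm ?M p (weak_gradient U (u n)) \<le> 4 ^ k)" for k using that by blast
  then have "\<forall>k. \<exists>n. 4 ^ k < Lp_nrm ?M p (weak_gradient U (u n))" by (meson linorder_not_le)
  then obtain \<nu> where \<nu>: "\<And>k. 4 ^ k < Lp_nrm ?M p (weak_gradient U (u (\<nu> k)))" by metis
  define z where "z k = u (\<nu> k)" for k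
  define X where "X = (W1 (ennreal p) U :: (real^'n \<Rightarrow> real^'m) set)"
  define N where "N w = Lp_nrm ?M p (weak_gradient U w)" for w :: "real^'n \<Rightarrow> real^'m"
  have zX: "z k \<in> X" for k using w by (simp add: W1_weakly_converges_def X_def z_def)
  have XD: "has_weak_gradient U w (weak_gradient U w)" "in_Lp ?M p (weak_gradient U w)" if "w \<in> X" for w
    using W1_D[OF U p] that by (auto simp: X_def)
  have pos: "0 < N (z k)" for k using \<nu>[of k] by (simp add: N_def z_def) (metis less_trans zero_less_numeral zero_less_power)
  have "\<exists>\<phi>. in_Lp ?M q \<phi> \<and> Lp_nrm ?M q \<phi> = 1 \<and> (\<integral>x. weak_gradient U (z k) x \<bullet> \<phi> x \<partial>?M) = N (z k)" for k
    using Lp_dual_element[OF XD(2)[OF zX[of k]] pos[of k, unfolded N_def] p q] unfolding N_def by blast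
  then obtain \<phi> where "\<forall>k. in_Lp ?M q (\<phi> k) \<and> Lp_nrm ?M q (\<phi> k) = 1 \<and> (\<integral>x. weak_gradient U (z k) x \<bullet> \<phi> k x \<partial>?M) = N (z k)"
    using choice[of "\<lambda>k \<phi>. in_Lp ?M q \<phi> \<and> Lp_nrm ?M q \<phi> = 1 \<and> (\<integral>x. weak_gradient U (z k) x \<bullet> \<phi> x \<partial>?M) = N (z k)"] by blast
  then have \<phi>: "\<And>k. in_Lp ?M q (\<phi> k)" "\<And>k. Lp_nrm ?M q (\<phi> k) = 1"
    "\<And>k. (\<integral>x. weak_gradient U (z k) x \<bullet> \<phi> k x \<partial>?M) = N (z k)" by blast+
  define l where "l k w = (\<integral>x. weak_gradient U w x \<bullet> \<phi> k x \<partial>?M)" for k w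
  note Hoe = Holder_inequality[OF XD(2) \<phi>(1) p q]
  have lb: "\<bar>l k w\<bar> \<le> N w" if "w \<in> X" for k w
    using Hoe(2)[OF that, of k] \<phi>(2) by (simp add: l_def N_def)
  have llin: "(\<lambda>x. a *\<^sub>R w x + b *\<^sub>R w' x) \<in> X \<and> l k (\<lambda>x. a *\<^sub>R w x + b *\<^sub>R w' x) = a * l k w + b * l k w'"
    if ww: "w \<in> X" "w' \<in> X" for k w w' a b
  proof -
    note lc = W1_lincomb[OF U p ww[unfolded X_def], of a b]
    have X1: "(\<lambda>x. a *\<^sub>R w x + b *\<^sub>R w' x) \<in> X" using lc(1) by (simp add: X_def)
    have m: "(\<lambda>x. weak_gradient U f x \<bullet> \<phi> k x) \<in> borel_measurable ?M" if "f \<in> X" for f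
      using Hoe(1)[OF that] by auto
    have "l k (\<lambda>x. a *\<^sub>R w x + b *\<^sub>R w' x) = (\<integral>x. a * (weak_gradient U w x \<bullet> \<phi> k x) + b * (weak_gradient U w' x \<bullet> \<phi> k x) \<partial>?M)"
      unfolding l_def
    proof (rule integral_cong_AE[OF m[OF X1]])
      show "(\<lambda>x. a * (weak_gradient U w x \<bullet> \<phi> k x) + b * (weak_gradient U w' x \<bullet> \<phi> k x)) \<in> borel_measurable ?M"
        using m[OF ww(1)] m[OF ww(2)] by measurable
      show "AE x in ?M. weak_gradient U (\<lambda>x. a *\<^sub>R w x + b *\<^sub>R w' x) x \<bullet> \<phi> k x = a * (weak_gradient U w x \<bullet> \<phi> k x) + b * (weak_gradient U w' x \<bullet> \<phi> k x)"
        using lc(2) by eventually_elim (simp add: inner_add_left)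
    qed
    also have "\<dots> = a * l k w + b * l k w'"
      using Hoe(1)[OF ww(1)] Hoe(1)[OF ww(2)] by (simp add: l_def)
    finally show ?thesis using X1 by simp
  qed
  have lz: "l k (z k) = N (z k)" for k using \<phi>(3) by (simp add: l_def)
  have "\<exists>\<epsilon>. (\<forall>w\<in>X. summable (\<lambda>k. \<epsilon> k * l k w)) \<and> (\<forall>w\<in>X. \<bar>\<Sum>k. \<epsilon> k * l k w\<bar> \<le> 3 / 2 * N w) \<and>
    (\<forall>k'. \<bar>\<Sum>k. \<epsilon> k * l k (z k')\<bar> \<ge> (1/3) ^ k' / 2 * N (z k'))"
    by (rule gliding_hump[of X l N z, OF lb zX lz]) blast+
  then obtain \<epsilon> :: "nat \<Rightarrow> real" where \<epsilon>0: "\<forall>w\<in>X. summable (\<lambda>k. \<epsilon> k * l k w)" "\<forall>w\<in>X. \<bar>\<Sum>k. \<epsilon> k * l k w\<bar> \<le> 3 / 2 * N w"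
    "\<forall>k'. \<bar>\<Sum>k. \<epsilon> k * l k (z k')\<bar> \<ge> (1/3) ^ k' / 2 * N (z k')" by blast
  note \<epsilon> = \<epsilon>0[rule_format]
  define L where "L w = (\<Sum>k. \<epsilon> k * l k w)" for w
  have Llin: "L (\<lambda>x. a *\<^sub>R w x + b *\<^sub>R w' x) = a * L w + b * L w'" if ww: "w \<in> X" "w' \<in> X" for w w' a b
  proof -
    have "L (\<lambda>x. a *\<^sub>R w x + b *\<^sub>R w' x) = (\<Sum>k. a * (\<epsilon> k * l k w) + b * (\<epsilon> k * l k w'))"
      unfolding L_def using llin[OF ww] by (simp add: algebra_simps)
    also have "\<dots> = (\<Sum>k. a * (\<epsilon> k * l k w)) + (\<Sum>k. b * (\<epsilon> k * l k w'))"
      using \<epsilon>(1) ww by (intro suminf_add[symmetric] summable_mult)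
    also have "\<dots> = a * L w + b * L w'" unfolding L_def using \<epsilon>(1) ww by (simp add: suminf_mult)
    finally show ?thesis .
  qed
  have LD: "L \<in> W1_dual p U"
    unfolding W1_dual_def
  proof (intro CollectI conjI ballI allI)
    show "L (\<lambda>x. w x + w' x) = L w + L w'" if "w \<in> W1 (ennreal p) U" "w' \<in> W1 (ennreal p) U" for w w'
      using Llin[of w w' 1 1] that by (simp add: X_def)
    show "L (\<lambda>x. c *\<^sub>R w x) = c * L w" if "w \<in> W1 (ennreal p) U" for c w
      using Llin[of w w c 0] that by (simp add: X_def)
    show "\<exists>C. \<forall>w\<in>W1 (ennreal p) U. \<bar>L w\<bar> \<le> C * W1_norm p U w"
    proof (intro exI[of _ "3/2"] ballI)
      fix w :: "real^'n \<Rightarrow> real^'m" assume "w \<in> W1 (ennreal p) U"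
      then have "\<bar>L w\<bar> \<le> 3 / 2 * N w" using \<epsilon>(2) by (simp add: L_def X_def)
      also have "\<dots> \<le> 3 / 2 * W1_norm p U w" by (simp add: N_def W1_norm_eq Lp_nrm_nonneg)
      finally show "\<bar>L w\<bar> \<le> 3 / 2 * W1_norm p U w" .
    qed
  qed
  then have "(\<lambda>n. L (u n)) \<longlonglongrightarrow> L v" using w by (simp add: W1_weakly_converges_def)
  then have "Bseq (\<lambda>n. L (u n))" by (rule convergentI[THEN convergent_imp_Bseq])
  then obtain B where B: "\<And>n. \<bar>L (u n)\<bar> \<le> B" by (auto simp: Bseq_def)
  have "(4/3) ^ k / 2 \<le> B" for k
  proof -
    have "(4/3) ^ k / 2 = (1/3 :: real) ^ k / 2 * 4 ^ k" by (simp add: power_divide)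
    also have "\<dots> \<le> (1/3) ^ k / 2 * N (z k)" using \<nu>[of k] by (intro mult_left_mono) (auto simp: N_def z_def)
    also have "\<dots> \<le> \<bar>L (z k)\<bar>" using \<epsilon>(3)[of k] by (simp add: L_def)
    also have "\<dots> \<le> B" using B by (simp add: z_def)
    finally show ?thesis .
  qed
  moreover obtain k where "2 * B < (4/3 :: real) ^ k" using real_arch_pow[of "4/3" "2 * B"] by auto
  ultimately show False by (smt (verit) field_sum_of_halves)
qed

text \<open>Each component of the integral over \<open>S\<close> is a bounded functional, by
  Hoelder's inequality on the finite measure space \<open>S\<close>.\<close>

lemma W1_weakly_mean:
  fixes u :: "nat \<Rightarrow> real^'n \<Rightarrow> real^'m"
  assumes U: "open U" and p: "1 < p" and w: "W1_weakly_converges p U u v" and S: "S \<in> lmeasurable" "S \<subseteq> U"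
  shows "(\<lambda>n. mean S (u n)) \<longlonglongrightarrow> mean S v"
proof -
  have SL: "S \<in> sets lebesgue" using S by (simp add: fmeasurable_def)
  have UL: "U \<in> sets lebesgue" using U by auto
  note fin = finite_measure_lebesgue_on[OF S(1)]
  let ?v = "measure lebesgue S powr (1 - 1 / p)"
  have LS: "in_Lp (lebesgue_on S) p f" "Lp_nrm (lebesgue_on S) p f \<le> Lp_nrm (lebesgue_on U) p f"
    if "f \<in> W1 (ennreal p) U" for f :: "real^'n \<Rightarrow> real^'m"
    using in_Lp_subset[OF UL SL S(2) W1_D(1)[OF U p that]] p
    by (auto simp: Lp_nrm_def Lp_int_nonneg intro!: powr_mono2)
  have I: "integrable (lebesgue_on S) f" if "f \<in> W1 (ennreal p) U" for f :: "real^'n \<Rightarrow> real^'m"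
    by (rule in_Lp_integrable(1)[OF fin LS(1)[OF that] p])
  have comp: "(\<lambda>n. (\<integral>x. u n x \<partial>lebesgue_on S) $ i) \<longlonglongrightarrow> (\<integral>x. v x \<partial>lebesgue_on S) $ i" for i
  proof -
    define l where "l f = (\<integral>x. f x \<partial>lebesgue_on S) $ i" for f :: "real^'n \<Rightarrow> real^'m"
    have "l \<in> W1_dual p U"
      unfolding W1_dual_def
    proof (intro CollectI conjI ballI allI)
      show "l (\<lambda>x. f x + g x) = l f + l g" if "f \<in> W1 (ennreal p) U" "g \<in> W1 (ennreal p) U" for f g
        using I[OF that(1)] I[OF that(2)] by (simp add: l_def)
      show "l (\<lambda>x. c *\<^sub>R f x) = c * l f" for c f by (simp add: l_def)
      show "\<exists>C. \<forall>f\<in>W1 (ennreal p) U. \<bar>l f\<bar> \<le> C * W1_norm p U f"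
      proof (intro exI[of _ ?v] ballI)
        fix f :: "real^'n \<Rightarrow> real^'m" assume f: "f \<in> W1 (ennreal p) U"
        have "\<bar>l f\<bar> \<le> norm (\<integral>x. f x \<partial>lebesgue_on S)" unfolding l_def by (rule component_le_norm_cart)
        also have "\<dots> \<le> (\<integral>x. norm (f x) \<partial>lebesgue_on S)" by (rule integral_norm_bound)
        also have "\<dots> \<le> Lp_nrm (lebesgue_on S) p f * ?v"
          using in_Lp_integrable(2)[OF fin LS(1)[OF f] p] by (simp add: measure_restrict_space SL)
        also have "\<dots> \<le> W1_norm p U f * ?v"
          using LS(2)[OF f] Lp_nrm_nonneg[of "lebesgue_on U" p "weak_gradient U f"]
          by (intro mult_right_mono) (auto simp: W1_norm_eq)
        finally show "\<bar>l f\<bar> \<le> ?v * W1_norm p U f" by (simp add: mult.commute)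
      qed
    qed
    then have "(\<lambda>n. l (u n)) \<longlonglongrightarrow> l v" using w unfolding W1_weakly_converges_def by blast
    then show ?thesis unfolding l_def .
  qed
  have "(\<lambda>n. \<integral>x. u n x \<partial>lebesgue_on S) \<longlonglongrightarrow> (\<integral>x. v x \<partial>lebesgue_on S)"
    by (rule vec_tendstoI) (rule comp)
  then show ?thesis unfolding mean_def by (intro tendsto_scaleR tendsto_const)
qed

section \<open>Rellich's theorem on boxes\<close>

lemma bisect_cbox:
  assumes ab: "\<And>i. a $ i < b $ i" and cd: "(c, d) \<in> set (bisect js a b)"
  shows "cbox c d \<subseteq> cbox a b"
proof -
  note B = bisect_boxes[OF ab cd]
  have "box c d \<noteq> {}" "box a b \<noteq> {}" using B(2) ab by (auto simp: interval_ne_empty_cart)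
  then show ?thesis using closure_mono[OF B(3)] by (simp add: closure_box)
qed

lemma cycles_exist:
  obtains js :: "'n::finite list" where "\<And>i. count_list js i = k"
proof -
  obtain dirs :: "'n list" where dirs: "distinct dirs" "set dirs = UNIV" using finite_distinct_list[of "UNIV :: 'n set"] by auto
  have "count_list (concat (replicate k dirs)) i = k" for i
    using dirs count_list_distinct[of dirs i] by (induction k) auto
  then show ?thesis by (rule that)
qed

lemma Lp_int_mean_split:
  assumes S: "S \<in> lmeasurable" and f: "in_Lp (lebesgue_on S) p f" and p: "0 \<le> p"
  shows "Lp_int (lebesgue_on S) p f \<le> 2 powr p * (Lp_int (lebesgue_on S) p (\<lambda>x. f x - c) + norm c powr p * measure lebesgue S)"
proof -
  note fin = finite_measure_lebesgue_on[OF S]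
  have SL: "S \<in> sets lebesgue" using S by (simp add: fmeasurable_def)
  have "Lp_int (lebesgue_on S) p (\<lambda>x. (f x - c) + c) \<le> 2 powr p * (Lp_int (lebesgue_on S) p (\<lambda>x. f x - c) + Lp_int (lebesgue_on S) p (\<lambda>x. c))"
    by (intro in_Lp_add(2) in_Lp_diff(1) f in_Lp_const(1)[OF fin] p)
  then show ?thesis by (simp add: in_Lp_const(2)[OF fin] measure_restrict_space SL)
qed

text \<open>The box is cut into leaves of equal shape. On each leaf the Poincare inequality controls
  the deviation of \<open>u n - v\<close> from its mean, with a factor that shrinks with the leaf,
  and weak convergence sends the finitely many means to 0.\<close>

lemma W1_weakly_Rellich_box:
  fixes u :: "nat \<Rightarrow> real^'n \<Rightarrow> real^'m"
  assumes U: "open U" and p: "1 < p" and w: "W1_weakly_converges p U u v"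
    and ab: "\<And>i. a $ i < b $ i" and sub: "cbox a b \<subseteq> U"
  shows "(\<lambda>n. Lp_int (lebesgue_on (box a b)) p (\<lambda>x. u n x - v x)) \<longlonglongrightarrow> 0"
proof (rule LIMSEQ_I)
  fix e :: real assume e: "0 < e"
  have p0: "0 \<le> p" "0 < p" using p by auto
  have UL: "U \<in> sets lebesgue" using U by auto
  have uW: "u n \<in> W1 (ennreal p) U" for n using w by (simp add: W1_weakly_converges_def)
  have vW: "v \<in> W1 (ennreal p) U" using w by (simp add: W1_weakly_converges_def)
  obtain M where M: "\<And>n. Lp_nrm (lebesgue_on U) p (weak_gradient U (u n)) \<le> M"
    by (rule W1_weakly_bounded[OF U p w]) blast
  define z where "z n x = u n x - v x" for n x
  define G where "G n x = weak_gradient U (u n) x - weak_gradient U v x" for n x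
  note uD = W1_D[OF U p uW] and vD = W1_D[OF U p vW]
  have zL: "in_Lp (lebesgue_on U) p (z n)" for n unfolding z_def by (intro in_Lp_diff(1) uD vD p0)
  have GL: "in_Lp (lebesgue_on U) p (G n)" for n unfolding G_def by (intro in_Lp_diff(1) uD vD p0)
  have zG: "has_weak_gradient U (z n) (G n)" for n unfolding z_def G_def by (intro has_weak_gradient_diff U uD vD)
  define A where "A = 2 powr p * (M powr p + Lp_int (lebesgue_on U) p (weak_gradient U v)) + 1"
  have GA: "Lp_int (lebesgue_on U) p (G n) \<le> A" for n
  proof -
    have "Lp_int (lebesgue_on U) p (weak_gradient U (u n)) \<le> M powr p"
      using powr_mono2[OF p0(1) Lp_nrm_nonneg M[of n]] by (simp add: Lp_nrm_powr p0)
    then have "Lp_int (lebesgue_on U) p (G n) \<le> 2 powr p * (M powr p + Lp_int (lebesgue_on U) p (weak_gradient U v))"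
      unfolding G_def using in_Lp_diff(2)[OF uD(3)[of n] vD(3) p0(1)] by (smt (verit) mult_left_mono powr_ge_zero)
    then show ?thesis by (simp add: A_def)
  qed
  define h where "h = (\<Sum>i\<in>UNIV. b $ i - a $ i)"
  have h: "b $ i - a $ i \<le> h" for i unfolding h_def using ab by (intro member_le_sum) (auto intro: less_imp_le)
  have h0: "0 < h" using ab[of undefined] h[of undefined] by linarith
  define C where "C = real CARD('m) * real CARD('n) * h"
  have C0: "0 < C" using h0 by (simp add: C_def)
  \<comment> \<open>The depth is fixed from the uniform gradient bound \<open>A\<close> before
    \<open>n\<close> is chosen, so that the deviations contribute less than half of \<open>e\<close>
    for every \<open>n\<close>.\<close>
  obtain k where k: "(C / 2 ^ k) powr p * A < e / (2 * 2 powr p)"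
  proof -
    have "(\<lambda>k. (C / 2 ^ k) powr p * A) \<longlonglongrightarrow> 0 powr p * A"
    proof (intro tendsto_intros tendsto_powr')
      show "(\<lambda>k. C / 2 ^ k) \<longlonglongrightarrow> 0"
        using tendsto_mult[OF tendsto_const[of C] LIMSEQ_inverse_realpow_zero[of 2]] by (simp add: divide_inverse)
    qed (use p0 C0 in \<open>auto intro!: always_eventually\<close>)
    then have "eventually (\<lambda>k. (C / 2 ^ k) powr p * A < e / (2 * 2 powr p)) sequentially"
      using e by (intro order_tendstoD(2)) auto
    then show ?thesis using that by (auto simp: eventually_sequentially)
  qed
  obtain js :: "'n list" where js: "\<And>i. count_list js i = k" using cycles_exist[where 'n='n] by blast
  define L where "L = bisect js a b"
  note LB = bisect_boxes[OF ab, of _ _ js, folded L_def] and LC = bisect_cbox[OF ab, of _ _ js, folded L_def]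
  have leaf: "Lp_int (lebesgue_on (box c d)) p (z n) \<le> 2 powr p * ((C / 2 ^ k) powr p * Lp_int (lebesgue_on (box c d)) p (G n)
      + norm (mean (box c d) (z n)) powr p * measure lebesgue (box c d))" if cd: "(c, d) \<in> set L" for c d n
  proof -
    have c_d: "\<And>i. c $ i < d $ i" by (rule LB(2)[OF cd])
    have csub: "cbox c d \<subseteq> U" using LC[OF cd] sub by auto
    then have bsub: "box c d \<subseteq> U" using box_subset_cbox[of c d] by auto
    have zL': "in_Lp (lebesgue_on (box c d)) p (z n)" by (rule in_Lp_subset(1)[OF UL _ bsub zL]) simp
    have GL': "in_Lp (lebesgue_on (box c d)) p (G n)" by (rule in_Lp_subset(1)[OF UL _ bsub GL]) simp
    have "d $ i - c $ i \<le> h / 2 ^ k" for i using LB(1)[OF cd, of i] js h[of i] by (simp add: divide_right_mono)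
    from Poincare_box[OF U zG p GL' zL' c_d this csub]
    have P: "Lp_nrm (lebesgue_on (box c d)) p (\<lambda>x. z n x - mean (box c d) (z n)) \<le> (C / 2 ^ k) * Lp_nrm (lebesgue_on (box c d)) p (G n)"
      by (simp add: C_def)
    then have "Lp_int (lebesgue_on (box c d)) p (\<lambda>x. z n x - mean (box c d) (z n)) \<le> ((C / 2 ^ k) * Lp_nrm (lebesgue_on (box c d)) p (G n)) powr p"
      using C0 by (subst Lp_nrm_le_iff[OF p0(2), symmetric]) (auto simp: Lp_nrm_nonneg)
    also have "\<dots> = (C / 2 ^ k) powr p * Lp_int (lebesgue_on (box c d)) p (G n)"
      using C0 by (subst powr_mult) (auto simp: Lp_nrm_nonneg Lp_nrm_powr p0)
    finally have "2 powr p * (Lp_int (lebesgue_on (box c d)) p (\<lambda>x. z n x - mean (box c d) (z n)) + norm (mean (box c d) (z n)) powr p * measure lebesgue (box c d))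
      \<le> 2 powr p * ((C / 2 ^ k) powr p * Lp_int (lebesgue_on (box c d)) p (G n) + norm (mean (box c d) (z n)) powr p * measure lebesgue (box c d))"
      by simp
    then show ?thesis using Lp_int_mean_split[OF measure_box_pos(1)[OF c_d] zL' p0(1), of "mean (box c d) (z n)"] by linarith
  qed
  define R where "R n = (\<Sum>(c, d)\<leftarrow>L. norm (mean (box c d) (z n)) powr p * measure lebesgue (box c d))" for n
  have Rlim: "R \<longlonglongrightarrow> 0"
  proof -
    have "(\<lambda>n. norm (mean (box (fst q) (snd q)) (z n)) powr p * measure lebesgue (box (fst q) (snd q))) \<longlonglongrightarrow> 0" if q: "q \<in> set L" for q
    proof -
      obtain c d where cd: "q = (c, d)" by (cases q)
      have c_d: "\<And>i. c $ i < d $ i" using LB(2)[of c d] q cd by auto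
      have "cbox c d \<subseteq> U" using LC[of c d] sub q cd by auto
      then have bsub: "box c d \<subseteq> U" using box_subset_cbox[of c d] by auto
      note bm = measure_box_pos(1)[OF c_d]
      have BL: "box c d \<in> sets lebesgue" by simp
      have int: "integrable (lebesgue_on (box c d)) f" if "in_Lp (lebesgue_on U) p f" for f :: "real^'n \<Rightarrow> real^'m"
        by (rule in_Lp_integrable(1)[OF finite_measure_lebesgue_on[OF bm] in_Lp_subset(1)[OF UL BL bsub that] p])
      have "mean (box c d) (z n) = mean (box c d) (u n) - mean (box c d) v" for n
        unfolding z_def mean_def using int[OF uD(1)[of n]] int[OF vD(1)] by (simp add: scaleR_diff_right)
      then have "(\<lambda>n. mean (box c d) (z n)) \<longlonglongrightarrow> mean (box c d) v - mean (box c d) v"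
        using tendsto_diff[OF W1_weakly_mean[OF U p w bm bsub] tendsto_const[of "mean (box c d) v"]] by simp
      then have m0: "(\<lambda>n. mean (box c d) (z n)) \<longlonglongrightarrow> 0" by simp
      have "(\<lambda>n. norm (mean (box c d) (z n)) powr p) \<longlonglongrightarrow> norm (0::real^'m) powr p"
        by (rule tendsto_powr'[OF tendsto_norm[OF m0] tendsto_const]) (use p0 in auto)
      then have "(\<lambda>n. norm (mean (box c d) (z n)) powr p * measure lebesgue (box c d)) \<longlonglongrightarrow> 0 * measure lebesgue (box c d)"
        by (intro tendsto_mult tendsto_const) simp
      then show ?thesis by (simp add: cd)
    qed
    then have "(\<lambda>n. \<Sum>i<length L. norm (mean (box (fst (L ! i)) (snd (L ! i))) (z n)) powr p * measure lebesgue (box (fst (L ! i)) (snd (L ! i)))) \<longlonglongrightarrow> (\<Sum>i<length L. 0)"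
      by (intro tendsto_sum) auto
    then show ?thesis by (simp add: R_def[abs_def] sum_list_sum_nth case_prod_beta lessThan_atLeast0)
  qed
  have bound: "Lp_int (lebesgue_on (box a b)) p (z n) \<le> 2 powr p * ((C / 2 ^ k) powr p * A + R n)" for n
  proof -
    have bsub: "box a b \<subseteq> U" using box_subset_cbox[of a b] sub by auto
    have zL': "in_Lp (lebesgue_on (box a b)) p (z n)" by (rule in_Lp_subset(1)[OF UL _ bsub zL]) simp
    have GL': "in_Lp (lebesgue_on (box a b)) p (G n)" "Lp_int (lebesgue_on (box a b)) p (G n) \<le> Lp_int (lebesgue_on U) p (G n)"
      by (rule in_Lp_subset[OF UL _ bsub GL]; simp)+
    have "Lp_int (lebesgue_on (box a b)) p (z n) = (\<Sum>(c, d)\<leftarrow>L. Lp_int (lebesgue_on (box c d)) p (z n))"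
      unfolding L_def by (rule bisect_Lp_int[OF ab zL', symmetric])
    also have "\<dots> \<le> (\<Sum>(c, d)\<leftarrow>L. 2 powr p * ((C / 2 ^ k) powr p * Lp_int (lebesgue_on (box c d)) p (G n)
      + norm (mean (box c d) (z n)) powr p * measure lebesgue (box c d)))"
      by (rule sum_list_mono) (use leaf in auto)
    also have "\<dots> = 2 powr p * ((C / 2 ^ k) powr p * (\<Sum>(c, d)\<leftarrow>L. Lp_int (lebesgue_on (box c d)) p (G n)) + R n)"
      unfolding R_def by (induction L) (auto simp: algebra_simps)
    also have "(\<Sum>(c, d)\<leftarrow>L. Lp_int (lebesgue_on (box c d)) p (G n)) = Lp_int (lebesgue_on (box a b)) p (G n)"
      unfolding L_def by (rule bisect_Lp_int[OF ab GL'(1)])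
    also have "2 powr p * ((C / 2 ^ k) powr p * \<dots> + R n) \<le> 2 powr p * ((C / 2 ^ k) powr p * A + R n)"
      using GL'(2) GA[of n] by (intro mult_left_mono add_right_mono) auto
    finally show ?thesis .
  qed
  obtain N where N: "\<And>n. n \<ge> N \<Longrightarrow> R n < e / (2 * 2 powr p)"
    using order_tendstoD(2)[OF Rlim, of "e / (2 * 2 powr p)"] e by (auto simp: eventually_sequentially)
  have "Lp_int (lebesgue_on (box a b)) p (z n) < e" if "n \<ge> N" for n
  proof -
    have "2 powr p * ((C / 2 ^ k) powr p * A + R n) < 2 powr p * (e / (2 * 2 powr p) + e / (2 * 2 powr p))"
      using k N[OF that] by (intro mult_strict_left_mono add_strict_mono) auto
    then show ?thesis using bound[of n] by simp
  qed
  then show "\<exists>N. \<forall>n\<ge>N. norm (Lp_int (lebesgue_on (box a b)) p (\<lambda>x. u n x - v x) - 0) < e"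
    using Lp_int_nonneg[of "lebesgue_on (box a b)" p "z n" for n] unfolding z_def by (auto intro!: exI[of _ N])
qed

section \<open>From strong convergence to weak convergence\<close>

lemma tendsto_test_integral:
  fixes f :: "nat \<Rightarrow> 'a::euclidean_space \<Rightarrow> real"
  assumes V: "V \<in> lmeasurable" and p: "1 < p" and f: "\<And>n. in_Lp (lebesgue_on V) p (f n)" and F: "in_Lp (lebesgue_on V) p F"
    and lim: "(\<lambda>n. Lp_int (lebesgue_on V) p (\<lambda>x. f n x - F x)) \<longlonglongrightarrow> 0"
    and \<psi>: "\<psi> \<in> borel_measurable lebesgue" "\<And>x. \<bar>\<psi> x\<bar> \<le> B"
  shows "(\<lambda>n. \<integral>x. f n x * \<psi> x \<partial>lebesgue_on V) \<longlonglongrightarrow> (\<integral>x. F x * \<psi> x \<partial>lebesgue_on V)"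
proof -
  let ?M = "lebesgue_on V"
  note fin = finite_measure_lebesgue_on[OF V]
  have p0: "0 \<le> p" "0 < p" using p by auto
  have B0: "0 \<le> B" using \<psi>(2)[of undefined] by linarith
  have [measurable]: "\<psi> \<in> borel_measurable ?M" using \<psi>(1) by (rule measurable_restrict_space1)
  have i: "integrable ?M (\<lambda>x. g x * \<psi> x)" if "in_Lp ?M p g" for g
  proof (rule Bochner_Integration.integrable_bound)
    show "integrable ?M (\<lambda>x. B * g x)" using in_Lp_integrable(1)[OF fin that p] by simp
    show "(\<lambda>x. g x * \<psi> x) \<in> borel_measurable ?M" using that by (auto simp: in_Lp_def)
    show "AE x in ?M. norm (g x * \<psi> x) \<le> norm (B * g x)"
      using \<psi>(2) B0 by (intro AE_I2) (simp add: abs_mult mult.commute[of "\<bar>g _\<bar>"] mult_right_mono)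
  qed
  have d: "in_Lp ?M p (\<lambda>x. f n x - F x)" for n by (rule in_Lp_diff(1)[OF f F p0(1)])
  have bd: "norm ((\<integral>x. f n x * \<psi> x \<partial>?M) - (\<integral>x. F x * \<psi> x \<partial>?M)) \<le> B * (Lp_nrm ?M p (\<lambda>x. f n x - F x) * measure ?M (space ?M) powr (1 - 1 / p))" for n
  proof -
    have "(\<integral>x. f n x * \<psi> x \<partial>?M) - (\<integral>x. F x * \<psi> x \<partial>?M) = (\<integral>x. (f n x - F x) * \<psi> x \<partial>?M)"
      using i[OF f[of n]] i[OF F] by (simp add: left_diff_distrib)
    also have "norm \<dots> \<le> (\<integral>x. norm ((f n x - F x) * \<psi> x) \<partial>?M)" by (rule integral_norm_bound)
    also have "\<dots> \<le> (\<integral>x. B * norm (f n x - F x) \<partial>?M)"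
    proof (rule integral_mono)
      show "integrable ?M (\<lambda>x. norm ((f n x - F x) * \<psi> x))" using i[OF d[of n]] by simp
      show "integrable ?M (\<lambda>x. B * norm (f n x - F x))" using in_Lp_integrable(1)[OF fin d[of n] p] by simp
      show "norm ((f n x - F x) * \<psi> x) \<le> B * norm (f n x - F x)" for x
        using mult_left_mono[OF \<psi>(2)[of x], of "\<bar>f n x - F x\<bar>"] by (simp add: abs_mult mult.commute)
    qed
    also have "\<dots> = B * (\<integral>x. norm (f n x - F x) \<partial>?M)" by simp
    also have "\<dots> \<le> B * (Lp_nrm ?M p (\<lambda>x. f n x - F x) * measure ?M (space ?M) powr (1 - 1 / p))"
      by (intro mult_left_mono in_Lp_integrable(2)[OF fin d p] B0)
    finally show ?thesis .
  qed
  have "(\<lambda>n. Lp_nrm ?M p (\<lambda>x. f n x - F x)) \<longlonglongrightarrow> 0 powr (1 / p)"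
    unfolding Lp_nrm_def by (rule tendsto_powr'[OF lim tendsto_const]) (use p0 in \<open>auto simp: Lp_int_nonneg\<close>)
  then have n0: "(\<lambda>n. Lp_nrm ?M p (\<lambda>x. f n x - F x)) \<longlonglongrightarrow> 0" by simp
  have "(\<lambda>n. B * (Lp_nrm ?M p (\<lambda>x. f n x - F x) * measure ?M (space ?M) powr (1 - 1 / p))) \<longlonglongrightarrow> B * (0 * measure ?M (space ?M) powr (1 - 1 / p))"
    by (intro tendsto_mult tendsto_const n0)
  then have "(\<lambda>n. (\<integral>x. f n x * \<psi> x \<partial>?M) - (\<integral>x. F x * \<psi> x \<partial>?M)) \<longlonglongrightarrow> 0"
    by (intro Lim_null_comparison[OF always_eventually[OF allI[OF bd]]]) simp
  then show ?thesis by (rule LIM_zero_cancel)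
qed

text \<open>The weak gradient is a closed operator: both sides of the defining identity pass to the
  limit, so \<open>F\<close> is a weak gradient of 0, and such a gradient vanishes almost
  everywhere.\<close>

lemma weak_gradient_closed:
  fixes w :: "nat \<Rightarrow> real^'n \<Rightarrow> real^'m" and G :: "nat \<Rightarrow> real^'n \<Rightarrow> real^'n^'m"
  assumes V: "open V" "V \<in> lmeasurable" and p: "1 < p" and w: "\<And>n. in_Lp (lebesgue_on V) p (w n)"
    and G: "\<And>n. in_Lp (lebesgue_on V) p (G n)" "\<And>n. has_weak_gradient V (w n) (G n)"
    and lw: "(\<lambda>n. Lp_int (lebesgue_on V) p (w n)) \<longlonglongrightarrow> 0"
    and F: "in_Lp (lebesgue_on V) p F" and lG: "(\<lambda>n. Lp_int (lebesgue_on V) p (\<lambda>x. G n x - F x)) \<longlonglongrightarrow> 0"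
  shows "AE x in lebesgue_on V. F x = 0"
proof (rule has_weak_gradient_zero_AE[OF V(1)])
  let ?M = "lebesgue_on V"
  have VL: "V \<in> sets lebesgue" using V by auto
  have p0: "0 \<le> p" using p by simp
  note fin = finite_measure_lebesgue_on[OF V(2)]
  have comp: "in_Lp ?M p (\<lambda>x. f x $ i)" "Lp_int ?M p (\<lambda>x. f x $ i) \<le> Lp_int ?M p f" if f: "in_Lp ?M p f" for f :: "real^'n \<Rightarrow> real^'m" and i
  proof -
    have m: "(\<lambda>x. f x $ i) \<in> borel_measurable ?M"
      using borel_measurable_continuous_on[OF linear_continuous_on[OF bounded_linear_vec_nth] in_Lp_measurable[OF f]] .
    show "in_Lp ?M p (\<lambda>x. f x $ i)" "Lp_int ?M p (\<lambda>x. f x $ i) \<le> Lp_int ?M p f"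
      by (rule in_Lp_bound[OF f m _ p0], use component_le_norm_cart in auto)+
  qed
  have comp2: "in_Lp ?M p (\<lambda>x. f x $ i $ j)" "Lp_int ?M p (\<lambda>x. f x $ i $ j) \<le> Lp_int ?M p f" if f: "in_Lp ?M p f" for f :: "real^'n \<Rightarrow> real^'n^'m" and i j
  proof -
    have m: "(\<lambda>x. f x $ i $ j) \<in> borel_measurable ?M"
      using borel_measurable_continuous_on[OF linear_continuous_on[OF bounded_linear_compose[OF bounded_linear_vec_nth bounded_linear_vec_nth]] in_Lp_measurable[OF f]] .
    show "in_Lp ?M p (\<lambda>x. f x $ i $ j)" "Lp_int ?M p (\<lambda>x. f x $ i $ j) \<le> Lp_int ?M p f"
      by (rule in_Lp_bound[OF f m _ p0], use matrix_entry_le_norm in auto)+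
  qed
  show "has_weak_gradient V (\<lambda>x. 0) F"
    unfolding has_weak_gradient_def
  proof (intro conjI allI impI)
    show "locally_integrable V F" by (rule in_Lp_locally_integrable[OF VL F p])
    show "locally_integrable V (\<lambda>x. 0 :: real^'m)" by (simp add: locally_integrable_def)
    fix \<phi> i j assume \<phi>: "test_function V \<phi>"
    obtain K where K: "compact K" "K \<subseteq> V" "\<And>x. x \<notin> K \<Longrightarrow> \<phi> x = 0"
      "\<And>x j. x \<notin> K \<Longrightarrow> partial_derivative j \<phi> x = 0" using test_function_support[OF \<phi>] by blast
    note c = test_function_continuous[OF \<phi>]
    obtain B where B: "\<And>x. \<bar>\<phi> x\<bar> \<le> B" using continuous_compact_support_bounded[OF c(1) K(1,3)] by metis
    obtain B' where B': "\<And>x. \<bar>partial_derivative j \<phi> x\<bar> \<le> B'"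
      using continuous_compact_support_bounded[OF c(2) K(1,4)] by metis
    have l1: "(\<lambda>n. Lp_int ?M p (\<lambda>x. w n x $ i - 0)) \<longlonglongrightarrow> 0"
      by (rule tendsto_sandwich[OF _ _ tendsto_const lw]) (use comp(2)[OF w] in \<open>auto simp: Lp_int_nonneg intro!: always_eventually\<close>)
    have z: "in_Lp ?M p (\<lambda>x. 0::real)" by (rule in_Lp_const(1)[OF fin])
    have L1: "(\<lambda>n. \<integral>x. w n x $ i * partial_derivative j \<phi> x \<partial>?M) \<longlonglongrightarrow> (\<integral>x. 0 * partial_derivative j \<phi> x \<partial>?M)"
      by (rule tendsto_test_integral[OF V(2) p comp(1)[OF w] z l1 continuous_borel_lebesgue[OF c(2)] B'])
    have "in_Lp ?M p (\<lambda>x. G n x - F x)" for n by (rule in_Lp_diff(1)[OF G(1) F p0])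
    from comp2(2)[OF this]
    have l2: "(\<lambda>n. Lp_int ?M p (\<lambda>x. G n x $ i $ j - F x $ i $ j)) \<longlonglongrightarrow> 0"
      by (intro tendsto_sandwich[OF _ _ tendsto_const lG]) (auto simp: Lp_int_nonneg)
    have L2: "(\<lambda>n. \<integral>x. G n x $ i $ j * \<phi> x \<partial>?M) \<longlonglongrightarrow> (\<integral>x. F x $ i $ j * \<phi> x \<partial>?M)"
      by (rule tendsto_test_integral[OF V(2) p comp2(1)[OF G(1)] comp2(1)[OF F] l2 continuous_borel_lebesgue[OF c(1)] B])
    have "(\<integral>x. w n x $ i * partial_derivative j \<phi> x \<partial>?M) = - (\<integral>x. G n x $ i $ j * \<phi> x \<partial>?M)" for n
      using G(2)[of n] \<phi> by (simp add: has_weak_gradient_def)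
    then have "(\<lambda>n. - (\<integral>x. G n x $ i $ j * \<phi> x \<partial>?M)) \<longlonglongrightarrow> (\<integral>x. 0 * partial_derivative j \<phi> x \<partial>?M)"
      using L1 by simp
    from LIMSEQ_unique[OF this tendsto_minus[OF L2]]
    show "(\<integral>x. (0::real^'m) $ i * partial_derivative j \<phi> x \<partial>?M) = - (\<integral>x. F x $ i $ j * \<phi> x \<partial>?M)" by simp
  qed
qed

lemma W1_dualD:
  assumes "l \<in> W1_dual p U"
  shows "u \<in> W1 (ennreal p) U \<Longrightarrow> v \<in> W1 (ennreal p) U \<Longrightarrow> l (\<lambda>x. u x + v x) = l u + l v"
    and "u \<in> W1 (ennreal p) U \<Longrightarrow> l (\<lambda>x. c *\<^sub>R u x) = c * l u"
    and "\<exists>C. \<forall>u\<in>W1 (ennreal p) U. \<bar>l u\<bar> \<le> C * W1_norm p U u"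
  using assms by (simp_all add: W1_dual_def)

text \<open>The sets \<open>K n\<close> are nonempty, decreasing, closed under midpoints, and
  concentrate at 0 in \<open>Lp\<close>. Nearly minimal gradient energies in them make the gradients
  Cauchy, and closedness of the gradient forces their limit to be 0. The minimisers then tend to 0
  in the Sobolev norm, although \<open>l\<close> stays at least \<open>c\<close> on them.\<close>

lemma W1_weak_compactness_aux:
  fixes z :: "nat \<Rightarrow> real^'n \<Rightarrow> real^'m"
  assumes V: "open V" "V \<in> lmeasurable" and p: "1 < p" and z: "\<And>k. z k \<in> W1 (ennreal p) V"
    and lz: "(\<lambda>k. Lp_int (lebesgue_on V) p (z k)) \<longlonglongrightarrow> 0"
    and bz: "\<And>k. Lp_int (lebesgue_on V) p (weak_gradient V (z k)) \<le> M"
    and l: "l \<in> W1_dual p V" and c: "0 < c" and lc: "\<And>k. c \<le> l (z k)"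
  shows False
proof -
  let ?M = "lebesgue_on V"
  let ?D = "weak_gradient V :: (real^'n \<Rightarrow> real^'m) \<Rightarrow> _"
  let ?E = "\<lambda>w. Lp_int ?M p (?D w)"
  have p0: "0 \<le> p" "0 < p" "1 \<le> p" using p by auto
  define \<delta> where "\<delta> n = 1 / real (Suc n)" for n
  have \<delta>: "0 < \<delta> n" for n by (simp add: \<delta>_def)
  have \<delta>_anti: "\<delta> m \<le> \<delta> n" if "n \<le> m" for n m using that by (simp add: \<delta>_def frac_le)
  have \<delta>0: "\<delta> \<longlonglongrightarrow> 0" unfolding \<delta>_def[abs_def] by (rule LIMSEQ_Suc[OF lim_1_over_n])
  define K where "K n = {w \<in> W1 (ennreal p) V. Lp_nrm ?M p w \<le> \<delta> n \<and> ?E w \<le> M \<and> c \<le> l w}" for n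
  have KD: "w \<in> W1 (ennreal p) V" "Lp_nrm ?M p w \<le> \<delta> n" "?E w \<le> M" "c \<le> l w" if "w \<in> K n" for w n
    using that by (auto simp: K_def)
  have Kanti: "K m \<subseteq> K n" if "n \<le> m" for n m using \<delta>_anti[OF that] by (auto simp: K_def)
  have Kne: "K n \<noteq> {}" for n
  proof -
    have "(\<lambda>k. Lp_nrm ?M p (z k)) \<longlonglongrightarrow> 0 powr (1 / p)"
      unfolding Lp_nrm_def by (rule tendsto_powr'[OF lz tendsto_const]) (use p0 in \<open>auto simp: Lp_int_nonneg\<close>)
    then have "eventually (\<lambda>k. Lp_nrm ?M p (z k) < \<delta> n) sequentially"
      using \<delta> by (intro order_tendstoD(2)) auto
    then obtain k where "Lp_nrm ?M p (z k) < \<delta> n" by (auto simp: eventually_sequentially)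
    then have "z k \<in> K n" using z bz lc by (simp add: K_def)
    then show ?thesis by auto
  qed
  have Klin: "(\<lambda>x. (1/2) *\<^sub>R w x + (1/2) *\<^sub>R w' x) \<in> K n"
      "?E (\<lambda>x. (1/2) *\<^sub>R w x + (1/2) *\<^sub>R w' x) = Lp_int ?M p (\<lambda>x. (1/2) *\<^sub>R (?D w x + ?D w' x))"
    if w: "w \<in> K n" "w' \<in> K n" for w w' n
  proof -
    note wW = KD(1)[OF w(1)] KD(1)[OF w(2)]
    note lc' = W1_lincomb[OF V(1) p wW, of "1/2" "1/2"]
    note dw = W1_D[OF V(1) p wW(1)] and dw' = W1_D[OF V(1) p wW(2)]
    show E: "?E (\<lambda>x. (1/2) *\<^sub>R w x + (1/2) *\<^sub>R w' x) = Lp_int ?M p (\<lambda>x. (1/2) *\<^sub>R (?D w x + ?D w' x))"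
      using lc'(3) by (simp add: scaleR_add_right)
    have "?E (\<lambda>x. (1/2) *\<^sub>R w x + (1/2) *\<^sub>R w' x) \<le> (1 - 1/2) * ?E w + (1/2) * ?E w'"
      using lc'(3) Lp_int_convex[OF dw(3) dw'(3) p0(3), of "1/2"] by simp
    then have EM: "?E (\<lambda>x. (1/2) *\<^sub>R w x + (1/2) *\<^sub>R w' x) \<le> M" using KD(3)[OF w(1)] KD(3)[OF w(2)] by simp
    have "Lp_nrm ?M p (\<lambda>x. (1/2) *\<^sub>R w x + (1/2) *\<^sub>R w' x) \<le> (1/2) * Lp_nrm ?M p w + (1/2) * Lp_nrm ?M p w'"
      using Lp_nrm_triangle[OF in_Lp_scaleR(1)[OF dw(1), of "1/2"] in_Lp_scaleR(1)[OF dw'(1), of "1/2"] p0(3)]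
      by (simp add: Lp_nrm_scaleR[OF dw(1) p0(2)] Lp_nrm_scaleR[OF dw'(1) p0(2)])
    then have Nd: "Lp_nrm ?M p (\<lambda>x. (1/2) *\<^sub>R w x + (1/2) *\<^sub>R w' x) \<le> \<delta> n" using KD(2)[OF w(1)] KD(2)[OF w(2)] by simp
    have "(\<lambda>x. (1/2) *\<^sub>R w x) \<in> W1 (ennreal p) V" "(\<lambda>x. (1/2) *\<^sub>R w' x) \<in> W1 (ennreal p) V"
      using W1_lincomb(1)[OF V(1) p wW, of "1/2" 0] W1_lincomb(1)[OF V(1) p wW, of 0 "1/2"] by simp_all
    then have "l (\<lambda>x. (1/2) *\<^sub>R w x + (1/2) *\<^sub>R w' x) = (1/2) * l w + (1/2) * l w'"
      by (simp only: W1_dualD(1)[OF l] W1_dualD(2)[OF l wW(1)] W1_dualD(2)[OF l wW(2)])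
    then have "c \<le> l (\<lambda>x. (1/2) *\<^sub>R w x + (1/2) *\<^sub>R w' x)" using KD(4)[OF w(1)] KD(4)[OF w(2)] by simp
    then show "(\<lambda>x. (1/2) *\<^sub>R w x + (1/2) *\<^sub>R w' x) \<in> K n" using lc'(1) Nd EM by (simp add: K_def)
  qed
  define d where "d n = Inf (?E ` K n)" for n
  have bdd: "bdd_below (?E ` K n)" for n by (rule bdd_belowI[of _ 0]) (auto simp: Lp_int_nonneg)
  have d_le: "d n \<le> ?E w" if "w \<in> K n" for w n unfolding d_def using that bdd by (auto intro: cInf_lower)
  have d_mono: "d n \<le> d m" if "n \<le> m" for n m
    unfolding d_def by (rule cInf_superset_mono[OF _ bdd]) (use Kne Kanti[OF that] in auto)
  have dM: "d n \<le> M" for n 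
  proof -
    obtain w where "w \<in> K n" using Kne[of n] by blast
    from d_le[OF this] KD(3)[OF this] show ?thesis by linarith
  qed
  \<comment> \<open>The infima increase because the sets shrink, and are bounded by
    \<open>M\<close>; their convergence is what makes late minimisers comparable.\<close>
  have "incseq d" using d_mono by (simp add: incseq_def)
  then obtain d0 where "d \<longlonglongrightarrow> d0" using incseq_convergent[of d M] dM by blast
  then have dC: "Cauchy d" by (rule LIMSEQ_imp_Cauchy)
  have "\<exists>w. w \<in> K n \<and> ?E w < d n + \<delta> n" for n
  proof -
    have "\<exists>e\<in>?E ` K n. e < d n + \<delta> n"
      unfolding d_def by (rule cInf_lessD) (use Kne \<delta>[of n] in auto)
    then show ?thesis by auto
  qed
  then obtain w where w: "\<And>n. w n \<in> K n" "\<And>n. ?E (w n) < d n + \<delta> n" by metis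
  have wW: "w n \<in> W1 (ennreal p) V" for n by (rule KD(1)[OF w(1)])
  note wD = W1_D[OF V(1) p wW]
  \<comment> \<open>The midpoint of \<open>w n\<close> and \<open>w m\<close> still lies in the
    larger set \<open>K n\<close>, so its energy is at least \<open>d n\<close>, while the two
    energies themselves are nearly \<open>d n\<close> and \<open>d m\<close>. Thus the convexity gap
    is small.\<close>
  have gap: "(?E (w n) + ?E (w m)) / 2 - Lp_int ?M p (\<lambda>x. (1/2) *\<^sub>R (?D (w n) x + ?D (w m) x)) \<le> \<bar>d m - d n\<bar> + \<delta> n" if nm: "n \<le> m" for n m
  proof -
    have wm: "w m \<in> K n" using w(1) Kanti[OF nm] by auto
    have "d n \<le> Lp_int ?M p (\<lambda>x. (1/2) *\<^sub>R (?D (w n) x + ?D (w m) x))"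
      using d_le[OF Klin(1)[OF w(1) wm]] Klin(2)[OF w(1) wm] by simp
    then show ?thesis using w(2)[of n] w(2)[of m] \<delta>_anti[OF nm] by argo
  qed
  have M0: "0 \<le> M" using bz[of 0] Lp_int_nonneg order_trans by blast
  have cau: "\<exists>N. \<forall>m\<ge>N. \<forall>n\<ge>N. Lp_int ?M p (\<lambda>x. ?D (w m) x - ?D (w n) x) < e" if e: "e > 0" for e
  proof -
    \<comment> \<open>With energies at most \<open>M\<close> the first term of the uniform convexity
      estimate stays below \<open>e / 2\<close>; the thresholds \<open>N1\<close> and
      \<open>N2\<close> leave \<open>3 / 8 * e\<close> for the gap.\<close>
    define e1 where "e1 = e / (4 * (M + 1))"
    have e1: "0 < e1" using e M0 by (simp add: e1_def)
    obtain C where C: "0 < C" "\<And>a b :: real^'n^'m. norm (a - b) powr p \<le> e1 * (norm a powr p + norm b powr p)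
       + C * ((norm a powr p + norm b powr p) / 2 - norm ((1/2) *\<^sub>R (a + b)) powr p)"
      using powr_uniformly_convex[OF p e1] by metis
    have key: "Lp_int ?M p (\<lambda>x. ?D (w n) x - ?D (w m) x) \<le> e1 * (2 * M) + C * (\<bar>d m - d n\<bar> + \<delta> n)" if nm: "n \<le> m" for n m
    proof -
      let ?a = "?D (w n)" and ?b = "?D (w m)"
      have i: "integrable ?M (\<lambda>x. norm (?a x) powr p)" "integrable ?M (\<lambda>x. norm (?b x) powr p)"
        using wD(3) by (auto simp: in_Lp_def)
      have i2: "integrable ?M (\<lambda>x. norm ((1/2) *\<^sub>R (?a x + ?b x)) powr p)"
        using in_Lp_scaleR(1)[OF in_Lp_add(1)[OF wD(3)[of n] wD(3)[of m] p0(1)], of "1/2"] by (simp add: in_Lp_def)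
      have i3: "integrable ?M (\<lambda>x. norm (?a x - ?b x) powr p)"
        using in_Lp_diff(1)[OF wD(3)[of n] wD(3)[of m] p0(1)] by (simp add: in_Lp_def)
      have "Lp_int ?M p (\<lambda>x. ?a x - ?b x) \<le> (\<integral>x. e1 * (norm (?a x) powr p + norm (?b x) powr p)
          + C * ((norm (?a x) powr p + norm (?b x) powr p) / 2 - norm ((1/2) *\<^sub>R (?a x + ?b x)) powr p) \<partial>?M)"
        unfolding Lp_int_def using i i2 i3 C(2) by (intro integral_mono) auto
      also have "\<dots> = e1 * (?E (w n) + ?E (w m)) + C * ((?E (w n) + ?E (w m)) / 2 - Lp_int ?M p (\<lambda>x. (1/2) *\<^sub>R (?a x + ?b x)))"
        using i i2 by (simp add: Lp_int_def del: norm_scaleR scaleR_add_right)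
      also have "\<dots> \<le> e1 * (2 * M) + C * (\<bar>d m - d n\<bar> + \<delta> n)"
        using gap[OF nm] KD(3)[OF w(1)[of n]] KD(3)[OF w(1)[of m]] e1 C(1)
        by (intro add_mono mult_left_mono) auto
      finally show ?thesis .
    qed
    obtain N1 where N1: "\<And>m n. m \<ge> N1 \<Longrightarrow> n \<ge> N1 \<Longrightarrow> \<bar>d m - d n\<bar> < e / (4 * C)"
      using dC e C(1) unfolding Cauchy_def dist_real_def by (metis divide_pos_pos mult_pos_pos zero_less_numeral)
    obtain N2 where N2: "\<And>n. n \<ge> N2 \<Longrightarrow> \<delta> n < e / (8 * C)"
      using order_tendstoD(2)[OF \<delta>0, of "e / (8 * C)"] e C(1) by (auto simp: eventually_sequentially)
    have fin: "Lp_int ?M p (\<lambda>x. ?D (w n) x - ?D (w m) x) < e" if "n \<le> m" "n \<ge> max N1 N2" for n m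
    proof -
      have "e1 * (2 * M) \<le> e / 2" using e M0 by (simp add: e1_def field_simps)
      moreover have "C * (\<bar>d m - d n\<bar> + \<delta> n) < C * (e / (4 * C) + e / (8 * C))"
        using N1[of m n] N2[of n] that C(1) by (intro mult_strict_left_mono add_strict_mono) auto
      moreover have "C * (e / (4 * C) + e / (8 * C)) = 3 / 8 * e" using C(1) by (simp add: field_simps)
      ultimately show ?thesis using key[OF that(1)] e by linarith
    qed
    have sym: "Lp_int ?M p (\<lambda>x. ?D (w m) x - ?D (w n) x) = Lp_int ?M p (\<lambda>x. ?D (w n) x - ?D (w m) x)" for n m
      by (simp add: Lp_int_def norm_minus_commute)
    show ?thesis
    proof (intro exI[of _ "max N1 N2"] allI impI)
      fix m n assume "m \<ge> max N1 N2" "n \<ge> max N1 N2"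
      then show "Lp_int ?M p (\<lambda>x. ?D (w m) x - ?D (w n) x) < e"
        using fin[of n m] fin[of m n] sym[of m n] by (cases "n \<le> m") auto
    qed
  qed
  obtain F where F: "in_Lp ?M p F" "(\<lambda>n. Lp_int ?M p (\<lambda>x. ?D (w n) x - F x)) \<longlonglongrightarrow> 0"
    by (rule Lp_complete[OF wD(3) p0(2) cau])
  have wn0: "(\<lambda>n. Lp_nrm ?M p (w n)) \<longlonglongrightarrow> 0"
    by (rule tendsto_sandwich[OF _ _ tendsto_const \<delta>0]) (use KD(2)[OF w(1)] in \<open>auto simp: Lp_nrm_nonneg intro!: always_eventually\<close>)
  have lw: "(\<lambda>n. Lp_int ?M p (w n)) \<longlonglongrightarrow> 0"
  proof -
    have "(\<lambda>n. Lp_nrm ?M p (w n) powr p) \<longlonglongrightarrow> 0 powr p"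
      by (rule tendsto_powr'[OF wn0 tendsto_const]) (use p0 in \<open>auto simp: Lp_nrm_nonneg\<close>)
    then show ?thesis by (simp add: Lp_nrm_powr[OF p0(2)])
  qed
  have F0: "AE x in ?M. F x = 0" by (rule weak_gradient_closed[OF V p wD(1) wD(3) wD(2) lw F])
  have "Lp_int ?M p (\<lambda>x. ?D (w n) x - F x) = ?E (w n)" for n
  proof (rule in_Lp_cong_AE(2))
    show "(\<lambda>x. ?D (w n) x - F x) \<in> borel_measurable ?M" using in_Lp_diff(1)[OF wD(3) F(1) p0(1)] by (simp add: in_Lp_def)
    show "?D (w n) \<in> borel_measurable ?M" using wD(3) by (simp add: in_Lp_def)
    show "AE x in ?M. ?D (w n) x - F x = ?D (w n) x" using F0 by eventually_elim simp
  qed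
  then have E0: "(\<lambda>n. ?E (w n)) \<longlonglongrightarrow> 0" using F(2) by simp
  have "(\<lambda>n. Lp_nrm ?M p (?D (w n))) \<longlonglongrightarrow> 0 powr (1 / p)"
    unfolding Lp_nrm_def by (rule tendsto_powr'[OF E0 tendsto_const]) (use p0 in \<open>auto simp: Lp_int_nonneg\<close>)
  then have W0: "(\<lambda>n. W1_norm p V (w n)) \<longlonglongrightarrow> 0"
    unfolding W1_norm_eq using tendsto_add[OF wn0] by fastforce
  obtain C where "\<forall>u\<in>W1 (ennreal p) V. \<bar>l u\<bar> \<le> C * W1_norm p V u"
    using W1_dualD(3)[OF l] by (rule exE)
  then have C: "\<bar>l (w n)\<bar> \<le> C * W1_norm p V (w n)" for n using wW by (rule bspec)
  have "(\<lambda>n. C * W1_norm p V (w n)) \<longlonglongrightarrow> C * 0" by (intro tendsto_mult tendsto_const W0)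
  then have "c \<le> C * 0"
    by (rule LIMSEQ_le_const) (use order_trans[OF KD(4)[OF w(1)] order_trans[OF abs_ge_self C]] in blast)
  then show False using c by simp
qed

text \<open>If \<open>l (v n)\<close> failed to converge to \<open>l v0\<close>, then along a
  subsequence the difference would stay away from 0 with one sign \<open>s\<close>. The functions
  \<open>s\<close> times \<open>v n - v0\<close> would contradict
  \<open>W1_weak_compactness_aux\<close>.\<close>

lemma W1_weakly_convergesI:
  fixes v :: "nat \<Rightarrow> real^'n \<Rightarrow> real^'m"
  assumes V: "open V" "V \<in> lmeasurable" and p: "1 < p" and v: "\<And>k. v k \<in> W1 (ennreal p) V" "v0 \<in> W1 (ennreal p) V"
    and lim: "(\<lambda>k. Lp_int (lebesgue_on V) p (\<lambda>x. v k x - v0 x)) \<longlonglongrightarrow> 0"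
    and bd: "\<And>k. Lp_int (lebesgue_on V) p (weak_gradient V (v k)) \<le> M"
  shows "W1_weakly_converges p V v v0"
  unfolding W1_weakly_converges_def
proof (intro conjI allI ballI)
  show "v n \<in> W1 (ennreal p) V" "v0 \<in> W1 (ennreal p) V" for n by (rule v)+
  let ?M = "lebesgue_on V"
  fix l :: "(real^'n \<Rightarrow> real^'m) \<Rightarrow> real" assume l: "l \<in> W1_dual p V"
  have p0: "0 \<le> p" "0 < p" using p by auto
  \<comment> \<open>\<open>s\<close> is a sign, 1 or -1. The difference is written as a linear
    combination so that \<open>W1_lincomb\<close> applies.\<close>
  define zz where "zz s k x = s *\<^sub>R v k x + (- s) *\<^sub>R v0 x" for s k x
  note lc = W1_lincomb[OF V(1) p v(1) v(2)]
  have zW: "zz s k \<in> W1 (ennreal p) V" for s k unfolding zz_def[abs_def] by (rule lc(1))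
  have zl: "l (zz s k) = s * (l (v k) - l v0)" for s k
  proof -
    have "(\<lambda>x. s *\<^sub>R v k x) \<in> W1 (ennreal p) V" "(\<lambda>x. (- s) *\<^sub>R v0 x) \<in> W1 (ennreal p) V"
      using W1_lincomb(1)[OF V(1) p v(1) v(2), of s k 0] W1_lincomb(1)[OF V(1) p v(1) v(2), of 0 k "- s"] by simp_all
    from W1_dualD(1)[OF l this] have "l (zz s k) = l (\<lambda>x. s *\<^sub>R v k x) + l (\<lambda>x. (- s) *\<^sub>R v0 x)"
      by (simp add: zz_def[abs_def])
    also have "\<dots> = s * l (v k) + (- s) * l v0" by (simp only: W1_dualD(2)[OF l v(1)] W1_dualD(2)[OF l v(2)])
    finally show ?thesis by (simp add: algebra_simps)
  qed
  have gb: "Lp_int ?M p (weak_gradient V (zz s k)) \<le> 2 powr p * (M + Lp_int ?M p (weak_gradient V v0))" if s: "\<bar>s\<bar> = 1" for s k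
  proof -
    note d = W1_D(3)[OF V(1) p v(1), of k] W1_D(3)[OF V(1) p v(2)]
    have "Lp_int ?M p (weak_gradient V (zz s k)) = Lp_int ?M p (\<lambda>x. s *\<^sub>R weak_gradient V (v k) x + (- s) *\<^sub>R weak_gradient V v0 x)"
      unfolding zz_def[abs_def] by (rule lc(3))
    also have "\<dots> \<le> 2 powr p * (Lp_int ?M p (\<lambda>x. s *\<^sub>R weak_gradient V (v k) x) + Lp_int ?M p (\<lambda>x. (- s) *\<^sub>R weak_gradient V v0 x))"
      by (intro in_Lp_add(2) in_Lp_scaleR(1) d p0)
    also have "\<dots> = 2 powr p * (Lp_int ?M p (weak_gradient V (v k)) + Lp_int ?M p (weak_gradient V v0))"
      using s in_Lp_scaleR(2)[OF d(1), of s] in_Lp_scaleR(2)[OF d(2), of "- s"] by simp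
    also have "\<dots> \<le> 2 powr p * (M + Lp_int ?M p (weak_gradient V v0))"
      using bd by (intro mult_left_mono add_right_mono) auto
    finally show ?thesis .
  qed
  have zlim: "(\<lambda>k. Lp_int ?M p (zz s k)) \<longlonglongrightarrow> 0" if s: "\<bar>s\<bar> = 1" for s
  proof -
    have "zz s k = (\<lambda>x. s *\<^sub>R (v k x - v0 x))" for k by (simp add: zz_def fun_eq_iff scaleR_diff_right)
    then have "Lp_int ?M p (zz s k) = Lp_int ?M p (\<lambda>x. v k x - v0 x)" for k
      using s by (simp add: Lp_int_def)
    then show ?thesis using lim by simp
  qed
  show "(\<lambda>n. l (v n)) \<longlonglongrightarrow> l v0"
  proof (rule ccontr)
    assume "\<not> (\<lambda>n. l (v n)) \<longlonglongrightarrow> l v0"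
    then obtain c where c: "c > 0" "\<And>N. \<exists>n\<ge>N. c \<le> \<bar>l (v n) - l v0\<bar>"
      unfolding LIMSEQ_def dist_real_def by (meson linorder_not_le)
    have inf: "infinite {n. c \<le> \<bar>l (v n) - l v0\<bar>}"
      using c(2) by (auto simp: infinite_nat_iff_unbounded_le)
    have "{n. c \<le> \<bar>l (v n) - l v0\<bar>} = {n. c \<le> 1 * (l (v n) - l v0)} \<union> {n. c \<le> - 1 * (l (v n) - l v0)}"
      by auto
    then have "infinite {n. c \<le> 1 * (l (v n) - l v0)} \<or> infinite {n. c \<le> - 1 * (l (v n) - l v0)}"
      using inf by simp
    then obtain s :: real where s: "\<bar>s\<bar> = 1" "infinite {n. c \<le> s * (l (v n) - l v0)}"
      using that[of 1] that[of "- 1"] by auto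
    obtain r :: "nat \<Rightarrow> nat" where r: "strict_mono r" "\<And>n. r n \<in> {n. c \<le> s * (l (v n) - l v0)}"
      using infinite_enumerate[OF s(2)] by blast
    show False
    proof (rule W1_weak_compactness_aux[OF V p])
      show "zz s (r k) \<in> W1 (ennreal p) V" for k by (rule zW)
      show "(\<lambda>k. Lp_int ?M p (zz s (r k))) \<longlonglongrightarrow> 0"
        using LIMSEQ_subseq_LIMSEQ[OF zlim[OF s(1)] r(1)] by (simp add: o_def)
      show "Lp_int ?M p (weak_gradient V (zz s (r k))) \<le> 2 powr p * (M + Lp_int ?M p (weak_gradient V v0))" for k
        by (rule gb[OF s(1)])
      show "l \<in> W1_dual p V" by (rule l)
      show "0 < c" by (rule c)
      show "c \<le> l (zz s (r k))" for k using r(2)[of k] by (simp add: zl)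
    qed
  qed
qed

section \<open>Lower semicontinuity\<close>

lemma unit_cube_eq: "(unit_cube :: (real^'n) set) = box (\<chi> i. - 1 / 2) (\<chi> i. 1 / 2)"
  by (auto simp: unit_cube_def mem_box_cart)

lemma unit_cube_facts:
  "open (unit_cube :: (real^'n) set)" "(unit_cube :: (real^'n) set) \<in> lmeasurable"
  "(unit_cube :: (real^'n) set) \<in> sets lebesgue" "measure lebesgue (unit_cube :: (real^'n) set) = 1"
proof -
  show "open (unit_cube :: (real^'n) set)" "(unit_cube :: (real^'n) set) \<in> lmeasurable" "(unit_cube :: (real^'n) set) \<in> sets lebesgue"
    unfolding unit_cube_eq by (simp_all add: bounded_set_imp_lmeasurable open_box)
  have "measure lborel (cbox (\<chi> i. - 1 / 2) (\<chi> i. 1 / 2) :: (real^'n) set) = 1"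
    by (subst content_cbox_cart) (auto simp: interval_ne_empty_cart)
  then show "measure lebesgue (unit_cube :: (real^'n) set) = 1"
    unfolding unit_cube_eq by (simp add: measure_lborel_box_eq measure_lborel_cbox_eq)
qed

text \<open>Real-valued although \<open>L\<close> may be infinite, so that uniform continuity on
  bounded sets and arithmetic with errors make sense.\<close>

definition Ltrunc :: "('b \<Rightarrow> ennreal) \<Rightarrow> real \<Rightarrow> 'b \<Rightarrow> real"
  where "Ltrunc L K A = enn2real (min (L A) (ennreal K))"

lemma Ltrunc:
  assumes "0 \<le> K"
  shows "ennreal (Ltrunc L K A) = min (L A) (ennreal K)" "0 \<le> Ltrunc L K A" "Ltrunc L K A \<le> K"
proof -
  have "min (L A) (ennreal K) < top" by (simp add: min_less_iff_disj)
  then show e: "ennreal (Ltrunc L K A) = min (L A) (ennreal K)" by (simp add: Ltrunc_def)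
  show "0 \<le> Ltrunc L K A" by (simp add: Ltrunc_def)
  have "ennreal (Ltrunc L K A) \<le> ennreal K" unfolding e by simp
  then show "Ltrunc L K A \<le> K" using assms by simp
qed

lemma Ltrunc_continuous:
  assumes L: "continuous_on UNIV L" and K: "0 \<le> K"
  shows "continuous_on UNIV (Ltrunc L K)"
  unfolding continuous_on_def
proof
  fix A
  have "continuous_on UNIV (\<lambda>A. min (L A) (ennreal K))" by (intro continuous_intros L)
  then have "((\<lambda>A. min (L A) (ennreal K)) \<longlongrightarrow> min (L A) (ennreal K)) (at A within UNIV)"
    by (simp add: continuous_on_def)
  then have "((\<lambda>A. min (L A) (ennreal K)) \<longlongrightarrow> ennreal (Ltrunc L K A)) (at A within UNIV)" by (simp only: Ltrunc(1)[OF K])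
  from tendsto_enn2real[OF this Ltrunc(2)[OF K]]
  show "(Ltrunc L K \<longlongrightarrow> Ltrunc L K A) (at A within UNIV)" by (simp add: Ltrunc_def[abs_def])
qed

lemma Ltrunc_uniform:
  fixes L :: "'b::euclidean_space \<Rightarrow> ennreal"
  assumes L: "continuous_on UNIV L" and K: "0 \<le> K" and e: "0 < e"
  obtains \<eta> where "0 < \<eta>" "\<And>A B. norm A \<le> R \<Longrightarrow> norm (A - B) \<le> \<eta> \<Longrightarrow> \<bar>Ltrunc L K A - Ltrunc L K B\<bar> < e"
proof -
  \<comment> \<open>Only \<open>A\<close> is confined to the ball of radius \<open>R\<close>. The
    extra 1 leaves room for a \<open>B\<close> at distance at most 1, whence the minimum with 1
    below.\<close>
  have "uniformly_continuous_on (cball 0 (\<bar>R\<bar> + 1)) (Ltrunc L K)"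
    by (intro compact_uniformly_continuous continuous_on_subset[OF Ltrunc_continuous[OF L K]]) auto
  then obtain d where d: "0 < d" "\<And>A B. \<lbrakk>A \<in> cball 0 (\<bar>R\<bar> + 1); B \<in> cball 0 (\<bar>R\<bar> + 1); dist A B < d\<rbrakk> \<Longrightarrow> dist (Ltrunc L K A) (Ltrunc L K B) < e"
    unfolding uniformly_continuous_on_def using e by metis
  show ?thesis
  proof (rule that[of "min (d / 2) 1"])
    show "0 < min (d / 2) 1" using d by simp
    fix A B :: 'b assume A: "norm A \<le> R" and AB: "norm (A - B) \<le> min (d / 2) 1"
    have "norm B \<le> norm A + norm (A - B)" by (metis norm_triangle_sub norm_minus_commute)
    then show "\<bar>Ltrunc L K A - Ltrunc L K B\<bar> < e"
      using d(2)[of A B] A AB d(1) by (auto simp: dist_norm)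
  qed
qed

text \<open>Where the gradient \<open>G n\<close> is bounded, close to the gradient
  \<open>H n\<close> of the competitor, and of moderate \<open>L\<close>-value, uniform continuity
  bounds \<open>L (H n y)\<close> by \<open>L (G n y)\<close> plus a small error. Equi-integrability
  absorbs the remaining set, and quasiconvexity is applied to the competitor. The index is only
  claimed to exist beyond every \<open>N\<close>, as the condition provides a subsequence.\<close>

lemma condition_C_lower_bound:
  fixes L :: "real^'n^'m \<Rightarrow> ennreal"
  assumes p: "1 < p" and L: "continuous_on UNIV L" and qc: "W1_quasiconvex q L" and C: "condition_C p q L"
    and w: "W1_weakly_converges p unit_cube v (\<lambda>y. \<xi> *v y)"
    and eb: "\<And>n. energy L unit_cube (v n) \<le> ennreal K" and K: "0 \<le> K"
    and gb: "\<And>n. Lp_int (lebesgue_on unit_cube) p (weak_gradient unit_cube (v n)) \<le> M" and e: "0 < e"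
  shows "\<exists>n\<ge>N. L \<xi> \<le> energy L unit_cube (v n) + ennreal e"
proof -
  let ?M = "lebesgue_on (unit_cube :: (real^'n) set)"
  note Y = unit_cube_facts[where 'n='n]
  have p0: "0 < p" using p by simp
  have "(SUP n. energy L unit_cube (v n)) \<le> ennreal K" by (rule SUP_least[OF eb])
  then have "(SUP n. energy L unit_cube (v n)) < \<infinity>" by (simp add: le_less_trans)
  then obtain r :: "nat \<Rightarrow> nat" and ww where r: "strict_mono r" and ww: "\<And>n. ww n \<in> affine_W1_zero q \<xi>"
    and cm: "converges_to_zero_in_measure ?M (\<lambda>n y. norm (weak_gradient unit_cube (v (r n)) y - weak_gradient unit_cube (ww n) y))"
    and ei: "equi_integrable ?M (\<lambda>n y. L (weak_gradient unit_cube (ww n) y))"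
    using C w unfolding condition_C_def by blast
  define G where "G n = weak_gradient unit_cube (v (r n))" for n
  define H where "H n = weak_gradient unit_cube (ww n)" for n
  have vW: "v n \<in> W1 (ennreal p) unit_cube" for n using w by (simp add: W1_weakly_converges_def)
  have GL: "in_Lp ?M p (G n)" for n unfolding G_def by (rule W1_D(3)[OF Y(1) p vW])
  have [measurable]: "G n \<in> borel_measurable ?M" for n using GL by (simp add: in_Lp_def)
  have [measurable]: "L \<in> borel_measurable borel" by (rule borel_measurable_continuous_onI[OF L])
  have [measurable]: "(\<lambda>y. L (H n y)) \<in> borel_measurable ?M" for n
    using ei by (simp add: equi_integrable_def H_def)
  have [measurable]: "(\<lambda>y. norm (G n y - H n y)) \<in> borel_measurable ?M" for n
    using cm by (simp add: converges_to_zero_in_measure_def H_def G_def)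
  have eb': "(\<integral>\<^sup>+y. L (G n y) \<partial>?M) \<le> ennreal K" for n using eb[of "r n"] by (simp add: energy_def G_def)
  have "\<exists>\<delta>::real. \<delta> > 0 \<and> (\<forall>n. \<forall>E \<in> sets ?M. emeasure ?M E < ennreal \<delta> \<longrightarrow> (\<integral>\<^sup>+ y \<in> E. L (H n y) \<partial>?M) < ennreal (e / 2))"
    using ei[unfolded equi_integrable_def, THEN conjunct2, rule_format, OF half_gt_zero[OF e]] unfolding H_def .
  then obtain \<delta> :: real where \<delta>0: "0 < \<delta>" "\<forall>n. \<forall>E \<in> sets ?M. emeasure ?M E < ennreal \<delta> \<longrightarrow> (\<integral>\<^sup>+ y \<in> E. L (H n y) \<partial>?M) < ennreal (e / 2)"
    by (elim exE conjE)
  note \<delta> = \<delta>0(1) \<delta>0(2)[rule_format]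
  have M0: "0 \<le> M" using gb[of 0] Lp_int_nonneg order_trans by blast
  \<comment> \<open>\<open>M'\<close> and \<open>K'\<close> are Markov thresholds: the sets where
    the gradient, respectively its \<open>L\<close>-value, exceeds them have measure below
    \<open>\<delta> / 3\<close>. Together with the set from convergence in measure they stay below
    \<delta>. The summand 1 at the end keeps the thresholds positive.\<close>
  define M' where "M' = (3 * (M + 1) / \<delta> + 1) powr (1 / p)"
  have M': "0 < M'" "M' powr p = 3 * (M + 1) / \<delta> + 1"
  proof -
    have "0 < 3 * (M + 1) / \<delta> + 1" using M0 \<delta>(1) by (intro add_nonneg_pos divide_nonneg_pos) auto
    then show "0 < M'" "M' powr p = 3 * (M + 1) / \<delta> + 1" using p0 by (simp_all add: M'_def powr_powr)
  qed
  define K' where "K' = 3 * (K + 1) / \<delta> + 1"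
  have K': "0 < K'" using K \<delta>(1) by (simp add: K'_def add_nonneg_pos)
  have third: "x / (3 * (x + 1) / \<delta> + 1) < \<delta> / 3" if "0 \<le> x" for x
  proof -
    have pos: "0 < 3 * (x + 1) / \<delta> + 1" using that \<delta>(1) by (simp add: add_nonneg_pos)
    have "\<delta> / 3 * (3 * (x + 1) / \<delta> + 1) = x + 1 + \<delta> / 3" using \<delta>(1) by (simp add: field_simps)
    then show ?thesis using pos \<delta>(1) by (simp add: pos_divide_less_eq)
  qed
  \<comment> \<open>The truncation level exceeds \<open>K'\<close> by 1 and the oscillation is at
    most \<open>1/2\<close>. So at a matrix near one with \<open>L\<close>-value below
    \<open>K'\<close> the truncated value stays below the level, hence equals \<open>L\<close>; in
    particular \<open>L\<close> is finite there.\<close>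
  obtain \<eta> where \<eta>: "0 < \<eta>" "\<And>A B. norm A \<le> M' \<Longrightarrow> norm (A - B) \<le> \<eta> \<Longrightarrow> \<bar>Ltrunc L (K' + 1) A - Ltrunc L (K' + 1) B\<bar> < min (e / 2) (1 / 2)"
    using Ltrunc_uniform[OF L, of "K' + 1" "min (e / 2) (1 / 2)" M'] K' e by auto
  have "(\<lambda>n. emeasure ?M {y \<in> space ?M. \<bar>norm (G n y - H n y)\<bar> > \<eta>}) \<longlonglongrightarrow> 0"
    using cm \<eta>(1) by (simp add: converges_to_zero_in_measure_def G_def H_def)
  then have "eventually (\<lambda>n. emeasure ?M {y \<in> space ?M. \<bar>norm (G n y - H n y)\<bar> > \<eta>} < ennreal (\<delta> / 3)) sequentially"
    using \<delta>(1) by (intro order_tendstoD(2)) auto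
  then obtain N2 where N2: "\<And>n. n \<ge> N2 \<Longrightarrow> emeasure ?M {y \<in> space ?M. norm (G n y - H n y) > \<eta>} < ennreal (\<delta> / 3)"
    by (auto simp: eventually_sequentially)
  define n where "n = max N N2"
  define E1 where "E1 = {y \<in> space ?M. norm (G n y) \<ge> M'}"
  define E2 where "E2 = {y \<in> space ?M. norm (G n y - H n y) > \<eta>}"
  define E3 where "E3 = {y \<in> space ?M. L (G n y) \<ge> ennreal K'}"
  define E where "E = E1 \<union> E2 \<union> E3"
  have Es: "E1 \<in> sets ?M" "E2 \<in> sets ?M" "E3 \<in> sets ?M" unfolding E1_def E2_def E3_def by measurable
  have m1: "emeasure ?M E1 < ennreal (\<delta> / 3)"
  proof -
    have "emeasure ?M E1 \<le> ennreal (Lp_int ?M p (G n) / M' powr p)"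
      unfolding E1_def by (rule Lp_Markov[OF GL M'(1) p0])
    also have "\<dots> \<le> ennreal (M / M' powr p)" using gb[of "r n"] by (intro ennreal_leI divide_right_mono) (auto simp: G_def)
    also have "\<dots> < ennreal (\<delta> / 3)" unfolding M'(2) using third[OF M0] \<delta>(1) by (simp add: ennreal_lessI)
    finally show ?thesis .
  qed
  have m3: "emeasure ?M E3 < ennreal (\<delta> / 3)"
  proof -
    have "ennreal K' * emeasure ?M E3 = (\<integral>\<^sup>+y. ennreal K' * indicator E3 y \<partial>?M)"
      using Es(3) by (simp add: nn_integral_cmult_indicator)
    also have "\<dots> \<le> (\<integral>\<^sup>+y. L (G n y) \<partial>?M)"
      by (rule nn_integral_mono) (auto simp: E3_def indicator_def)
    also have "\<dots> \<le> ennreal K" by (rule eb')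
    finally have "ennreal K' * emeasure ?M E3 \<le> ennreal K" .
    then have "ennreal (1 / K') * (ennreal K' * emeasure ?M E3) \<le> ennreal (1 / K') * ennreal K" by (rule mult_left_mono) simp
    then have "emeasure ?M E3 \<le> ennreal (K / K')"
      using K' K by (simp add: mult.assoc[symmetric] ennreal_mult[symmetric])
    also have "\<dots> < ennreal (\<delta> / 3)" unfolding K'_def using third[OF K] \<delta>(1) by (simp add: ennreal_lessI)
    finally show ?thesis .
  qed
  have "emeasure ?M E \<le> emeasure ?M E1 + emeasure ?M E2 + emeasure ?M E3"
    unfolding E_def using Es by (intro order_trans[OF emeasure_subadditive] add_right_mono emeasure_subadditive) auto
  also have "\<dots> < ennreal (\<delta> / 3 + \<delta> / 3 + \<delta> / 3)"
    unfolding E2_def by (intro add_mono_ennreal m1 m3 N2) (simp add: n_def)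
  also have "\<dots> = ennreal \<delta>" by simp
  finally have mE: "emeasure ?M E < ennreal \<delta>" .
  have ES: "E \<in> sets ?M" using Es by (simp add: E_def)
  have pw: "L (H n y) \<le> L (G n y) + ennreal (e / 2)" if y: "y \<in> space ?M" "y \<notin> E" for y
  proof -
    have g: "norm (G n y) \<le> M'" "norm (G n y - H n y) \<le> \<eta>" "L (G n y) < ennreal K'"
      using y by (auto simp: E_def E1_def E2_def E3_def not_le)
    let ?T = "Ltrunc L (K' + 1)"
    have K1: "0 \<le> K' + 1" using K' by simp
    have cl: "\<bar>?T (G n y) - ?T (H n y)\<bar> < min (e / 2) (1 / 2)" by (rule \<eta>(2)[OF g(1,2)])
    have "ennreal K' \<le> ennreal (K' + 1)" by (intro ennreal_leI) simp
    then have TG: "ennreal (?T (G n y)) = L (G n y)" using g(3) by (simp add: Ltrunc(1)[OF K1] min_absorb1)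
    then have "?T (G n y) < K'" using g(3) K' by (metis Ltrunc(2)[OF K1] ennreal_less_iff)
    then have "?T (H n y) < K' + 1" using cl by linarith
    then have "ennreal (?T (H n y)) < ennreal (K' + 1)" using K' by (intro ennreal_lessI) auto
    then have "L (H n y) = ennreal (?T (H n y))" unfolding Ltrunc(1)[OF K1] by (auto simp: min_def split: if_splits)
    also have "\<dots> \<le> ennreal (?T (G n y) + e / 2)" using cl by (intro ennreal_leI) linarith
    also have "\<dots> = L (G n y) + ennreal (e / 2)"
      unfolding TG[symmetric] by (rule ennreal_plus) (use Ltrunc(2)[OF K1] e in auto)
    finally show ?thesis .
  qed
  have "L \<xi> \<le> energy L unit_cube (ww n)" using qc ww unfolding W1_quasiconvex_def by blast
  also have "\<dots> = (\<integral>\<^sup>+y. L (H n y) \<partial>?M)" by (simp add: energy_def H_def)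
  also have "\<dots> \<le> (\<integral>\<^sup>+y. L (H n y) * indicator E y + (L (G n y) + ennreal (e / 2)) \<partial>?M)"
    by (rule nn_integral_mono) (use pw in \<open>auto simp: indicator_def\<close>)
  also have "\<dots> = (\<integral>\<^sup>+y. L (H n y) * indicator E y \<partial>?M) + ((\<integral>\<^sup>+y. L (G n y) \<partial>?M) + (\<integral>\<^sup>+y. ennreal (e / 2) \<partial>?M))"
    using ES by (simp add: nn_integral_add)
  also have "(\<integral>\<^sup>+y. ennreal (e / 2) \<partial>?M) = ennreal (e / 2)"
  proof -
    have "emeasure lebesgue (unit_cube :: (real^'n) set) = 1"
      using Y(2,4) emeasure_eq_measure2[OF Y(2)] by simp
    then show ?thesis using Y(3) by (simp add: emeasure_restrict_space)
  qed
  also have "(\<integral>\<^sup>+y. L (H n y) * indicator E y \<partial>?M) + ((\<integral>\<^sup>+y. L (G n y) \<partial>?M) + ennreal (e / 2))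
     \<le> ennreal (e / 2) + ((\<integral>\<^sup>+y. L (G n y) \<partial>?M) + ennreal (e / 2))"
    using \<delta>(2)[OF ES mE, of n] by (intro add_right_mono) simp
  also have "\<dots> = (\<integral>\<^sup>+y. L (G n y) \<partial>?M) + (ennreal (e / 2) + ennreal (e / 2))" by (simp only: ac_simps)
  also have "ennreal (e / 2) + ennreal (e / 2) = ennreal e" using e by (simp add: ennreal_plus[symmetric] del: ennreal_plus)
  finally have "L \<xi> \<le> energy L unit_cube (v (r n)) + ennreal e" by (simp add: energy_def G_def)
  moreover have "r n \<ge> N" using seq_suble[OF r, of n] by (simp add: n_def)
  ultimately show ?thesis by blast
qed

lemma norm_matrix_vector_le:
  fixes A :: "real^'n^'m"
  shows "norm (A *v y) \<le> real CARD('m) * norm A * norm y"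
proof -
  have "norm (A *v y) \<le> (\<Sum>i\<in>UNIV. \<bar>(A *v y) $ i\<bar>)" by (rule norm_le_l1_cart)
  also have "\<dots> \<le> (\<Sum>i\<in>(UNIV :: 'm set). norm A * norm y)"
  proof (rule sum_mono)
    fix i
    have "\<bar>(A *v y) $ i\<bar> = \<bar>(A $ i) \<bullet> y\<bar>" by (simp add: matrix_vector_mul_component)
    also have "\<dots> \<le> norm (A $ i) * norm y" by (rule Cauchy_Schwarz_ineq2)
    also have "\<dots> \<le> norm A * norm y" by (intro mult_right_mono Finite_Cartesian_Product.norm_nth_le) simp
    finally show "\<bar>(A *v y) $ i\<bar> \<le> norm A * norm y" .
  qed
  finally show ?thesis by simp
qed

lemma in_Lp_affine:
  fixes \<xi> :: "real^'n^'m"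
  assumes V: "V \<in> lmeasurable" "bounded V" and p: "0 \<le> p"
  shows "in_Lp (lebesgue_on V) p (\<lambda>y. \<xi> *v y + k)"
proof -
  obtain R where R: "\<And>y. y \<in> V \<Longrightarrow> norm y \<le> R" using V(2) by (auto simp: bounded_iff)
  have m: "(\<lambda>y. \<xi> *v y + k) \<in> borel_measurable (lebesgue_on V)"
    by (intro measurable_restrict_space1 continuous_borel_lebesgue continuous_intros linear_continuous_on linear_conv_bounded_linear[THEN iffD1] matrix_vector_mul_linear)
  show ?thesis
  proof (rule in_Lp_bound(1)[OF in_Lp_const(1)[OF finite_measure_lebesgue_on[OF V(1)], of p "real CARD('m) * norm \<xi> * \<bar>R\<bar> + norm k"] m _ p])
    show "AE y in lebesgue_on V. norm (\<xi> *v y + k) \<le> norm (real CARD('m) * norm \<xi> * \<bar>R\<bar> + norm k)"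
    proof (rule AE_I2)
      fix y assume "y \<in> space (lebesgue_on V)"
      then have "norm y \<le> \<bar>R\<bar>" using R[of y] by simp
      then have "real CARD('m) * norm \<xi> * norm y \<le> real CARD('m) * norm \<xi> * \<bar>R\<bar>" by (intro mult_left_mono) auto
      then have "norm (\<xi> *v y + k) \<le> real CARD('m) * norm \<xi> * \<bar>R\<bar> + norm k"
        using norm_matrix_vector_le[of \<xi> y] norm_triangle_ineq[of "\<xi> *v y" k] by linarith
      then show "norm (\<xi> *v y + k) \<le> norm (real CARD('m) * norm \<xi> * \<bar>R\<bar> + norm k)" by simp
    qed
  qed
qed

text \<open>Counterexamples for \<delta> tending to 0 have, after passing to a subsequence,
  convergent matrices; the functions then approach one linear map in \<open>Lp\<close> with bounded
  gradients, hence weakly, and \<open>condition_C_lower_bound\<close> applies.\<close>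

lemma uniform_lower_bound:
  fixes L :: "real^'n^'m \<Rightarrow> ennreal"
  assumes p: "1 < p" and L: "continuous_on UNIV L" and qc: "W1_quasiconvex q L" and C: "condition_C p q L"
    and K: "0 \<le> K" and e: "0 < e"
  obtains \<delta> where "0 < \<delta>"
    "\<And>\<xi> v. \<lbrakk>norm \<xi> \<le> R; v \<in> W1 (ennreal p) unit_cube; Lp_int (lebesgue_on unit_cube) p (weak_gradient unit_cube v) \<le> M;
       Lp_int (lebesgue_on unit_cube) p (\<lambda>y. v y - \<xi> *v y) \<le> \<delta>\<rbrakk>
     \<Longrightarrow> ennreal (Ltrunc L K \<xi>) \<le> energy L unit_cube v + ennreal e"
proof (rule ccontr)
  let ?M = "lebesgue_on (unit_cube :: (real^'n) set)"
  note Y = unit_cube_facts[where 'n='n]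
  have bY: "bounded (unit_cube :: (real^'n) set)" unfolding unit_cube_eq by (rule bounded_box)
  have p0: "0 < p" "0 \<le> p" using p by auto
  assume neg: "\<not> thesis"
  define Bad where "Bad k \<xi> v \<longleftrightarrow> norm \<xi> \<le> R \<and> v \<in> W1 (ennreal p) unit_cube \<and> Lp_int ?M p (weak_gradient unit_cube v) \<le> M \<and>
       Lp_int ?M p (\<lambda>y. v y - \<xi> *v y) \<le> 1 / real (Suc k) \<and> \<not> ennreal (Ltrunc L K \<xi>) \<le> energy L unit_cube v + ennreal e"
    for k :: nat and \<xi> :: "real^'n^'m" and v
  have "\<exists>\<xi> v. Bad k \<xi> v" for k
  proof (rule ccontr)
    assume "\<nexists>\<xi> v. Bad k \<xi> v"
    then have "thesis" by (intro that[of "1 / real (Suc k)"]) (auto simp: Bad_def)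
    then show False using neg by simp
  qed
  then obtain x v where xv: "\<And>k. Bad k (x k) (v k)" by metis
  have "compact (cball (0 :: real^'n^'m) R)" by simp
  moreover have "\<forall>k. x k \<in> cball 0 R" using xv by (auto simp: Bad_def)
  ultimately obtain \<xi> r where \<xi>: "strict_mono r" "(x \<circ> r) \<longlonglongrightarrow> \<xi>"
    unfolding compact_def by metis
  define u where "u k = v (r k)" for k
  define \<zeta> where "\<zeta> k = x (r k)" for k
  have \<zeta>: "\<zeta> \<longlonglongrightarrow> \<xi>" using \<xi>(2) by (simp add: \<zeta>_def[abs_def] o_def)
  have u: "u k \<in> W1 (ennreal p) unit_cube" "Lp_int ?M p (weak_gradient unit_cube (u k)) \<le> M"
    "Lp_int ?M p (\<lambda>y. u k y - \<zeta> k *v y) \<le> 1 / real (Suc (r k))"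
    "energy L unit_cube (u k) + ennreal e < ennreal (Ltrunc L K (\<zeta> k))" for k
    using xv[of "r k"] by (auto simp: Bad_def u_def \<zeta>_def not_le)
  have lin: "in_Lp ?M p (\<lambda>y. A *v y)" for A :: "real^'n^'m" using in_Lp_affine[OF Y(2) bY p0(2), of A 0] by simp
  have lW: "(\<lambda>y. \<xi> *v y) \<in> W1 (ennreal p) unit_cube"
    by (rule W1_intro(1)[OF Y(1) p lin in_Lp_const(1)[OF finite_measure_lebesgue_on[OF Y(2)]]])
       (use has_weak_gradient_linear[OF Y(1), of \<xi> 0] in simp)
  have conv: "(\<lambda>k. Lp_int ?M p (\<lambda>y. u k y - \<xi> *v y)) \<longlonglongrightarrow> 0"
  proof -
    obtain b where b: "\<And>y. y \<in> (unit_cube :: (real^'n) set) \<Longrightarrow> norm y \<le> b" using bY by (auto simp: bounded_iff)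
    have b2: "Lp_int ?M p (\<lambda>y. (\<zeta> k - \<xi>) *v y) \<le> (real CARD('m) * norm (\<zeta> k - \<xi>) * \<bar>b\<bar>) powr p" for k
    proof -
      have "Lp_int ?M p (\<lambda>y. (\<zeta> k - \<xi>) *v y) \<le> Lp_int ?M p (\<lambda>y. real CARD('m) * norm (\<zeta> k - \<xi>) * \<bar>b\<bar>)"
      proof (rule in_Lp_bound(2)[OF in_Lp_const(1)[OF finite_measure_lebesgue_on[OF Y(2)]] _ _ p0(2)])
        show "(\<lambda>y. (\<zeta> k - \<xi>) *v y) \<in> borel_measurable ?M" using lin by (simp add: in_Lp_def)
        show "AE y in ?M. norm ((\<zeta> k - \<xi>) *v y) \<le> norm (real CARD('m) * norm (\<zeta> k - \<xi>) * \<bar>b\<bar>)"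
        proof (rule AE_I2)
          fix y assume "y \<in> space ?M"
          then have "norm y \<le> \<bar>b\<bar>" using b[of y] by simp
          then have "real CARD('m) * norm (\<zeta> k - \<xi>) * norm y \<le> real CARD('m) * norm (\<zeta> k - \<xi>) * \<bar>b\<bar>" by (intro mult_left_mono) auto
          then show "norm ((\<zeta> k - \<xi>) *v y) \<le> norm (real CARD('m) * norm (\<zeta> k - \<xi>) * \<bar>b\<bar>)"
            using order_trans[OF norm_matrix_vector_le[of "\<zeta> k - \<xi>" y]] by (simp add: abs_mult)
        qed
      qed
      also have "\<dots> = (real CARD('m) * norm (\<zeta> k - \<xi>) * \<bar>b\<bar>) powr p"
        using in_Lp_const(2)[OF finite_measure_lebesgue_on[OF Y(2)], of p "real CARD('m) * norm (\<zeta> k - \<xi>) * \<bar>b\<bar>"] Y(3,4)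
        by (simp add: measure_restrict_space abs_mult)
      finally show ?thesis .
    qed
    have bd: "Lp_int ?M p (\<lambda>y. u k y - \<xi> *v y) \<le> 2 powr p * (1 / real (Suc k) + (real CARD('m) * norm (\<zeta> k - \<xi>) * \<bar>b\<bar>) powr p)" for k
    proof -
      have "1 / real (Suc (r k)) \<le> 1 / real (Suc k)" using seq_suble[OF \<xi>(1), of k] by (simp add: frac_le)
      then have "Lp_int ?M p (\<lambda>y. u k y - \<zeta> k *v y) \<le> 1 / real (Suc k)" using u(3)[of k] by linarith
      then have "2 powr p * (Lp_int ?M p (\<lambda>y. u k y - \<zeta> k *v y) + Lp_int ?M p (\<lambda>y. (\<zeta> k - \<xi>) *v y))
        \<le> 2 powr p * (1 / real (Suc k) + (real CARD('m) * norm (\<zeta> k - \<xi>) * \<bar>b\<bar>) powr p)"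
        using b2[of k] by (intro mult_left_mono add_mono) auto
      moreover have "Lp_int ?M p (\<lambda>y. (u k y - \<zeta> k *v y) + (\<zeta> k - \<xi>) *v y) \<le> 2 powr p * (Lp_int ?M p (\<lambda>y. u k y - \<zeta> k *v y) + Lp_int ?M p (\<lambda>y. (\<zeta> k - \<xi>) *v y))"
        by (intro in_Lp_add(2) in_Lp_diff(1) lin p0 W1_D(1)[OF Y(1) p u(1)])
      moreover have eq: "(\<lambda>y. u k y - \<xi> *v y) = (\<lambda>y. (u k y - \<zeta> k *v y) + (\<zeta> k - \<xi>) *v y)"
        by (auto simp: matrix_vector_mult_diff_rdistrib)
      ultimately show ?thesis unfolding eq by linarith
    qed
    have "(\<lambda>k. norm (\<zeta> k - \<xi>)) \<longlonglongrightarrow> 0" using \<zeta> by (simp add: LIM_zero tendsto_norm_zero)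
    then have c0: "(\<lambda>k. real CARD('m) * norm (\<zeta> k - \<xi>) * \<bar>b\<bar>) \<longlonglongrightarrow> 0"
      by (intro tendsto_mult_left_zero tendsto_mult_right_zero)
    have "(\<lambda>k. (real CARD('m) * norm (\<zeta> k - \<xi>) * \<bar>b\<bar>) powr p) \<longlonglongrightarrow> 0 powr p"
      by (rule tendsto_powr'[OF c0 tendsto_const]) (use p0 in \<open>auto intro!: always_eventually\<close>)
    then have "(\<lambda>k. 2 powr p * (1 / real (Suc k) + (real CARD('m) * norm (\<zeta> k - \<xi>) * \<bar>b\<bar>) powr p)) \<longlonglongrightarrow> 2 powr p * (0 + 0)"
      by (intro tendsto_mult tendsto_add tendsto_const LIMSEQ_Suc[OF lim_1_over_n]) simp
    then have t0: "(\<lambda>k. 2 powr p * (1 / real (Suc k) + (real CARD('m) * norm (\<zeta> k - \<xi>) * \<bar>b\<bar>) powr p)) \<longlonglongrightarrow> 0" by simp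
    show ?thesis
      by (rule tendsto_sandwich[OF _ _ tendsto_const t0]) (use bd in \<open>auto simp: Lp_int_nonneg intro!: always_eventually\<close>)
  qed
  have wk: "W1_weakly_converges p unit_cube u (\<lambda>y. \<xi> *v y)"
    by (rule W1_weakly_convergesI[OF Y(1,2) p u(1) lW conv u(2)])
  \<comment> \<open>A counterexample has energy below a value of the truncated integrand, hence at
    most \<open>K\<close>. This is where truncation supplies the energy bound of
    \<open>condition_C\<close>.\<close>
  have eb: "energy L unit_cube (u n) \<le> ennreal K" for n
  proof -
    have "energy L unit_cube (u n) \<le> energy L unit_cube (u n) + ennreal e" by simp
    also have "\<dots> \<le> ennreal (Ltrunc L K (\<zeta> n))" using u(4)[of n] by simp
    also have "\<dots> \<le> ennreal K" by (intro ennreal_leI Ltrunc(3) K)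
    finally show ?thesis .
  qed
  have "(\<lambda>k. Ltrunc L K (\<zeta> k)) \<longlonglongrightarrow> Ltrunc L K \<xi>"
    using Ltrunc_continuous[OF L K] \<zeta> by (intro isCont_tendsto_compose[of \<xi> "Ltrunc L K"]) (auto simp: continuous_on_eq_continuous_at)
  then have "eventually (\<lambda>k. Ltrunc L K (\<zeta> k) < Ltrunc L K \<xi> + e / 2) sequentially"
    using e by (intro order_tendstoD(2)) auto
  then obtain N where N: "\<And>k. k \<ge> N \<Longrightarrow> Ltrunc L K (\<zeta> k) < Ltrunc L K \<xi> + e / 2" by (auto simp: eventually_sequentially)
  \<comment> \<open>The lower bound is used with \<open>e / 2\<close>; the other half pays for
    replacing the matrix \<open>\<zeta> n\<close> by its limit.\<close>
  obtain n where n: "n \<ge> N" "L \<xi> \<le> energy L unit_cube (u n) + ennreal (e / 2)"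
    using condition_C_lower_bound[OF p L qc C wk eb K u(2), of "e / 2" N] e by auto
  have "ennreal (Ltrunc L K (\<zeta> n)) \<le> ennreal (Ltrunc L K \<xi> + e / 2)" using N[OF n(1)] by (intro ennreal_leI) simp
  also have "\<dots> = ennreal (Ltrunc L K \<xi>) + ennreal (e / 2)" by (rule ennreal_plus) (use Ltrunc(2)[OF K] e in auto)
  also have "\<dots> \<le> L \<xi> + ennreal (e / 2)" unfolding Ltrunc(1)[OF K] by (intro add_right_mono) simp
  also have "\<dots> \<le> (energy L unit_cube (u n) + ennreal (e / 2)) + ennreal (e / 2)" by (intro add_right_mono n)
  also have "\<dots> = energy L unit_cube (u n) + ennreal e" using e by (simp add: add.assoc ennreal_plus[symmetric] del: ennreal_plus)
  finally show False using u(4)[of n] by simp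
qed

section \<open>Estimates on a single cube\<close>

lemma sum_Lp_int_disjoint_le:
  fixes g :: "'a::euclidean_space \<Rightarrow> 'b::euclidean_space"
  assumes I: "finite I" and W: "W \<in> sets lebesgue" and S: "\<And>i. i \<in> I \<Longrightarrow> S i \<in> sets lebesgue \<and> S i \<subseteq> W"
    and dj: "disjoint_family_on S I" and g: "in_Lp (lebesgue_on W) p g"
  shows "(\<Sum>i\<in>I. Lp_int (lebesgue_on (S i)) p g) \<le> Lp_int (lebesgue_on W) p g"
proof -
  let ?f = "\<lambda>x. norm (g x) powr p"
  have fW: "set_integrable lebesgue W ?f" using g W by (simp add: in_Lp_def set_integrable_def integrable_restrict_space)
  have fS: "set_integrable lebesgue (S i) ?f" if "i \<in> I" for i
    using set_integrable_subset[OF fW] S[OF that] by blast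
  have "(\<Sum>i\<in>I. Lp_int (lebesgue_on (S i)) p g) = (\<Sum>i\<in>I. \<integral>x. indicator (S i) x *\<^sub>R ?f x \<partial>lebesgue)"
    using S by (intro sum.cong) (auto simp: Lp_int_def integral_restrict_space)
  also have "\<dots> = (\<integral>x. (\<Sum>i\<in>I. indicator (S i) x *\<^sub>R ?f x) \<partial>lebesgue)"
    using fS by (intro Bochner_Integration.integral_sum[symmetric]) (auto simp: set_integrable_def)
  also have "\<dots> \<le> (\<integral>x. indicator W x *\<^sub>R ?f x \<partial>lebesgue)"
  proof (rule integral_mono)
    show "integrable lebesgue (\<lambda>x. \<Sum>i\<in>I. indicator (S i) x *\<^sub>R ?f x)"
      using fS by (intro Bochner_Integration.integrable_sum) (auto simp: set_integrable_def)
    show "integrable lebesgue (\<lambda>x. indicator W x *\<^sub>R ?f x)" using fW by (simp add: set_integrable_def)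
    fix x
    have "(\<Sum>i\<in>I. indicator (S i) x :: real) = indicator (\<Union>i\<in>I. S i) x"
      by (rule indicator_UN_disjoint[OF I dj, symmetric])
    also have "\<dots> \<le> indicator W x" using S by (auto simp: indicator_def)
    finally show "(\<Sum>i\<in>I. indicator (S i) x *\<^sub>R ?f x) \<le> indicator W x *\<^sub>R ?f x"
      by (simp add: sum_distrib_right[symmetric] mult_right_mono del: sum_indicator_eq_card)
  qed
  also have "\<dots> = Lp_int (lebesgue_on W) p g" using W by (simp add: Lp_int_def integral_restrict_space)
  finally show ?thesis .
qed

lemma sum_nn_integral_disjoint:
  fixes f :: "'a::euclidean_space \<Rightarrow> ennreal"
  assumes I: "finite I" and W: "W \<in> sets lebesgue" and S: "\<And>i. i \<in> I \<Longrightarrow> S i \<in> sets lebesgue \<and> S i \<subseteq> W"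
    and dj: "disjoint_family_on S I" and f: "f \<in> borel_measurable (lebesgue_on W)"
  shows "(\<Sum>i\<in>I. \<integral>\<^sup>+x. f x \<partial>lebesgue_on (S i)) = (\<integral>\<^sup>+x. f x * indicator (\<Union>i\<in>I. S i) x \<partial>lebesgue_on W)"
proof -
  have r: "lebesgue_on (S i) = restrict_space (lebesgue_on W) (S i)" if "i \<in> I" for i
    using S[OF that] W by (simp add: restrict_restrict_space Int_absorb1)
  have SS: "S i \<in> sets (lebesgue_on W)" if "i \<in> I" for i using S[OF that] W by (simp add: sets_restrict_space_iff)
  have "(\<Sum>i\<in>I. \<integral>\<^sup>+x. f x \<partial>lebesgue_on (S i)) = (\<Sum>i\<in>I. \<integral>\<^sup>+x. f x * indicator (S i) x \<partial>lebesgue_on W)"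
  proof (rule sum.cong[OF refl])
    fix i assume i: "i \<in> I"
    show "(\<integral>\<^sup>+x. f x \<partial>lebesgue_on (S i)) = (\<integral>\<^sup>+x. f x * indicator (S i) x \<partial>lebesgue_on W)"
      unfolding r[OF i] by (rule nn_integral_restrict_space) (use SS[OF i] S[OF i] in \<open>simp add: Int_absorb2\<close>)
  qed
  also have "\<dots> = (\<integral>\<^sup>+x. (\<Sum>i\<in>I. f x * indicator (S i) x) \<partial>lebesgue_on W)"
    using f SS by (intro nn_integral_sum[symmetric]) auto
  also have "\<dots> = (\<integral>\<^sup>+x. f x * indicator (\<Union>i\<in>I. S i) x \<partial>lebesgue_on W)"
    by (simp only: indicator_UN_disjoint[OF I dj] sum_distrib_left)
  finally show ?thesis .
qed

lemma cube_scaling: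
  fixes c d :: "real^'n"
  assumes \<rho>: "0 < \<rho>" and cd: "\<And>i. d $ i - c $ i = \<rho>"
  shows "(1/2) *\<^sub>R (c + d) + \<rho> *\<^sub>R y \<in> box c d \<longleftrightarrow> y \<in> unit_cube"
    and "measure lebesgue (box c d) = \<rho> ^ CARD('n)"
proof -
  have d: "d $ i = c $ i + \<rho>" for i using cd[of i] by simp
  have "(c $ i < (1/2) * (c $ i + d $ i) + \<rho> * y $ i \<and> (1/2) * (c $ i + d $ i) + \<rho> * y $ i < d $ i) \<longleftrightarrow> (- 1 / 2 < y $ i \<and> y $ i < 1 / 2)" for i
  proof -
    have "c $ i < (1/2) * (c $ i + d $ i) + \<rho> * y $ i \<longleftrightarrow> \<rho> * (- 1 / 2) < \<rho> * y $ i" by (auto simp: d field_simps)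
    moreover have "(1/2) * (c $ i + d $ i) + \<rho> * y $ i < d $ i \<longleftrightarrow> \<rho> * y $ i < \<rho> * (1 / 2)" by (auto simp: d field_simps)
    ultimately show ?thesis using \<rho> by (simp only: mult_less_cancel_left_pos)
  qed
  then show "(1/2) *\<^sub>R (c + d) + \<rho> *\<^sub>R y \<in> box c d \<longleftrightarrow> y \<in> unit_cube"
    by (simp add: mem_box_cart unit_cube_def)
  have "cbox c d \<noteq> {}" using \<rho> d by (simp add: interval_ne_empty_cart)
  then have "measure lborel (cbox c d) = \<rho> ^ CARD('n)" by (simp add: content_cbox_cart cd)
  moreover have "measure lborel (box c d) = measure lborel (cbox c d)" by (simp add: measure_lborel_box_eq measure_lborel_cbox_eq)
  ultimately show "measure lebesgue (box c d) = \<rho> ^ CARD('n)" by simp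
qed

lemma nn_integral_Ltrunc_le:
  fixes G :: "'a::euclidean_space \<Rightarrow> 'b::euclidean_space"
  assumes S: "S \<in> lmeasurable" and K: "0 \<le> K"
  shows "(\<integral>\<^sup>+x. ennreal (Ltrunc L K (G x)) \<partial>lebesgue_on S) \<le> ennreal (K * measure lebesgue S)"
proof -
  have SL: "S \<in> sets lebesgue" using S by (simp add: fmeasurable_def)
  have "(\<integral>\<^sup>+x. ennreal (Ltrunc L K (G x)) \<partial>lebesgue_on S) \<le> (\<integral>\<^sup>+x. ennreal K \<partial>lebesgue_on S)"
    by (intro nn_integral_mono ennreal_leI Ltrunc(3) K)
  also have "\<dots> = ennreal K * emeasure lebesgue S" using SL by (simp add: emeasure_restrict_space)
  also have "\<dots> = ennreal (K * measure lebesgue S)" using K by (simp add: emeasure_eq_measure2[OF S] ennreal_mult)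
  finally show ?thesis .
qed

text \<open>The values are divided by the same \<rho> that scales the variable, so the gradient
  takes the same matrices as values and the energy only changes by the volume factor.\<close>

lemma rescaled_in_W1:
  fixes u :: "real^'n \<Rightarrow> real^'m" and k :: "real^'m"
  assumes U: "open U" and p: "1 < p" and u: "u \<in> W1 (ennreal p) U" and \<rho>: "0 < \<rho>" and V: "open V" "V \<in> lmeasurable"
    and B: "B \<in> sets lebesgue" "B \<subseteq> U" and VB: "\<And>y. a + \<rho> *\<^sub>R y \<in> B \<longleftrightarrow> y \<in> V"
  defines "w \<equiv> \<lambda>y. (1 / \<rho>) *\<^sub>R (u (a + \<rho> *\<^sub>R y) - k)"
  shows "w \<in> W1 (ennreal p) V"
    and "AE y in lebesgue_on V. weak_gradient V w y = weak_gradient U u (a + \<rho> *\<^sub>R y)"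
    and "Lp_int (lebesgue_on V) p (weak_gradient V w) = Lp_int (lebesgue_on B) p (weak_gradient U u) / \<rho> ^ CARD('n)"
proof -
  have p0: "0 \<le> p" using p by simp
  have UL: "U \<in> sets lebesgue" and VL: "V \<in> sets lebesgue" using U V by auto
  note d = W1_D[OF U p u]
  have uB: "in_Lp (lebesgue_on B) p u" "in_Lp (lebesgue_on B) p (weak_gradient U u)"
    by (intro in_Lp_subset(1)[OF UL B] d)+
  note s1 = in_Lp_scaling[OF \<rho> VL B(1) VB uB(1)] and s2 = in_Lp_scaling[OF \<rho> VL B(1) VB uB(2)]
  have sub: "a + \<rho> *\<^sub>R y \<in> U" if "y \<in> V" for y using VB[of y] B that by auto
  have g1: "has_weak_gradient V (\<lambda>y. u (a + \<rho> *\<^sub>R y)) (\<lambda>y. \<rho> *\<^sub>R weak_gradient U u (a + \<rho> *\<^sub>R y))"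
  proof (rule has_weak_gradient_scaling[OF \<rho> U V(1) _ d(2)])
    show "a + \<rho> *\<^sub>R y \<in> U" if "y \<in> V" for y by (rule sub[OF that])
    show "locally_integrable V (\<lambda>y. u (a + \<rho> *\<^sub>R y))" by (rule in_Lp_locally_integrable[OF VL s1(1) p])
    show "locally_integrable V (\<lambda>y. weak_gradient U u (a + \<rho> *\<^sub>R y))" by (rule in_Lp_locally_integrable[OF VL s2(1) p])
  qed
  have g2: "has_weak_gradient V (\<lambda>y. k) (\<lambda>y. 0)" using has_weak_gradient_linear[OF V(1), of 0 k] by simp
  have g: "has_weak_gradient V w (\<lambda>y. weak_gradient U u (a + \<rho> *\<^sub>R y))"
    unfolding w_def using has_weak_gradient_scaleR[OF V(1) has_weak_gradient_diff[OF V(1) g1 g2], of "1 / \<rho>"] \<rho> by simp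
  have wL: "in_Lp (lebesgue_on V) p w"
    unfolding w_def by (intro in_Lp_scaleR(1) in_Lp_diff(1) s1(1) in_Lp_const(1)[OF finite_measure_lebesgue_on[OF V(2)]] p0)
  note W = W1_intro[OF V(1) p wL s2(1) g]
  show "w \<in> W1 (ennreal p) V" by (rule W(1))
  show "AE y in lebesgue_on V. weak_gradient V w y = weak_gradient U u (a + \<rho> *\<^sub>R y)" by (rule W(2))
  show "Lp_int (lebesgue_on V) p (weak_gradient V w) = Lp_int (lebesgue_on B) p (weak_gradient U u) / \<rho> ^ CARD('n)"
    using W(3) s2(2) \<rho> by simp
qed

lemma rescaled_energy:
  fixes w :: "real^'n \<Rightarrow> real^'m" and G :: "real^'n \<Rightarrow> real^'n^'m"
  assumes L: "L \<in> borel_measurable borel" and V: "open V" and \<rho>: "0 < \<rho>"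
    and B: "B \<in> sets lebesgue" and VB: "\<And>y. a + \<rho> *\<^sub>R y \<in> B \<longleftrightarrow> y \<in> V"
    and G: "G \<in> borel_measurable (lebesgue_on B)" and ae: "AE y in lebesgue_on V. weak_gradient V w y = G (a + \<rho> *\<^sub>R y)"
  shows "ennreal (\<rho> ^ CARD('n)) * energy L V w = (\<integral>\<^sup>+x. L (G x) \<partial>lebesgue_on B)"
proof -
  have VL: "V \<in> sets lebesgue" using V by auto
  have "energy L V w = (\<integral>\<^sup>+y. L (G (a + \<rho> *\<^sub>R y)) \<partial>lebesgue_on V)"
    unfolding energy_def by (rule nn_integral_cong_AE) (use ae in \<open>auto elim: eventually_mono\<close>)
  then show ?thesis
    using lebesgue_scaling(2)[OF \<rho> VL B VB, of "\<lambda>x. L (G x)"] measurable_compose[OF G L] by simp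
qed

text \<open>Where \<open>G\<close> is within \<eta> of \<xi>, the truncated integrand is within
  \<open>e\<close> of its value at \<xi>; elsewhere it is at most \<open>K\<close>, and Markov's
  inequality bounds the measure of that set.\<close>

lemma truncated_integral_near_mean:
  fixes G :: "'a::euclidean_space \<Rightarrow> 'b::euclidean_space"
  assumes S: "S \<in> lmeasurable" and K: "0 \<le> K" and e: "0 \<le> e" and p: "1 < p" and \<eta>: "0 < \<eta>" and G: "in_Lp (lebesgue_on S) p G"
    and near: "\<And>B. norm (\<xi> - B) \<le> \<eta> \<Longrightarrow> \<bar>Ltrunc L K \<xi> - Ltrunc L K B\<bar> < e"
  shows "(\<integral>\<^sup>+x. ennreal (Ltrunc L K (G x)) \<partial>lebesgue_on S)
    \<le> ennreal (measure lebesgue S * (Ltrunc L K \<xi> + e) + K * (Lp_int (lebesgue_on S) p (\<lambda>x. G x - \<xi>) / \<eta> powr p))"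
proof -
  let ?M = "lebesgue_on S"
  have SL: "S \<in> sets lebesgue" using S by (simp add: fmeasurable_def)
  define E where "E = {x \<in> space ?M. norm (G x - \<xi>) \<ge> \<eta>}"
  have GL: "in_Lp ?M p (\<lambda>x. G x - \<xi>)" using p by (intro in_Lp_diff(1) G in_Lp_const(1)[OF finite_measure_lebesgue_on[OF S]]) auto
  have [measurable]: "(\<lambda>x. G x - \<xi>) \<in> borel_measurable ?M" using GL by (simp add: in_Lp_def)
  have ES: "E \<in> sets ?M" unfolding E_def by measurable
  have T0: "0 \<le> Ltrunc L K \<xi>" by (rule Ltrunc(2)[OF K])
  have "(\<integral>\<^sup>+x. ennreal (Ltrunc L K (G x)) \<partial>?M) \<le> (\<integral>\<^sup>+x. ennreal (Ltrunc L K \<xi> + e) + ennreal K * indicator E x \<partial>?M)"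
  proof (rule nn_integral_mono)
    fix x assume x: "x \<in> space ?M"
    show "ennreal (Ltrunc L K (G x)) \<le> ennreal (Ltrunc L K \<xi> + e) + ennreal K * indicator E x"
    proof (cases "x \<in> E")
      case True
      have "ennreal (Ltrunc L K (G x)) \<le> ennreal K" by (intro ennreal_leI Ltrunc(3) K)
      then show ?thesis using True by (simp add: add_increasing)
    next
      case False
      then have "norm (\<xi> - G x) \<le> \<eta>" using x by (simp add: E_def norm_minus_commute)
      then have "Ltrunc L K (G x) \<le> Ltrunc L K \<xi> + e" using near[of "G x"] by linarith
      then show ?thesis using False by (simp add: ennreal_leI)
    qed
  qed
  also have "\<dots> = ennreal (Ltrunc L K \<xi> + e) * emeasure lebesgue S + ennreal K * emeasure ?M E"
    using ES SL by (simp add: nn_integral_add nn_integral_cmult_indicator emeasure_restrict_space)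
  also have "\<dots> \<le> ennreal (Ltrunc L K \<xi> + e) * ennreal (measure lebesgue S) + ennreal K * ennreal (Lp_int ?M p (\<lambda>x. G x - \<xi>) / \<eta> powr p)"
    unfolding emeasure_eq_measure2[OF S] E_def by (intro add_left_mono mult_left_mono Lp_Markov[OF GL \<eta>]) (use p in auto)
  also have "\<dots> = ennreal (measure lebesgue S * (Ltrunc L K \<xi> + e) + K * (Lp_int ?M p (\<lambda>x. G x - \<xi>) / \<eta> powr p))"
    using T0 e K Lp_int_nonneg[of ?M p "\<lambda>x. G x - \<xi>"] by (simp add: ennreal_mult[symmetric] ennreal_plus[symmetric] mult.commute del: ennreal_plus)
  finally show ?thesis .
qed

text \<open>The error term is additive over cubes and covers good and bad cubes alike. Its three
  quotients measure how far the cube is from satisfying the hypotheses of the uniform bound. If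
  their sum reaches the volume, the trivial bound by \<open>K\<close> times the volume is enough;
  otherwise each is below the volume, and this is exactly what the hypotheses require.\<close>

lemma cube_estimate:
  fixes u v :: "real^'n \<Rightarrow> real^'m" and L :: "real^'n^'m \<Rightarrow> ennreal"
  assumes U: "open U" and p: "1 < p" and L: "L \<in> borel_measurable borel" and K: "0 \<le> K" and e: "0 < e"
    and M: "0 < M" and R: "0 < R" and \<delta>: "0 < \<delta>" and \<eta>: "0 < \<eta>"
    and lower: "\<And>\<xi> w. \<lbrakk>norm \<xi> \<le> R; w \<in> W1 (ennreal p) unit_cube; Lp_int (lebesgue_on unit_cube) p (weak_gradient unit_cube w) \<le> M;
       Lp_int (lebesgue_on unit_cube) p (\<lambda>y. w y - \<xi> *v y) \<le> \<delta>\<rbrakk> \<Longrightarrow> ennreal (Ltrunc L K \<xi>) \<le> energy L unit_cube w + ennreal e"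
    and near: "\<And>A B. norm A \<le> R \<Longrightarrow> norm (A - B) \<le> \<eta> \<Longrightarrow> \<bar>Ltrunc L K A - Ltrunc L K B\<bar> < e"
    and \<rho>: "0 < \<rho>" and cd: "\<And>i. d $ i - c $ i = \<rho>" and sub: "cbox c d \<subseteq> U"
    and u: "u \<in> W1 (ennreal p) U" and v: "v \<in> W1 (ennreal p) U"
    and close: "Lp_int (lebesgue_on (box c d)) p (\<lambda>x. u x - v x) \<le> \<rho> powr p * \<rho> ^ CARD('n) * \<delta> / (2 * 2 powr p)"
  defines "B \<equiv> box c d" and "D \<equiv> real CARD('m) * real CARD('n)"
  shows "(\<integral>\<^sup>+x. ennreal (Ltrunc L K (weak_gradient U v x)) \<partial>lebesgue_on B)
    \<le> (\<integral>\<^sup>+x. L (weak_gradient U u x) \<partial>lebesgue_on B)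
      + ennreal (2 * e * measure lebesgue B + K * (Lp_int (lebesgue_on B) p (weak_gradient U u) / M
         + Lp_int (lebesgue_on B) p (weak_gradient U v) / R powr p
         + (1 / \<eta> powr p + 2 * 2 powr p * D powr p / \<delta>) * Lp_int (lebesgue_on B) p (\<lambda>x. weak_gradient U v x - mean B (weak_gradient U v))))"
proof -
  note Y = unit_cube_facts[where 'n='n]
  have p0: "0 < p" "0 \<le> p" "1 \<le> p" using p by auto
  let ?M = "lebesgue_on B"
  define Gu where "Gu = weak_gradient U u"
  define Gv where "Gv = weak_gradient U v"
  define \<xi> where "\<xi> = mean B Gv"
  define J where "J = Lp_int ?M p (\<lambda>x. Gv x - \<xi>)"
  have cdi: "c $ i < d $ i" for i using cd[of i] \<rho> by linarith
  have UL: "U \<in> sets lebesgue" using U by auto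
  have BU: "B \<subseteq> U" unfolding B_def using sub box_subset_cbox[of c d] by auto
  have Bm: "B \<in> lmeasurable" "0 < measure lebesgue B" unfolding B_def by (rule measure_box_pos[OF cdi])+
  have BL: "B \<in> sets lebesgue" by (simp add: B_def)
  define V where "V = measure lebesgue B"
  have VV: "V = \<rho> ^ CARD('n)" unfolding V_def B_def by (rule cube_scaling(2)[OF \<rho> cd])
  have V0: "0 < V" using Bm by (simp add: V_def)
  have D0: "0 < D" by (simp add: D_def)
  note ud = W1_D[OF U p u, folded Gu_def] and vd = W1_D[OF U p v, folded Gv_def]
  have uB: "in_Lp ?M p u" "in_Lp ?M p Gu" and vB: "in_Lp ?M p v" "in_Lp ?M p Gv"
    by (intro in_Lp_subset(1)[OF UL BL BU] ud vd)+
  have nn: "0 \<le> Lp_int ?M p Gu" "0 \<le> Lp_int ?M p Gv" "0 \<le> J" by (auto simp: J_def Lp_int_nonneg)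
  \<comment> \<open>Chosen so that \<open>Z * J < V\<close> bounds the Poincare remainder, after
    rescaling, by half of \<delta>. The other half is reserved for the distance of \<open>u\<close>
    from \<open>v\<close>.\<close>
  define Z where "Z = 2 * 2 powr p * D powr p / \<delta>"
  have Z0: "0 < Z" using \<delta> D0 by (simp add: Z_def)
  have eta0: "0 < \<eta> powr p" "0 < R powr p" using \<eta> R by auto
  define P where "P = Lp_int ?M p Gu / M + Lp_int ?M p Gv / R powr p + (1 / \<eta> powr p + Z) * J"
  have P_parts: "0 \<le> Lp_int ?M p Gu / M" "0 \<le> Lp_int ?M p Gv / R powr p" "0 \<le> J / \<eta> powr p" "0 \<le> Z * J"
    using nn M eta0 Z0 by auto
  have P_eq: "P = Lp_int ?M p Gu / M + Lp_int ?M p Gv / R powr p + J / \<eta> powr p + Z * J" by (simp add: P_def algebra_simps)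
  \<comment> \<open>A good cube contributes \<open>2 * e * V\<close>: one \<open>e\<close> from the
    uniform lower bound, one from replacing the gradient of \<open>v\<close> by its mean.\<close>
  have goal: "(\<integral>\<^sup>+x. ennreal (Ltrunc L K (Gv x)) \<partial>?M) \<le> (\<integral>\<^sup>+x. L (Gu x) \<partial>?M) + ennreal (2 * e * V + K * P)"
  proof (cases "V \<le> P")
    case True
    have "(\<integral>\<^sup>+x. ennreal (Ltrunc L K (Gv x)) \<partial>?M) \<le> ennreal (K * V)"
      unfolding V_def by (rule nn_integral_Ltrunc_le[OF Bm(1) K])
    also have "\<dots> \<le> ennreal (2 * e * V + K * P)"
      using True e V0 K by (intro ennreal_leI) (simp add: add_increasing mult_left_mono)
    finally show ?thesis by (simp add: add_increasing)
  next
    case False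
    then have small: "Lp_int ?M p Gu / M < V" "Lp_int ?M p Gv / R powr p < V" "Z * J < V"
      using P_parts P_eq by linarith+
    have xi: "norm \<xi> \<le> R"
    proof (rule ccontr)
      assume "\<not> norm \<xi> \<le> R"
      then have "R powr p * V \<le> norm \<xi> powr p * V" using R p V0 by (intro mult_right_mono powr_mono2) auto
      also have "\<dots> \<le> Lp_int ?M p Gv" unfolding \<xi>_def V_def by (rule mean_powr_le[OF Bm vB(2) p])
      finally show False using small(2) eta0 by (simp add: pos_divide_less_eq mult.commute)
    qed
    define x0 where "x0 = (1/2) *\<^sub>R (c + d)"
    \<comment> \<open>\<open>v\<close> minus the linear part with matrix \<xi>, centred at the
      midpoint of the cube. Its gradient has mean 0 over \<open>B\<close>, and after rescaling
      around \<open>x0\<close> the subtracted part becomes the linear map \<xi>.\<close>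
    define f where "f x = v x - (\<xi> *v x + - (\<xi> *v x0))" for x
    have fG: "has_weak_gradient U f (\<lambda>x. Gv x - \<xi>)"
      unfolding f_def by (intro has_weak_gradient_diff has_weak_gradient_linear U vd(2))
    have bB: "bounded B" by (simp add: B_def)
    have fL: "in_Lp ?M p f" unfolding f_def by (intro in_Lp_diff(1) vB in_Lp_affine[OF Bm(1) bB] p0)
    have GL: "in_Lp ?M p (\<lambda>x. Gv x - \<xi>)" by (intro in_Lp_diff(1) vB in_Lp_const(1)[OF finite_measure_lebesgue_on[OF Bm(1)]] p0)
    have "Lp_nrm ?M p (\<lambda>x. f x - mean B f) \<le> D * \<rho> * Lp_nrm ?M p (\<lambda>x. Gv x - \<xi>)"
      unfolding B_def D_def by (rule Poincare_box[OF U fG p GL[unfolded B_def] fL[unfolded B_def] cdi _ sub]) (simp add: cd)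
    then have "Lp_int ?M p (\<lambda>x. f x - mean B f) \<le> (D * \<rho> * Lp_nrm ?M p (\<lambda>x. Gv x - \<xi>)) powr p"
      using D0 \<rho> by (subst Lp_nrm_le_iff[OF p0(1), symmetric]) (auto simp: Lp_nrm_nonneg)
    also have "\<dots> = D powr p * \<rho> powr p * J"
      using D0 \<rho> by (simp add: powr_mult Lp_nrm_nonneg Lp_nrm_powr[OF p0(1)] J_def)
    finally have Pf: "Lp_int ?M p (\<lambda>x. f x - mean B f) \<le> D powr p * \<rho> powr p * J" .
    define k where "k = mean B f"
    define w where "w y = (1 / \<rho>) *\<^sub>R (u (x0 + \<rho> *\<^sub>R y) - k)" for y
    have VB: "x0 + \<rho> *\<^sub>R y \<in> B \<longleftrightarrow> y \<in> unit_cube" for y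
      unfolding x0_def B_def by (rule cube_scaling(1)[OF \<rho> cd])
    note w = rescaled_in_W1[OF U p u \<rho> Y(1,2) BL BU VB, of k, folded w_def Gu_def]
    have wM: "Lp_int (lebesgue_on unit_cube) p (weak_gradient unit_cube w) \<le> M"
      unfolding w(3) VV[symmetric] using small(1) M V0 by (simp add: field_simps)
    \<comment> \<open>Up to the factor \<rho> this is the rescaled \<open>u\<close> minus the linear
      map, split into the distance of \<open>u\<close> from \<open>v\<close> and the Poincare
      remainder of \<open>v\<close>.\<close>
    define g where "g x = (u x - v x) + (f x - k)" for x
    have gL: "in_Lp ?M p g" "Lp_int ?M p g \<le> 2 powr p * (Lp_int ?M p (\<lambda>x. u x - v x) + Lp_int ?M p (\<lambda>x. f x - k))"
      unfolding g_def by (intro in_Lp_add in_Lp_diff(1) uB vB fL in_Lp_const(1)[OF finite_measure_lebesgue_on[OF Bm(1)]] p0)+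
    have "w y - \<xi> *v y = (1 / \<rho>) *\<^sub>R g (x0 + \<rho> *\<^sub>R y)" for y
      using \<rho> by (simp add: w_def g_def f_def matrix_vector_right_distrib matrix_vector_mult_scaleR scaleR_add_right scaleR_diff_right)
    then have "Lp_int (lebesgue_on unit_cube) p (\<lambda>y. w y - \<xi> *v y) = (1 / \<rho>) powr p * Lp_int (lebesgue_on unit_cube) p (\<lambda>y. g (x0 + \<rho> *\<^sub>R y))"
      using in_Lp_scaleR(2)[OF in_Lp_scaling(1)[OF \<rho> Y(3) BL VB gL(1)], of "1 / \<rho>"] \<rho> by simp
    also have "Lp_int (lebesgue_on unit_cube) p (\<lambda>y. g (x0 + \<rho> *\<^sub>R y)) = Lp_int ?M p g / V"
      using in_Lp_scaling(2)[OF \<rho> Y(3) BL VB gL(1)] \<rho> by (simp add: VV)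
    also have "(1 / \<rho>) powr p * (Lp_int ?M p g / V) \<le> (1 / \<rho>) powr p * ((\<rho> powr p * V * \<delta>) / V)"
    proof (intro mult_left_mono divide_right_mono)
      have "2 powr p * (D powr p * \<rho> powr p * J) \<le> \<rho> powr p * V * \<delta> / 2"
      proof -
        have "2 * 2 powr p * D powr p * J \<le> V * \<delta>"
          using small(3) \<delta> by (simp add: Z_def field_simps)
        then have "\<rho> powr p * (2 * 2 powr p * D powr p * J) \<le> \<rho> powr p * (V * \<delta>)" by (rule mult_left_mono) simp
        then show ?thesis by (simp add: mult_ac)
      qed
      from this have "2 powr p * Lp_int ?M p (\<lambda>x. f x - k) \<le> \<rho> powr p * V * \<delta> / 2"
        unfolding k_def by (rule order_trans[OF mult_left_mono[OF Pf], rotated]) simp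
      moreover have "2 powr p * Lp_int ?M p (\<lambda>x. u x - v x) \<le> \<rho> powr p * V * \<delta> / 2"
        using mult_left_mono[OF close, of "2 powr p"] by (simp add: B_def VV)
      ultimately show "Lp_int ?M p g \<le> \<rho> powr p * V * \<delta>" using gL(2) by (simp add: distrib_left)
    qed (use V0 in auto)
    also have "\<dots> = \<delta>" using V0 \<rho> by (simp add: powr_divide)
    finally have wd: "Lp_int (lebesgue_on unit_cube) p (\<lambda>y. w y - \<xi> *v y) \<le> \<delta>" .
    have low: "ennreal (Ltrunc L K \<xi>) \<le> energy L unit_cube w + ennreal e"
      by (rule lower[OF xi w(1) wM wd])
    have en: "ennreal V * energy L unit_cube w = (\<integral>\<^sup>+x. L (Gu x) \<partial>?M)"
      unfolding VV by (rule rescaled_energy[OF L Y(1) \<rho> BL VB in_Lp_measurable[OF uB(2)] w(2)])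
    have T0: "0 \<le> Ltrunc L K \<xi>" by (rule Ltrunc(2)[OF K])
    have "(\<integral>\<^sup>+x. ennreal (Ltrunc L K (Gv x)) \<partial>?M) \<le> ennreal (V * (Ltrunc L K \<xi> + e) + K * (J / \<eta> powr p))"
      unfolding V_def J_def
      by (rule truncated_integral_near_mean[OF Bm(1) K less_imp_le[OF e] p \<eta> vB(2) near[OF xi]])
    also have "\<dots> = ennreal V * ennreal (Ltrunc L K \<xi>) + ennreal (e * V + K * (J / \<eta> powr p))"
    proof -
      have "0 \<le> e * V + K * (J / \<eta> powr p)" using V0 e K P_parts(3) by (intro add_nonneg_nonneg mult_nonneg_nonneg) auto
      moreover have "V * (Ltrunc L K \<xi> + e) + K * (J / \<eta> powr p) = V * Ltrunc L K \<xi> + (e * V + K * (J / \<eta> powr p))"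
        by (simp add: algebra_simps)
      ultimately show ?thesis using V0 T0 by (simp only: ennreal_plus ennreal_mult less_imp_le mult_nonneg_nonneg)
    qed
    also have "\<dots> \<le> ennreal V * (energy L unit_cube w + ennreal e) + ennreal (e * V + K * (J / \<eta> powr p))"
      by (intro add_right_mono mult_left_mono low) simp
    also have "\<dots> = (\<integral>\<^sup>+x. L (Gu x) \<partial>?M) + (ennreal V * ennreal e + ennreal (e * V + K * (J / \<eta> powr p)))"
      by (simp add: distrib_left en add.assoc)
    also have "ennreal V * ennreal e + ennreal (e * V + K * (J / \<eta> powr p)) = ennreal (2 * e * V + K * (J / \<eta> powr p))"
    proof -
      have "0 \<le> e * V + K * (J / \<eta> powr p)" using V0 e K P_parts(3) by (intro add_nonneg_nonneg mult_nonneg_nonneg) auto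
      moreover have "2 * e * V + K * (J / \<eta> powr p) = V * e + (e * V + K * (J / \<eta> powr p))"
        by (simp add: algebra_simps)
      ultimately show ?thesis using V0 e by (simp only: ennreal_plus ennreal_mult less_imp_le mult_nonneg_nonneg)
    qed
    also have "\<dots> \<le> ennreal (2 * e * V + K * P)"
      using P_parts P_eq K by (intro ennreal_leI add_left_mono mult_left_mono) linarith+
    finally show ?thesis by simp
  qed
  then show ?thesis unfolding Gv_def Gu_def V_def P_def Z_def J_def \<xi>_def .
qed

text \<open>A dyadic covering subordinate to a gauge whose balls lie in \<open>U\<close> and have
  radius at most \<open>d / 2\<close> consists of small cubes inside \<open>U\<close>. Finitely many
  of them carry all but \<open>e\<close> of the measure, and passing to open boxes loses only a null
  set.\<close>

lemma exhausting_cubes: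
  fixes U :: "(real^'n) set"
  assumes U: "open U" "bounded U" and d: "0 < d" and e: "0 < e"
  obtains I :: "nat set" and c b where "finite I"
    "\<forall>k\<in>I. (\<exists>\<rho>>0. \<forall>i. b k $ i - c k $ i = \<rho>) \<and> cbox (c k) (b k) \<subseteq> U \<and> (\<forall>x\<in>box (c k) (b k). \<forall>y\<in>box (c k) (b k). dist x y \<le> d)"
    "disjoint_family_on (\<lambda>k. box (c k) (b k)) I" "measure lebesgue (U - (\<Union>k\<in>I. box (c k) (b k))) < e"
proof -
  obtain r where r: "0 < r" "U \<subseteq> cball 0 r" using U(2) by (auto simp: bounded_pos subset_iff)
  \<comment> \<open>The ambient box has equal sides, so its dyadic subdivisions are cubes.\<close>
  define A where "A = (\<chi> i. - r :: real^'n)"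
  define B where "B = (\<chi> i. r :: real^'n)"
  have UAB: "U \<subseteq> cbox A B"
  proof
    fix x assume "x \<in> U"
    then have "norm x \<le> r" using r(2) by auto
    then have "\<bar>x $ i\<bar> \<le> r" for i using component_le_norm_cart[of x i] by linarith
    then show "x \<in> cbox A B" by (simp add: A_def B_def mem_box_cart abs_le_iff) (metis minus_le_iff)
  qed
  have AB: "box A B \<noteq> {}" using r(1) by (simp add: A_def B_def interval_ne_empty_cart)
  have "\<forall>x. \<exists>s>0. x \<in> U \<longrightarrow> ball x s \<subseteq> U"
    using U(1) by (metis open_contains_ball zero_less_one)
  then obtain s where s: "\<And>x. 0 < s x" "\<And>x. x \<in> U \<Longrightarrow> ball x (s x) \<subseteq> U" by metis
  \<comment> \<open>The radius \<open>s x\<close> keeps the piece inside \<open>U\<close>, the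
    radius \<open>d / 2\<close> keeps its diameter at most \<open>d\<close>.\<close>
  define g where "g x = ball x (min (s x) (d / 2))" for x
  have gg: "gauge g" unfolding g_def by (rule gauge_ball_dependent) (use s(1) d in simp)
  obtain \<D> where \<D>: "countable \<D>" "\<Union>\<D> \<subseteq> cbox A B"
    "\<And>K. K \<in> \<D> \<Longrightarrow> interior K \<noteq> {} \<and> (\<exists>c d. K = cbox c d)"
    "pairwise (\<lambda>A B. interior A \<inter> interior B = {}) \<D>"
    "\<And>K. K \<in> \<D> \<Longrightarrow> \<exists>x \<in> U \<inter> K. K \<subseteq> g x"
    "\<And>u v. cbox u v \<in> \<D> \<Longrightarrow> \<exists>n. \<forall>i \<in> Basis. v \<bullet> i - u \<bullet> i = (B \<bullet> i - A \<bullet> i) / 2^n"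
    "U \<subseteq> \<Union>\<D>"
    using covering_lemma[OF UAB AB gg] by blast
  have gU: "g x \<subseteq> U" if "x \<in> U" for x using s(2)[OF that] by (auto simp: g_def)
  have KU: "K \<subseteq> U" if "K \<in> \<D>" for K using \<D>(5)[OF that] gU by blast
  have UD: "\<Union>\<D> = U" using \<D>(7) KU by blast
  have Km: "K \<in> lmeasurable" if "K \<in> \<D>" for K using \<D>(3)[OF that] by auto
  have Um: "U \<in> lmeasurable" using U by (simp add: lmeasurable_open)
  have "measure lebesgue (\<Union>D') \<le> measure lebesgue U" if "D' \<subseteq> \<D>" "finite D'" for D'
  proof (rule measure_mono_fmeasurable[OF _ _ Um])
    show "\<Union>D' \<subseteq> U" using that KU by blast
    show "\<Union>D' \<in> sets lebesgue" using that Km by (intro sets.finite_Union) (auto simp: fmeasurable_def)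
  qed
  from measure_countable_Union_approachable[OF \<D>(1) e Km this]
  obtain F where F: "F \<subseteq> \<D>" "finite F" "measure lebesgue (\<Union>\<D>) - e < measure lebesgue (\<Union>F)" by metis
  obtain h where h: "bij_betw h {0..<card F} F" using ex_bij_betw_nat_finite[OF F(2)] by blast
  define I where "I = {0..<card F}"
  have hF: "h k \<in> F" if "k \<in> I" for k using h that by (auto simp: bij_betw_def I_def)
  have "\<forall>k. \<exists>c b. k \<in> I \<longrightarrow> h k = cbox c b" using hF F(1) \<D>(3) by blast
  then obtain c b where cb: "\<And>k. k \<in> I \<Longrightarrow> h k = cbox (c k) (b k)" by metis
  have intk: "interior (h k) = box (c k) (b k)" if "k \<in> I" for k using cb[OF that] by (simp add: interior_cbox)
  have hD: "h k \<in> \<D>" if "k \<in> I" for k using hF[OF that] F(1) by blast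
  show ?thesis
  proof (rule that[of I b c])
    show "finite I" by (simp add: I_def)
    have s1: "\<exists>\<rho>>0. \<forall>i. b k $ i - c k $ i = \<rho>" if k: "k \<in> I" for k
    proof -
      obtain n where n: "\<forall>i \<in> Basis. b k \<bullet> i - c k \<bullet> i = (B \<bullet> i - A \<bullet> i) / 2^n"
        using \<D>(6)[of "c k" "b k"] hD[OF k] cb[OF k] by auto
      have "b k $ i - c k $ i = 2 * r / 2 ^ n" for i
        using n[rule_format, of "axis i 1"] by (simp add: inner_axis A_def B_def)
      then show ?thesis using r(1) by (intro exI[of _ "2 * r / 2 ^ n"]) auto
    qed
    have s2: "cbox (c k) (b k) \<subseteq> U" if k: "k \<in> I" for k using KU[OF hD[OF k]] cb[OF k] by simp
    have s3: "dist x y \<le> d" if k: "k \<in> I" and xy: "x \<in> box (c k) (b k)" "y \<in> box (c k) (b k)" for k x y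
    proof -
      obtain z where z: "h k \<subseteq> g z" using \<D>(5)[OF hD[OF k]] by blast
      have "x \<in> g z" "y \<in> g z" using z xy box_subset_cbox[of "c k" "b k"] cb[OF k] by auto
      then have "dist z x < d / 2" "dist z y < d / 2" by (auto simp: g_def)
      then show ?thesis using dist_triangle3[of x y z] by linarith
    qed
    show "\<forall>k\<in>I. (\<exists>\<rho>>0. \<forall>i. b k $ i - c k $ i = \<rho>) \<and> cbox (c k) (b k) \<subseteq> U \<and> (\<forall>x\<in>box (c k) (b k). \<forall>y\<in>box (c k) (b k). dist x y \<le> d)"
      by (intro ballI conjI s1 s2 s3)
    show "disjoint_family_on (\<lambda>k. box (c k) (b k)) I"
      unfolding disjoint_family_on_def
    proof (intro ballI impI)
      fix k l assume kl: "k \<in> I" "l \<in> I" "k \<noteq> l"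
      then have "h k \<noteq> h l" using h by (auto simp: bij_betw_def inj_on_def I_def)
      then have "interior (h k) \<inter> interior (h l) = {}" using \<D>(4) hD[OF kl(1)] hD[OF kl(2)] by (auto simp: pairwise_def)
      then show "box (c k) (b k) \<inter> box (c l) (b l) = {}" using intk kl by simp
    qed
    have FU: "\<Union>F = (\<Union>k\<in>I. cbox (c k) (b k))" using h cb by (auto simp: bij_betw_def I_def)
    have neg: "negligible (\<Union>k\<in>I. cbox (c k) (b k) - box (c k) (b k))"
      by (intro negligible_Union) (auto simp: I_def negligible_frontier_interval)
    have bm: "(\<Union>k\<in>I. box (c k) (b k)) \<in> lmeasurable" by (intro fmeasurable.finite_UN) (auto simp: I_def bounded_set_imp_lmeasurable)
    have "\<Union>F = (\<Union>k\<in>I. box (c k) (b k)) \<union> (\<Union>k\<in>I. cbox (c k) (b k) - box (c k) (b k))"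
      unfolding FU using box_subset_cbox by blast
    then have "measure lebesgue (\<Union>F) = measure lebesgue ((\<Union>k\<in>I. box (c k) (b k)) \<union> (\<Union>k\<in>I. cbox (c k) (b k) - box (c k) (b k)))"
      by simp
    also have "\<dots> = measure lebesgue (\<Union>k\<in>I. box (c k) (b k))"
      by (rule measure_Un_null_set[OF fmeasurableD[OF bm] neg[unfolded negligible_iff_null_sets]])
    finally have "measure lebesgue U - e < measure lebesgue (\<Union>k\<in>I. box (c k) (b k))" using F(3) UD by simp
    moreover have "(\<Union>k\<in>I. box (c k) (b k)) \<subseteq> U"
    proof
      fix x assume "x \<in> (\<Union>k\<in>I. box (c k) (b k))"
      then obtain k where "k \<in> I" "x \<in> box (c k) (b k)" by auto
      then show "x \<in> U" using KU[OF hD] cb box_subset_cbox[of "c k" "b k"] by blast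
    qed
    ultimately show "measure lebesgue (U - (\<Union>k\<in>I. box (c k) (b k))) < e"
      using measurable_measure_Diff[OF Um fmeasurableD[OF bm]] by simp
  qed
qed

text \<open>The order of choices matters. The gradient bounds fix \<open>M\<close> and
  \<open>R\<close>; these fix \<delta> and \<eta>; then the fineness \<open>d\<close> is chosen for
  the gradient of \<open>v\<close>; then finitely many cubes; and only last the index
  \<open>N\<close>. In the error, \<open>2 * measure lebesgue \<Omega>\<close> comes from the good
  cubes, 3 from the three quotients of \<open>cube_estimate\<close>, and 1 from the part left
  uncovered.\<close>

lemma truncated_energy_lsc:
  fixes \<Omega> :: "(real^'n) set" and L :: "real^'n^'m \<Rightarrow> ennreal"
  assumes U: "open \<Omega>" "bounded \<Omega>" and p: "1 < p" and L: "continuous_on UNIV L"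
    and qc: "W1_quasiconvex q L" and C: "condition_C p q L"
    and w: "W1_weakly_converges p \<Omega> u v" and K: "0 < K" and e: "0 < e"
  shows "\<exists>N. \<forall>n\<ge>N. (\<integral>\<^sup>+x. ennreal (Ltrunc L K (weak_gradient \<Omega> v x)) \<partial>lebesgue_on \<Omega>)
     \<le> energy L \<Omega> (u n) + ennreal (e * (2 * measure lebesgue \<Omega> + 4))"
proof -
  let ?M = "lebesgue_on \<Omega>"
  have p0: "0 < p" "0 \<le> p" using p by auto
  have K0: "0 \<le> K" using K by simp
  have Um: "\<Omega> \<in> lmeasurable" using U by (simp add: lmeasurable_open)
  have UL: "\<Omega> \<in> sets lebesgue" using U by auto
  have Lm: "L \<in> borel_measurable borel" by (rule borel_measurable_continuous_onI[OF L])
  have uW: "u n \<in> W1 (ennreal p) \<Omega>" for n using w by (simp add: W1_weakly_converges_def)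
  have vW: "v \<in> W1 (ennreal p) \<Omega>" using w by (simp add: W1_weakly_converges_def)
  note ud = W1_D[OF U(1) p uW] and vd = W1_D[OF U(1) p vW]
  obtain A0 where A0: "\<And>n. Lp_nrm ?M p (weak_gradient \<Omega> (u n)) \<le> A0"
    using W1_weakly_bounded[OF U(1) p w] by blast
  define A where "A = A0 powr p + 1"
  have A: "Lp_int ?M p (weak_gradient \<Omega> (u n)) \<le> A" for n
    using powr_mono2[OF p0(2) Lp_nrm_nonneg A0[of n]] by (simp add: A_def Lp_nrm_powr[OF p0(1)])
  have Apos: "0 < A" by (simp add: A_def add_nonneg_pos)
  define Bv where "Bv = Lp_int ?M p (weak_gradient \<Omega> v) + 1"
  have Bpos: "0 < Bv" by (simp add: Bv_def add_nonneg_pos Lp_int_nonneg)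
  \<comment> \<open>\<open>M\<close>, \<open>R\<close> and later the fineness
    \<open>e / (K * Z)\<close> are set so that each of the three quotients of
    \<open>cube_estimate\<close>, summed over all cubes and multiplied by \<open>K\<close>,
    contributes at most \<open>e\<close>.\<close>
  define M where "M = K * A / e"
  have M: "0 < M" using K Apos e by (simp add: M_def)
  define R where "R = (K * Bv / e) powr (1 / p)"
  have R: "0 < R" "R powr p = K * Bv / e" using K Bpos e p0 by (auto simp: R_def powr_powr)
  have "\<exists>\<delta>>0. \<forall>\<xi> w. norm \<xi> \<le> R \<longrightarrow> w \<in> W1 (ennreal p) unit_cube \<longrightarrow> Lp_int (lebesgue_on unit_cube) p (weak_gradient unit_cube w) \<le> M \<longrightarrow>
       Lp_int (lebesgue_on unit_cube) p (\<lambda>y. w y - \<xi> *v y) \<le> \<delta> \<longrightarrow> ennreal (Ltrunc L K \<xi>) \<le> energy L unit_cube w + ennreal e"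
    by (rule uniform_lower_bound[OF p L qc C K0 e, of R M]) (intro exI conjI allI impI; assumption?; blast)
  then obtain \<delta> where \<delta>: "0 < \<delta>" and lower0: "\<forall>\<xi> w. norm \<xi> \<le> R \<longrightarrow> w \<in> W1 (ennreal p) unit_cube \<longrightarrow> Lp_int (lebesgue_on unit_cube) p (weak_gradient unit_cube w) \<le> M \<longrightarrow>
       Lp_int (lebesgue_on unit_cube) p (\<lambda>y. w y - \<xi> *v y) \<le> \<delta> \<longrightarrow> ennreal (Ltrunc L K \<xi>) \<le> energy L unit_cube w + ennreal e"
    by (elim exE conjE)
  note lower = lower0[rule_format]
  obtain \<eta> where \<eta>: "0 < \<eta>" and near: "\<And>A B. norm A \<le> R \<Longrightarrow> norm (A - B) \<le> \<eta> \<Longrightarrow> \<bar>Ltrunc L K A - Ltrunc L K B\<bar> < e"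
    using Ltrunc_uniform[OF L K0 e, of R] by blast
  define D where "D = real CARD('m) * real CARD('n)"
  define Z where "Z = 1 / \<eta> powr p + 2 * 2 powr p * D powr p / \<delta>"
  have Z: "0 < Z" using \<eta> \<delta> by (simp add: Z_def add_pos_nonneg)
  have eZ: "0 < e / (K * Z)" using e K Z by simp
  obtain d where d: "0 < d" "osc_fine \<Omega> p (weak_gradient \<Omega> v) d (e / (K * Z))"
    by (rule osc_fine_exists[OF Um U(2) vd(3) p eZ])
  \<comment> \<open>The truncated integrand is at most \<open>K\<close>, so an uncovered part of
    measure below \<open>e / K\<close> contributes at most \<open>e\<close>.\<close>
  have eK: "0 < e / K" using e K by simp
  obtain I :: "nat set" and c b where I0: "finite I"
    "\<forall>k\<in>I. (\<exists>\<rho>>0. \<forall>i. b k $ i - c k $ i = \<rho>) \<and> cbox (c k) (b k) \<subseteq> \<Omega> \<and> (\<forall>x\<in>box (c k) (b k). \<forall>y\<in>box (c k) (b k). dist x y \<le> d)"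
    "disjoint_family_on (\<lambda>k. box (c k) (b k)) I" "measure lebesgue (\<Omega> - (\<Union>k\<in>I. box (c k) (b k))) < e / K"
    by (rule exhausting_cubes[OF U d(1) eK])
  have I: "finite I" "\<And>k. k \<in> I \<Longrightarrow> \<exists>\<rho>>0. \<forall>i. b k $ i - c k $ i = \<rho>"
    "\<And>k. k \<in> I \<Longrightarrow> cbox (c k) (b k) \<subseteq> \<Omega>" "\<And>k x y. k \<in> I \<Longrightarrow> x \<in> box (c k) (b k) \<Longrightarrow> y \<in> box (c k) (b k) \<Longrightarrow> dist x y \<le> d"
    "disjoint_family_on (\<lambda>k. box (c k) (b k)) I" "measure lebesgue (\<Omega> - (\<Union>k\<in>I. box (c k) (b k))) < e / K"
    using I0 by auto
  define S where "S k = box (c k) (b k)" for k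
  have "\<forall>k. \<exists>\<rho>. k \<in> I \<longrightarrow> 0 < \<rho> \<and> (\<forall>i. b k $ i - c k $ i = \<rho>)" using I(2) by blast
  then obtain \<rho> where \<rho>: "\<And>k. k \<in> I \<Longrightarrow> 0 < \<rho> k" "\<And>k i. k \<in> I \<Longrightarrow> b k $ i - c k $ i = \<rho> k" by metis
  have cb: "c k $ i < b k $ i" if "k \<in> I" for k i using \<rho>(2)[OF that, of i] \<rho>(1)[OF that] by linarith
  have SU: "S k \<subseteq> \<Omega>" if "k \<in> I" for k using I(3)[OF that] box_subset_cbox[of "c k" "b k"] by (auto simp: S_def)
  have SL: "S k \<in> sets lebesgue" for k by (simp add: S_def)
  have Sm: "S k \<in> lmeasurable" "0 < measure lebesgue (S k)" if "k \<in> I" for k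
    unfolding S_def using measure_box_pos[OF cb[OF that]] by auto
  have SLU: "\<And>k. k \<in> I \<Longrightarrow> S k \<in> sets lebesgue \<and> S k \<subseteq> \<Omega>" using SL SU by blast
  have dj: "disjoint_family_on S I" using I(5) by (simp add: S_def[abs_def])
  \<comment> \<open>The closeness that \<open>cube_estimate\<close> demands:
    \<open>\<rho> k powr p\<close> from scaling the values, \<open>\<rho> k ^ CARD('n)\<close> from
    the volume. There are finitely many cubes, so the maximum of the indices from Rellich's theorem
    serves all of them.\<close>
  define T where "T k = \<rho> k powr p * \<rho> k ^ CARD('n) * \<delta> / (2 * 2 powr p)" for k
  have "\<exists>N. \<forall>n\<ge>N. Lp_int (lebesgue_on (S k)) p (\<lambda>x. u n x - v x) \<le> T k" if k: "k \<in> I" for k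
  proof -
    have "0 < T k" using \<rho>(1)[OF k] \<delta> by (simp add: T_def)
    from order_tendstoD(2)[OF W1_weakly_Rellich_box[OF U(1) p w cb[OF k] I(3)[OF k]] this]
    show ?thesis unfolding S_def eventually_sequentially by (meson less_imp_le)
  qed
  then obtain Nk where Nk: "\<And>k n. k \<in> I \<Longrightarrow> n \<ge> Nk k \<Longrightarrow> Lp_int (lebesgue_on (S k)) p (\<lambda>x. u n x - v x) \<le> T k" by metis
  define N where "N = Max (insert 0 (Nk ` I))"
  have NN: "Nk k \<le> N" if "k \<in> I" for k unfolding N_def using I(1) that by (intro Max_ge) auto
  have Jsum: "(\<Sum>k\<in>I. Lp_int (lebesgue_on (S k)) p (\<lambda>x. weak_gradient \<Omega> v x - mean (S k) (weak_gradient \<Omega> v))) \<le> e / (K * Z)"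
  proof (rule d(2)[unfolded osc_fine_def, rule_format], intro conjI ballI allI impI)
    show "finite I" by (rule I(1))
    show "S k \<in> lmeasurable" "0 < measure lebesgue (S k)" "S k \<subseteq> \<Omega>" if "k \<in> I" for k using Sm SU that by auto
    show "dist x y \<le> d" if "k \<in> I" "x \<in> S k" "y \<in> S k" for k x y using I(4) that by (auto simp: S_def)
    show "(\<Sum>k\<in>I. Lp_int (lebesgue_on (S k)) p g) \<le> Lp_int ?M p g" if "in_Lp ?M p g" for g :: "real^'n \<Rightarrow> real^'n^'m"
      by (rule sum_Lp_int_disjoint_le[OF I(1) UL SLU dj that])
  qed
  define Gv where "Gv = weak_gradient \<Omega> v"
  let ?T = "\<lambda>x. ennreal (Ltrunc L K (Gv x))"
  have GvM: "Gv \<in> borel_measurable ?M" using vd(3) by (simp add: in_Lp_def Gv_def)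
  have TM: "?T \<in> borel_measurable ?M"
    using measurable_compose[OF GvM borel_measurable_continuous_onI[OF Ltrunc_continuous[OF L K0]]] by simp
  define W where "W = (\<Union>k\<in>I. S k)"
  have WL: "W \<in> sets lebesgue" unfolding W_def using I(1) SL by (intro sets.finite_UN) auto
  have WU: "W \<subseteq> \<Omega>" using SU by (auto simp: W_def)
  define Rm where "Rm = \<Omega> - W"
  have RmL: "Rm \<in> sets lebesgue" "Rm \<subseteq> \<Omega>" using UL WL by (auto simp: Rm_def)
  have Rmm: "Rm \<in> lmeasurable" using fmeasurable_Diff[OF Um WL] by (simp add: Rm_def)
  have mRm: "measure lebesgue Rm < e / K" using I(6) by (simp add: Rm_def W_def S_def)
  show ?thesis
  proof (intro exI[of _ N] allI impI)
    fix n assume n: "n \<ge> N"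
    define Gu where "Gu = weak_gradient \<Omega> (u n)"
    have GuM: "Gu \<in> borel_measurable ?M" using ud(3)[of n] by (simp add: in_Lp_def Gu_def)
    have LuM: "(\<lambda>x. L (Gu x)) \<in> borel_measurable ?M" by (rule measurable_compose[OF GuM Lm])
    define J where "J k = Lp_int (lebesgue_on (S k)) p (\<lambda>x. Gv x - mean (S k) Gv)" for k
    define E where "E k = 2 * e * measure lebesgue (S k) + K * (Lp_int (lebesgue_on (S k)) p Gu / M + Lp_int (lebesgue_on (S k)) p Gv / R powr p + Z * J k)" for k
    have E0: "0 \<le> E k" for k
      unfolding E_def using e K M R(1) Z by (auto intro!: add_nonneg_nonneg mult_nonneg_nonneg divide_nonneg_pos simp: Lp_int_nonneg J_def)
    have cube: "(\<integral>\<^sup>+x. ?T x \<partial>lebesgue_on (S k)) \<le> (\<integral>\<^sup>+x. L (Gu x) \<partial>lebesgue_on (S k)) + ennreal (E k)" if k: "k \<in> I" for k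
      using cube_estimate[OF U(1) p Lm K0 e M R(1) \<delta> \<eta> lower near \<rho>(1)[OF k] \<rho>(2)[OF k] I(3)[OF k] uW[of n] vW]
        Nk[OF k order_trans[OF NN[OF k] n]]
      unfolding S_def[symmetric] T_def[symmetric] Gv_def[symmetric] Gu_def[symmetric] E_def J_def Z_def D_def by blast
    have "(\<integral>\<^sup>+x. ?T x \<partial>?M) = (\<integral>\<^sup>+x. ?T x * indicator W x + ?T x * indicator Rm x \<partial>?M)"
      by (rule nn_integral_cong) (auto simp: Rm_def indicator_def)
    also have "\<dots> = (\<integral>\<^sup>+x. ?T x * indicator W x \<partial>?M) + (\<integral>\<^sup>+x. ?T x * indicator Rm x \<partial>?M)"
      using TM WL WU RmL UL by (intro nn_integral_add borel_measurable_times_ennreal borel_measurable_indicator) (auto simp: sets_restrict_space_iff)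
    also have "(\<integral>\<^sup>+x. ?T x * indicator Rm x \<partial>?M) \<le> ennreal e"
    proof -
      have "(\<integral>\<^sup>+x. ?T x * indicator Rm x \<partial>?M) = (\<integral>\<^sup>+x. ?T x \<partial>lebesgue_on Rm)"
        using sum_nn_integral_disjoint[of "{0::nat}" \<Omega> "\<lambda>_. Rm" ?T] UL RmL TM by (simp add: disjoint_family_on_def)
      also have "\<dots> \<le> ennreal (K * measure lebesgue Rm)" by (rule nn_integral_Ltrunc_le[OF Rmm K0])
      also have "\<dots> \<le> ennreal e" using mRm K by (intro ennreal_leI) (simp add: field_simps)
      finally show ?thesis .
    qed
    also have "(\<integral>\<^sup>+x. ?T x * indicator W x \<partial>?M) = (\<Sum>k\<in>I. \<integral>\<^sup>+x. ?T x \<partial>lebesgue_on (S k))"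
      unfolding W_def by (rule sum_nn_integral_disjoint[OF I(1) UL SLU dj TM, symmetric])
    also have "\<dots> \<le> (\<Sum>k\<in>I. (\<integral>\<^sup>+x. L (Gu x) \<partial>lebesgue_on (S k)) + ennreal (E k))" by (rule sum_mono[OF cube])
    also have "\<dots> = (\<Sum>k\<in>I. \<integral>\<^sup>+x. L (Gu x) \<partial>lebesgue_on (S k)) + ennreal (\<Sum>k\<in>I. E k)"
      using E0 by (simp add: sum.distrib sum_ennreal)
    also have "(\<Sum>k\<in>I. \<integral>\<^sup>+x. L (Gu x) \<partial>lebesgue_on (S k)) \<le> energy L \<Omega> (u n)"
    proof -
      have "(\<Sum>k\<in>I. \<integral>\<^sup>+x. L (Gu x) \<partial>lebesgue_on (S k)) = (\<integral>\<^sup>+x. L (Gu x) * indicator (\<Union>k\<in>I. S k) x \<partial>?M)"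
        by (rule sum_nn_integral_disjoint[OF I(1) UL SLU dj LuM])
      also have "\<dots> \<le> (\<integral>\<^sup>+x. L (Gu x) \<partial>?M)"
        by (rule nn_integral_mono) (auto simp: indicator_def)
      finally show ?thesis by (simp add: energy_def Gu_def)
    qed
    \<comment> \<open>Summation uses only disjointness of the cubes: the volumes and both gradient
      energies add up to at most their values on the domain, the oscillations to at most
      \<open>e / (K * Z)\<close>.\<close>
    also have "(\<Sum>k\<in>I. E k) \<le> 2 * e * measure lebesgue \<Omega> + 3 * e"
    proof -
      have s1: "(\<Sum>k\<in>I. measure lebesgue (S k)) \<le> measure lebesgue \<Omega>"
      proof -
        have "(\<Sum>k\<in>I. measure lebesgue (S k)) = measure lebesgue W"
          unfolding W_def using I(1) dj Sm(1)
          by (intro measure_UNION'[symmetric]) (auto simp: disjoint_family_on_def pairwise_def disjnt_def)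
        also have "\<dots> \<le> measure lebesgue \<Omega>" by (rule measure_mono_fmeasurable[OF WU WL Um])
        finally show ?thesis .
      qed
      have s2: "(\<Sum>k\<in>I. Lp_int (lebesgue_on (S k)) p Gu) \<le> A"
        using sum_Lp_int_disjoint_le[OF I(1) UL SLU dj ud(3)[of n]] A[of n] by (simp add: Gu_def)
      have s3: "(\<Sum>k\<in>I. Lp_int (lebesgue_on (S k)) p Gv) \<le> Bv"
        using sum_Lp_int_disjoint_le[OF I(1) UL SLU dj vd(3)] by (simp add: Gv_def Bv_def)
      have s4: "(\<Sum>k\<in>I. J k) \<le> e / (K * Z)" using Jsum by (simp add: J_def Gv_def)
      have "(\<Sum>k\<in>I. E k) = 2 * e * (\<Sum>k\<in>I. measure lebesgue (S k)) + K * ((\<Sum>k\<in>I. Lp_int (lebesgue_on (S k)) p Gu) / M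
          + (\<Sum>k\<in>I. Lp_int (lebesgue_on (S k)) p Gv) / R powr p + Z * (\<Sum>k\<in>I. J k))"
        by (simp add: E_def sum.distrib sum_distrib_left sum_divide_distrib distrib_left)
      also have "\<dots> \<le> 2 * e * measure lebesgue \<Omega> + K * (A / M + Bv / R powr p + Z * (e / (K * Z)))"
        using e K M R(1) Z Bpos by (intro add_mono mult_left_mono divide_right_mono s1 s2 s3 s4) auto
      also have "K * (A / M + Bv / R powr p + Z * (e / (K * Z))) = 3 * e"
        unfolding R(2) M_def using e K Apos Bpos Z by (simp add: field_simps)
      finally show ?thesis .
    qed
    finally have "(\<integral>\<^sup>+x. ?T x \<partial>?M) \<le> energy L \<Omega> (u n) + ennreal (2 * e * measure lebesgue \<Omega> + 3 * e) + ennreal e"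
      by (simp add: add_mono ennreal_leI)
    also have "\<dots> = energy L \<Omega> (u n) + ennreal (e * (2 * measure lebesgue \<Omega> + 4))"
      using e by (simp add: add.assoc ennreal_plus[symmetric] algebra_simps del: ennreal_plus)
    finally show "(\<integral>\<^sup>+x. ennreal (Ltrunc L K (weak_gradient \<Omega> v x)) \<partial>?M) \<le> energy L \<Omega> (u n) + ennreal (e * (2 * measure lebesgue \<Omega> + 4))"
      by (simp add: Gv_def)
  qed
qed

theorem theorem1p1:
  fixes \<Omega> :: "(real^'n) set" and L :: "real^'n^'m \<Rightarrow> ennreal"
    and p :: real and q :: ennreal
  assumes "open \<Omega>" and "bounded \<Omega>" and "lipschitz_boundary \<Omega>"
    and "1 < p" and "1 \<le> q"
    and "continuous_on UNIV L"
    and "W1_quasiconvex q L"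
    and "condition_C p q L"
  shows "W1_seq_weakly_lsc p \<Omega> (energy L \<Omega>)"
  unfolding W1_seq_weakly_lsc_def
proof (intro allI impI)
  fix u :: "nat \<Rightarrow> real^'n \<Rightarrow> real^'m" and v
  assume w: "W1_weakly_converges p \<Omega> u v"
  note U = assms(1,2) and p = assms(4) and L = assms(6)
  let ?M = "lebesgue_on \<Omega>"
  define l where "l = liminf (\<lambda>n. energy L \<Omega> (u n))"
  define G where "G = weak_gradient \<Omega> v"
  have vW: "v \<in> W1 (ennreal p) \<Omega>" using w by (simp add: W1_weakly_converges_def)
  have Gm: "G \<in> borel_measurable ?M" using W1_D(3)[OF U(1) p vW] by (simp add: in_Lp_def G_def)
  \<comment> \<open>For a fixed level the error factor is a constant \<open>c\<close>, so applying
    the estimate with \<open>e / c\<close> makes the error an arbitrary \<open>e\<close>.\<close>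
  have trunc: "(\<integral>\<^sup>+x. ennreal (Ltrunc L K (G x)) \<partial>?M) \<le> l" if K: "0 < K" for K
  proof (rule ennreal_le_epsilon)
    fix e :: real assume e: "0 < e"
    define c where "c = 2 * measure lebesgue \<Omega> + 4"
    have c: "0 < c" by (simp add: c_def add_nonneg_pos)
    have "0 < e / c" using e c by simp
    from truncated_energy_lsc[OF U p L assms(7,8) w K this]
    obtain N where N: "\<And>n. n \<ge> N \<Longrightarrow> (\<integral>\<^sup>+x. ennreal (Ltrunc L K (G x)) \<partial>?M) \<le> energy L \<Omega> (u n) + ennreal (e / c * c)"
      unfolding G_def c_def by blast
    \<comment> \<open>The error is moved to the left so that the limit inferior is taken of the
      energies alone.\<close>
    have "(\<integral>\<^sup>+x. ennreal (Ltrunc L K (G x)) \<partial>?M) - ennreal e \<le> l"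
      unfolding l_def
    proof (rule Liminf_bounded)
      have "(\<integral>\<^sup>+x. ennreal (Ltrunc L K (G x)) \<partial>?M) - ennreal e \<le> energy L \<Omega> (u n)" if "n \<ge> N" for n
        using N[OF that] c by (simp add: ennreal_minus_le_iff add.commute)
      then show "\<forall>\<^sub>F n in sequentially. (\<integral>\<^sup>+x. ennreal (Ltrunc L K (G x)) \<partial>?M) - ennreal e \<le> energy L \<Omega> (u n)"
        by (auto simp: eventually_sequentially)
    qed
    then show "(\<integral>\<^sup>+x. ennreal (Ltrunc L K (G x)) \<partial>?M) \<le> l + ennreal e"
      by (simp add: ennreal_minus_le_iff add.commute)
  qed
  \<comment> \<open>Levels \<open>Suc k\<close> increase to infinity and the truncations increase to
    \<open>L\<close>, also where \<open>L\<close> is infinite; monotone convergence recovers the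
    full energy of the limit.\<close>
  have "energy L \<Omega> v = (\<integral>\<^sup>+x. (SUP k. ennreal (Ltrunc L (real (Suc k)) (G x))) \<partial>?M)"
    unfolding energy_def G_def[symmetric]
  proof (rule nn_integral_cong)
    fix x
    have "(SUP k. ennreal (real (Suc k))) = top"
    proof (rule SUP_eq_top_iff[THEN iffD2], intro allI impI)
      fix y :: ennreal assume "y < top"
      then obtain r where "y = ennreal r" "0 \<le> r" by (cases y) auto
      moreover obtain k where "r < real k" using reals_Archimedean2 by blast
      then have "ennreal r < ennreal (real (Suc k))" by (intro ennreal_lessI) auto
      ultimately show "\<exists>i\<in>UNIV. y < ennreal (real (Suc i))" by blast
    qed
    then have "L (G x) = inf (L (G x)) (SUP k. ennreal (real (Suc k)))" by (simp only: inf_top_right)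
    also have "\<dots> = (SUP k. inf (L (G x)) (ennreal (real (Suc k))))" by (rule inf_SUP)
    finally show "L (G x) = (SUP k. ennreal (Ltrunc L (real (Suc k)) (G x)))"
      by (simp add: Ltrunc(1) inf_min)
  qed
  also have "\<dots> = (SUP k. \<integral>\<^sup>+x. ennreal (Ltrunc L (real (Suc k)) (G x)) \<partial>?M)"
  proof (rule nn_integral_monotone_convergence_SUP)
    show "incseq (\<lambda>k x. ennreal (Ltrunc L (real (Suc k)) (G x)))"
      unfolding incseq_def le_fun_def
    proof (intro allI impI)
      fix m n :: nat and x assume "m \<le> n"
      then have "ennreal (real (Suc m)) \<le> ennreal (real (Suc n))" by (intro ennreal_leI) simp
      then show "ennreal (Ltrunc L (real (Suc m)) (G x)) \<le> ennreal (Ltrunc L (real (Suc n)) (G x))"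
        unfolding Ltrunc(1)[OF of_nat_0_le_iff] by (intro min.mono order_refl)
    qed
    show "(\<lambda>x. ennreal (Ltrunc L (real (Suc k)) (G x))) \<in> borel_measurable ?M" for k
      using measurable_compose[OF Gm borel_measurable_continuous_onI[OF Ltrunc_continuous[OF L, of "real (Suc k)"]]] by simp
  qed
  also have "\<dots> \<le> l" by (rule SUP_least) (rule trunc, simp)
  finally show "energy L \<Omega> v \<le> liminf (\<lambda>n. energy L \<Omega> (u n))" by (simp add: l_def)
qed

end
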